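(* Let $q$ be an odd prime power. Let $r$ be an odd integer at least $3$ and let $s$ be a positive integer relatively prime to $r$. Let $F/\mathbb{F}_q$ be a global function field and let $N$ be the largest integer such that $$B_s(F)\ge N \quad\text{and}\quad B_r(F) > \left\lfloor \frac{3+\lceil 2(2N+1)^{1/2}\rceil}{r-2}\right\rfloor .$$ Suppose further that $h(F\mathbb{F}_{q^r})/h(F)$ is odd. Then $$A(q^{rs}) \ge \frac{4Ns}{4g(F) + \left\lfloor \frac{3+\lceil 2(2N+1)^{1/2}\rceil}{r-2}\right\rfloor + \lceil 2(2N+1)^{1/2}\rceil}.$$
   Context: A global function field $F/\mathbb{F}_q$ is a global function field $F$ with full constant field $\mathbb{F}_q$ (i.e. $\mathbb{F}_q$ is algebraically closed in $F$). $g(F)$ is its genus, $h(F)$ its divisor class number (number of divisor classes of degree zero), and $B_t(F)$ the number of places of $F$ of degree $t$. $F\mathbb{F}_{q^r}$ is the constant field extension of $F$ by $\mathbb{F}_{q^r}$, with full constant field $\mathbb{F}_{q^r}$. A rational place is a place of degree $1$. For a prime power $Q$ and an integer $g\ge 0$, $N_Q(g)$ is the maximum number of rational places of a global function field of genus $g$ with full constant field $\mathbb{F}_Q$, and $A(Q)=\limsup_{g\to\infty} N_Q(g)/g$. *)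

theory Defs
  imports "HOL-Algebra.Algebra" "HOL-Library.Extended_Real" "HOL-Number_Theory.Prime_Powers"
begin

locale global_function_field = field F + subfield K F
  for F :: "('a, 'b) ring_scheme" (structure) and K :: "'a set" +
  assumes finite_constants: "finite K"
    and finite_over_rational_function_field:
      "\<exists>x\<in>carrier F. (transcendental over K) x \<and>
         finite_dimension (generate_field F (insert x K)) (carrier F)"
    and full_constant_field:
      "\<lbrakk> a \<in> carrier F; (algebraic over K) a \<rbrakk> \<Longrightarrow> a \<in> K"

text \<open>A place is the maximal ideal of a valuation ring of \<open>F/K\<close>; for global function fields
  these correspond one-to-one to the equivalence classes of nontrivial valuations.\<close>

definition valuation_rings :: "('a, 'b) ring_scheme \<Rightarrow> 'a set \<Rightarrow> 'a set set" where
  "valuation_rings F K =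
     {V. subring V F \<and> K \<subset> V \<and> V \<subset> carrier F \<and>
         (\<forall>z\<in>carrier F - {\<zero>\<^bsub>F\<^esub>}. z \<in> V \<or> inv\<^bsub>F\<^esub> z \<in> V)}"

definition places :: "('a, 'b) ring_scheme \<Rightarrow> 'a set \<Rightarrow> 'a set set" where
  "places F K = {P. \<exists>V\<in>valuation_rings F K. maximalideal P (F\<lparr>carrier := V\<rparr>)}"

definition place_ring :: "('a, 'b) ring_scheme \<Rightarrow> 'a set \<Rightarrow> 'a set \<Rightarrow> ('a, 'b) ring_scheme" where
  "place_ring F K P =
     F\<lparr>carrier := (THE V. V \<in> valuation_rings F K \<and> maximalideal P (F\<lparr>carrier := V\<rparr>))\<rparr>"

definition residue_field :: "('a, 'b) ring_scheme \<Rightarrow> 'a set \<Rightarrow> 'a set \<Rightarrow> 'a set ring" where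
  "residue_field F K P = place_ring F K P Quot P"

definition place_degree :: "('a, 'b) ring_scheme \<Rightarrow> 'a set \<Rightarrow> 'a set \<Rightarrow> nat" where
  "place_degree F K P =
     ring.dim (residue_field F K P)
       ((\<lambda>a. P +>\<^bsub>place_ring F K P\<^esub> a) ` K) (carrier (residue_field F K P))"

definition num_places :: "('a, 'b) ring_scheme \<Rightarrow> 'a set \<Rightarrow> nat \<Rightarrow> nat" where
  "num_places F K t = card {P \<in> places F K. place_degree F K P = t}"

text \<open>The normalized valuation at \<open>P\<close> of a nonzero element: \<open>n\<close> with \<open>z = t\<^sup>n u\<close>, where \<open>t\<close> generates \<open>P\<close>
  and \<open>u\<close> is a unit of the valuation ring; \<open>n\<close> does not depend on the choice of \<open>t\<close>.\<close>

definition place_val :: "('a, 'b) ring_scheme \<Rightarrow> 'a set \<Rightarrow> 'a set \<Rightarrow> 'a \<Rightarrow> int" where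
  "place_val F K P z =
     (THE n. \<exists>t\<in>P. P = PIdl\<^bsub>place_ring F K P\<^esub> t \<and>
        (\<exists>u\<in>Units (place_ring F K P). z = (t [^]\<^bsub>F\<^esub> n) \<otimes>\<^bsub>F\<^esub> u))"

definition divisor_group :: "('a, 'b) ring_scheme \<Rightarrow> 'a set \<Rightarrow> ('a set \<Rightarrow>\<^sub>0 int) monoid" where
  "divisor_group F K = free_Abelian_group (places F K)"

definition divisor_degree :: "('a, 'b) ring_scheme \<Rightarrow> 'a set \<Rightarrow> ('a set \<Rightarrow>\<^sub>0 int) \<Rightarrow> int" where
  "divisor_degree F K D =
     (\<Sum>P\<in>Poly_Mapping.keys D. Poly_Mapping.lookup D P * int (place_degree F K P))"

definition principal_divisors :: "('a, 'b) ring_scheme \<Rightarrow> 'a set \<Rightarrow> ('a set \<Rightarrow>\<^sub>0 int) set" where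
  "principal_divisors F K =
     {D \<in> carrier (divisor_group F K). \<exists>z\<in>carrier F - {\<zero>\<^bsub>F\<^esub>}.
        \<forall>P\<in>places F K. Poly_Mapping.lookup D P = place_val F K P z}"

text \<open>Principal divisors have degree \<open>0\<close>, so the degree is constant on each class.\<close>

definition class_number :: "('a, 'b) ring_scheme \<Rightarrow> 'a set \<Rightarrow> nat" where
  "class_number F K =
     card {C \<in> carrier (divisor_group F K Mod principal_divisors F K).
             \<exists>D\<in>C. divisor_degree F K D = 0}"

definition riemann_roch_space ::
  "('a, 'b) ring_scheme \<Rightarrow> 'a set \<Rightarrow> ('a set \<Rightarrow>\<^sub>0 int) \<Rightarrow> 'a set" where
  "riemann_roch_space F K D =
     {z \<in> carrier F. z = \<zero>\<^bsub>F\<^esub> \<or>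
        (\<forall>P\<in>places F K. place_val F K P z \<ge> - Poly_Mapping.lookup D P)}"

text \<open>The maximum is nonnegative, since \<open>D = 0\<close> contributes \<open>0\<close>; it exists by Riemann's theorem.\<close>

definition genus :: "('a, 'b) ring_scheme \<Rightarrow> 'a set \<Rightarrow> nat" where
  "genus F K =
     nat (GREATEST n. \<exists>D\<in>carrier (divisor_group F K).
       n = divisor_degree F K D - int (ring.dim F K (riemann_roch_space F K D)) + 1)"

text \<open>The constant field extension of degree \<open>r\<close> is the compositum, inside the algebraic closure of \<open>F\<close>
  (into which \<open>indexed_const\<close> embeds \<open>F\<close>), of \<open>F\<close> with the subfield of order \<open>q\<^sup>r\<close>, i.e.\ the set of
  roots of \<open>X\<^bsup>q^r\<^esup> - X\<close>, where \<open>q\<close> is the order of \<open>K\<close>.\<close>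

definition ext_constants ::
  "('a, 'b) ring_scheme \<Rightarrow> 'a set \<Rightarrow> nat \<Rightarrow> (('a list \<times> nat) multiset \<Rightarrow> 'a) set" where
  "ext_constants F K r =
     {x \<in> carrier (field.alg_closure F). x [^]\<^bsub>field.alg_closure F\<^esub> (card K ^ r) = x}"

definition constant_field_ext ::
  "('a, 'b) ring_scheme \<Rightarrow> 'a set \<Rightarrow> nat \<Rightarrow> (('a list \<times> nat) multiset \<Rightarrow> 'a) ring" where
  "constant_field_ext F K r =
     (field.alg_closure F)\<lparr>carrier :=
        generate_field (field.alg_closure F)
          (ring.indexed_const F ` carrier F \<union> ext_constants F K r)\<rparr>"

text \<open>\<open>N\<^sub>Q(g)\<close>. Every global function field is countably infinite, hence isomorphic to one whose elements
  are natural numbers, so ranging over \<open>nat ring\<close> ranges over all of them up to isomorphism. The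
  set is finite (Hasse--Weil bound), and nonempty for every prime power \<open>Q\<close> and every \<open>g\<close>.\<close>

definition max_rational_places :: "nat \<Rightarrow> nat \<Rightarrow> nat" where
  "max_rational_places Q g =
     Max {num_places F K 1 | (F :: nat ring) K.
            global_function_field F K \<and> card K = Q \<and> genus F K = g}"

definition ihara_A :: "nat \<Rightarrow> ereal" where
  "ihara_A Q = limsup (\<lambda>g. ereal (real (max_rational_places Q g) / real g))"

end

(* Put l = q^s. Double counting the pairs of a place of degree s and a function from a Riemann-Roch space that
   vanishes there bounds B_s(F) linearly in the genus. It follows that the right-hand side of the theorem is at most
   2(l^2 - 1)/(l + 2).

   A lower bound for A(l^r) comes from a tower of Drinfeld modular type. Over the field K with Q = l^r elements let g be
   transcendental and consider the F_l-linear operator phi_g(z) = z + g z^(Q/l) - z^Q. A nonzero x_0 in its kernel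
   spans the kernel of an isogeny to phi_(g_1), where g_1 lies in K(g, x_0); iterating along a chain of compatible
   torsion points yields x_1, x_2, ... and the fields E_m = K(g, x_0, ..., x_(m-1)). At a zero of g every g_i vanishes
   and every x_i is a root of z = z^Q, so g = 0 splits into rational places. Moreover E_m = E_m^p[g], and expanding the
   functions with poles above g = infinity in this form, with derivations to bound the coefficients, bounds
   the Riemann-Roch dimensions from below and hence the genus from above, as the Riemann-Hurwitz formula would.
   In the limit A(Q) >= 2/(1/(l - 1) + 1/(Q/l - 1)), and this is at least 2(l^2 - 1)/(l + 2) because Q/l >= l^2. *)
theory Submission
 imports Defs
begin

text \<open>Three choices shape the development. Dimensions over the constants are mostly replaced
  by cardinalities of finite additive groups: a map with small fibres does the work of linear
  algebra, and finiteness of residue degrees, valuations and zeros comes from comparing growth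
  rates. Ramification is never computed as such: each place of \<open>E m\<close> is extended to a
  valuation ring \<open>W\<close> of an algebraically closed field, where scaled torsion points and
  a local parameter exist as roots, and only membership in \<open>W\<close> is tested. Finally one
  inequality per place suffices: in f = sum of c_l^p g^l the map h -> h'/g', applied i times,
  isolates the top coefficient c_i, so L(pkD) is filtered with quotients inside spaces L(D_i).
  Summing dimensions over i < p compares (p - 1)(genus - 1) with a sum of the i from 0 to p - 1,
  whence the factor 2 in the limit. The two constants meet exactly: for Q/l = l^2 the limit 2/(1/(l
  - 1) + 1/(Q/l - 1)) is 2(l^2 - 1)/(l + 2), which is why r >= 3 is enough.\<close>

context cring
begin

section \<open>Additive subgroups and values of polynomials\<close>

definition asub :: "'a set => bool" where
 "asub A \<longleftrightarrow> A <= carrier R & \<zero> : A & (ALL a:A. ALL b:A. a \<ominus> b : A)"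

lemma asubI:
 assumes "A <= carrier R" "\<zero> : A" "!!a b. a : A ==> b : A ==> a \<ominus> b : A"
 shows "asub A"
 using assms by (auto simp: asub_def)

lemma asubD:
 assumes "asub A"
 shows "A <= carrier R" "\<zero> : A" "a : A ==> a : carrier R"
  "a : A ==> \<ominus> a : A" "a : A ==> b : A ==> a \<ominus> b : A" "a : A ==> b : A ==> a \<oplus> b : A"
proof -
 have 1: "A <= carrier R" "\<zero> : A" and 2: "!!a b. a : A ==> b : A ==> a \<ominus> b : A"
  using assms by (auto simp: asub_def)
 show "A <= carrier R" "\<zero> : A" "a : A ==> b : A ==> a \<ominus> b : A" "a : A ==> a : carrier R"
  using 1 2 by auto
 have 3: "\<ominus> a : A" if "a : A" for a
  using 2[of \<zero> a] 1 that by (auto simp: minus_eq)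
 show "a : A ==> \<ominus> a : A" by (rule 3)
 show "a : A ==> b : A ==> a \<oplus> b : A"
  using 2[of a "\<ominus> b"] 3[of b] 1 by (auto simp: minus_eq)
qed

lemma asub_diff_zero:
 assumes "a : carrier R" "b : carrier R" "a \<ominus> b = \<zero>"
 shows "a = b"
 using assms by simp

lemma asub_subring: "subring S R ==> asub S"
 by (rule asubI) (auto dest: subringE simp: a_minus_def)

text \<open>Subtracting a chosen member of its fibre leaves \<open>x\<close> determined by
  \<open>f x\<close> and an element of \<open>C\<close>. As \<open>f\<close> may be any function, it
  can later be an arbitrary choice of leading coefficients.\<close>

lemma card_le_fibres:
 assumes A: "asub A" and fin: "finite B" "finite C"
  and f: "!!x. x : A ==> f x : B"
  and ker: "!!x y. x : A ==> y : A ==> f x = f y ==> x \<ominus> y : C"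
 shows "finite A" "card A <= card B * card C"
proof -
 define r where "r b = (SOME a. a : A & f a = b)" for b
 have r: "r (f x) : A & f (r (f x)) = f x" if "x : A" for x
  unfolding r_def by (rule someI[where x=x]) (use that in auto)
 define h where "h x = (f x, x \<ominus> r (f x))" for x
 have inj: "inj_on h A"
 proof (rule inj_onI)
  fix x y assume xy: "x : A" "y : A" "h x = h y"
  have "x \<ominus> r (f x) = y \<ominus> r (f x)" using xy unfolding h_def by auto
  thus "x = y" using xy r asubD(3)[OF A] by (simp add: minus_eq)
 qed
 have sub: "h ` A <= B \<times> C" using f ker r by (auto simp: h_def)
 show "finite A" using fin sub using inj finite_imageD by (meson finite_SigmaI finite_subset)
 have "card A = card (h ` A)" using inj card_image by metis
 also have "\<dots> <= card (B \<times> C)" by (intro card_mono) (use sub fin in auto)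
 finally show "card A <= card B * card C" by (simp add: card_cartesian_product)
qed

text \<open>The values at \<open>y\<close> of polynomials with \<open>k\<close> coefficients from
  \<open>A\<close>, in Horner form.\<close>

primrec ladder :: "'a set => 'a => nat => 'a set" where
 "ladder A y 0 = {\<zero>}"
| "ladder A y (Suc k) = {a \<oplus> y \<otimes> b | a b. a : A & b : ladder A y k}"

lemma ladder_SucI: "a : A ==> b : ladder A y k ==> a \<oplus> y \<otimes> b : ladder A y (Suc k)"
 by auto

lemma ladder_SucE:
 assumes "f : ladder A y (Suc k)"
 obtains a b where "f = a \<oplus> y \<otimes> b" "a : A" "b : ladder A y k"
 using assms by auto

lemma ladder_subring:
 assumes "subring S R" "A <= S" "y : S"
 shows "ladder A y k <= S"
 by (induction k) (use assms in \<open>auto intro: subringE\<close>)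

declare ladder.simps(2) [simp del]

lemma ladder_carrier: "A <= carrier R ==> y : carrier R ==> ladder A y k <= carrier R"
 by (rule ladder_subring[OF carrier_is_subring])

lemma ladder_asub:
 assumes A: "asub A" and y: "y : carrier R"
 shows "asub (ladder A y k)"
proof (induction k)
 case 0 show ?case by (rule asubI) (auto simp: minus_eq)
next
 case (Suc k)
 show ?case
 proof (rule asubI)
  show "ladder A y (Suc k) <= carrier R" by (rule ladder_carrier[OF asubD(1)[OF A] y])
  show "\<zero> : ladder A y (Suc k)" using y
   using ladder_SucI[OF asubD(2)[OF A] asubD(2)[OF Suc]] by simp
  fix f g assume "f : ladder A y (Suc k)" "g : ladder A y (Suc k)"
  then obtain a b c d where *: "a : A" "c : A" "b : ladder A y k" "d : ladder A y k"
   "f = a \<oplus> y \<otimes> b" "g = c \<oplus> y \<otimes> d" by (metis ladder_SucE)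
  show "f \<ominus> g : ladder A y (Suc k)" using * asubD(3)[OF A] asubD(3)[OF Suc] y *
   using ladder_SucI[OF asubD(5)[OF A *(1,2)] asubD(5)[OF Suc *(3,4)]] by (simp add: minus_eq r_distr r_minus a_ac minus_add)
 qed
qed

lemma ladder_Suc: "asub A ==> y : carrier R ==> ladder A y k <= ladder A y (Suc k)"
proof (induction k)
 case 0
 thus ?case using asubD(2)[OF 0(1)] ladder_SucI[of \<zero> A \<zero> y 0] by auto
next
 case (Suc k) thus ?case by (auto elim!: ladder_SucE intro!: ladder_SucI)
qed

lemma ladder_mono: "asub A ==> y : carrier R ==> k <= l ==> ladder A y k <= ladder A y l"
proof (induction l)
 case (Suc l) thus ?case using ladder_Suc[of A y l] by (cases "k = Suc l") auto
qed auto

lemma ladder_base: "A <= carrier R ==> y : carrier R ==> ladder A y (Suc 0) = A"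
 by (auto simp: subset_iff ladder.simps(2)) (metis r_zero)

lemma ladder_scale:
 assumes "A <= carrier R" "z : carrier R" "y : carrier R" "!!a. a : A ==> z \<otimes> a : B"
 shows "f : ladder A y k ==> z \<otimes> f : ladder B y k"
proof (induction k arbitrary: f)
 case 0 thus ?case using assms by auto
next
 case (Suc k)
 then obtain a b where *: "f = a \<oplus> y \<otimes> b" "a : A" "b : ladder A y k" by (meson ladder_SucE)
 show ?case using * assms ladder_carrier[OF assms(1,3)] using ladder_SucI[OF assms(4)[OF *(2)] Suc.IH[OF *(3)]] by (auto simp: r_distr m_lcomm subset_iff)
qed

lemma ladder_shift:
 assumes "asub A" "y : carrier R" "f : ladder A y k"
 shows "y \<otimes> f : ladder A y (Suc k)"
proof -
 show ?thesis using assms asubD(3)[OF ladder_asub] using ladder_SucI[OF asubD(2)[OF assms(1)] assms(3)] by simp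
qed

lemma ladder_pow_shift:
 assumes "asub A" "y : carrier R" "f : ladder A y k"
 shows "y [^] (i::nat) \<otimes> f : ladder A y (k + i)"
proof (induction i)
 case 0 thus ?case using assms asubD(3)[OF ladder_asub[OF assms(1,2)]] by simp
next
 case (Suc i)
 show ?case using assms asubD(3)[OF ladder_asub[OF assms(1,2)]] using ladder_shift[OF assms(1,2) Suc] by (simp add: m_ac)
qed

text \<open>The recursion splits off the constant coefficient; arguments with relations of minimal
  degree need the leading one.\<close>

lemma ladder_top:
 assumes "asub A" "y : carrier R"
 shows "f : ladder A y (Suc k) \<longleftrightarrow> (EX b:ladder A y k. EX c:A. f = b \<oplus> y [^] k \<otimes> c)"
proof
 assume "EX b:ladder A y k. EX c:A. f = b \<oplus> y [^] k \<otimes> c"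
 then obtain b c where bc: "b : ladder A y k" "c : A" "f = b \<oplus> y [^] k \<otimes> c" by auto
 have "y [^] k \<otimes> c : ladder A y (Suc 0 + k)"
  using bc ladder_base[of A y] asubD(1)[OF assms(1)] assms by (intro ladder_pow_shift) auto
 moreover have "b : ladder A y (Suc k)" using ladder_Suc[OF assms] bc by blast
 ultimately show "f : ladder A y (Suc k)"
  using bc asubD(6)[OF ladder_asub[OF assms]] by simp
next
 show "f : ladder A y (Suc k) ==> EX b:ladder A y k. EX c:A. f = b \<oplus> y [^] k \<otimes> c"
 proof (induction k arbitrary: f)
  case 0
  then show ?case using assms asubD(3)[OF assms(1)] by (auto elim!: ladder_SucE)
 next
  case (Suc k)
  then obtain a b where ab: "f = a \<oplus> y \<otimes> b" "a : A" "b : ladder A y (Suc k)" using ladder_SucE by blast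
  then obtain d c where dc: "d : ladder A y k" "c : A" "b = d \<oplus> y [^] k \<otimes> c" using Suc.IH by blast
  have "f = (a \<oplus> y \<otimes> d) \<oplus> y [^] Suc k \<otimes> c"
   using ab dc asubD(3)[OF assms(1)] asubD(3)[OF ladder_asub[OF assms]] assms by (simp add: r_distr m_ac a_ac)
  moreover have "a \<oplus> y \<otimes> d : ladder A y (Suc k)" using ab dc ladder_SucI by blast
  ultimately show ?case using dc by blast
 qed
qed

lemma ladder_finite:
 assumes "finite A"
 shows "finite (ladder A y k)" "card (ladder A y k) <= card A ^ k"
proof (induction k)
 case (Suc k)
 have e: "ladder A y (Suc k) = (%(a, b). a \<oplus> y \<otimes> b) ` (A \<times> ladder A y k)" by (auto simp: ladder.simps(2))
 { case 1 show ?case unfolding e using assms Suc by simp }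
 { case 2
  have "card (ladder A y (Suc k)) <= card (A \<times> ladder A y k)"
   unfolding e using assms Suc by (intro card_image_le) simp
  also have "\<dots> <= card A ^ Suc k" using Suc by (simp add: card_cartesian_product)
  finally show ?case . }
qed auto

lemma ladder_mult:
 assumes S: "S <= carrier R" and A: "asub A" and SA: "!!s a. s : S ==> a : A ==> s \<otimes> a : A"
  and y: "y : carrier R"
 shows "f : ladder S y i ==> g : ladder A y j ==> f \<otimes> g : ladder A y (i + j)"
proof (induction i arbitrary: f)
 case 0
 thus ?case using asubD(2,3)[OF ladder_asub[OF A y]] by simp
next
 case (Suc i)
 then obtain a b where ab: "f = a \<oplus> y \<otimes> b" "a : S" "b : ladder S y i" using ladder_SucE by blast
 have gc: "g : carrier R" "b : carrier R" "a : carrier R"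
  using Suc(3) ab(2,3) S asubD(3)[OF ladder_asub[OF A y]] subsetD[OF ladder_carrier[OF S y]] by auto
 have "f \<otimes> g = a \<otimes> g \<oplus> y \<otimes> (b \<otimes> g)" using gc y ab by (simp add: l_distr m_assoc)
 moreover have "a \<otimes> g : ladder A y (Suc i + j)"
  using ladder_scale[OF asubD(1)[OF A] gc(3) y _ Suc.prems(2), of A] SA ab(2)
   ladder_mono[OF A y, of j "Suc i + j"] by auto
 moreover have "y \<otimes> (b \<otimes> g) : ladder A y (Suc i + j)"
  using ladder_shift[OF A y Suc.IH[OF ab(3) Suc.prems(2)]] by simp
 ultimately show ?case using asubD(6)[OF ladder_asub[OF A y]] by simp
qed

definition adjoin :: "'a set => 'a => 'a set" where
 "adjoin S y = (\<Union>k. ladder S y k)"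

lemma adjoin_subring:
 assumes S: "subring S R" and y: "y : carrier R"
 shows "subring (adjoin S y) R" "S <= adjoin S y" "y : adjoin S y"
proof -
 have sc: "S <= carrier R" by (rule subringE(1)[OF S])
 have A: "asub S" by (rule asub_subring[OF S])
 have lb: "S <= ladder S y (Suc 0)" using ladder_base[OF sc y] by simp
 show S': "S <= adjoin S y" using lb by (auto simp only: adjoin_def)
 have "\<one> : ladder S y (Suc 0)" using subringE(3)[OF S] lb by blast
 from ladder_shift[OF A y this] show "y : adjoin S y" using y by (auto simp only: adjoin_def r_one)
 show "subring (adjoin S y) R"
 proof (rule subringI)
  show "adjoin S y <= carrier R" using ladder_carrier[OF sc y] by (auto simp only: adjoin_def)
  show "\<one> : adjoin S y" using S' subringE(3)[OF S] by blast
  show "\<ominus> h : adjoin S y" if "h : adjoin S y" for h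
   using that asubD(4)[OF ladder_asub[OF A y]] by (auto simp only: adjoin_def)
  fix f g assume "f : adjoin S y" "g : adjoin S y"
  then obtain i j where ij: "f : ladder S y i" "g : ladder S y j" by (auto simp only: adjoin_def)
  show "f \<otimes> g : adjoin S y"
   using ladder_mult[OF sc A _ y ij] subringE(6)[OF S] by (auto simp only: adjoin_def)
  have "f : ladder S y (i + j)" "g : ladder S y (i + j)"
   using ij ladder_mono[OF A y, of i "i+j"] ladder_mono[OF A y, of j "i+j"] by auto
  thus "f \<oplus> g : adjoin S y"
   using asubD(6)[OF ladder_asub[OF A y]] by (auto simp only: adjoin_def)
 qed
qed

lemma adjoin_min: "subring T R ==> S <= T ==> y : T ==> adjoin S y <= T"
 unfolding adjoin_def using ladder_subring by blast

end

context domain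
begin

text \<open>Since \<open>A\<close> meets \<open>y S\<close> only in zero, the coefficients can be
  recovered one after the other, like digits in base \<open>y\<close>.\<close>

lemma ladder_card_eq:
 assumes S: "subring S R" and A: "asub A" "A <= S" "finite A" and y: "y : S" "y ~= \<zero>"
  and indep: "!!a b. a : A ==> b : S ==> a = y \<otimes> b ==> a = \<zero>"
 shows "card (ladder A y k) = card A ^ k"
proof (induction k)
 case (Suc k)
 have sc: "S <= carrier R" by (rule subringE(1)[OF S])
 have yc: "y : carrier R" using y sc by auto
 have e: "ladder A y (Suc k) = (%(a, b). a \<oplus> y \<otimes> b) ` (A \<times> ladder A y k)" by (auto simp: ladder.simps(2))
 have "inj_on (%(a, b). a \<oplus> y \<otimes> b) (A \<times> ladder A y k)"
 proof (rule inj_onI, clarify)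
  fix a b c d assume *: "a : A" "c : A" "b : ladder A y k" "d : ladder A y k" "a \<oplus> y \<otimes> b = c \<oplus> y \<otimes> d"
  have S': "b : S" "d : S" using ladder_subring[OF S A(2) y(1)] * by auto
  have cc: "a : carrier R" "c : carrier R" "b : carrier R" "d : carrier R" using * A S' sc by auto
  have "a \<ominus> c = (a \<oplus> y \<otimes> b) \<ominus> (c \<oplus> y \<otimes> b)" using cc yc by (simp add: minus_eq minus_add a_ac r_neg)
  also have "\<dots> = (c \<oplus> y \<otimes> d) \<ominus> (c \<oplus> y \<otimes> b)" using * by simp
  also have "\<dots> = y \<otimes> (d \<ominus> b)" using cc yc by (simp add: minus_eq minus_add a_ac r_distr r_minus r_neg2)
  finally have eq: "a \<ominus> c = y \<otimes> (d \<ominus> b)" .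
  have "a \<ominus> c = \<zero>" using indep[OF asubD(5)[OF A(1) *(1,2)] _ eq] S' subringE(5,7)[OF S]
   by (simp add: minus_eq)
  moreover from this eq have "d \<ominus> b = \<zero>" using y yc cc by (metis integral minus_closed)
  ultimately show "a = c & b = d" using cc asub_diff_zero by metis
 qed
 thus ?case unfolding e using Suc by (simp add: card_image card_cartesian_product)
qed auto

text \<open>Pigeonhole: two coefficient tuples with the same value differ in some highest place, and
  subtracting them gives a relation for \<open>y\<close> with leading coefficient
  \<open>p\<close>.\<close>

lemma ladder_card_lt_relation:
 assumes A: "asub A" "finite A" and y: "y : carrier R"
  and lt: "card (ladder A y k) < card A ^ k"
 shows "EX j. EX p:A. p ~= \<zero> & p \<otimes> y [^] (j::nat) : ladder A y j"
 using lt
proof (induction k)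
 case (Suc k)
 show ?case
 proof (rule ccontr)
  assume neg: "\<not> ?thesis"
  define f where "f = (%(b, c). b \<oplus> y [^] k \<otimes> c)"
  have e: "ladder A y (Suc k) = f ` (ladder A y k \<times> A)"
   unfolding set_eq_iff ladder_top[OF A(1) y] f_def image_iff by force
  have cl: "!!b. b : ladder A y k ==> b : carrier R" "!!b. b : A ==> b : carrier R"
   using asubD(3)[OF ladder_asub[OF A(1) y]] asubD(3)[OF A(1)] by auto
  have "inj_on f (ladder A y k \<times> A)"
  proof (rule inj_onI, clarify)
   fix b c b' c' assume *: "b : ladder A y k" "b' : ladder A y k" "c : A" "c' : A" "f (b, c) = f (b', c')"
   note [simp] = cl(1)[OF *(1)] cl(1)[OF *(2)] cl(2)[OF *(3)] cl(2)[OF *(4)] y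
   have eq: "b \<oplus> y [^] k \<otimes> c = b' \<oplus> y [^] k \<otimes> c'" using * by (simp add: f_def)
   have "b' \<ominus> b = (b' \<oplus> y [^] k \<otimes> c') \<ominus> (b \<oplus> y [^] k \<otimes> c')"
    by (simp add: minus_eq minus_add a_ac r_neg)
   also have "\<dots> = (b \<oplus> y [^] k \<otimes> c) \<ominus> (b \<oplus> y [^] k \<otimes> c')" by (simp add: eq)
   also have "\<dots> = (c \<ominus> c') \<otimes> y [^] k"
    by (simp add: minus_eq minus_add a_ac r_distr r_minus r_neg2 r_neg1 r_neg m_comm[of _ "y [^] k"])
   finally have 1: "b' \<ominus> b = (c \<ominus> c') \<otimes> y [^] k" .
   have "c \<ominus> c' = \<zero>" using asubD(5)[OF ladder_asub[OF A(1) y]] * using neg asubD(5)[OF A(1) *(3,4)] 1 by metis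
   moreover from this 1 have "b' \<ominus> b = \<zero>" by (metis l_null nat_pow_closed y)
   ultimately show "b = b' & c = c'" by simp
  qed
  hence "card (ladder A y (Suc k)) = card (ladder A y k) * card A"
   unfolding e by (simp add: card_image card_cartesian_product)
  moreover have "\<not> card (ladder A y k) < card A ^ k" using Suc neg by blast
  ultimately show False using Suc.prems by simp
 qed
qed auto

end

lemma (in ring) normalize_snoc_eq_Nil: "normalize (p @ [c]) = [] ==> c = \<zero>"
 by (induction p) (auto split: if_splits)

context domain
begin

lemma ladder_eval:
 assumes K: "subring K R" and y: "y : carrier R"
 shows "f : ladder K y k ==> EX p. set p <= K & eval p y = f"
proof (induction k arbitrary: f)
 case 0 thus ?case by (auto intro!: exI[of _ "[]"])
next
 case (Suc k)
 then obtain a b where ab: "f = a \<oplus> y \<otimes> b" "a : K" "b : ladder K y k" by (meson ladder_SucE)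
 then obtain p where p: "set p <= K" "eval p y = b" using Suc.IH by blast
 have sc: "K <= carrier R" by (rule subringE(1)[OF K])
 have c: "b : carrier R" "a : carrier R" "set p <= carrier R"
  using subsetD[OF ladder_carrier[OF sc y] ab(3)] ab(2) sc p by auto
 have "eval (p @ [a]) y = f" using c y eval_append_aux[OF c(3,2) y] p ab by (simp add: m_comm a_comm)
 thus ?case using p ab by (intro exI[of _ "p @ [a]"]) auto
qed

text \<open>Bringing \<open>a\<close> to the other side gives a polynomial relation for
  \<open>y\<close> with constant term \<open>- a\<close>.\<close>

lemma transcendental_ladder:
 assumes K: "subring K R" and y: "y : carrier R" "(transcendental over K) y"
  and a: "a : K" "b : adjoin K y" "a = y \<otimes> b"
 shows "a = \<zero>"
proof -
 obtain p where p: "set p <= K" "eval p y = b"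
  using a ladder_eval[OF K y(1)] unfolding adjoin_def by blast
 have sc: "K <= carrier R" by (rule subringE(1)[OF K])
 have c: "b : carrier R" "a : carrier R" "set p <= carrier R"
  using subringE(1)[OF adjoin_subring(1)[OF K y(1)]] a sc p by auto
 have "eval (p @ [\<ominus> a]) y = \<zero>"
  using c y eval_append_aux[OF c(3) _ y(1)] p a by (simp add: m_comm r_neg)
 moreover have "set (p @ [\<ominus> a]) <= K" using p a subringE(5)[OF K] by auto
 moreover from this have "set (p @ [\<ominus> a]) <= carrier R" using sc by blast
 ultimately have "normalize (p @ [\<ominus> a]) = []" using eval_normalize[OF _ y(1)] normalize_gives_polynomial using eval_transcendental[OF y(2)] by (auto simp: univ_poly_def)
 hence "\<ominus> a = \<zero>" by (rule normalize_snoc_eq_Nil)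
 thus ?thesis using c by simp
qed

end

lemma (in field) inv_nz:
 assumes "x : carrier R" "x ~= \<zero>"
 shows "inv x : carrier R" "inv x ~= \<zero>" "x \<otimes> inv x = \<one>" "inv x \<otimes> x = \<one>" "inv (inv x) = x"
proof -
 show 1: "inv x : carrier R" "x \<otimes> inv x = \<one>" "inv x \<otimes> x = \<one>" "inv (inv x) = x" using assms field_Units by auto
 show "inv x ~= \<zero>" using 1 assms by auto
qed

lemma (in field) inv_mult_nz:
 assumes "x : carrier R" "x ~= \<zero>" "y : carrier R" "y ~= \<zero>"
 shows "inv (x \<otimes> y) = inv x \<otimes> inv y"
proof -
 note c = inv_nz[OF assms(1,2)] inv_nz[OF assms(3,4)] assms
 show ?thesis using c comm_inv_char[of "x \<otimes> y" "inv x \<otimes> inv y"] by (simp add: m_ac)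
qed

lemma (in domain) pow_nz: "x : carrier R ==> x ~= \<zero> ==> x [^] (n::nat) ~= \<zero>"
 by (induction n) (auto simp: integral_iff)

lemma (in domain) card_scale:
 assumes "z : carrier R" "z ~= \<zero>" "A <= carrier R"
 shows "card ((\<otimes>) z ` A) = card A"
 by (rule card_image) (use assms in \<open>auto intro!: inj_onI simp: m_lcancel subset_iff\<close>)

text \<open>Compares growth rates; the factor \<open>C\<close> will collect the cost of clearing
  denominators.\<close>

lemma power_growth_le:
 fixes a b C :: nat
 assumes "!!k. a ^ k <= C * b ^ k"
 shows "a <= b"
proof (rule ccontr)
 assume "\<not> a <= b"
 hence ab: "b + 1 <= a" by simp
 have "b > 0" using assms[of 1] ab by (cases b) auto
 hence "real a / real b > 1" using ab by simp
 then obtain n where n: "real C < (real a / real b) ^ n" using real_arch_pow by blast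
 have "real (a ^ n) <= real (C * b ^ n)" using assms[of n] of_nat_mono by blast
 hence "(real a / real b) ^ n <= real C" using \<open>b > 0\<close> by (simp add: field_simps)
 thus False using n by simp
qed

section \<open>Counting in a finite extension of a rational function field\<close>

context global_function_field
begin

abbreviation "VR == valuation_rings F K"

lemma K_subring: "subring K F"
 using subfieldE(1)[OF subfield_axioms] .

lemma K_carrier: "K <= carrier F" "\<zero> : K" "\<one> : K"
 using subringE[OF K_subring] by auto

lemma K_asub: "asub K"
 by (rule asub_subring[OF K_subring])

lemma K_inv: "a : K ==> a ~= \<zero> ==> inv a : K"
 using subfield_m_inv(1)[OF subfield_axioms] by blast

lemma card_K_gt_1: "card K > 1"
proof -
 have "card {\<zero>, \<one>} <= card K" using K_carrier finite_constants by (intro card_mono) auto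
 thus ?thesis by simp
qed

lemma nonconstant_transcendental: "y : carrier F ==> y ~: K ==> (transcendental over K) y"
 using full_constant_field by (auto simp: over_def)

lemma nonconstant_ladder:
 assumes "y : carrier F" "y ~: K" "a : K" "b : adjoin K y" "a = y \<otimes> b"
 shows "a = \<zero>"
 using transcendental_ladder[OF K_subring assms(1) nonconstant_transcendental[OF assms(1,2)] assms(3-5)] .

lemma transcendental_nonconstant:
 assumes "y : carrier F" "(transcendental over K) y"
 shows "y ~: K"
 using algebraic_self[OF K_subring] assms by (auto simp: over_def)

text \<open>Combinations of the list whose coefficients are polynomials in \<open>x\<close> of
  degree below \<open>d\<close>. For a basis over K(x) they exhaust the field up to
  denominators.\<close>

primrec lincombs :: "'a => nat => 'a list => 'a set" where
 "lincombs x d [] = {\<zero>}"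
| "lincombs x d (u # us) = {a \<otimes> u \<oplus> m | a m. a : ladder K x d & m : lincombs x d us}"

lemma lincombs_asub:
 assumes "x : carrier F" "set us <= carrier F"
 shows "asub (lincombs x d us)"
 using assms(2)
proof (induction us)
 case Nil show ?case by (rule asubI) (auto simp: minus_eq)
next
 case (Cons u us)
 hence u: "u : carrier F" and I: "asub (lincombs x d us)" by auto
 have L: "asub (ladder K x d)" by (rule ladder_asub[OF K_asub assms(1)])
 show ?case
 proof (rule asubI)
  show "lincombs x d (u # us) <= carrier F"
   using u asubD(3)[OF L] asubD(3)[OF I] by auto
  show "\<zero> : lincombs x d (u # us)" using u using asubD(2)[OF L] asubD(2)[OF I] by force
  fix f g assume "f : lincombs x d (u # us)" "g : lincombs x d (u # us)"
  then obtain a b m n where *: "a : ladder K x d" "b : ladder K x d" "m : lincombs x d us"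
   "n : lincombs x d us" "f = a \<otimes> u \<oplus> m" "g = b \<otimes> u \<oplus> n" by auto
  have "f \<ominus> g = (a \<ominus> b) \<otimes> u \<oplus> (m \<ominus> n)"
   using * asubD(3)[OF L] asubD(3)[OF I] u * by (simp add: minus_eq l_distr l_minus a_ac minus_add)
  thus "f \<ominus> g : lincombs x d (u # us)"
   using asubD(5)[OF L *(1,2)] asubD(5)[OF I *(3,4)] by auto
 qed
qed

lemma lincombs_mult:
 assumes "x : carrier F" "set us <= carrier F" "f : ladder K x i"
 shows "m : lincombs x d us ==> f \<otimes> m : lincombs x (i + d) us"
 using assms(2)
proof (induction us arbitrary: m)
 case Nil thus ?case using assms subsetD[OF ladder_carrier[OF K_carrier(1) assms(1)]] by auto
next
 case (Cons u us)
 then obtain a n where *: "a : ladder K x d" "n : lincombs x d us" "m = a \<otimes> u \<oplus> n" by auto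
 have c: "a : carrier F" "n : carrier F" "f : carrier F" "u : carrier F"
  using * Cons assms subsetD[OF ladder_carrier[OF K_carrier(1) assms(1)]]
   asubD(3)[OF lincombs_asub[OF assms(1)]] by auto
 have "f \<otimes> m = (f \<otimes> a) \<otimes> u \<oplus> f \<otimes> n" using c * by (simp add: r_distr m_assoc)
 moreover have "f \<otimes> a : ladder K x (i + d)"
  using ladder_mult[OF K_carrier(1) K_asub _ assms(1,3) *(1)] by blast
 ultimately show ?case using Cons * by auto
qed

lemma lincombs_finite:
 "finite (lincombs x d us) & card (lincombs x d us) <= card K ^ (length us * d)"
proof (induction us)
 case (Cons u us)
 have e: "lincombs x d (u # us) = (%(a, m). a \<otimes> u \<oplus> m) ` (ladder K x d \<times> lincombs x d us)" by auto
 have "card (lincombs x d (u # us)) <= card (ladder K x d \<times> lincombs x d us)"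
  unfolding e using Cons ladder_finite(1)[OF finite_constants] by (intro card_image_le) simp
 also have "\<dots> <= card K ^ d * card K ^ (length us * d)"
  using Cons ladder_finite(2)[OF finite_constants] by (auto simp: card_cartesian_product intro!: mult_le_mono)
 finally show ?case unfolding e using Cons ladder_finite(1)[OF finite_constants] by (simp add: power_add)
qed auto

lemma fraction_representation:
 assumes x: "x : carrier F"
 shows "k : generate_field F (insert x K) ==>
  k : carrier F & (EX H:adjoin K x. H ~= \<zero> & H \<otimes> k : adjoin K x)"
proof (induction rule: generate_field.induct)
 note S = adjoin_subring[OF K_subring x]
 note SE = subringE[OF S(1)]
 have one: "\<one> : adjoin K x" by (rule SE(3))
 { case one show ?case by (intro conjI bexI[OF _ \<open>\<one> : adjoin K x\<close>]) (use SE(3) in auto) }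
 { case (incl h) hence "h : adjoin K x" "h : carrier F" using S x K_carrier by auto
  thus ?case using one by (intro conjI bexI[OF _ one]) auto }
 { case (a_inv h) thus ?case using SE by (auto simp: r_minus subset_iff) }
 { case (m_inv h)
  then obtain H where H: "H : adjoin K x" "H ~= \<zero>" "H \<otimes> h : adjoin K x" by auto
  have c: "H : carrier F" "h : carrier F" using H SE(1) m_inv by auto
  have "(H \<otimes> h) \<otimes> inv h = H" using c m_inv inv_nz[of h] by (simp add: m_assoc)
  moreover have "H \<otimes> h ~= \<zero>" using c H m_inv by (simp add: integral_iff)
  ultimately show ?case using H m_inv inv_nz[of h] by auto }
 { case (eng_add h1 h2)
  then obtain H1 H2 where H: "H1 : adjoin K x" "H1 ~= \<zero>" "H1 \<otimes> h1 : adjoin K x"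
   "H2 : adjoin K x" "H2 ~= \<zero>" "H2 \<otimes> h2 : adjoin K x" by auto
  have c: "H1 : carrier F" "H2 : carrier F" "h1 : carrier F" "h2 : carrier F"
   using H SE(1) eng_add by auto
  have "(H1 \<otimes> H2) \<otimes> (h1 \<oplus> h2) = H2 \<otimes> (H1 \<otimes> h1) \<oplus> H1 \<otimes> (H2 \<otimes> h2)"
   using c by (simp add: r_distr m_ac)
  also have "\<dots> : adjoin K x" using H SE by auto
  finally show ?case using H SE c by (intro conjI bexI[of _ "H1 \<otimes> H2"]) (auto simp: integral_iff) }
 { case (eng_mult h1 h2)
  then obtain H1 H2 where H: "H1 : adjoin K x" "H1 ~= \<zero>" "H1 \<otimes> h1 : adjoin K x"
   "H2 : adjoin K x" "H2 ~= \<zero>" "H2 \<otimes> h2 : adjoin K x" by auto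
  have c: "H1 : carrier F" "H2 : carrier F" "h1 : carrier F" "h2 : carrier F"
   using H SE(1) eng_mult by auto
  have "(H1 \<otimes> H2) \<otimes> (h1 \<otimes> h2) = (H1 \<otimes> h1) \<otimes> (H2 \<otimes> h2)"
   using c by (simp add: m_ac)
  also have "\<dots> : adjoin K x" using H SE by auto
  finally show ?case using H SE c by (intro conjI bexI[of _ "H1 \<otimes> H2"]) (auto simp: integral_iff) }
qed

lemma span_representation:
 assumes x: "x : carrier F" and us: "set us <= carrier F"
 shows "f : Span (generate_field F (insert x K)) us ==>
  EX H:adjoin K x. H ~= \<zero> & (EX d. H \<otimes> f : lincombs x d us)"
 using us
proof (induction us arbitrary: f)
 note S = adjoin_subring[OF K_subring x]
 note SE = subringE[OF S(1)]
 case Nil thus ?case using SE(3) by (intro bexI[of _ \<one>]) auto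
next
 note S = adjoin_subring[OF K_subring x]
 note SE = subringE[OF S(1)]
 case (Cons u us)
 then obtain k v where kv: "k : generate_field F (insert x K)" "v : Span (generate_field F (insert x K)) us"
  "f = k \<otimes> u \<oplus> v" by (auto simp: line_extension_mem_iff)
 obtain H1 where H1: "H1 : adjoin K x" "H1 ~= \<zero>" "H1 \<otimes> k : adjoin K x" "k : carrier F"
  using fraction_representation[OF x kv(1)] by blast
 obtain H2 d where H2: "H2 : adjoin K x" "H2 ~= \<zero>" "H2 \<otimes> v : lincombs x d us"
  using Cons.IH[OF kv(2)] Cons.prems(2) by auto
 have sf: "subfield (generate_field F (insert x K)) F"
  using x by (intro generate_field_is_subfield) auto
 have c: "H1 : carrier F" "H2 : carrier F" "u : carrier F" "v : carrier F"
  using H1 H2 SE(1) Cons Span_in_carrier[OF subringE(1)[OF subfieldE(1)[OF sf]], of us] kv(2) by auto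
 obtain i where i: "H1 : ladder K x i" using H1 by (auto simp only: adjoin_def)
 have "H2 \<otimes> (H1 \<otimes> k) : adjoin K x" using H1 H2 SE by auto
 then obtain j where j: "H2 \<otimes> (H1 \<otimes> k) : ladder K x j" by (auto simp only: adjoin_def)
 have mono: "lincombs x a us <= lincombs x b us" if "a <= b" for a b
 proof -
  have "lincombs x a us <= lincombs x b us" if "set us <= carrier F" for us
   using that
  proof (induction us)
   case (Cons u us)
   thus ?case using ladder_mono[OF K_asub x \<open>a <= b\<close>] by auto
  qed auto
  thus ?thesis using Cons by auto
 qed
 have 1: "H1 \<otimes> (H2 \<otimes> v) : lincombs x (i + d + j) us" using lincombs_mult[OF x _ i H2(3)] Cons using mono[of "i+d" "i+d+j"] by auto
 have 2: "H2 \<otimes> (H1 \<otimes> k) : ladder K x (i + d + j)"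
  using j ladder_mono[OF K_asub x, of j "i+d+j"] by auto
 have "(H1 \<otimes> H2) \<otimes> f = (H2 \<otimes> (H1 \<otimes> k)) \<otimes> u \<oplus> H1 \<otimes> (H2 \<otimes> v)"
  using c H1 kv by (simp add: r_distr m_ac)
 also have "\<dots> : lincombs x (i + d + j) (u # us)" using 1 2 by auto
 finally have 3: "(H1 \<otimes> H2) \<otimes> f : lincombs x (i + d + j) (u # us)" .
 have "H1 \<otimes> H2 ~= \<zero>" using H1 H2 c by (simp add: integral_iff)
 thus ?case using 3 SE(6)[OF H1(1) H2(1)] by blast
qed

text \<open>Transcendence degree one in terms of counting. \<open>M d\<close> consists of the
  combinations of a basis over K(x) with polynomial coefficients of degree below \<open>d\<close>,
  so the logarithm of its size is linear in \<open>d\<close>; multiplying by a fixed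
  \<open>y\<close> costs one denominator \<open>H\<close> and a fixed shift
  \<open>c\<close>.\<close>

lemma growth_family:
 obtains M n where
  "!!d. asub (M d)" "!!d. finite (M d)" "!!d. card (M d) <= card K ^ (n * d)"
  "!!A. finite A ==> A <= carrier F ==> EX H:carrier F. H ~= \<zero> & (EX d. ALL a:A. H \<otimes> a : M d)"
  "!!y. y : carrier F ==> EX H:carrier F. H ~= \<zero> &
    (EX c. ALL d. ALL m:M d. H \<otimes> m : M (d + c) & H \<otimes> (y \<otimes> m) : M (d + c))"
proof -
 obtain x where x: "x : carrier F" and fd: "finite_dimension (generate_field F (insert x K)) (carrier F)"
  using finite_over_rational_function_field by blast
 have sf: "subfield (generate_field F (insert x K)) F"
  using x by (intro generate_field_is_subfield) auto
 obtain n where "dimension n (generate_field F (insert x K)) (carrier F)"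
  using finite_dimensionE[OF sf fd] by blast
 then obtain us where us: "set us <= carrier F" "Span (generate_field F (insert x K)) us = carrier F"
  using exists_base[OF sf] by blast
 note S = adjoin_subring[OF K_subring x]
 note SE = subringE[OF S(1)]
 define M where "M d = lincombs x d us" for d
 have asub: "asub (M d)" for d unfolding M_def by (rule lincombs_asub[OF x us(1)])
 have mult: "f \<otimes> m : M (i + d)" if "f : ladder K x i" "m : M d" for f m i d
  using lincombs_mult[OF x us(1) that(1)] that(2) unfolding M_def by blast
 have mono: "M d <= M e" if "d <= e" for d e
 proof
  fix m assume m: "m : M d"
  have "d = e \<or> \<one> : ladder K x (e - d)" using ladder_base[OF K_carrier(1) x] K_carrier using ladder_mono[OF K_asub x, of "Suc 0" "e - d"] that
   by force
  thus "m : M e" using mult[of \<one> "e - d" m d] m asubD(3)[OF asub m] that by auto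
 qed
 have fin: "EX H:adjoin K x. H ~= \<zero> & (EX d. ALL a:A. H \<otimes> a : M d)" if "finite A" "A <= carrier F" for A
  using that
 proof (induction A)
  case empty thus ?case using SE(3) by (intro bexI[of _ \<one>]) auto
 next
  case (insert a A)
  then obtain H d where H: "H : adjoin K x" "H ~= \<zero>" "ALL a:A. H \<otimes> a : M d" by auto
  obtain H' d' where H': "H' : adjoin K x" "H' ~= \<zero>" "H' \<otimes> a : M d'"
   using span_representation[OF x us(1), of a] us insert unfolding M_def by auto
  obtain i j where ij: "H : ladder K x i" "H' : ladder K x j" using H H' by (auto simp only: adjoin_def)
  have c: "H : carrier F" "H' : carrier F" "a : carrier F" using H H' SE(1) insert by auto
  have "(H \<otimes> H') \<otimes> b : M (i + j + d + d')" if "b : insert a A" for b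
  proof (cases "b = a")
   case True
   have "(H \<otimes> H') \<otimes> b = H \<otimes> (H' \<otimes> a)" using c True by (simp add: m_assoc)
   thus ?thesis using mult[OF ij(1) H'(3)] mono[of "i + d'" "i + j + d + d'"] by auto
  next
   case False
   hence b: "b : A" "b : carrier F" using that insert by auto
   have "(H \<otimes> H') \<otimes> b = H' \<otimes> (H \<otimes> b)" using c b by (simp add: m_ac)
   thus ?thesis using mult[OF ij(2), of "H \<otimes> b" d] H b mono[of "j + d" "i + j + d + d'"] by auto
  qed
  thus ?case using H H' c SE(6) by (intro bexI[of _ "H \<otimes> H'"]) (auto simp: integral_iff)
 qed
 have y: "EX H:carrier F. H ~= \<zero> &
    (EX c. ALL d. ALL m:M d. H \<otimes> m : M (d + c) & H \<otimes> (y \<otimes> m) : M (d + c))" if y: "y : carrier F" for y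
 proof -
  obtain H c where H: "H : adjoin K x" "H ~= \<zero>" "ALL a:(%u. y \<otimes> u) ` set us. H \<otimes> a : M c"
   using fin[of "(%u. y \<otimes> u) ` set us"] us y by auto
  obtain i where i: "H : ladder K x i" using H by (auto simp only: adjoin_def)
  have Hc: "H : carrier F" using H SE(1) by auto
  have *: "H \<otimes> (y \<otimes> m) : M (d + c)" if "m : lincombs x d vs" "set vs <= set us" for vs d m
   using that
  proof (induction vs arbitrary: m)
   case Nil thus ?case using asubD(2)[OF asub] y Hc by simp
  next
   case (Cons v vs)
   then obtain a n where an: "a : ladder K x d" "n : lincombs x d vs" "m = a \<otimes> v \<oplus> n" by auto
   have cl: "a : carrier F" "v : carrier F" "n : carrier F"
    using an Cons us subsetD[OF ladder_carrier[OF K_carrier(1) x]] asubD(3)[OF lincombs_asub[OF x, of vs]] by auto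
   have "H \<otimes> (y \<otimes> m) = a \<otimes> (H \<otimes> (y \<otimes> v)) \<oplus> H \<otimes> (y \<otimes> n)"
    using cl an y Hc by (simp add: r_distr m_ac)
   moreover have "a \<otimes> (H \<otimes> (y \<otimes> v)) : M (d + c)" using mult[OF an(1), of "H \<otimes> (y \<otimes> v)" c] H Cons by auto
   ultimately show ?case using Cons an asubD(6)[OF asub] by auto
  qed
  show ?thesis
  proof (intro bexI[OF _ Hc] conjI exI[of _ "c + i"] allI ballI)
   fix d m assume m: "m : M d"
   show "H \<otimes> m : M (d + (c + i))" using mult[OF i m] mono[of "i + d" "d + (c + i)"] by auto
   show "H \<otimes> (y \<otimes> m) : M (d + (c + i))"
    using *[of m d us] m mono[of "d + c" "d + (c + i)"] unfolding M_def by auto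
  qed (rule H(2))
 qed
 show thesis
 proof (rule that[of M "length us"])
  show "finite (M d)" "card (M d) <= card K ^ (length us * d)" for d
   using lincombs_finite unfolding M_def by auto
  show "EX H:carrier F. H ~= \<zero> & (EX d. ALL a:A. H \<otimes> a : M d)" if "finite A" "A <= carrier F" for A
   using fin[OF that] SE(1) by blast
 qed (use asub y in auto)
qed

lemma ladder_shift_bound:
 assumes M: "!!d. asub (M d)"
  and H: "H : carrier F" "!!d m. m : M d ==> H \<otimes> m : M (d + c)" "!!d m. m : M d ==> H \<otimes> (y \<otimes> m) : M (d + c)"
  and y: "y : carrier F" and A: "A <= carrier F"
  and H': "H' : carrier F" "!!a. a : A ==> H' \<otimes> a : M d0"
 shows "f : ladder A y (Suc k) ==> H' \<otimes> (H [^] k \<otimes> f) : M (d0 + k * c)"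
proof (induction k arbitrary: f)
 case 0
 thus ?case using ladder_base[OF A y] A H' by auto
next
 case (Suc k)
 then obtain a b where ab: "f = a \<oplus> y \<otimes> b" "a : A" "b : ladder A y (Suc k)" by (meson ladder_SucE)
 have c: "a : carrier F" "b : carrier F" using ab A subsetD[OF ladder_carrier[OF A y]] by auto
 have pw: "H [^] i \<otimes> m : M (d + i * c)" if "m : M d" for i d m
 proof (induction i)
  case 0 thus ?case using that asubD(3)[OF M] by auto
 next
  case (Suc i)
  have "H [^] Suc i \<otimes> m = H \<otimes> (H [^] i \<otimes> m)" using H asubD(3)[OF M that] by (simp add: m_ac)
  thus ?case using H(2)[OF Suc] by (simp add: add.commute add.left_commute)
 qed
 have "H' \<otimes> (H [^] Suc k \<otimes> f) = H [^] Suc k \<otimes> (H' \<otimes> a) \<oplus> H \<otimes> (y \<otimes> (H' \<otimes> (H [^] k \<otimes> b)))"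
  using c H y H' ab by (simp add: r_distr m_ac)
 moreover have "H [^] Suc k \<otimes> (H' \<otimes> a) : M (d0 + Suc k * c)" by (rule pw[OF H'(2)[OF ab(2)]])
 moreover have "H \<otimes> (y \<otimes> (H' \<otimes> (H [^] k \<otimes> b))) : M (d0 + Suc k * c)"
  using H(3)[OF Suc.IH[OF ab(3)]] by (simp add: add.commute add.left_commute)
 ultimately show ?case using asubD(6)[OF M] by simp
qed

text \<open>The \<open>card A ^ k\<close> values fit, after scaling, into a member of the growth
  family whose index is linear in \<open>k\<close>; comparing rates bounds \<open>card A\<close> in
  terms of \<open>y\<close> alone. This stands in for the degree [F : K(y)], and it bounds chains of
  nonunits, residue fields and numbers of zeros.\<close>

lemma ladder_bound:
 assumes y: "y : carrier F"
 shows "EX B. ALL A. asub A & finite A & (ALL k. card (ladder A y k) = card A ^ k) --> card A <= B"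
proof -
 obtain M n where M: "!!d. asub (M d)" "!!d. finite (M d)" "!!d. card (M d) <= card K ^ (n * d)"
  "!!A. finite A ==> A <= carrier F ==> EX H:carrier F. H ~= \<zero> & (EX d. ALL a:A. H \<otimes> a : M d)"
  "!!y. y : carrier F ==> EX H:carrier F. H ~= \<zero> &
    (EX c. ALL d. ALL m:M d. H \<otimes> m : M (d + c) & H \<otimes> (y \<otimes> m) : M (d + c))"
  by (rule growth_family) blast
 obtain H c where H: "H : carrier F" "H ~= \<zero>" "!!d m. m : M d ==> H \<otimes> m : M (d + c)"
  "!!d m. m : M d ==> H \<otimes> (y \<otimes> m) : M (d + c)" using M(5)[OF y] by blast
 have "card A <= card K ^ (n * c)"
  if A: "asub A" "finite A" "!!k. card (ladder A y k) = card A ^ k" for A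
 proof -
  have Ac: "A <= carrier F" by (rule asubD(1)[OF A(1)])
  obtain H' d0 where H': "H' : carrier F" "H' ~= \<zero>" "!!a. a : A ==> H' \<otimes> a : M d0"
   using M(4)[OF A(2) Ac] by blast
  show ?thesis
  proof (rule power_growth_le)
   fix k :: nat
   have z: "H' \<otimes> H [^] k : carrier F" "H' \<otimes> H [^] k ~= \<zero>"
    using H H' pow_nz[OF H(1,2)] by (auto simp: integral_iff)
   have L: "ladder A y (Suc k) <= carrier F" by (rule ladder_carrier[OF Ac y])
   have "(H' \<otimes> H [^] k) \<otimes> f : M (d0 + k * c)" if "f : ladder A y (Suc k)" for f
    using ladder_shift_bound[of M H c y A H' d0 f k, OF M(1) H(1,3,4) y Ac H'(1,3) that] that L H H'
    by (auto simp: m_assoc)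
   hence "card ((\<otimes>) (H' \<otimes> H [^] k) ` ladder A y (Suc k)) <= card (M (d0 + k * c))"
    by (intro card_mono[OF M(2)]) auto
   hence "card A ^ Suc k <= card K ^ (n * (d0 + k * c))"
    using card_scale[OF z L] A(3)[of "Suc k"] M(3)[of "d0 + k * c"] by simp
   moreover have "card A >= 1" using A asubD(2)[OF A(1)] by (metis One_nat_def Suc_leI card_gt_0_iff empty_iff)
   hence "card A ^ k <= card A ^ Suc k" by simp
   ultimately have "card A ^ k <= card K ^ (n * (d0 + k * c))" by (rule order_trans[rotated])
   thus "card A ^ k <= card K ^ (n * d0) * (card K ^ (n * c)) ^ k"
    by (simp add: power_mult[symmetric] power_add[symmetric] algebra_simps)
  qed
 qed
 thus ?thesis by blast
qed

lemma card_polynomials: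
 assumes y: "y : carrier F" "y ~: K"
 shows "card (ladder K y k) = card K ^ k"
proof (rule ladder_card_eq[OF adjoin_subring(1)[OF K_subring y(1)]])
 show "K <= adjoin K y" "y : adjoin K y" using adjoin_subring[OF K_subring y(1)] by auto
 show "y ~= \<zero>" using y K_carrier by auto
qed (use K_asub finite_constants nonconstant_ladder[OF y] in auto)

text \<open>Were \<open>y\<close> and \<open>a\<close> independent, polynomials of degree below
  \<open>k\<close> in each of them would give \<open>card K ^ (k * k)\<close> values, while the
  growth family allows only an exponent linear in \<open>k\<close>.\<close>

lemma algebraic_relation:
 assumes y: "y : carrier F" "y ~: K" and a: "a : carrier F"
 shows "EX k. EX j. EX p:ladder K y k. p ~= \<zero> & p \<otimes> a [^] (j::nat) : ladder (ladder K y k) a j"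
proof (rule ccontr)
 assume neg: "\<not> ?thesis"
 have ge: "card K ^ (k * k) <= card (ladder (ladder K y k) a k)" for k
 proof -
  have "\<not> card (ladder (ladder K y k) a k) < card (ladder K y k) ^ k"
   using ladder_card_lt_relation[OF ladder_asub[OF K_asub y(1)] ladder_finite(1)[OF finite_constants] a] neg by blast
  thus ?thesis by (simp add: card_polynomials[OF y] power_mult)
 qed
 obtain M n where M: "!!d. asub (M d)" "!!d. finite (M d)" "!!d. card (M d) <= card K ^ (n * d)"
  "!!A. finite A ==> A <= carrier F ==> EX H:carrier F. H ~= \<zero> & (EX d. ALL a:A. H \<otimes> a : M d)"
  "!!y. y : carrier F ==> EX H:carrier F. H ~= \<zero> &
    (EX c. ALL d. ALL m:M d. H \<otimes> m : M (d + c) & H \<otimes> (y \<otimes> m) : M (d + c))"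
  by (rule growth_family) blast
 obtain H c where H: "H : carrier F" "H ~= \<zero>" "!!d m. m : M d ==> H \<otimes> m : M (d + c)"
  "!!d m. m : M d ==> H \<otimes> (y \<otimes> m) : M (d + c)" using M(5)[OF y(1)] by blast
 obtain G e where G: "G : carrier F" "G ~= \<zero>" "!!d m. m : M d ==> G \<otimes> m : M (d + e)"
  "!!d m. m : M d ==> G \<otimes> (a \<otimes> m) : M (d + e)" using M(5)[OF a] by blast
 obtain H' d0 where H': "H' : carrier F" "H' ~= \<zero>" "!!a. a : K ==> H' \<otimes> a : M d0"
  using M(4)[OF finite_constants K_carrier(1)] by blast
 \<comment> \<open>With this \<open>k\<close> the linear bound on the exponent is at most
   \<open>k * Suc k\<close>, just below the quadratic \<open>Suc k * Suc k\<close>.\<close>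
 define k where "k = n * (d0 + (c + e))"
 let ?A = "ladder K y (Suc k)"
 have Ac: "?A <= carrier F" by (rule ladder_carrier[OF K_carrier(1) y(1)])
 have z: "H' \<otimes> H [^] k : carrier F" "H' \<otimes> H [^] k ~= \<zero>"
  using H H' pow_nz[OF H(1,2)] by (auto simp: integral_iff)
 have 1: "(H' \<otimes> H [^] k) \<otimes> f : M (d0 + k * c)" if "f : ?A" for f
  using ladder_shift_bound[of M H c y K H' d0 f k, OF M(1) H(1,3,4) y(1) K_carrier(1) H'(1,3) that] that Ac H H'
  by (auto simp: m_assoc)
 have z2: "(H' \<otimes> H [^] k) \<otimes> G [^] k : carrier F" "(H' \<otimes> H [^] k) \<otimes> G [^] k ~= \<zero>"
  using z G pow_nz[OF G(1,2)] by (auto simp: integral_iff)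
 have L: "ladder ?A a (Suc k) <= carrier F" by (rule ladder_carrier[OF Ac a])
 have 2: "((H' \<otimes> H [^] k) \<otimes> G [^] k) \<otimes> f : M (d0 + k * c + k * e)" if "f : ladder ?A a (Suc k)" for f
  using ladder_shift_bound[of M G e a ?A "H' \<otimes> H [^] k" "d0 + k * c" f k, OF M(1) G(1,3,4) a Ac z(1) 1 that] that L G z
  by (auto simp: m_assoc)
 hence "card ((\<otimes>) ((H' \<otimes> H [^] k) \<otimes> G [^] k) ` ladder ?A a (Suc k)) <= card (M (d0 + k * c + k * e))"
  by (intro card_mono[OF M(2)]) auto
 hence "card K ^ (Suc k * Suc k) <= card K ^ (n * (d0 + k * c + k * e))"
  using card_scale[OF z2 L] ge[of "Suc k"] M(3)[of "d0 + k * c + k * e"] by simp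
 hence "Suc k * Suc k <= n * (d0 + k * c + k * e)" using card_K_gt_1 by (simp only: power_increasing_iff)
 also have "\<dots> <= n * (d0 + (c + e)) * Suc k" by (simp add: algebra_simps)
 also have "\<dots> = k * Suc k" by (simp add: k_def)
 finally show False by simp
qed

end

section \<open>Valuation rings of a field and Chevalley's extension theorem\<close>

context field
begin

definition valring :: "'a set => bool" where
 "valring V \<longleftrightarrow> subring V R & (ALL z:carrier R - {\<zero>}. z : V \<or> inv z : V)"

lemma inv_mem_of_mult:
 assumes "subring T R" "a : carrier R" "t : T" "a \<otimes> t = \<one>"
 shows "inv a : T"
 using assms comm_inv_char[of a t] subringE(1)[OF assms(1)] by auto

text \<open>\<open>a\<close> lies in every maximal ideal of a subring \<open>T\<close> that is
  maximal for avoiding 1/a. The powers of \<open>w = 1 - a s\<close> are congruent to 1 modulo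
  \<open>a\<close>, so a polynomial expression of 1/a in 1/w would put 1/a into \<open>T\<close>;
  hence adjoining 1/w changes nothing.\<close>

lemma inv_one_minus_mem:
 assumes T: "subring T R" and a: "a : T" "a ~= \<zero>" "inv a ~: T"
  and max: "!!T'. subring T' R ==> T <= T' ==> inv a ~: T' ==> T' = T"
  and s: "s : T"
 shows "\<one> \<ominus> a \<otimes> s ~= \<zero>" "inv (\<one> \<ominus> a \<otimes> s) : T"
proof -
 define w where "w = \<one> \<ominus> a \<otimes> s"
 note TE = subringE[OF T]
 have c: "a : carrier R" "s : carrier R" using a s TE(1) by auto
 have wT: "w : T" unfolding w_def minus_eq using a s TE by auto
 hence wc: "w : carrier R" using TE(1) by auto
 show wnz: "\<one> \<ominus> a \<otimes> s ~= \<zero>"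
  using inv_mem_of_mult[OF T c(1) s] a c by auto
 have wn: "w ~= \<zero>" using wnz w_def by simp
 note iw = inv_nz[OF wc wn]
 have pow: "EX t:T. w [^] k = \<one> \<ominus> a \<otimes> t" for k :: nat
 proof (induction k)
  case 0 show ?case using TE(2) c by (intro bexI[of _ \<zero>]) (auto simp: minus_eq)
 next
  case (Suc k)
  then obtain t where t: "t : T" "w [^] k = \<one> \<ominus> a \<otimes> t" by auto
  have tc: "t : carrier R" using t TE(1) by auto
  have "w [^] Suc k = \<one> \<ominus> a \<otimes> (t \<oplus> s \<ominus> a \<otimes> (t \<otimes> s))"
   using t tc c by (simp add: w_def minus_eq r_distr r_minus minus_add m_ac a_ac)
  moreover have "t \<oplus> s \<ominus> a \<otimes> (t \<otimes> s) : T" unfolding minus_eq using t s a TE by auto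
  ultimately show ?case by blast
 qed
 have clear: "w [^] k \<otimes> f : T" if "f : ladder T (inv w) k" for f and k :: nat
  using that
 proof (induction k arbitrary: f)
  case 0 thus ?case using TE(2) by simp
 next
  case (Suc k)
  then obtain x b where xb: "f = x \<oplus> inv w \<otimes> b" "x : T" "b : ladder T (inv w) k" by (meson ladder_SucE)
  have bc: "b : carrier R" "x : carrier R"
   using xb subsetD[OF ladder_carrier[OF TE(1) iw(1)]] TE(1) by auto
  have "w [^] Suc k \<otimes> f = w [^] Suc k \<otimes> x \<oplus> (w [^] k \<otimes> b) \<otimes> (w \<otimes> inv w)"
   using xb bc wc iw(1) by (simp add: r_distr m_ac)
  hence "w [^] Suc k \<otimes> f = w [^] Suc k \<otimes> x \<oplus> w [^] k \<otimes> b" using iw wc bc by simp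
  moreover have "w [^] i : T" for i :: nat by (induction i) (use wT TE in auto)
  ultimately show ?case using Suc.IH[OF xb(3)] TE(6,7) xb(2) by metis
 qed
 note AD = adjoin_subring[OF T iw(1)]
 have "inv a ~: adjoin T (inv w)"
 proof
  assume "inv a : adjoin T (inv w)"
  then obtain k where "inv a : ladder T (inv w) k" by (auto simp only: adjoin_def)
  hence 1: "w [^] k \<otimes> inv a : T" by (rule clear)
  obtain t where t: "t : T" "w [^] k = \<one> \<ominus> a \<otimes> t" using pow by blast
  have tc: "t : carrier R" using t TE(1) by auto
  note ia = inv_nz[OF c(1) a(2)]
  have "w [^] k \<otimes> inv a \<oplus> (a \<otimes> inv a) \<otimes> t = (w [^] k \<oplus> a \<otimes> t) \<otimes> inv a"
   using ia(1) tc c wc by (simp add: r_distr m_ac)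
  also have "w [^] k \<oplus> a \<otimes> t = \<one>" using t tc c by (simp add: minus_eq a_assoc l_neg)
  finally have "inv a = w [^] k \<otimes> inv a \<oplus> t" using inv_nz[OF c(1) a(2)] tc by simp
  thus False using 1 t(1) TE(7) a(3) by metis
 qed
 hence "adjoin T (inv w) = T" using max[OF AD(1,2)] by blast
 thus "inv (\<one> \<ominus> a \<otimes> s) : T" using AD(3) w_def by simp
qed

text \<open>Chevalley's theorem. A subring maximal for containing \<open>S\<close> and avoiding 1/a
  exists by Zorn's lemma; two shortest relations, one for \<open>z\<close> and one for 1/z, show
  that it contains one of them.\<close>

lemma exists_valring:
 assumes S: "subring S R" and a: "a : S" "a ~= \<zero>" "inv a ~: S"
 obtains V where "valring V" "S <= V" "inv a ~: V"
proof -
 define A where "A = {T. subring T R & S <= T & inv a ~: T}"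
 have "EX M:A. ALL N:A. M <= N --> N = M"
 proof (rule subset_Zorn_nonempty)
  show "A ~= {}" using S a by (auto simp: A_def)
  fix C assume C: "C ~= {}" "subset.chain A C"
  have sub: "T : C ==> subring T R & S <= T & inv a ~: T" for T
   using C(2) by (auto simp: A_def subset_chain_def)
  have dir: "EX T:C. f : T & g : T" if fg: "f : \<Union>C" "g : \<Union>C" for f g
  proof -
   obtain M N where XY: "M : C" "N : C" "f : M" "g : N" using fg by auto
   hence "M <= N \<or> N <= M" using C(2) by (auto simp: subset_chain_def)
   thus ?thesis using XY by blast
  qed
  have "subring (\<Union>C) R"
  proof (rule subringI)
   show "\<Union>C <= carrier R" using sub subringE(1) by auto
   show "\<one> : \<Union>C" using sub subringE(3) C(1) by blast
   show "\<ominus> h : \<Union>C" if "h : \<Union>C" for h using that sub subringE(5) by (meson Union_iff)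
   show "f \<otimes> g : \<Union>C" "f \<oplus> g : \<Union>C" if fg: "f : \<Union>C" "g : \<Union>C" for f g
    using dir[OF fg] sub subringE(6,7) by (meson Union_iff)+
  qed
  thus "\<Union>C \<in> A" using sub C(1) by (auto simp: A_def)
 qed
 then obtain T where T: "subring T R" "S <= T" "inv a ~: T"
  and max: "!!T'. subring T' R ==> T <= T' ==> inv a ~: T' ==> T' = T"
  by (auto simp: A_def)
 note TE = subringE[OF T(1)]
 have aT: "a : T" "a : carrier R" using a T TE by auto
 define I where "I = (\<otimes>) a ` T"
 have IT: "I <= T" using aT TE(6) by (auto simp: I_def)
 have Ic: "I <= carrier R" using IT TE(1) by auto
 have Iasub: "asub I"
 proof (rule asubI[OF Ic])
  show "\<zero> : I" using TE(2) aT by (auto simp: I_def image_iff intro!: bexI[of _ \<zero>])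
  fix x y assume "x : I" "y : I"
  then obtain s t where st: "x = a \<otimes> s" "y = a \<otimes> t" "s : T" "t : T" by (auto simp: I_def)
  have "x \<ominus> y = a \<otimes> (s \<ominus> t)" using st aT subsetD[OF TE(1)] by (auto simp: minus_eq r_distr r_minus)
  thus "x \<ominus> y : I" using st TE by (auto simp: I_def minus_eq)
 qed
 have mI: "t \<otimes> i : I" if ti: "t : T" "i : I" for t i
 proof -
  obtain s where s: "i = a \<otimes> s" "s : T" using ti(2) by (auto simp: I_def)
  have "t \<otimes> i = a \<otimes> (t \<otimes> s)" using s ti aT subsetD[OF TE(1)] by (simp add: m_lcomm)
  thus ?thesis using s ti TE by (auto simp: I_def)
 qed
 \<comment> \<open>By maximality T[z] contains 1/a; multiplying by \<open>a\<close> moves all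
   coefficients into the ideal \<open>I = a T\<close>.\<close>
 have one_in: "EX n. \<one> : ladder I z n" if z: "z : carrier R" "z ~: T" for z
 proof -
  note AD = adjoin_subring[OF T(1) z(1)]
  have "inv a : adjoin T z" using max[OF AD(1,2)] AD(3) z by blast
  then obtain n where n: "inv a : ladder T z n" by (auto simp only: adjoin_def)
  have "a \<otimes> inv a : ladder I z n"
   by (rule ladder_scale[OF TE(1) aT(2) z(1) _ n]) (auto simp: I_def)
  thus ?thesis using inv_nz[OF aT(2) a(2)] by auto
 qed
 \<comment> \<open>The relation in 1/z, divided by the unit \<open>1 - d\<close>, writes 1 as a
   polynomial in 1/z without constant term. Multiplied into the top term of the relation in
   \<open>z\<close>, it lowers the degree and contradicts the minimality of
   \<open>n\<close>.\<close>
 have key: False if z: "z : carrier R" "z ~= \<zero>" and n: "\<one> : ladder I z n" "!!k. k < n ==> \<one> ~: ladder I z k"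
  and m: "\<one> : ladder I (inv z) m" "m <= n" for z n m
 proof -
  note iz = inv_nz[OF z]
  obtain m' where m': "m = Suc m'" using m(1) by (cases m) auto
  obtain n' where n': "n = Suc n'" using n(1) by (cases n) auto
  obtain b c where bc: "b : ladder I z n'" "c : I" "\<one> = b \<oplus> z [^] n' \<otimes> c"
   using n(1) ladder_top[OF Iasub z(1)] unfolding n' by blast
  obtain d e where de: "\<one> = d \<oplus> inv z \<otimes> e" "d : I" "e : ladder I (inv z) m'"
   using m(1) unfolding m' by (meson ladder_SucE)
  obtain s where s: "d = a \<otimes> s" "s : T" using de by (auto simp: I_def)
  define u where "u = \<one> \<ominus> d"
  have u: "u ~= \<zero>" "inv u : T"
   using inv_one_minus_mem[OF T(1) aT(1) a(2) T(3) max s(2)] s u_def by auto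
  have cl: "b : carrier R" "c : carrier R" "d : carrier R" "e : carrier R"
   using bc de Ic subsetD[OF ladder_carrier[OF Ic z(1)]] subsetD[OF ladder_carrier[OF Ic iz(1)]] by auto
  have uc: "u : carrier R" using cl by (simp add: u_def)
  define e' where "e' = inv u \<otimes> e"
  have e': "e' : ladder I (inv z) m'"
   unfolding e'_def by (rule ladder_scale[OF Ic _ iz(1) _ de(3)]) (use inv_nz[OF uc u(1)] mI u in auto)
  have e'c: "e' : carrier R" using e' subsetD[OF ladder_carrier[OF Ic iz(1)]] by auto
  have "inv z \<otimes> e = (d \<oplus> inv z \<otimes> e) \<ominus> d" using cl iz by (simp add: minus_eq a_ac r_neg2)
  hence "inv z \<otimes> e = u" unfolding u_def de(1)[symmetric] .
  hence we: "inv z \<otimes> e' = \<one>" unfolding e'_def using inv_nz[OF uc u(1)] iz cl by (simp add: m_lcomm)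
  obtain j where j: "n' = Suc j"
  proof (cases n')
   case 0
   hence "m' = 0" using m m' n' by simp
   hence "e' = \<zero>" using e' by simp
   thus ?thesis using we iz by simp
  qed auto
  have shift: "z [^] j \<otimes> f : ladder I z (Suc j)" if "f : ladder I (inv z) k" "k <= Suc j" for f and j k :: nat
   using that
  proof (induction k arbitrary: j f)
   case 0 thus ?case using asubD(2)[OF ladder_asub[OF Iasub z(1)]] z by simp
  next
   case (Suc k)
   then obtain i g where ig: "f = i \<oplus> inv z \<otimes> g" "i : I" "g : ladder I (inv z) k" by (meson ladder_SucE)
   have ic: "i : carrier R" "g : carrier R" using ig Ic subsetD[OF ladder_carrier[OF Ic iz(1)]] by auto
   have t1: "z [^] j \<otimes> i : ladder I z (Suc j)"
    using ladder_pow_shift[OF Iasub z(1), of i "Suc 0" j] ladder_base[OF Ic z(1)] ig by simp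
   show ?case
   proof (cases j)
    case 0
    show ?thesis using Suc using ig t1 ic iz 0 by simp
   next
    case (Suc l)
    have "z [^] j \<otimes> f = z [^] j \<otimes> i \<oplus> (z [^] l \<otimes> g) \<otimes> (z \<otimes> inv z)"
     using ig ic z iz(1) Suc by (simp add: r_distr m_ac)
    hence "z [^] j \<otimes> f = z [^] j \<otimes> i \<oplus> z [^] l \<otimes> g" using iz ic z by simp
    moreover have "z [^] l \<otimes> g : ladder I z (Suc j)" using Suc.IH[OF ig(3), of l] Suc.prems using ladder_mono[OF Iasub z(1), of "Suc l" "Suc j"] Suc by auto
    ultimately show ?thesis using t1 asubD(6)[OF ladder_asub[OF Iasub z(1)]] by simp
   qed
  qed
  have "z [^] n' \<otimes> c = c \<otimes> (z [^] j \<otimes> e')"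
  proof -
   have "z [^] n' \<otimes> c = (z [^] n' \<otimes> c) \<otimes> (inv z \<otimes> e')" using we z cl by simp
   also have "\<dots> = c \<otimes> (z [^] j \<otimes> e') \<otimes> (z \<otimes> inv z)" using j z iz(1) cl e'c by (simp add: m_ac)
   finally show ?thesis using z iz cl e'c by simp
  qed
  moreover have "c \<otimes> (z [^] j \<otimes> e') : ladder I z n'"
   unfolding j by (rule ladder_scale[OF Ic cl(2) z(1) _ shift[OF e']])
    (use m m' n' j mI bc(2) IT in auto)
  ultimately show False using bc asubD(6)[OF ladder_asub[OF Iasub z(1)]] using n(2)[of n'] n' by simp
 qed
 have "z : T \<or> inv z : T" if z: "z : carrier R" "z ~= \<zero>" for z
 proof (rule ccontr)
  assume "\<not> ?thesis"
  hence nT: "z ~: T" "inv z ~: T" by auto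
  note iz = inv_nz[OF z]
  define n where "n = (LEAST n. \<one> : ladder I z n)"
  define m where "m = (LEAST n. \<one> : ladder I (inv z) n)"
  have n: "\<one> : ladder I z n" "!!k. k < n ==> \<one> ~: ladder I z k"
   unfolding n_def using one_in[OF z(1) nT(1)] by (auto intro: LeastI dest: not_less_Least)
  have m: "\<one> : ladder I (inv z) m" "!!k. k < m ==> \<one> ~: ladder I (inv z) k"
   unfolding m_def using one_in[OF iz(1) nT(2)] by (auto intro: LeastI dest: not_less_Least)
  show False
   using key[OF z n m(1)] key[OF iz(1,2) m] n(1) iz(5) by (metis nat_le_linear)
 qed
 hence "valring T" using T by (auto simp: valring_def)
 thus thesis using that T by blast
qed

definition nonunits :: "'a set => 'a set" where
 "nonunits V = {z : V. z = \<zero> \<or> inv z ~: V}"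

context
 fixes V assumes V: "valring V"
begin

lemma valring_subring: "subring V R" and valring_carrier: "V <= carrier R"
 and valring_zero: "\<zero> : V" and valring_one: "\<one> : V"
 and valring_mult: "a : V ==> b : V ==> a \<otimes> b : V"
 and valring_add: "a : V ==> b : V ==> a \<oplus> b : V"
 and valring_neg: "a : V ==> \<ominus> a : V"
 and valring_minus: "a : V ==> b : V ==> a \<ominus> b : V"
 using V subringE[of V R] by (auto simp: valring_def minus_eq)

lemma valring_pow: "a : V ==> a [^] (n::nat) : V"
 by (induction n) (auto simp: valring_one valring_mult)

lemma valring_inv: "z : carrier R ==> z ~: V ==> inv z : nonunits V"
proof -
 assume z: "z : carrier R" "z ~: V"
 hence "z ~= \<zero>" using valring_zero by auto
 thus "inv z : nonunits V" using V z inv_nz[of z] by (auto simp: valring_def nonunits_def)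
qed

lemma nonunits_subset: "nonunits V <= V"
 by (auto simp: nonunits_def)

lemma nonunits_carrier: "z : nonunits V ==> z : carrier R"
 using valring_carrier nonunits_subset by auto

lemma zero_nonunit: "\<zero> : nonunits V"
 using valring_zero by (auto simp: nonunits_def)

lemma one_not_nonunit: "\<one> ~: nonunits V"
  by (auto simp: nonunits_def)

lemma unit_iff: "z : V - nonunits V \<longleftrightarrow> z : V & z ~= \<zero> & inv z : V"
 by (auto simp: nonunits_def)

lemma nonunits_mult:
 assumes "v : V" "z : nonunits V"
 shows "v \<otimes> z : nonunits V"
proof (cases "v \<otimes> z = \<zero>")
 case True thus ?thesis using zero_nonunit by simp
next
 case False
 have z: "z : V" "z : carrier R" "v : carrier R" using assms nonunits_subset valring_carrier by auto
 have nz: "v ~= \<zero>" "z ~= \<zero>" using False z by auto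
 have "inv z = v \<otimes> inv (v \<otimes> z)"
  using inv_mult_nz[OF z(3) nz(1) z(2) nz(2)] inv_nz[OF z(3) nz(1)] inv_nz[OF z(2) nz(2)] z
  by (simp flip: m_assoc)
 hence "inv (v \<otimes> z) ~: V" using valring_mult[OF assms(1)] assms(2) nz by (auto simp: nonunits_def)
 thus ?thesis using valring_mult[OF assms(1) z(1)] by (auto simp: nonunits_def)
qed

lemma nonunits_mult2: "z : nonunits V ==> v : V ==> z \<otimes> v : nonunits V"
 using nonunits_mult[of v z] m_comm[of v z] nonunits_carrier valring_carrier by auto

lemma unit_mult: "u : V - nonunits V ==> v : V - nonunits V ==> u \<otimes> v : V - nonunits V"
 unfolding unit_iff using valring_mult valring_carrier inv_mult_nz[of u v] by (auto simp: integral_iff subset_iff)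

lemma unit_inv: "u : V - nonunits V ==> inv u : V - nonunits V"
 unfolding unit_iff using inv_nz[of u] valring_carrier by auto

lemma nonunits_add:
 assumes "x : nonunits V" "y : nonunits V"
 shows "x \<oplus> y : nonunits V"
proof -
 have *: "x \<oplus> y : nonunits V"
  if "x : nonunits V" "y : nonunits V" "x ~= \<zero>" "y \<otimes> inv x : V" for x y
 proof -
  have c: "x : carrier R" "y : carrier R" using that nonunits_carrier by auto
  show ?thesis using inv_nz[OF c(1) that(3)] c using nonunits_mult[OF valring_add[OF valring_one that(4)] that(1)] by (simp add: l_distr m_assoc)
 qed
 have c: "x : carrier R" "y : carrier R" using assms nonunits_carrier by auto
 show ?thesis
 proof (cases "x = \<zero> \<or> y = \<zero>")
  case False
  hence nz: "x ~= \<zero>" "y ~= \<zero>" by auto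
  note i = inv_nz[OF c(1) nz(1)] inv_nz[OF c(2) nz(2)]
  show ?thesis
  proof (cases "y \<otimes> inv x : V")
   case False
   have "inv (y \<otimes> inv x) : nonunits V" using False c i by (intro valring_inv) auto
   moreover have "inv (y \<otimes> inv x) = x \<otimes> inv y" using inv_mult_nz[OF c(2) nz(2), of "inv x"] i c by (simp add: m_comm)
   ultimately show ?thesis using *[OF assms(2,1) nz(2)] nonunits_subset c a_comm by auto
  qed (use * assms nz in auto)
 qed (use assms c in auto)
qed

lemma nonunits_neg: "x : nonunits V ==> \<ominus> x : nonunits V"
 using nonunits_mult[OF valring_neg[OF valring_one], of x] nonunits_carrier by (simp add: l_minus)

lemma nonunits_minus: "x : nonunits V ==> y : nonunits V ==> x \<ominus> y : nonunits V"
 using nonunits_add nonunits_neg by (simp add: minus_eq)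

lemma unit_add_nonunit:
 assumes "u : V - nonunits V" "x : nonunits V"
 shows "u \<oplus> x : V - nonunits V"
proof -
 have c: "u : carrier R" "x : carrier R" using assms valring_carrier nonunits_carrier by auto
 have "u = (u \<oplus> x) \<ominus> x" using c by (simp add: minus_eq a_assoc r_neg)
 thus ?thesis using nonunits_minus[of "u \<oplus> x" x] assms valring_add nonunits_subset by auto
qed

lemma nonunits_pow: "x : nonunits V ==> n > 0 ==> x [^] (n::nat) : nonunits V"
 by (cases n) (use nonunits_mult valring_pow nonunits_subset in auto)

lemma nonunits_prime:
 assumes "x \<otimes> y : nonunits V" "x : V" "y : V"
 shows "x : nonunits V \<or> y : nonunits V"
 using unit_mult[of x y] assms by blast

text \<open>If \<open>z\<close> is outside \<open>V\<close>, then 1/z is inside, and multiplying the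
  monic relation by a power of 1/z expresses \<open>z\<close> by elements of
  \<open>V\<close>.\<close>

lemma valring_integral:
 assumes z: "z : carrier R" and l: "z [^] (j::nat) : ladder V z j"
 shows "z : V"
proof (rule ccontr)
 assume nV: "z ~: V"
 have zz: "z ~= \<zero>" using nV valring_zero by auto
 note i = inv_nz[OF z zz]
 have iV: "inv z : V" using valring_inv[OF z nV] nonunits_subset by auto
 have *: "inv z [^] k \<otimes> f : V" if "f : ladder V z (Suc k)" for f and k :: nat
  using that
 proof (induction k arbitrary: f)
  case 0 thus ?case using ladder_base[OF valring_carrier z] valring_carrier by auto
 next
  case (Suc k)
  then obtain a b where ab: "f = a \<oplus> z \<otimes> b" "a : V" "b : ladder V z (Suc k)" by (meson ladder_SucE)
  have c: "a : carrier R" "b : carrier R" using ab valring_carrier subsetD[OF ladder_carrier[OF valring_carrier z]] by auto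
  have "inv z [^] Suc k \<otimes> f = inv z [^] Suc k \<otimes> a \<oplus> (inv z [^] k \<otimes> b) \<otimes> (inv z \<otimes> z)"
   using ab c i(1) z by (simp add: r_distr m_ac)
  hence "inv z [^] Suc k \<otimes> f = inv z [^] Suc k \<otimes> a \<oplus> inv z [^] k \<otimes> b" using i c by simp
  thus ?case using Suc.IH[OF ab(3)] valring_add valring_mult[OF valring_pow[OF iV] ab(2)] by metis
 qed
 show False
 proof (cases j)
  case 0 thus ?thesis using l by simp
 next
  case (Suc k)
  have "inv z [^] k \<otimes> z [^] Suc k = (inv z \<otimes> z) [^] k \<otimes> z"
   using i(1) z by (simp add: nat_pow_distrib m_assoc)
  hence "inv z [^] k \<otimes> z [^] Suc k = z" using i z by simp
  thus ?thesis using *[of "z [^] j" k] l Suc nV by simp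
 qed
qed

end

end

section \<open>Discreteness of the valuations of a function field\<close>

context global_function_field
begin

lemma valuation_rings_iff:
 "V : VR \<longleftrightarrow> valring V & K <= V & V ~= carrier F"
proof
 assume V: "V : VR"
 thus "valring V & K <= V & V ~= carrier F" by (auto simp: valuation_rings_def valring_def)
next
 assume V: "valring V & K <= V & V ~= carrier F"
 obtain x where x: "x : carrier F" "(transcendental over K) x"
  using finite_over_rational_function_field by blast
 have xK: "x ~: K" by (rule transcendental_nonconstant[OF x])
 hence xz: "x ~= \<zero>" using K_carrier by auto
 \<comment> \<open>The strict inclusion of \<open>K\<close> is automatic: \<open>V\<close> contains
   \<open>x\<close> or 1/x, and neither is constant.\<close>
 have "V ~= K" using K_inv[of "inv x"] inv_nz[OF x(1) xz] using V x xz xK by (auto simp: valring_def)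
 thus "V : VR" using V valring_carrier[of V] by (auto simp: valuation_rings_def valring_def)
qed

context
 fixes V assumes V: "V : VR"
begin

lemma vr: "valring V" and vr_K: "K <= V" and vr_proper: "V ~= carrier F"
 using V valuation_rings_iff by auto

lemma K_nonunits: "c : K ==> c : nonunits V ==> c = \<zero>"
 using K_inv[of c] vr_K by (auto simp: nonunits_def)

lemma K_units: "c : K ==> c ~= \<zero> ==> c : V - nonunits V"
 using K_nonunits vr_K by auto

text \<open>Along V > aV > ayV: the constants are independent modulo \<open>a\<close>, and
  \<open>a A\<close> is independent modulo \<open>a y\<close>. So \<open>K + a A\<close> is
  independent modulo \<open>a y\<close> and larger by the factor \<open>card K\<close>.\<close>

lemma extend_independent:
 assumes A: "asub A" "finite A" "A <= V" and y: "y : V" "y ~= \<zero>"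
  and ind: "!!z b. z : A ==> b : V ==> z = y \<otimes> b ==> z = \<zero>"
  and a: "a : nonunits V" "a ~= \<zero>"
 shows "EX A'. asub A' & finite A' & A' <= V & card A' = card K * card A &
  (ALL z:A'. ALL b:V. z = (a \<otimes> y) \<otimes> b --> z = \<zero>)"
proof -
 note VS = valring_carrier[OF vr] valring_mult[OF vr] valring_add[OF vr]
 have aV: "a : V" "a : carrier F" using a nonunits_subset[OF vr] VS(1) by auto
 define f where "f = (%(c, z). c \<oplus> a \<otimes> z)"
 define A' where "A' = f ` (K \<times> A)"
 have cz: "c = \<zero>" if "c : K" "z : V" "c \<oplus> a \<otimes> z : nonunits V" for c z
 proof -
  have cl: "c : carrier F" "z : carrier F" using that VS(1) by auto
  have "c : nonunits V" using cl aV using nonunits_minus[OF vr that(3) nonunits_mult2[OF vr a(1) that(2)]] by (simp add: minus_eq a_assoc r_neg)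
  thus ?thesis using K_nonunits that(1) by simp
 qed
 have diff: "f (c, z) \<ominus> f (d, w) = f (c \<ominus> d, z \<ominus> w)" if "c : K" "d : K" "z : A" "w : A" for c d z w
  using that asubD(3)[OF A(1)] aV
  by (auto simp: f_def minus_eq r_distr r_minus minus_add a_ac)
 have ker: "c = \<zero> & z = \<zero>" if "c : K" "z : A" "b : V" "f (c, z) = (a \<otimes> y) \<otimes> b" for c z b
 proof -
  have cl: "c : carrier F" "z : carrier F" "b : carrier F" "y : carrier F" "z : V"
   using that VS(1) y(1) A(3) by auto
  have "f (c, z) = a \<otimes> (y \<otimes> b)" using that cl aV by (simp add: m_assoc)
  hence eq: "c \<oplus> a \<otimes> z = a \<otimes> (y \<otimes> b)" by (simp add: f_def)
  hence c0: "c = \<zero>" using cz[OF that(1) cl(5)] nonunits_mult2[OF vr a(1) VS(2)[OF y(1) that(3)]] by simp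
  show ?thesis using eq a aV cl using ind[OF that(2,3)] c0 by (simp add: m_lcancel)
 qed
 have "inj_on f (K \<times> A)"
 proof (rule inj_onI, clarify)
  fix c z d w assume *: "c : K" "z : A" "d : K" "w : A" "f (c, z) = f (d, w)"
  have cl: "c : carrier F" "d : carrier F" "z : carrier F" "w : carrier F" "y : carrier F" "f (d, w) : carrier F"
   using * asubD(3)[OF A(1)] VS(1) y(1) aV by (auto simp: f_def)
  have e0: "f (d, w) \<ominus> f (d, w) = \<zero>" using cl by simp
  have "f (c \<ominus> d, z \<ominus> w) = \<zero>" using diff[OF *(1,3,2,4)] unfolding *(5) e0 by (rule sym)
  hence "f (c \<ominus> d, z \<ominus> w) = (a \<otimes> y) \<otimes> \<zero>" using cl aV by simp
  hence "c \<ominus> d = \<zero> & z \<ominus> w = \<zero>"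
   using ker asubD(5)[OF K_asub *(1,3)] asubD(5)[OF A(1) *(2,4)] valring_zero[OF vr] by blast
  thus "c = d & z = w" using asub_diff_zero cl by blast
 qed
 hence card: "card A' = card K * card A" unfolding A'_def by (simp add: card_image card_cartesian_product)
 have "asub A'"
 proof (rule asubI)
  show "A' <= carrier F" using asubD(3)[OF A(1)] aV by (auto simp: A'_def f_def)
  have "f (\<zero>, \<zero>) = \<zero>" using aV by (simp add: f_def)
  thus "\<zero> : A'" using K_carrier(2) asubD(2)[OF A(1)] unfolding A'_def by (metis SigmaI image_eqI)
  fix x z assume "x : A'" "z : A'"
  thus "x \<ominus> z : A'" unfolding A'_def using diff asubD(5)[OF K_asub] asubD(5)[OF A(1)] by force
 qed
 moreover have "finite A'" using A finite_constants by (simp add: A'_def)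
 moreover have "A' <= V" using subsetD[OF A(3)] subsetD[OF vr_K] aV(1) VS(2,3) by (auto simp: A'_def f_def)
 moreover have "ALL z:A'. ALL b:V. z = (a \<otimes> y) \<otimes> b --> z = \<zero>"
 proof (intro ballI impI)
  fix z b assume z: "z : A'" "b : V" "z = (a \<otimes> y) \<otimes> b"
  then obtain c w where cw: "z = f (c, w)" "c : K" "w : A" by (auto simp: A'_def)
  thus "z = \<zero>" using ker[OF cw(2,3) z(2)] z(3) aV by (simp add: f_def)
 qed
 ultimately show ?thesis using card by blast
qed

lemma chain_independent:
 assumes "set as <= nonunits V - {\<zero>}"
 shows "foldr (\<otimes>) as \<one> : V & foldr (\<otimes>) as \<one> ~= \<zero> &
  (EX A. asub A & finite A & A <= V & card A = card K ^ length as &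
   (ALL z:A. ALL b:V. z = foldr (\<otimes>) as \<one> \<otimes> b --> z = \<zero>))"
 using assms
proof (induction as)
 case Nil
 have "asub {\<zero>}" by (rule asubI) (auto simp: minus_eq)
 moreover have "ALL z:{\<zero>}. ALL b:V. z = foldr (\<otimes>) [] \<one> \<otimes> b --> z = \<zero>" by blast
 have "{\<zero>} <= V" using valring_zero[OF vr] by blast
 moreover have "foldr (\<otimes>) [] \<one> : V" "foldr (\<otimes>) [] \<one> ~= \<zero>" using valring_one[OF vr] by auto
 moreover have "card {\<zero>} = card K ^ length []" "finite {\<zero>}" by auto
 ultimately show ?case by blast
next
 case (Cons a as)
 let ?y = "foldr (\<otimes>) as \<one>"
 have a: "a : nonunits V" "a ~= \<zero>" using Cons by auto
 obtain A where A: "?y : V" "?y ~= \<zero>" "asub A" "finite A" "A <= V" "card A = card K ^ length as"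
   "ALL z:A. ALL b:V. z = ?y \<otimes> b --> z = \<zero>" using Cons by auto
 show ?case using valring_mult[OF vr subsetD[OF nonunits_subset[OF vr] a(1)] A(1)] a(2) A(2)
   nonunits_carrier[OF vr a(1)] subsetD[OF valring_carrier[OF vr] A(1)] using extend_independent[OF A(3,4,5,1,2) _ a] A(6,7) by (simp_all add: integral_iff)
qed

text \<open>A factorization of \<open>y\<close> into n nonunits yields \<open>card K ^ n\<close>
  elements independent modulo \<open>y\<close>, a number bounded by
  \<open>ladder_bound\<close>.\<close>

lemma chain_bound:
 assumes y: "y : carrier F"
 shows "EX B. ALL as. set as <= nonunits V - {\<zero>} & foldr (\<otimes>) as \<one> = y --> length as <= B"
proof -
 obtain B where B: "!!A. asub A ==> finite A ==> (ALL k. card (ladder A y k) = card A ^ k) ==> card A <= B"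
  using ladder_bound[OF y] by blast
 have "length as <= B" if as: "set as <= nonunits V - {\<zero>}" "foldr (\<otimes>) as \<one> = y" for as
 proof -
  obtain A where A: "y : V" "y ~= \<zero>" "asub A" "finite A" "A <= V" "card A = card K ^ length as"
   "ALL z:A. ALL b:V. z = y \<otimes> b --> z = \<zero>" using chain_independent[OF as(1)] as(2) by auto
  have "card K ^ length as <= B"
   using B[OF A(3,4)] ladder_card_eq[OF valring_subring[OF vr] A(3,5,4,1,2)] A(6,7) by auto
  moreover have "length as < card K ^ length as" using card_K_gt_1 by (intro power_gt_expt) auto
  ultimately show ?thesis by simp
 qed
 thus ?thesis by blast
qed

text \<open>Take a factorization of some nonunit into as many nonunits as possible. A factor
  \<open>t\<close> divides every nonunit \<open>w\<close>, for otherwise t/w would be a nonunit and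
  replacing \<open>t\<close> by \<open>w\<close> and t/w would lengthen the factorization.\<close>

lemma exists_uniformizer: "EX t:nonunits V - {\<zero>}. ALL z:nonunits V. EX v:V. z = t \<otimes> v"
proof -
 obtain z where z: "z : carrier F" "z ~: V" using vr_proper valring_carrier[OF vr] by auto
 define y where "y = inv z"
 have zz: "z ~= \<zero>" using z valring_zero[OF vr] by auto
 have y: "y : nonunits V" "y ~= \<zero>" "y : carrier F"
  using valring_inv[OF vr z] inv_nz[OF z(1) zz] by (auto simp: y_def)
 define P where "P as \<longleftrightarrow> set as <= nonunits V - {\<zero>} & foldr (\<otimes>) as \<one> = y" for as
 obtain B where B: "!!as. P as ==> length as <= B" using chain_bound[OF y(3)] unfolding P_def by blast
 have "P [y]" using y by (auto simp: P_def)
 then obtain as where as: "P as" "!!bs. P bs ==> length bs <= length as"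
  using ex_has_greatest_nat[of P "[y]" length "Suc B"] B by (metis le_imp_less_Suc)
 obtain t bs where t: "as = t # bs"
  using as(2)[OF \<open>P [y]\<close>] by (cases as) auto
 have tm: "t : nonunits V" "t ~= \<zero>" "t : carrier F" using as(1) nonunits_carrier[OF vr] unfolding P_def t by auto
 let ?p = "foldr (\<otimes>) bs \<one>"
 have p: "?p : carrier F" using chain_independent[of bs] as(1) valring_carrier[OF vr] unfolding P_def t by auto
 note it = inv_nz[OF tm(3,2)]
 have "EX v:V. w = t \<otimes> v" if w: "w : nonunits V" for w
 proof (cases "w = \<zero>")
  case True thus ?thesis using valring_zero[OF vr] tm by (intro bexI[of _ \<zero>]) auto
 next
  case False
  have wc: "w : carrier F" using w nonunits_carrier[OF vr] by auto
  note iw = inv_nz[OF wc False]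
  have "inv t \<otimes> w : V"
  proof (rule ccontr)
   assume "inv t \<otimes> w ~: V"
   hence 1: "inv (inv t \<otimes> w) : nonunits V" using it wc by (intro valring_inv[OF vr]) auto
   have 2: "inv (inv t \<otimes> w) = t \<otimes> inv w" using inv_mult_nz[OF it(1,2) wc False] it by simp
   have "P (w # (t \<otimes> inv w) # bs)"
    using 1 2 w as(1) tm iw p wc
    by (auto simp: P_def t integral_iff) (simp add: m_ac flip: m_assoc)
   thus False using as(2) t by fastforce
  qed
  thus ?thesis using it wc tm by (intro bexI[of _ "inv t \<otimes> w"]) (auto simp: m_assoc[symmetric])
 qed
 thus ?thesis using tm by blast
qed

definition uniformizer :: "'a => bool" where
 "uniformizer t \<longleftrightarrow> t : nonunits V & t ~= \<zero> & (ALL z:nonunits V. EX v:V. z = t \<otimes> v)"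

end

end

context field
begin

lemma ipow_nz:
 assumes "x : carrier R" "x ~= \<zero>"
 shows "x [^] (n::int) : carrier R" "x [^] (n::int) ~= \<zero>"
proof -
 have "x [^] (k::nat) : carrier R" "x [^] (k::nat) ~= \<zero>" for k using assms pow_nz by auto
 thus "x [^] (n::int) : carrier R" "x [^] (n::int) ~= \<zero>"
  unfolding int_pow_def2 using inv_nz(1,2) by presburger+
qed

lemma ipow_Suc:
 assumes x: "x : carrier R" "x ~= \<zero>"
 shows "x [^] (n + 1 :: int) = x [^] n \<otimes> x"
proof (cases "n >= 0")
 case True
 then obtain k where k: "n = int k" by (metis nonneg_int_cases)
 have "x [^] (int (Suc k)) = x [^] (int k) \<otimes> x" unfolding int_pow_int by simp
 thus ?thesis using k by (simp add: add.commute)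
next
 case False
 define k where "k = nat (- n - 1)"
 have n: "n = - int (Suc k)" using False by (simp add: k_def)
 note p = nat_pow_closed[OF x(1), of k] pow_nz[OF x, of k]
 have *: "inv (x [^] Suc k) \<otimes> x = inv (x [^] k)" using inv_mult_nz[OF p x] x using inv_nz[OF p] inv_nz[OF x] by (simp add: m_assoc)
 have neg: "x [^] (- int j) = inv (x [^] j)" for j
  unfolding int_pow_def2 by (cases j) (simp_all del: of_nat_Suc nat_pow_Suc)
 show ?thesis using * neg[of k] neg[of "Suc k"] n by simp
qed

lemma ipow_add:
 assumes x: "x : carrier R" "x ~= \<zero>"
 shows "x [^] (m + n :: int) = x [^] m \<otimes> x [^] n"
proof (induction n rule: int_induct[of _ 0])
 case base show ?case using ipow_nz[OF x, of m] by simp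
next
 case (step1 i)
 have "x [^] (m + (i + 1)) = x [^] (m + i) \<otimes> x" using ipow_Suc[OF x, of "m + i"] by (simp add: add.assoc)
 thus ?case using step1 ipow_Suc[OF x, of i] ipow_nz[OF x] x by (simp add: m_assoc)
next
 case (step2 i)
 have "x [^] (m + (i - 1)) \<otimes> x = x [^] (m + i)" using ipow_Suc[OF x, of "m + (i - 1)"] by simp
 also have "\<dots> = (x [^] m \<otimes> x [^] (i - 1)) \<otimes> x"
  using step2 ipow_Suc[OF x, of "i - 1"] ipow_nz[OF x] x by (simp add: m_assoc)
 finally show ?case using ipow_nz[OF x] x by (simp add: m_rcancel)
qed

lemma ipow_one: "x : carrier R ==> x [^] (1::int) = x"
 using int_pow_int[of R x 1] by simp

lemma ipow_minus:
 assumes x: "x : carrier R" "x ~= \<zero>"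
 shows "x [^] (- n :: int) = inv (x [^] n)"
proof -
 have "x [^] n \<otimes> x [^] (- n) = \<one>" using ipow_add[OF x, of n "- n"] by simp
 thus ?thesis using comm_inv_char ipow_nz[OF x] by metis
qed

end

context global_function_field
begin

context
 fixes V assumes V: "V : VR"
begin

definition unif :: 'a where
 "unif = (SOME t. t : nonunits V & t ~= \<zero> & (ALL z:nonunits V. EX v:V. z = t \<otimes> v))"

lemma unif: "unif : nonunits V" "unif ~= \<zero>" "z : nonunits V ==> EX v:V. z = unif \<otimes> v"
 "unif : carrier F" "unif : V"
proof -
 have "EX t. t : nonunits V & t ~= \<zero> & (ALL z:nonunits V. EX v:V. z = t \<otimes> v)"
  using exists_uniformizer[OF V] by blast
 from someI_ex[OF this] show "unif : nonunits V" "unif ~= \<zero>" "z : nonunits V ==> EX v:V. z = unif \<otimes> v"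
  unfolding unif_def by auto
 thus "unif : carrier F" "unif : V" using nonunits_carrier[OF vr[OF V]] nonunits_subset[OF vr[OF V]] by auto
qed

text \<open>\<open>chain_bound\<close> limits the powers of the uniformizer that divide
  \<open>z\<close>; at the largest one the cofactor is a unit.\<close>

lemma unif_decomp_nat:
 assumes z: "z : V" "z ~= \<zero>"
 shows "EX n::nat. EX u:V - nonunits V. z = unif [^] n \<otimes> u"
proof -
 note vr = vr[OF V]
 have zc: "z : carrier F" using z valring_carrier[OF vr] by auto
 obtain B where B: "!!as. set as <= nonunits V - {\<zero>} ==> foldr (\<otimes>) as \<one> = z ==> length as <= B"
  using chain_bound[OF V zc] by blast
 define P where "P n \<longleftrightarrow> (EX w:V. z = unif [^] (n::nat) \<otimes> w)" for n
 have rep: "foldr (\<otimes>) (replicate n unif @ [w]) \<one> = unif [^] n \<otimes> w" if "w : V" for n :: nat and w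
  using that valring_carrier[OF vr] unif(4) by (induction n) (auto simp: m_ac nat_pow_Suc2 simp del: nat_pow_Suc)
 have bound: "n <= B" if Pn: "P n" for n
 proof (cases n)
  case (Suc k)
  obtain w where w: "w : V" "z = unif [^] n \<otimes> w" using Pn P_def by auto
  have wc: "w : carrier F" using w valring_carrier[OF vr] by auto
  have eq: "z = unif [^] k \<otimes> (unif \<otimes> w)" using w wc unif(4) Suc by (simp add: m_assoc)
  have m: "unif \<otimes> w : nonunits V" by (rule nonunits_mult2[OF vr unif(1) w(1)])
  have "length (replicate k unif @ [unif \<otimes> w]) <= B" using z unif(4)
   using B[of "replicate k unif @ [unif \<otimes> w]"] rep[of "unif \<otimes> w" k] m unif(1,2) eq nonunits_subset[OF vr]
   by force
  thus ?thesis using Suc by simp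
 qed auto
 have "P 0" using z zc by (auto simp: P_def intro!: bexI[of _ z])
 then obtain n where n: "P n" "!!m. P m ==> m <= n"
  using ex_has_greatest_nat[of P 0 id "Suc B"] bound by (auto simp: less_Suc_eq_le)
 obtain w where w: "w : V" "z = unif [^] n \<otimes> w" using n(1) P_def by auto
 have "w ~: nonunits V"
 proof
  assume "w : nonunits V"
  then obtain v where v: "v : V" "w = unif \<otimes> v" using unif(3) by blast
  hence "z = unif [^] Suc n \<otimes> v" using w unif(4) valring_carrier[OF vr] by (auto simp: m_assoc)
  hence "P (Suc n)" using v P_def by blast
  thus False using n(2) by fastforce
 qed
 thus ?thesis using w by blast
qed

lemma unif_decomp:
 assumes z: "z : carrier F" "z ~= \<zero>"
 shows "EX n::int. EX u:V - nonunits V. z = unif [^] n \<otimes> u"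
proof (cases "z : V")
 case True
 thus ?thesis using unif_decomp_nat[OF True z(2)] by (metis int_pow_int)
next
 case False
 note vr = vr[OF V]
 note iz = inv_nz[OF z]
 have "inv z : V" using valring_inv[OF vr z(1) False] nonunits_subset[OF vr] by auto
 then obtain n u where nu: "u : V - nonunits V" "inv z = unif [^] (int n) \<otimes> u"
  using unif_decomp_nat[OF _ iz(2)] by (metis int_pow_int)
 have uc: "u : carrier F" "u ~= \<zero>" using nu unit_iff[OF vr, of u] valring_carrier[OF vr] by auto
 show ?thesis using iz(5) inv_mult_nz[OF ipow_nz[OF unif(4,2)] uc, of "int n"] nu(2) ipow_minus[OF unif(4,2), of "int n"] using unit_inv[OF vr nu(1)] by metis
qed

lemma unif_ipow_unit:
 assumes "unif [^] (n::int) : V - nonunits V"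
 shows "n = 0"
proof -
 note vr = vr[OF V]
 have pos: "unif [^] n : nonunits V" if "n > 0" for n :: int
  using nonunits_pow[OF vr unif(1), of "nat n"] that by simp
 have "n <= 0" using pos[of n] assms by force
 moreover have "- n <= 0" using unit_inv[OF vr assms] ipow_minus[OF unif(4,2)] using pos[of "- n"] by force
 ultimately show ?thesis by simp
qed

definition valn :: "'a => int" where
 "valn z = (THE n. EX u:V - nonunits V. z = unif [^] n \<otimes> u)"

lemma valn_unique:
 assumes z: "z = unif [^] (n::int) \<otimes> u" "u : V - nonunits V"
 shows "valn z = n"
 unfolding valn_def
proof (rule the_equality)
 note vr = vr[OF V]
 show "EX u:V - nonunits V. z = unif [^] n \<otimes> u" using z by blast
 fix m :: int assume "EX u:V - nonunits V. z = unif [^] m \<otimes> u"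
 then obtain w where w: "w : V - nonunits V" "z = unif [^] m \<otimes> w" by blast
 have c: "u : carrier F" "u ~= \<zero>" "w : carrier F" "w ~= \<zero>"
  using w z unit_iff[OF vr] valring_carrier[OF vr] by auto
 note p = ipow_nz[OF unif(4,2)]
 have "unif [^] (m - n) \<otimes> w = unif [^] (- n) \<otimes> (unif [^] m \<otimes> w)"
  using ipow_add[OF unif(4,2), of "- n" m] p c by (simp add: m_assoc)
 also have "\<dots> = (unif [^] (- n) \<otimes> unif [^] n) \<otimes> u" using w z p c by (simp add: m_assoc)
 also have "unif [^] (- n) \<otimes> unif [^] n = \<one>" using ipow_add[OF unif(4,2), of "- n" n] by simp
 also have "\<one> \<otimes> u = u" using c by simp
 finally have "unif [^] (m - n) : V - nonunits V" using c p inv_nz[OF c(3,4)] using unit_mult[OF vr z(2) unit_inv[OF vr w(1)]] by (metis m_assoc r_one)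
 thus "m = n" using unif_ipow_unit by force
qed

lemma valnE:
 assumes z: "z : carrier F" "z ~= \<zero>"
 obtains u where "u : V - nonunits V" "z = unif [^] valn z \<otimes> u"
 using unif_decomp[OF z] valn_unique by metis

lemma valn_mult:
 assumes "x : carrier F" "x ~= \<zero>" "y : carrier F" "y ~= \<zero>"
 shows "valn (x \<otimes> y) = valn x + valn y"
proof -
 note vr = vr[OF V]
 obtain u where u: "u : V - nonunits V" "x = unif [^] valn x \<otimes> u" using valnE[OF assms(1,2)] by blast
 obtain w where w: "w : V - nonunits V" "y = unif [^] valn y \<otimes> w" using valnE[OF assms(3,4)] by blast
 have c: "u : carrier F" "w : carrier F" using u w valring_carrier[OF vr] by auto
 have "x \<otimes> y = (unif [^] valn x \<otimes> u) \<otimes> (unif [^] valn y \<otimes> w)" using u w by simp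
 also have "\<dots> = unif [^] (valn x + valn y) \<otimes> (u \<otimes> w)"
  using c ipow_nz[OF unif(4,2)] by (simp add: ipow_add[OF unif(4,2)] m_ac)
 finally show ?thesis using valn_unique unit_mult[OF vr u(1) w(1)] by blast
qed

lemma valn_unit: "u : V - nonunits V ==> valn u = 0"
 using valn_unique[of u 0 u] valring_carrier[OF vr[OF V]] by auto

lemma valn_one: "valn \<one> = 0"
 using valn_unit valring_one[OF vr[OF V]] one_not_nonunit[OF vr[OF V]] by blast

lemma valn_unif: "valn unif = 1"
 using valn_unique[of unif 1 \<one>] valring_one[OF vr[OF V]] one_not_nonunit[OF vr[OF V]] unif(4) ipow_one by simp

lemma valn_const: "c : K ==> c ~= \<zero> ==> valn c = 0"
 using valn_unit K_units[OF V] by blast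

lemma valn_inv:
 assumes "x : carrier F" "x ~= \<zero>"
 shows "valn (inv x) = - valn x"
 using valn_mult[OF assms inv_nz(1,2)[OF assms]] inv_nz(3)[OF assms] valn_one by simp

lemma valn_pow:
 assumes "x : carrier F" "x ~= \<zero>"
 shows "valn (x [^] (n::nat)) = int n * valn x"
 by (induction n) (use assms pow_nz[OF assms] valn_mult valn_one in \<open>auto simp: algebra_simps\<close>)

lemma valn_ge_0:
 assumes "x : carrier F" "x ~= \<zero>"
 shows "valn x >= 0 \<longleftrightarrow> x : V"
proof
 note vr = vr[OF V]
 obtain u where u: "u : V - nonunits V" "x = unif [^] valn x \<otimes> u" using valnE[OF assms] by blast
 { assume "valn x >= 0"
  hence "unif [^] valn x = unif [^] nat (valn x)" by simp
  thus "x : V" using u valring_mult[OF vr] valring_pow[OF vr unif(5)] by (metis Diff_iff) }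
 { assume "x : V"
  then obtain n u where "u : V - nonunits V" "x = unif [^] (int n) \<otimes> u"
   using unif_decomp_nat[OF _ assms(2)] by (metis int_pow_int)
  thus "valn x >= 0" using valn_unique by force }
qed

lemma valn_gt_0:
 assumes "x : carrier F" "x ~= \<zero>"
 shows "valn x > 0 \<longleftrightarrow> x : nonunits V"
 using valn_ge_0[OF assms] valn_ge_0[OF inv_nz(1,2)[OF assms]] valn_inv[OF assms] assms
 by (auto simp: nonunits_def)

text \<open>The fractional ideal of order \<open>n\<close>; zero is added by hand because
  \<open>valn\<close> has no meaning there.\<close>

definition vset :: "int => 'a set" where
 "vset n = {z : carrier F. z = \<zero> \<or> n <= valn z}"

lemma vset_iff: "z : vset n \<longleftrightarrow> z : carrier F & (EX v:V. z = unif [^] n \<otimes> v)"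
proof
 note vr = vr[OF V]
 note p = ipow_nz[OF unif(4,2)]
 { assume z: "z : vset n"
  have zc: "z : carrier F" using z by (auto simp: vset_def)
  show "z : carrier F & (EX v:V. z = unif [^] n \<otimes> v)"
  proof (cases "z = \<zero>")
   case True thus ?thesis using valring_zero[OF vr] p by (auto intro!: bexI[of _ \<zero>])
  next
   case False
   obtain u where u: "u : V - nonunits V" "z = unif [^] valn z \<otimes> u" using valnE[OF zc False] by blast
   have uc: "u : carrier F" using u valring_carrier[OF vr] by auto
   have e: "unif [^] (valn z - n) = unif [^] nat (valn z - n)" using z False by (simp add: vset_def)
   have "unif [^] (valn z - n) \<otimes> u : V" unfolding e
    using valring_mult[OF vr valring_pow[OF vr unif(5)]] u by blast
   moreover have "z = unif [^] n \<otimes> (unif [^] (valn z - n) \<otimes> u)"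
    using u(2) ipow_add[OF unif(4,2), of n "valn z - n"] p uc by (simp add: m_assoc)
   ultimately show ?thesis using zc by blast
  qed }
 { assume "z : carrier F & (EX v:V. z = unif [^] n \<otimes> v)"
  then obtain v where v: "v : V" "z = unif [^] n \<otimes> v" "z : carrier F" by blast
  have vc: "v : carrier F" using v valring_carrier[OF vr] by auto
  show "z : vset n"
  proof (cases "v = \<zero>")
   case True thus ?thesis using v p by (simp add: vset_def)
  next
   case False
   show ?thesis using valn_unique[of "unif [^] n" n \<one>] p valring_one[OF vr] one_not_nonunit[OF vr] using v valn_mult[OF p vc False] valn_ge_0[OF vc False] by (simp add: vset_def)
  qed }
qed

lemma vset_asub: "asub (vset n)"
proof (rule asubI)
 note vr = vr[OF V]
 note p = ipow_nz[OF unif(4,2)]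
 fix a b assume "a : vset n" "b : vset n"
 then obtain v w where v: "v : V" "a = unif [^] n \<otimes> v" "w : V" "b = unif [^] n \<otimes> w" "a : carrier F" "b : carrier F"
  by (auto simp: vset_iff)
 have "a \<ominus> b = unif [^] n \<otimes> (v \<ominus> w)" using v p subsetD[OF valring_carrier[OF vr]] by (simp add: minus_eq r_distr r_minus)
 moreover have "a \<ominus> b : carrier F" using v by simp
 ultimately show "a \<ominus> b : vset n" using valring_minus[OF vr v(1,3)] vset_iff by blast
qed (auto simp: vset_def)

lemma vset_mult: "a : vset m ==> b : vset n ==> a \<otimes> b : vset (m + n)"
 using valn_mult by (auto simp: vset_def integral_iff)

lemma vset_0: "vset 0 = V"
 using valn_ge_0 valring_carrier[OF vr[OF V]] valring_zero[OF vr[OF V]] by (auto simp: vset_def)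

lemma vset_1: "vset 1 = nonunits V"
 using valn_gt_0 nonunits_carrier[OF vr[OF V]] zero_nonunit[OF vr[OF V]]
 by (auto simp: vset_def int_one_le_iff_zero_less)

lemma vset_antimono: "m <= n ==> vset n <= vset m"
 by (auto simp: vset_def)

lemma vset_K: "c : K ==> a : vset n ==> c \<otimes> a : vset n"
 using vset_mult[of c 0 a n] vset_0 vr_K[OF V] by auto

lemma vset_scale:
 assumes "x : carrier F" "x ~= \<zero>" "a : carrier F"
 shows "x \<otimes> a : vset n \<longleftrightarrow> a : vset (n - valn x)"
 using valn_mult[OF assms(1,2)] assms by (auto simp: vset_def integral_iff)

end

definition kspace :: "'a set => bool" where
 "kspace A \<longleftrightarrow> asub A & (ALL c:K. ALL a:A. c \<otimes> a : A)"

text \<open>A largest \<open>K\<close>-subspace of \<open>V\<close> meeting the maximal ideal only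
  in zero maps onto the residue field: a class that is missed would enlarge it. Its size is bounded
  by \<open>ladder_bound\<close> at the uniformizer.\<close>

lemma residue_representatives:
 assumes V: "V : VR"
 shows "EX A. kspace A & finite A & A <= V & A \<inter> nonunits V = {\<zero>} &
  (ALL v:V. EX a:A. v \<ominus> a : nonunits V)"
proof -
 note vr = vr[OF V]
 note VS = valring_carrier[OF vr]
 define P where "P A \<longleftrightarrow> kspace A & finite A & A <= V & A \<inter> nonunits V = {\<zero>}" for A
 obtain B where B: "!!A. asub A ==> finite A ==> (ALL k. card (ladder A (unif V) k) = card A ^ k) ==> card A <= B"
  using ladder_bound[OF unif(4)[OF V]] by blast
 have bound: "card A <= B" if "P A" for A
 proof (rule B)
  show A: "asub A" "finite A" using that by (auto simp: P_def kspace_def)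
  show "ALL k. card (ladder A (unif V) k) = card A ^ k"
  proof
   fix k
   show "card (ladder A (unif V) k) = card A ^ k"
   proof (rule ladder_card_eq[OF valring_subring[OF vr] A(1) _ A(2) unif(5,2)[OF V]])
    show "A <= V" using that by (auto simp: P_def)
    fix a b assume "a : A" "b : V" "a = unif V \<otimes> b"
    hence "a : A \<inter> nonunits V" using nonunits_mult2[OF vr unif(1)[OF V]] by auto
    thus "a = \<zero>" using that by (auto simp: P_def)
   qed
  qed
 qed
 have "asub {\<zero>}" by (rule asubI) (auto simp: minus_eq)
 hence "P {\<zero>}" using valring_zero[OF vr] zero_nonunit[OF vr] by (auto simp: P_def kspace_def)
 then obtain A where A: "P A" "!!A'. P A' ==> card A' <= card A"
  using ex_has_greatest_nat[of P "{\<zero>}" card "Suc B"] bound by (auto simp: less_Suc_eq_le)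
 have As: "asub A" "!!c a. c : K ==> a : A ==> c \<otimes> a : A" "finite A" "A <= V" "A \<inter> nonunits V = {\<zero>}"
  using A(1) by (auto simp: P_def kspace_def)
 have "EX a:A. v \<ominus> a : nonunits V" if v: "v : V" for v
 proof (rule ccontr)
  assume neg: "\<not> ?thesis"
  have vc: "v : carrier F" using v VS by auto
  define A' where "A' = (%(a, c). a \<oplus> c \<otimes> v) ` (A \<times> K)"
  have cl: "!!a. a : A ==> a : carrier F" "!!c. c : K ==> c : carrier F"
   using asubD(3)[OF As(1)] by auto
  have asub: "asub A'"
  proof (rule asubI)
   show "A' <= carrier F" using cl vc by (auto simp: A'_def)
   show "\<zero> : A'" using asubD(2)[OF As(1)] K_carrier(2) vc by (auto simp: A'_def image_iff intro!: bexI[of _ "\<zero>"])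
   fix x y assume "x : A'" "y : A'"
   then obtain a c b d where *: "x = a \<oplus> c \<otimes> v" "y = b \<oplus> d \<otimes> v" "a : A" "b : A" "c : K" "d : K"
    by (auto simp: A'_def)
   have "x \<ominus> y = (a \<ominus> b) \<oplus> (c \<ominus> d) \<otimes> v"
    using * cl vc by (simp add: minus_eq l_distr l_minus minus_add a_ac)
   thus "x \<ominus> y : A'" using asubD(5)[OF As(1) *(3,4)] asubD(5)[OF K_asub *(5,6)]
    by (auto simp: A'_def)
  qed
  have kcl: "c \<otimes> x : A'" if c: "c : K" and x: "x : A'" for c x
  proof -
   obtain a d where *: "x = a \<oplus> d \<otimes> v" "a : A" "d : K" using x by (auto simp: A'_def)
   have "c \<otimes> x = c \<otimes> a \<oplus> (c \<otimes> d) \<otimes> v" using * c cl vc by (simp add: r_distr m_assoc)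
   thus ?thesis using As(2)[OF c *(2)] subringE(6)[OF K_subring c *(3)] by (auto simp: A'_def)
  qed
  have sub: "A' <= V"
   using subsetD[OF As(4)] subsetD[OF vr_K[OF V]] valring_add[OF vr] valring_mult[OF vr] v by (auto simp: A'_def)
  have int: "x = \<zero>" if x: "x : A'" "x : nonunits V" for x
  proof -
   obtain a c where *: "x = a \<oplus> c \<otimes> v" "a : A" "c : K" using x by (auto simp: A'_def)
   show ?thesis
   proof (cases "c = \<zero>")
    case True
    hence "x = a" using * cl vc by simp
    thus ?thesis using As(5) x * by auto
   next
    case False
    note ic = inv_nz[OF cl(2)[OF *(3)] False]
    have iK: "inv c : K" by (rule K_inv[OF *(3) False])
    have cc: "a : carrier F" "c : carrier F" using * cl by auto
    have "inv c \<otimes> x = inv c \<otimes> a \<oplus> (inv c \<otimes> c) \<otimes> v" using * cc ic(1) vc by (simp add: r_distr m_assoc)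
    hence "inv c \<otimes> x = v \<ominus> (\<ominus> (inv c \<otimes> a))" using ic vc cc by (simp add: minus_eq a_comm)
    moreover have "inv c \<otimes> x : nonunits V" using nonunits_mult[OF vr _ x(2)] iK vr_K[OF V] by auto
    ultimately show ?thesis using neg asubD(4)[OF As(1) As(2)[OF iK *(2)]] by auto
   qed
  qed
  have finA': "finite A'" using As(3) finite_constants by (simp add: A'_def)
  have "P A'" using int asubD(2)[OF asub] zero_nonunit[OF vr] unfolding P_def kspace_def using asub kcl finA' sub by blast
  have "A <= A'"
  proof
   fix a assume a: "a : A"
   show "a : A'" using cl vc using a K_carrier(2) unfolding A'_def by force
  qed
  moreover have "v : A'"
  proof -
   have "v = \<zero> \<oplus> \<one> \<otimes> v" using vc by simp
   thus ?thesis using asubD(2)[OF As(1)] unfolding A'_def by force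
  qed
  moreover have "v ~: A" using neg zero_nonunit[OF vr] vc by (auto simp: minus_eq r_neg)
  ultimately have "card A < card A'" using finA' by (intro psubset_card_mono) auto
  thus False using A(2)[OF \<open>P A'\<close>] by simp
 qed
 thus ?thesis using A(1) unfolding P_def by blast
qed

end

text \<open>Cancellation across one intervening summand, for sums that have been sorted by
  \<open>a_ac\<close>.\<close>

lemma (in abelian_group) add_cancel:
 assumes "a : carrier G" "b : carrier G" "c : carrier G"
 shows "a \<oplus> (b \<oplus> (\<ominus> a \<oplus> c)) = b \<oplus> c" "\<ominus> a \<oplus> (b \<oplus> (a \<oplus> c)) = b \<oplus> c"
  "a \<oplus> (b \<oplus> \<ominus> a) = b" "\<ominus> a \<oplus> (b \<oplus> a) = b"
proof -
 have *: "x \<oplus> (b \<oplus> (y \<oplus> z)) = b \<oplus> z" if "x : carrier G" "y : carrier G" "z : carrier G" "x \<oplus> y = \<zero>" for x y z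
 proof -
  have "x \<oplus> (b \<oplus> (y \<oplus> z)) = b \<oplus> ((x \<oplus> y) \<oplus> z)" using that(1-3) assms by (simp add: a_ac)
  thus ?thesis using that(3,4) by simp
 qed
 show "a \<oplus> (b \<oplus> (\<ominus> a \<oplus> c)) = b \<oplus> c" "\<ominus> a \<oplus> (b \<oplus> (a \<oplus> c)) = b \<oplus> c"
  using assms by (auto intro!: * simp: r_neg l_neg)
 show "a \<oplus> (b \<oplus> \<ominus> a) = b" "\<ominus> a \<oplus> (b \<oplus> a) = b"
  using assms *[of a "\<ominus> a" \<zero>] *[of "\<ominus> a" a \<zero>] by (auto simp: r_neg l_neg)
qed

section \<open>Cardinality and dimension; places, their valuations and degrees\<close>

lemma (in ring) card_dimension:
 assumes K: "subfield K R" "finite K" and d: "dimension n K E"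
 shows "finite E & card E = card K ^ n"
 using d K
proof (induction n K E rule: dimension.induct)
 case (zero_dim K) thus ?case by simp
next
 case (Suc_dim v E n K)
 note P = space_subgroup_props[OF Suc_dim.prems(1) Suc_dim.hyps(3)]
 have Kc: "K <= carrier R" by (rule subringE(1)[OF subfieldE(1)[OF Suc_dim.prems(1)]])
 have e: "line_extension K v E = (%(k, e). k \<otimes> v \<oplus> e) ` (K \<times> E)"
  unfolding set_eq_iff line_extension_mem_iff image_iff by force
 have "inj_on (%(k, e). k \<otimes> v \<oplus> e) (K \<times> E)"
 proof (rule inj_onI, clarify)
  fix k a l b assume *: "k : K" "a : E" "l : K" "b : E" "k \<otimes> v \<oplus> a = l \<otimes> v \<oplus> b"
  have c: "k : carrier R" "l : carrier R" "a : carrier R" "b : carrier R" "v : carrier R"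
   using * P(1) subsetD[OF Kc] Suc_dim(1) by auto
  have "(k \<ominus> l) \<otimes> v \<oplus> a = (k \<otimes> v \<oplus> a) \<ominus> l \<otimes> v" using c by (simp add: minus_eq l_distr l_minus a_ac)
  also have "\<dots> = b" unfolding *(5) using c by (simp add: minus_eq a_ac r_neg)
  finally have 1: "(k \<ominus> l) \<otimes> v \<oplus> a = b" .
  hence 2: "(k \<ominus> l) \<otimes> v = b \<ominus> a" using c by (simp add: minus_eq a_assoc r_neg flip: 1)
  have "b \<ominus> a : E" using P(3,4) * by (simp add: minus_eq)
  moreover have "k \<ominus> l : K" using subringE(5,7)[OF subfieldE(1)[OF Suc_dim.prems(1)]] * by (simp add: minus_eq)
  ultimately have "k \<ominus> l = \<zero>" using P(6)[of "k \<ominus> l" v] 2 Suc_dim.hyps by auto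
  moreover from this have "a = b" using 1 c(3,5) by simp
  ultimately show "k = l & a = b" using c by simp
 qed
 hence "card (line_extension K v E) = card K * card E"
  unfolding e by (simp add: card_image card_cartesian_product)
 thus ?case using Suc_dim unfolding e by simp
qed

lemma (in ring) card_finite_subspace:
 assumes K: "subfield K R" "finite K" and E: "subalgebra K E R" "finite E"
 shows "finite_dimension K E" "card E = card K ^ dim K E"
proof -
 obtain us where us: "set us = E" using E(2) finite_list by blast
 have c: "set us <= carrier R" using subalgebra_in_carrier[OF E(1)] us by simp
 show 1: "finite_dimension K E" using subalgebra_Span_incl[OF K(1) E(1), of us] Span_base_incl[OF K(1) c] us using Span_finite_dimension[OF K(1) c] by simp
 show "card E = card K ^ dim K E"
  using card_dimension[OF K finite_dimensionE[OF K(1) 1]] by (simp add: over_def)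
qed

context global_function_field
begin

lemma kspace_subalgebra: "kspace A ==> subalgebra K A F"
proof -
 assume A: "kspace A"
 have a: "asub A" using A by (simp add: kspace_def)
 have "subgroup A (add_monoid F)"
  using asubD[OF a] by (intro add.subgroupI) (auto simp: a_inv_def[symmetric])
 thus ?thesis using A by (auto simp: subalgebra_def subalgebra_axioms_def kspace_def)
qed

lemma card_kspace: "kspace A ==> finite A ==> card A = card K ^ dim K A"
 using card_finite_subspace(2)[OF subfield_axioms finite_constants kspace_subalgebra] by blast

context
 fixes V assumes V: "V : VR"
begin

abbreviation "FV == F\<lparr>carrier := V\<rparr>"

lemma FV_ring: "ring FV" "cring FV"
proof -
 show r: "ring FV" by (rule subring_is_ring[OF valring_subring[OF vr[OF V]]])
 show "cring FV" using valring_subring[OF vr[OF V]] subcringI' using subcring_iff valring_carrier[OF vr[OF V]] by blast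
qed

lemma nonunits_ideal: "ideal (nonunits V) FV"
proof (rule idealI[OF FV_ring(1)])
 note vr = vr[OF V]
 interpret S: ring FV by (rule FV_ring)
 have inv: "a_inv FV a = \<ominus> a" if "a : V" for a
  using S.minus_equality[of "\<ominus> a" a] that valring_neg[OF vr that] subsetD[OF valring_carrier[OF vr] that]
  by (simp add: l_neg)
 show "subgroup (nonunits V) (add_monoid FV)"
 proof (rule S.add.subgroupI)
  show "nonunits V <= carrier FV" using nonunits_subset[OF vr] by simp
  show "nonunits V ~= {}" using zero_nonunit[OF vr] by auto
  show "!!a. a : nonunits V ==> \<ominus>\<^bsub>FV\<^esub> a : nonunits V"
   using inv nonunits_neg[OF vr] subsetD[OF nonunits_subset[OF vr]] by simp
  show "!!a b. a : nonunits V ==> b : nonunits V ==> a \<oplus>\<^bsub>FV\<^esub> b : nonunits V"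
   using nonunits_add[OF vr] by simp
 qed
qed (use nonunits_mult[OF vr[OF V]] nonunits_mult2[OF vr[OF V]] in auto)

lemma ideal_FV_eq:
 assumes J: "ideal J FV" and u: "u : J" "u : V - nonunits V"
 shows "J = V"
proof -
 note vr = vr[OF V]
 interpret J: ideal J FV by (rule J)
 have iu: "u ~= \<zero>" "inv u : V" "u : carrier F" using u(2) unit_iff[OF vr] valring_carrier[OF vr] by auto
 have 1: "\<one> : J" using J.I_l_closed[of u "inv u"] u(1) iu using inv_nz[OF iu(3,1)] by simp
 have "v : J" if "v : V" for v
  using J.I_l_closed[OF 1, of v] that subsetD[OF valring_carrier[OF vr]] by simp
 thus ?thesis using J.a_subset by auto
qed

lemma nonunits_maximalideal: "maximalideal (nonunits V) FV"
proof (rule maximalidealI[OF nonunits_ideal])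
 show "carrier FV ~= nonunits V" using valring_one[OF vr[OF V]] one_not_nonunit[OF vr[OF V]] by auto
 fix J assume J: "ideal J FV" "nonunits V <= J" "J <= carrier FV"
 show "J = nonunits V \<or> J = carrier FV" using ideal_FV_eq[OF J(1)] J(2,3) by auto
qed

lemma maximalideal_unique: "maximalideal P FV ==> P = nonunits V"
proof -
 assume P: "maximalideal P FV"
 interpret P: maximalideal P FV by (rule P)
 have sub: "P <= nonunits V"
  using ideal_FV_eq[OF P.is_ideal] P.I_notcarr P.a_subset by auto
 show "P = nonunits V"
  using P.I_maximal[OF nonunits_ideal sub] nonunits_maximalideal nonunits_subset[OF vr[OF V]]
   maximalideal.I_notcarr by force
qed

text \<open>The maximal ideal determines its valuation ring, so places correspond to valuation rings
  and the description in \<open>place_ring\<close> is unambiguous.\<close>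

lemma valring_from_nonunits: "V = {z : carrier F. z = \<zero> \<or> inv z ~: nonunits V}"
proof -
 note vr = vr[OF V]
 have "z : V \<longleftrightarrow> z = \<zero> \<or> inv z ~: nonunits V" if z: "z : carrier F" for z
 proof (cases "z = \<zero>")
  case False
  note iz = inv_nz[OF z False]
  show ?thesis using iz valring_inv[OF vr z] unfolding nonunits_def by auto
 qed (use valring_zero[OF vr] in auto)
 thus ?thesis using valring_carrier[OF vr] by auto
qed

end

lemma nonunits_inj: "inj_on nonunits (VR)"
 by (rule inj_onI) (metis valring_from_nonunits)

lemma places_eq: "places F K = nonunits ` VR"
 unfolding places_def using maximalideal_unique nonunits_maximalideal by blast

lemma place_ring_eq:
 assumes V: "V : VR"
 shows "place_ring F K (nonunits V) = F\<lparr>carrier := V\<rparr>"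
proof -
 have "(THE W. W : VR & maximalideal (nonunits V) (F\<lparr>carrier := W\<rparr>)) = V"
 proof (rule the_equality)
  show "V : VR & maximalideal (nonunits V) (F\<lparr>carrier := V\<rparr>)"
   using V nonunits_maximalideal by blast
  fix W assume W: "W : VR & maximalideal (nonunits V) (F\<lparr>carrier := W\<rparr>)"
  show "W = V" using maximalideal_unique using nonunits_inj V W by (metis inj_onD)
 qed
 thus ?thesis by (simp add: place_ring_def)
qed

lemma Units_FV:
 assumes V: "V : VR"
 shows "Units (F\<lparr>carrier := V\<rparr>) = V - nonunits V"
proof -
 note vr = vr[OF V]
 have "u : Units (F\<lparr>carrier := V\<rparr>)" if "u : V" "u ~= \<zero>" "inv u : V" for u
  using that inv_nz[of u] valring_carrier[OF vr] by (auto simp: Units_def intro!: bexI[of _ "inv u"])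
 moreover have "u : V & u ~= \<zero> & inv u : V" if u: "u : Units (F\<lparr>carrier := V\<rparr>)" for u
 proof -
  obtain w where w: "u : V" "w : V" "w \<otimes> u = \<one>" "u \<otimes> w = \<one>" using u by (auto simp: Units_def)
  have c: "u : carrier F" "w : carrier F" using w valring_carrier[OF vr] by auto
  show ?thesis using comm_inv_char[OF c w(4)] using w c by auto
 qed
 ultimately show ?thesis using unit_iff[OF vr] by blast
qed

lemma valn_ipow:
 assumes V: "V : VR" and x: "x : carrier F" "x ~= \<zero>"
 shows "valn V (x [^] (n::int)) = n * valn V x"
proof (cases n rule: int_cases2)
 case (nonneg k)
 show ?thesis unfolding nonneg int_pow_int by (rule valn_pow[OF V x])
next
 case (nonpos k)
 have "valn V (inv (x [^] int k)) = - valn V (x [^] int k)" by (rule valn_inv[OF V ipow_nz[OF x]])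
 thus ?thesis unfolding nonpos ipow_minus[OF x] int_pow_int by (simp add: valn_pow[OF V x])
qed

text \<open>The definition of \<open>place_val\<close> allows any generator \<open>t\<close> of the
  maximal ideal. Such a \<open>t\<close> divides the uniformizer and is a nonunit, so its valuation
  is one and the exponent is determined.\<close>

lemma place_val_eq:
 assumes V: "V : VR" and z: "z : carrier F" "z ~= \<zero>"
 shows "place_val F K (nonunits V) z = valn V z"
 unfolding place_val_def place_ring_eq[OF V] Units_FV[OF V]
proof (rule the_equality)
 note vr = vr[OF V]
 obtain u where u: "u : V - nonunits V" "z = unif V [^] valn V z \<otimes> u" using valnE[OF V z] by blast
 have P: "nonunits V = PIdl\<^bsub>F\<lparr>carrier := V\<rparr>\<^esub> unif V"
 proof
  show "nonunits V <= PIdl\<^bsub>F\<lparr>carrier := V\<rparr>\<^esub> unif V"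
  proof
   fix x assume "x : nonunits V"
   then obtain v where "v : V" "x = unif V \<otimes> v" using unif(3)[OF V] by blast
   thus "x : PIdl\<^bsub>F\<lparr>carrier := V\<rparr>\<^esub> unif V"
    using m_comm[of "unif V" v] unif(4)[OF V] subsetD[OF valring_carrier[OF vr]] by (auto simp: cgenideal_def)
  qed
  show "PIdl\<^bsub>F\<lparr>carrier := V\<rparr>\<^esub> unif V <= nonunits V"
   using nonunits_mult[OF vr _ unif(1)[OF V]] by (auto simp: cgenideal_def)
 qed
 show "EX t:nonunits V. nonunits V = PIdl\<^bsub>F\<lparr>carrier := V\<rparr>\<^esub> t & (EX u:V - nonunits V. z = t [^] valn V z \<otimes> u)"
  using P u unif(1)[OF V] by blast
 fix n :: int
 assume "EX t:nonunits V. nonunits V = PIdl\<^bsub>F\<lparr>carrier := V\<rparr>\<^esub> t & (EX u:V - nonunits V. z = t [^] n \<otimes> u)"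
 then obtain t w where t: "t : nonunits V" "nonunits V = PIdl\<^bsub>F\<lparr>carrier := V\<rparr>\<^esub> t" "w : V - nonunits V" "z = t [^] n \<otimes> w"
  by blast
 obtain x where x: "x : V" "unif V = x \<otimes> t" using unif(1)[OF V] unfolding t(2) by (auto simp: cgenideal_def)
 have c: "x : carrier F" "t : carrier F" "w : carrier F" "w ~= \<zero>"
  using x t valring_carrier[OF vr] nonunits_carrier[OF vr] unit_iff[OF vr] by auto
 have nz: "x ~= \<zero>" "t ~= \<zero>" using x unif(2)[OF V] c by auto
 have "valn V x + valn V t = 1" using valn_mult[OF V c(1) nz(1) c(2) nz(2)] x valn_unif[OF V] by simp
 moreover have "valn V x >= 0" using valn_ge_0[OF V c(1) nz(1)] x by simp
 moreover have "valn V t > 0" using valn_gt_0[OF V c(2) nz(2)] t by simp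
 ultimately have "valn V (t [^] n) = n" using valn_ipow[OF V c(2) nz(2)] by simp
 thus "n = valn V z" using t(4) valn_mult[OF V ipow_nz[OF c(2) nz(2)] c(3,4)] valn_unit[OF V t(3)] by simp
qed

abbreviation degv :: "'a set => nat" where "degv V == place_degree F K (nonunits V)"

text \<open>\<open>A\<close> is in bijection with the residue field, and the degree is the dimension
  of that field over the image of \<open>K\<close>.\<close>

lemma card_residue_representatives:
 assumes V: "V : VR" and A: "kspace A" "finite A" "A <= V" "A \<inter> nonunits V = {\<zero>}"
  "ALL v:V. EX a:A. v \<ominus> a : nonunits V"
 shows "card A = card K ^ degv V"
proof -
 note vr = vr[OF V]
 define S where "S = F\<lparr>carrier := V\<rparr>"
 define Q where "Q = S Quot nonunits V"
 interpret I: maximalideal "nonunits V" S unfolding S_def by (rule nonunits_maximalideal[OF V])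
 have cS: "cring S" unfolding S_def by (rule FV_ring[OF V])
 interpret Q: field Q unfolding Q_def by (rule I.quotient_is_field[OF cS])
 interpret h: ring_hom_ring S Q "%a. nonunits V +>\<^bsub>S\<^esub> a"
  unfolding Q_def using I.rcos_ring_hom_ring by simp
 have minus: "a \<ominus>\<^bsub>S\<^esub> b = a \<ominus> b" if "a : V" "b : V" for a b
 proof -
  have "\<ominus>\<^bsub>S\<^esub> b = \<ominus> b"
   using I.minus_equality[of "\<ominus> b" b] that valring_neg[OF vr that(2)] subsetD[OF valring_carrier[OF vr] that(2)]
   by (simp add: l_neg S_def)
  thus ?thesis by (simp add: a_minus_def S_def)
 qed
 have eq: "nonunits V +>\<^bsub>S\<^esub> a = nonunits V +>\<^bsub>S\<^esub> b \<longleftrightarrow> a \<ominus> b : nonunits V" if "a : V" "b : V" for a b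
  using I.quotient_eq_iff_same_a_r_cos[OF I.is_ideal, of a b] that minus[OF that] by (simp add: S_def)
 let ?h = "%a. nonunits V +>\<^bsub>S\<^esub> a"
 have Kf: "subfield K S"
 proof (rule I.subfield_iff(1))
  show "field (S\<lparr>carrier := K\<rparr>)" using subfield_iff(2)[OF subfield_axioms] by (simp add: S_def)
  show "K <= carrier S" using vr_K[OF V] by (simp add: S_def)
 qed
 note K' = h.img_is_subfield[OF Kf Q.one_not_zero]
 have carQ: "carrier Q = ?h ` V" unfolding Q_def FactRing_def A_RCOSETS_def' by (auto simp: S_def)
 have hA: "carrier Q = ?h ` A"
 proof -
  have "EX a:A. ?h v = ?h a" if "v : V" for v
   using A(5) that eq[OF that] A(3) by (metis subsetD)
  thus ?thesis unfolding carQ using A(3) by (auto, blast)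
 qed
 have "inj_on ?h A"
 proof (rule inj_onI)
  fix a b assume ab: "a : A" "b : A" "?h a = ?h b"
  have As: "asub A" using A(1) by (simp add: kspace_def)
  have "a \<ominus> b = \<zero>" using eq ab A(3) using asubD(5)[OF As ab(1,2)] A(4) by blast
  thus "a = b" using asub_diff_zero asubD(3)[OF As] ab by blast
 qed
 hence "card (carrier Q) = card A" unfolding hA by (rule card_image)
 moreover have "finite (carrier Q)" unfolding hA using A(2) by simp
 hence "card (carrier Q) = card (?h ` K) ^ Q.dim (?h ` K) (carrier Q)"
  using Q.card_finite_subspace(2)[OF K'(2) _ Q.carrier_is_subalgebra] finite_constants
   subringE(1)[OF subfieldE(1)[OF K'(2)]] by blast
 moreover have "degv V = Q.dim (?h ` K) (carrier Q)"
  by (simp add: place_degree_def residue_field_def place_ring_eq[OF V] Q_def S_def)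
 ultimately show ?thesis using card_image[OF K'(1)] by metis
qed

lemma residues:
 assumes V: "V : VR"
 obtains A where "kspace A" "finite A" "A <= V" "A \<inter> nonunits V = {\<zero>}"
  "!!v. v : V ==> EX a:A. v \<ominus> a : nonunits V" "card A = card K ^ degv V"
 using residue_representatives[OF V] card_residue_representatives[OF V] by metis

lemma degv_pos:
 assumes V: "V : VR"
 shows "degv V > 0"
proof -
 obtain A where A: "kspace A" "finite A" "A <= V" "A \<inter> nonunits V = {\<zero>}"
  "!!v. v : V ==> EX a:A. v \<ominus> a : nonunits V" "card A = card K ^ degv V" by (rule residues[OF V]) blast
 obtain a where a: "a : A" "\<one> \<ominus> a : nonunits V" using A(5) valring_one[OF vr[OF V]] by blast
 have "a ~= \<zero>" using a one_not_nonunit[OF vr[OF V]] by (auto simp: minus_eq)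
 moreover have "\<zero> : A" using A(4) by auto
 ultimately have "card A ~= 1" using a(1) by (auto simp: card_1_singleton_iff)
 thus ?thesis using A(6) by simp
qed

end

section \<open>Weak approximation and the number of zeros\<close>

locale odd_function_field = global_function_field +
 assumes odd_card: "odd (card K)"
begin

text \<open>Otherwise {0, 1} would be a subgroup of order two in the additive group of
  \<open>K\<close>. A nonzero 2 makes \<open>1 + h^n\<close> a unit wherever \<open>h^n\<close> has
  residue one.\<close>

lemma two_nonzero: "\<one> \<oplus> \<one> ~= \<zero>"
proof
 assume two: "\<one> \<oplus> \<one> = \<zero>"
 define KR where "KR = F\<lparr>carrier := K\<rparr>"
 interpret KR: ring KR unfolding KR_def by (rule subring_is_ring[OF K_subring])
 have "subgroup {\<zero>, \<one>} (add_monoid KR)"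
 proof (rule KR.add.subgroupI)
  show "\<ominus>\<^bsub>KR\<^esub> a : {\<zero>, \<one>}" if "a : {\<zero>, \<one>}" for a
   using that KR.minus_equality[of \<one> \<one>] two KR.minus_zero by (auto simp: KR_def)
  show "{\<zero>, \<one>} <= carrier KR" using K_carrier(2,3) by (simp add: KR_def)
  show "a \<oplus>\<^bsub>KR\<^esub> b : {\<zero>, \<one>}" if "a : {\<zero>, \<one>}" "b : {\<zero>, \<one>}" for a b
  proof -
   have "a \<oplus> b : {\<zero>, \<one>}"
    using that(1)
   proof (elim insertE emptyE)
    assume "a = \<zero>" thus ?thesis using that(2) by auto
   next
    assume "a = \<one>" thus ?thesis using that(2) two by auto
   qed
   thus ?thesis by (simp add: KR_def)
  qed
 qed simp
 hence "card {\<zero>, \<one>} dvd order (add_monoid KR)"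
  using KR.add.lagrange by (metis dvd_triv_right)
 moreover have "order (add_monoid KR) = card K" by (simp add: order_def KR_def)
 moreover have "card {\<zero>, \<one>} = 2" by simp
 ultimately show False using odd_card by metis
qed

text \<open>The values are integers: if \<open>w\<close> in \<open>W\<close> has negative valuation
  at \<open>V\<close>, any \<open>z\<close> lies in \<open>w^k V\<close> for large \<open>k\<close>,
  hence in \<open>W\<close>, and \<open>W\<close> would be the whole field.\<close>

lemma valuation_rings_incomparable:
 assumes V: "V : VR" and W: "W : VR" and sub: "V <= W"
 shows "V = W"
proof (rule ccontr)
 assume "V ~= W"
 then obtain w where w: "w : W" "w ~: V" using sub by auto
 have wc: "w : carrier F" using w valring_carrier[OF vr[OF W]] by auto
 have wz: "w ~= \<zero>" using w valring_zero[OF vr[OF V]] by auto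
 have "z : W" if z: "z : carrier F" for z
 proof (cases "z = \<zero>")
  case False
  define k where "k = nat \<bar>valn V z\<bar>"
  note p = nat_pow_closed[OF wc, of k] pow_nz[OF wc wz, of k]
  note ip = inv_nz[OF p]
  have "int k * (valn V w + 1) <= 0" using valn_ge_0[OF V wc wz] w by (simp add: mult_nonneg_nonpos)
  moreover have "valn V z >= - int k" by (simp add: k_def)
  ultimately have "0 <= valn V z - int k * valn V w" by (simp add: algebra_simps)
  hence "z \<otimes> inv (w [^] k) : V"
   using valn_ge_0[OF V, of "z \<otimes> inv (w [^] k)"] valn_mult[OF V z False ip(1,2)] valn_inv[OF V p] valn_pow[OF V wc wz, of k]
    z False ip by (simp add: integral_iff)
  hence "(z \<otimes> inv (w [^] k)) \<otimes> w [^] k : W" using sub valring_mult[OF vr[OF W]] valring_pow[OF vr[OF W] w(1)] by blast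
  thus ?thesis using z ip p by (simp add: m_assoc)
 qed (use valring_zero[OF vr[OF W]] in simp)
 thus False using vr_proper[OF W] valring_carrier[OF vr[OF W]] by blast
qed

lemma separating_element:
 assumes V: "V : VR" and W: "W : VR" and ne: "V ~= W"
 obtains h where "h : nonunits V" "h ~= \<zero>" "inv h : nonunits W"
proof -
 obtain a where a: "a : V" "a ~: W" using valuation_rings_incomparable[OF V W] ne by auto
 obtain b where b: "b : W" "b ~: V" using valuation_rings_incomparable[OF W V] ne by auto
 have c: "a : carrier F" "b : carrier F" using a b valring_carrier[OF vr[OF W]] valring_carrier[OF vr[OF V]] by auto
 have nz: "a ~= \<zero>" "b ~= \<zero>" using a b valring_zero[OF vr[OF W]] valring_zero[OF vr[OF V]] by auto
 note ia = inv_nz[OF c(1) nz(1)] and ib = inv_nz[OF c(2) nz(2)]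
 have "a \<otimes> inv b : nonunits V" using nonunits_mult[OF vr[OF V] a(1) valring_inv[OF vr[OF V] c(2) b(2)]] .
 moreover have "inv (a \<otimes> inv b) = b \<otimes> inv a" using inv_mult_nz[OF c(1) nz(1) ib(1,2)] ib c ia by (simp add: m_comm)
 moreover have "b \<otimes> inv a : nonunits W" using nonunits_mult[OF vr[OF W] b(1) valring_inv[OF vr[OF W] c(1) a(2)]] .
 moreover have "a \<otimes> inv b ~= \<zero>" using c nz ib by (simp add: integral_iff)
 ultimately show thesis using that by metis
qed

text \<open>The residue field is finite, so two powers of \<open>h\<close> have the same residue;
  the exponent \<open>e\<close> is their distance.\<close>

lemma unit_power_residue_one:
 assumes V: "V : VR" and h: "h : V - nonunits V"
 shows "EX e>0. ALL k. h [^] (e * k :: nat) \<ominus> \<one> : nonunits V"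
proof -
 note vr = vr[OF V]
 obtain A where A: "finite A" "A <= V" "!!v. v : V ==> EX a:A. v \<ominus> a : nonunits V"
  by (rule residues[OF V]) blast
 have hc: "h : carrier F" using h valring_carrier[OF vr] by auto
 define f where "f n = (SOME a. a : A & h [^] (n::nat) \<ominus> a : nonunits V)" for n
 have f: "f n : A & h [^] n \<ominus> f n : nonunits V" for n
  unfolding f_def by (rule someI_ex) (use A(3)[OF valring_pow[OF vr, of h n]] h in blast)
 have "\<not> inj f"
 proof
  assume "inj f"
  moreover have "finite (range f)" using f A(1) by (meson finite_subset image_subsetI)
  ultimately show False using finite_imageD by auto
 qed
 then obtain i j where ij: "f i = f j" "i < j" by (metis injI linorder_neqE_nat)
 define e where "e = j - i"
 have c: "f i : carrier F" using f A(2) valring_carrier[OF vr] by blast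
 have "h [^] j \<ominus> h [^] i = (h [^] j \<ominus> f j) \<ominus> (h [^] i \<ominus> f i)"
  using c hc ij by (simp add: minus_eq minus_add a_ac add_cancel)
 hence "h [^] j \<ominus> h [^] i : nonunits V" using nonunits_minus[OF vr] f by metis
 moreover have "h [^] j \<ominus> h [^] i = h [^] i \<otimes> (h [^] e \<ominus> \<one>)"
  using hc ij(2) nat_pow_mult[OF hc, of i e] by (simp add: e_def minus_eq r_distr r_minus)
 moreover have hV: "h [^] (n::nat) : V - nonunits V" for n
  by (induction n) (use unit_mult[OF vr] h valring_one[OF vr] one_not_nonunit[OF vr] in auto)
 moreover have "h [^] e \<ominus> \<one> : V" using hV valring_minus[OF vr] valring_one[OF vr] by blast
 ultimately have 1: "h [^] e \<ominus> \<one> : nonunits V" using nonunits_prime[OF vr] by auto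
 have "h [^] (e * k) \<ominus> \<one> : nonunits V" for k
 proof (induction k)
  case 0 thus ?case using zero_nonunit[OF vr] by (simp add: minus_eq r_neg)
 next
  case (Suc k)
  have "h [^] (e * Suc k) \<ominus> \<one> = h [^] e \<otimes> (h [^] (e * k) \<ominus> \<one>) \<oplus> (h [^] e \<ominus> \<one>)" using nat_pow_mult[OF hc, of e "e * k"]
   using hc by (simp add: minus_eq r_distr r_minus a_ac add_cancel)
  thus ?case using Suc 1 nonunits_mult[OF vr] nonunits_add[OF vr] hV by simp
 qed
 thus ?thesis using ij(2) by (intro exI[of _ e]) (auto simp: e_def)
qed

text \<open>For suitable \<open>e\<close> the residue of \<open>h^(e k)\<close> with
  \<open>k > 0\<close> is 0, 1 or infinity, hence that of \<open>1 + h^(e k)\<close> is 1, 2 or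
  infinity, and the inverse is integral in all three cases.\<close>

lemma one_plus_power_unit:
 assumes U: "U : VR" and h: "h : carrier F" "h ~= \<zero>"
 shows "EX e>0. ALL k>0. \<one> \<oplus> h [^] (e * k :: nat) ~= \<zero> -->
  inv (\<one> \<oplus> h [^] (e * k)) : U"
proof -
 note vr = vr[OF U]
 have two: "\<one> \<oplus> \<one> : U - nonunits U"
  using K_units[OF U] subringE(7)[OF K_subring] K_carrier two_nonzero by blast
 have one: "\<one> : U - nonunits U" using valring_one[OF vr] one_not_nonunit[OF vr] by blast
 consider "h : nonunits U" | "h : U - nonunits U" | "h ~: U" by blast
 thus ?thesis
 proof cases
  case 1
  have "inv (\<one> \<oplus> h [^] (1 * k)) : U" if "k > 0" for k :: nat
   using unit_inv[OF vr unit_add_nonunit[OF vr one nonunits_pow[OF vr 1 that]]] by simp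
  thus ?thesis by auto
 next
  case 2
  obtain e where e: "e > 0" "!!k. h [^] (e * k :: nat) \<ominus> \<one> : nonunits U" using unit_power_residue_one[OF U 2] by blast
  have "inv (\<one> \<oplus> h [^] (e * k)) : U" for k
  proof -
   show ?thesis using h using unit_inv[OF vr unit_add_nonunit[OF vr two e(2)[of k]]] by (simp add: minus_eq a_ac add_cancel)
  qed
  thus ?thesis using e(1) by blast
 next
  case 3
  note ih = inv_nz[OF h]
  have g: "inv h : nonunits U" by (rule valring_inv[OF vr h(1) 3])
  have "inv (\<one> \<oplus> h [^] (1 * k)) : U" if k: "k > 0" and nz: "\<one> \<oplus> h [^] k ~= \<zero>" for k :: nat
  proof -
   have hp: "h [^] k : carrier F" "inv h [^] k : carrier F" using h ih by auto
   have u: "\<one> \<oplus> inv h [^] k : U - nonunits U" by (rule unit_add_nonunit[OF vr one nonunits_pow[OF vr g k]])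
   have uc: "\<one> \<oplus> inv h [^] k : carrier F" "\<one> \<oplus> inv h [^] k ~= \<zero>" using u unit_iff[OF vr] hp by auto
   have "h [^] k \<otimes> inv h [^] k = \<one>" using ih h by (simp flip: nat_pow_distrib)
   hence "(\<one> \<oplus> h [^] k) \<otimes> inv h [^] k = \<one> \<oplus> inv h [^] k" using hp by (simp add: l_distr a_comm)
   hence "(\<one> \<oplus> h [^] k) \<otimes> (inv h [^] k \<otimes> inv (\<one> \<oplus> inv h [^] k)) = \<one>"
    using inv_nz[OF uc] hp by (simp flip: m_assoc)
   hence "inv (\<one> \<oplus> h [^] k) = inv h [^] k \<otimes> inv (\<one> \<oplus> inv h [^] k)"
    by (rule comm_inv_char[rotated 2]) (use inv_nz(1)[OF uc] hp in auto)
   thus ?thesis using valring_mult[OF vr] unit_inv[OF vr u] nonunits_pow[OF vr g k] nonunits_subset[OF vr] by auto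
  qed
  thus ?thesis by auto
 qed
qed

text \<open>Take 1/(1 + h^E) where \<open>h\<close> has a zero at \<open>V\<close> and a pole at
  \<open>W\<close>.\<close>

lemma approximate_pair:
 assumes V: "V : VR" and W: "W : VR" and ne: "V ~= W"
  and S: "finite S" "S <= VR" and M: "M > 0"
 shows "EX e:carrier F. (ALL U:S. e : U) & \<one> \<ominus> e : vset V (int M) & e : vset W (int M)"
proof -
 obtain h where h: "h : nonunits V" "h ~= \<zero>" "inv h : nonunits W" by (rule separating_element[OF V W ne])
 have hc: "h : carrier F" using h nonunits_carrier[OF vr[OF V]] by auto
 note ih = inv_nz[OF hc h(2)]
 define f where "f U = (SOME e. e > 0 & (ALL k>0. \<one> \<oplus> h [^] (e * k :: nat) ~= \<zero> --> inv (\<one> \<oplus> h [^] (e * k)) : U))" for U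
 have f: "f U > 0 & (ALL k>0. \<one> \<oplus> h [^] (f U * k :: nat) ~= \<zero> --> inv (\<one> \<oplus> h [^] (f U * k)) : U)"
  if "U : VR" for U
  unfolding f_def by (rule someI_ex) (rule one_plus_power_unit[OF that hc h(2)])
 \<comment> \<open>A multiple of the exponents required at all places of \<open>S\<close>, and large
   enough for approximation to order \<open>M\<close>.\<close>
 define E where "E = M * prod f S"
 have pos: "prod f S > 0" using f S by auto
 have E: "E >= M" "E > 0" using pos M by (auto simp: E_def)
 note one = valring_one[OF vr] one_not_nonunit[OF vr]
 have uV: "\<one> \<oplus> h [^] E : V - nonunits V"
  using unit_add_nonunit[OF vr[OF V] _ nonunits_pow[OF vr[OF V] h(1) E(2)], of \<one>] one[OF V] by blast
 have nz: "\<one> \<oplus> h [^] E ~= \<zero>" "\<one> \<oplus> h [^] E : carrier F" using uV unit_iff[OF vr[OF V]] hc by auto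
 define e where "e = inv (\<one> \<oplus> h [^] E)"
 note ie = inv_nz[OF nz(2,1), folded e_def]
 have "e : U" if "U : S" for U
 proof -
  define k where "k = M * prod f (S - {U})"
  have k: "E = f U * k" using prod.remove[OF S(1) that, of f] by (simp add: E_def k_def)
  show ?thesis using E(2) using f[of U] that S(2) nz unfolding e_def k by auto
 qed
 moreover have "\<one> \<ominus> e : vset V (int M)"
 proof -
  have "\<one> \<ominus> e = (\<one> \<oplus> h [^] E) \<otimes> e \<ominus> e" using ie by simp
  also have "\<dots> = h [^] E \<otimes> e" using ie(1) hc by (simp add: minus_eq l_distr a_ac r_neg2)
  finally have 1: "\<one> \<ominus> e = h [^] E \<otimes> e" .
  have "int M <= int E * valn V h" using valn_gt_0[OF V hc h(2)] h(1) using E mult_left_mono[of 1 "valn V h" "int E"] by linarith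
  hence "h [^] E : vset V (int M)" using valn_pow[OF V hc h(2), of E] hc by (simp add: vset_def[OF V])
  moreover have "e : vset V 0" using unit_inv[OF vr[OF V] uV] vset_0[OF V] by (simp add: e_def)
  ultimately show ?thesis using vset_mult[OF V, of "h [^] E" "int M" e 0] 1 by simp
 qed
 moreover have "e : vset W (int M)"
 proof -
  have hp: "h [^] E : carrier F" "inv h [^] E : carrier F" using hc ih by auto
  have u: "\<one> \<oplus> inv h [^] E : W - nonunits W"
   using unit_add_nonunit[OF vr[OF W] _ nonunits_pow[OF vr[OF W] h(3) E(2)], of \<one>] one[OF W] by blast
  have uc: "\<one> \<oplus> inv h [^] E : carrier F" "\<one> \<oplus> inv h [^] E ~= \<zero>" using u unit_iff[OF vr[OF W]] hp by auto
  have "h [^] E \<otimes> inv h [^] E = \<one>" using ih hc by (simp flip: nat_pow_distrib)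
  hence "(\<one> \<oplus> h [^] E) \<otimes> inv h [^] E = \<one> \<oplus> inv h [^] E" using hp by (simp add: l_distr a_comm)
  hence "(\<one> \<oplus> h [^] E) \<otimes> (inv h [^] E \<otimes> inv (\<one> \<oplus> inv h [^] E)) = \<one>"
   using inv_nz[OF uc] hp by (simp flip: m_assoc)
  hence eq: "e = inv h [^] E \<otimes> inv (\<one> \<oplus> inv h [^] E)"
   unfolding e_def by (rule comm_inv_char[rotated 2]) (use inv_nz(1)[OF uc] hp in auto)
  have "int M <= int E * valn W (inv h)" using valn_gt_0[OF W ih(1,2)] h(3) using E mult_left_mono[of 1 "valn W (inv h)" "int E"] by linarith
  hence "inv h [^] E : vset W (int M)" using valn_pow[OF W ih(1,2), of E] ih by (simp add: vset_def[OF W])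
  moreover have "inv (\<one> \<oplus> inv h [^] E) : vset W 0" using unit_inv[OF vr[OF W] u] vset_0[OF W] by simp
  ultimately show ?thesis using vset_mult[OF W, of "inv h [^] E" "int M" "inv (\<one> \<oplus> inv h [^] E)" 0] eq by simp
 qed
 ultimately show ?thesis using ie(1) by blast
qed

text \<open>The product of the functions from \<open>approximate_pair\<close> over all
  \<open>W\<close> in \<open>S\<close>. Their integrality at \<open>V\<close> and throughout
  \<open>S\<close> keeps each gained approximation.\<close>

lemma approximate_one_zero:
 assumes V: "V : VR"
  and S: "finite S" "S <= VR" "V ~: S" and M: "M > 0"
 shows "EX e:carrier F. \<one> \<ominus> e : vset V (int M) & (ALL U:S. e : vset U (int M))"
proof -
 have "EX e:carrier F. (ALL U:insert V S. e : U) & \<one> \<ominus> e : vset V (int M) & (ALL U:T. e : vset U (int M))"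
  if "finite T" "T <= S" for T
  using that
 proof (induction T)
  case empty
  have "ALL U:insert V S. \<one> : U" using V S(2) by (auto intro: valring_one[OF vr])
  moreover have "\<one> \<ominus> \<one> : vset V (int M)" using asubD(2)[OF vset_asub[OF V]] by (simp add: minus_eq r_neg)
  ultimately show ?case by blast
 next
  case (insert W T)
  then obtain e where e: "e : carrier F" "ALL U:insert V S. e : U" "\<one> \<ominus> e : vset V (int M)"
   "ALL U:T. e : vset U (int M)" by auto
  have W: "W : VR" "W : S" "V ~= W" using insert S by auto
  have fin: "finite (insert V S)" "insert V S <= VR" using S V by auto
  obtain d where d: "d : carrier F" "ALL U:insert V S. d : U" "\<one> \<ominus> d : vset V (int M)" "d : vset W (int M)"
   using approximate_pair[OF V W(1,3) fin M] by blast
  have "\<one> \<ominus> e \<otimes> d = (\<one> \<ominus> e) \<oplus> e \<otimes> (\<one> \<ominus> d)"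
   using e(1) d(1) by (simp add: minus_eq r_distr r_minus a_ac add_cancel)
  moreover have "e \<otimes> (\<one> \<ominus> d) : vset V (int M)"
   using vset_mult[OF V, of e 0 "\<one> \<ominus> d" "int M"] vset_0[OF V] e(2) d(3) by simp
  ultimately have 1: "\<one> \<ominus> e \<otimes> d : vset V (int M)" using asubD(6)[OF vset_asub[OF V] e(3)] by simp
  have 2: "ALL U:insert V S. e \<otimes> d : U"
  proof
   fix U assume U: "U : insert V S"
   show "e \<otimes> d : U" using valring_mult[OF vr[OF subsetD[OF fin(2) U]]] e(2) d(2) U by blast
  qed
  have "e \<otimes> d : vset U (int M)" if "U : insert W T" for U
  proof -
   have U: "U : VR" "U : S" using that insert S by auto
   show ?thesis using that e(4) d(4) using vset_mult[OF U(1), of e "int M" d 0] vset_mult[OF U(1), of e 0 d "int M"] vset_0[OF U(1)] e(2) d(2) U by auto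
  qed
  thus ?case using 1 2 e(1) d(1) by auto
 qed
 from this[OF S(1) subset_refl] show ?thesis by blast
qed

lemma vset_bounded_below:
 assumes S: "finite S" "S <= VR" and B: "finite B" "B <= carrier F"
 shows "EX k::nat. ALL U:S. ALL b:B. b : vset U (- int k)"
proof -
 define f where "f = (%(U, b). nat (- valn U b))"
 define k where "k = sum f (S \<times> B)"
 have "b : vset U (- int k)" if "U : S" "b : B" for U b
 proof -
  have "f (U, b) <= k" unfolding k_def using S B that by (intro member_le_sum) auto
  moreover have "- valn U b <= int (f (U, b))" by (simp add: f_def)
  moreover have "U : VR" "b : carrier F" using that S B by auto
  ultimately show ?thesis by (simp add: vset_def)
 qed
 thus ?thesis by blast
qed

text \<open>Expansions in the uniformizer with \<open>n\<close> digits taken from the residue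
  representatives.\<close>

lemma truncated_expansions:
 assumes V: "V : VR"
 shows "EX B. asub B & finite B & B <= V & (ALL b:B. b : vset V (int n) --> b = \<zero>) &
  card B = card K ^ (degv V * n)"
proof -
 note vr = vr[OF V]
 note t = unif[OF V]
 obtain A where A: "kspace A" "finite A" "A <= V" "A \<inter> nonunits V = {\<zero>}"
  "!!v. v : V ==> EX a:A. v \<ominus> a : nonunits V" "card A = card K ^ degv V" by (rule residues[OF V]) blast
 have As: "asub A" using A(1) by (simp add: kspace_def)
 have cA: "A <= carrier F" using asubD(1)[OF As] .
 have sub: "ladder A (unif V) k <= V" for k by (rule ladder_subring[OF valring_subring[OF vr] A(3) t(5)])
 have "card (ladder A (unif V) n) = card A ^ n"
 proof (rule ladder_card_eq[OF valring_subring[OF vr] As A(3,2) t(5,2)])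
  fix a b assume "a : A" "b : V" "a = unif V \<otimes> b"
  hence "a : A \<inter> nonunits V" using nonunits_mult2[OF vr t(1)] by auto
  thus "a = \<zero>" using A(4) by auto
 qed
 hence "card (ladder A (unif V) n) = card K ^ (degv V * n)" by (simp add: A(6) power_mult)
 moreover have "b = \<zero>" if "b : ladder A (unif V) n" "b : vset V (int n)" for b
  using that
 proof (induction n arbitrary: b)
  case (Suc n)
  then obtain a c where ac: "b = a \<oplus> unif V \<otimes> c" "a : A" "c : ladder A (unif V) n" by (meson ladder_SucE)
  have cl: "a : carrier F" "c : V" "c : carrier F" "b : carrier F"
   using ac cA subsetD[OF sub] subsetD[OF valring_carrier[OF vr]] t(4) by auto
  have "b : nonunits V" using Suc.prems(2) subsetD[OF vset_antimono[OF V, of 1 "int (Suc n)"]] vset_1[OF V] by simp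
  moreover have "a = b \<ominus> unif V \<otimes> c" using ac cl t(4) by (simp add: minus_eq a_ac r_neg)
  ultimately have a0: "a = \<zero>" using nonunits_minus[OF vr _ nonunits_mult2[OF vr t(1) cl(2)]] using A(4) ac(2) by auto
  hence "unif V \<otimes> c : vset V (int (Suc n))" using Suc.prems(2) ac cl t(4) by simp
  hence "c : vset V (int n)" using vset_scale[OF V t(4,2) cl(3)] valn_unif[OF V] by simp
  hence "c = \<zero>" using Suc.IH ac(3) by blast
  thus ?case using ac a0 t(4) by simp
 qed simp
 ultimately show ?thesis
  using ladder_asub[OF As t(4), of n] ladder_finite(1)[OF A(2)] sub by blast
qed

text \<open>The Chinese remainder theorem in counting form: expansions truncated at the order of
  \<open>x\<close> at each place are glued by approximate idempotents.\<close>

lemma independent_modulo: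
 assumes x: "x : carrier F" "x ~= \<zero>" and S: "finite S" "S <= VR" "!!V. V : S ==> x : V"
 shows "EX A. asub A & finite A & (ALL V:S. A <= V) &
  (ALL a:A. (ALL V:S. a : vset V (valn V x)) --> a = \<zero>) &
  card A = card K ^ (\<Sum>V\<in>S. degv V * nat (valn V x))"
 using S
proof (induction S)
 case empty
 have "asub {\<zero>}" by (rule asubI) (auto simp: minus_eq)
 moreover have "card {\<zero>} = card K ^ (\<Sum>V\<in>{}. degv V * nat (valn V x))" by simp
 ultimately show ?case by blast
next
 case (insert V S)
 have V: "V : VR" "x : V" and S: "S <= VR" using insert by auto
 obtain A where A: "asub A" "finite A" "ALL V:S. A <= V"
  "ALL a:A. (ALL V:S. a : vset V (valn V x)) --> a = \<zero>"
  "card A = card K ^ (\<Sum>V\<in>S. degv V * nat (valn V x))" using insert by auto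
 define n where "n U = valn U x" for U
 have n0: "n U >= 0" if "U : insert V S" for U
  using valn_ge_0[OF _ x] that insert unfolding n_def by auto
 obtain B where B: "asub B" "finite B" "B <= V" "ALL b:B. b : vset V (n V) --> b = \<zero>"
  "card B = card K ^ (degv V * nat (valn V x))"
  using truncated_expansions[OF V(1), of "nat (n V)"] n0[of V] unfolding n_def by auto
 have cl: "A <= carrier F" "B <= carrier F" using asubD(1) A(1) B(1) by auto
 obtain k where k: "ALL U:insert V S. ALL b:A \<union> B. b : vset U (- int k)"
  using vset_bounded_below[of "insert V S" "A \<union> B"] insert V A(2) B(2) cl by auto
 define s where "s = (\<Sum>U\<in>insert V S. nat (n U))"
 \<comment> \<open>The idempotents vanish to order \<open>M\<close>, which outweighs the poles of
   order \<open>k\<close> of the chosen elements and still leaves the order of \<open>x\<close>; the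
   extra one makes \<open>M\<close> positive.\<close>
 define M where "M = k + s + 1"
 have Mn: "int M - int k >= n U" if "U : insert V S" for U
 proof -
  have "nat (n U) <= s" unfolding s_def using insert that by (intro member_le_sum) auto
  thus ?thesis by (simp add: M_def)
 qed
 obtain e where e: "e : carrier F" "\<one> \<ominus> e : vset V (int M)" "ALL U:S. e : vset U (int M)"
  using approximate_one_zero[OF V(1) insert(1) S insert(2), of M] unfolding M_def by auto
 define d where "d = \<one> \<ominus> e"
 have dc: "d : carrier F" using e by (simp add: d_def)
 have small: "c \<otimes> b : vset U (n U)" if "U : insert V S" "c : vset U (int M)" "b : A \<union> B" for U c b
 proof -
  have U: "U : VR" using that V S by auto
  show ?thesis using vset_mult[OF U that(2)] k that(1,3) using subsetD[OF vset_antimono[OF U, of "n U" "int M + (- int k)"]] Mn[OF that(1)] by force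
 qed
 define f where "f = (%(a, b). d \<otimes> a \<oplus> e \<otimes> b)"
 define C where "C = f ` (A \<times> B)"
 have cA: "!!a. a : A ==> a : carrier F" and cB: "!!a. a : B ==> a : carrier F" using cl by auto
 have diff: "f (a, b) \<ominus> f (a', b') = f (a \<ominus> a', b \<ominus> b')" if "a : A" "a' : A" "b : B" "b' : B" for a b a' b'
  using cA[OF that(1)] cA[OF that(2)] cB[OF that(3)] cB[OF that(4)] dc e(1)
  by (simp add: f_def minus_eq r_distr r_minus minus_add a_ac)
 text \<open>Modulo \<open>x\<close>, the element \<open>f (a, b)\<close> agrees with \<open>a\<close> at the places of \<open>S\<close> and with \<open>b\<close> at \<open>V\<close>.\<close>
 have atS: "f (a, b) \<ominus> a : vset U (n U)" if "a : A" "b : B" "U : S" for a b U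
 proof -
  have U: "U : VR" "U : insert V S" using that S by auto
  have eq: "f (a, b) \<ominus> a = e \<otimes> b \<ominus> e \<otimes> a"
   using cA[OF that(1)] cB[OF that(2)] e(1)
   by (simp add: f_def d_def minus_eq l_distr l_minus a_ac r_neg2)
  show ?thesis unfolding eq
   using asubD(5)[OF vset_asub[OF U(1)] small[OF U(2)] small[OF U(2)]] e(3) that by blast
 qed
 have atV: "f (a, b) \<ominus> b : vset V (n V)" if "a : A" "b : B" for a b
 proof -
  have eq: "f (a, b) \<ominus> b = d \<otimes> a \<ominus> d \<otimes> b"
   using cA[OF that(1)] cB[OF that(2)] e(1)
   by (simp add: f_def d_def minus_eq l_distr l_minus minus_add a_ac)
  show ?thesis unfolding eq
   using asubD(5)[OF vset_asub[OF V(1)] small[of V] small[of V]] e(2) that by (auto simp: d_def)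
 qed
 have recover: "w : vset U m" if U: "U : VR" and "z \<ominus> w : vset U m" "z : vset U m" "w : carrier F" for U m z w
 proof -
  have zc: "z : carrier F" using asubD(3)[OF vset_asub[OF U] that(3)] .
  show ?thesis using zc that(4) using asubD(5)[OF vset_asub[OF U] that(3,2)] by (simp add: minus_eq minus_add r_neg2)
 qed
 have ker: "a = \<zero> & b = \<zero>" if ab: "a : A" "b : B" and z: "!!U. U : insert V S ==> f (a, b) : vset U (n U)" for a b
 proof
  show "a = \<zero>"
   using A(4) ab recover[OF subsetD[OF S] atS[OF ab] _ cA[OF ab(1)]] z unfolding n_def by blast
  show "b = \<zero>" using B(4) ab recover[OF V(1) atV[OF ab] _ cB[OF ab(2)]] z by blast
 qed
 have f00: "f (\<zero>, \<zero>) = \<zero>" using dc e(1) by (simp add: f_def)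
 have "inj_on f (A \<times> B)"
 proof (rule inj_onI, clarify)
  fix a b a' b' assume *: "a : A" "b : B" "a' : A" "b' : B" "f (a, b) = f (a', b')"
  have e0: "f (a', b') \<ominus> f (a', b') = \<zero>" using cA[OF *(3)] cB[OF *(4)] dc e(1) by (simp add: f_def)
  have z0: "f (a \<ominus> a', b \<ominus> b') = \<zero>" using diff[OF *(1,3,2,4)] unfolding *(5) e0 by (rule sym)
  have "a \<ominus> a' = \<zero> & b \<ominus> b' = \<zero>"
  proof (rule ker)
   show "a \<ominus> a' : A" "b \<ominus> b' : B" using asubD(5)[OF A(1)] asubD(5)[OF B(1)] * by auto
   show "f (a \<ominus> a', b \<ominus> b') : vset U (n U)" if "U : insert V S" for U
    unfolding z0 using asubD(2)[OF vset_asub] that V S by auto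
  qed
  thus "a = a' & b = b'" using asub_diff_zero cA cB * by blast
 qed
 hence "card C = card A * card B" unfolding C_def by (simp add: card_image card_cartesian_product)
 hence cardC: "card C = card K ^ (\<Sum>V\<in>insert V S. degv V * nat (valn V x))"
  using A(5) B(5) insert by (simp add: power_add)
 have asubC: "asub C"
 proof (rule asubI)
  show "C <= carrier F" using cA cB dc e(1) by (auto simp: C_def f_def)
  show "\<zero> : C" using f00 asubD(2)[OF A(1)] asubD(2)[OF B(1)] unfolding C_def by (metis SigmaI image_eqI)
  fix z w assume "z : C" "w : C"
  then obtain a b a' b' where *: "z = f (a, b)" "w = f (a', b')" "a : A" "b : B" "a' : A" "b' : B" by (auto simp: C_def)
  show "z \<ominus> w : C" using diff * using asubD(5)[OF A(1) *(3,5)] asubD(5)[OF B(1) *(4,6)] by (auto simp: C_def)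
 qed
 have inV: "z : U" if zw: "z \<ominus> w : vset U (n U)" and w: "w : U" and U: "U : insert V S" "U : VR"
  and zc: "z : carrier F" for z w U
 proof -
  have wc: "w : carrier F" using w valring_carrier[OF vr[OF U(2)]] by auto
  have "z \<ominus> w : U" using subsetD[OF vset_antimono[OF U(2) n0[OF U(1)]] zw] vset_0[OF U(2)] by simp
  moreover have "z = (z \<ominus> w) \<oplus> w" using zc wc by (simp add: minus_eq a_assoc l_neg)
  ultimately show ?thesis using valring_add[OF vr[OF U(2)] _ w] by metis
 qed
 have "C <= U" if U: "U : insert V S" for U
 proof
  fix z assume "z : C"
  then obtain a b where ab: "z = f (a, b)" "a : A" "b : B" "z : carrier F" using asubD(3)[OF asubC] by (auto simp: C_def)
  show "z : U"
  proof (cases "U = V")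
   case True thus ?thesis using inV[OF atV[OF ab(2,3)]] ab B(3) V(1) by auto
  next
   case False
   hence U: "U : S" "U : VR" using U S by auto
   thus ?thesis using inV[OF atS[OF ab(2,3)]] ab A(3) by auto
  qed
 qed
 moreover have "ALL z:C. (ALL U:insert V S. z : vset U (valn U x)) --> z = \<zero>"
 proof (intro ballI impI)
  fix z assume z: "z : C" "ALL U:insert V S. z : vset U (valn U x)"
  then obtain a b where ab: "z = f (a, b)" "a : A" "b : B" by (auto simp: C_def)
  have "a = \<zero> & b = \<zero>" using ker[OF ab(2,3)] z(2) ab(1) unfolding n_def by blast
  thus "z = \<zero>" using ab f00 by simp
 qed
 moreover have "finite C" using A(2) B(2) by (simp add: C_def)
 ultimately show ?case using asubC cardC by blast
qed

text \<open>The elements independent modulo \<open>x\<close> serve as digits in base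
  \<open>x\<close>, so \<open>ladder_bound\<close> limits their number and with it the total degree
  of the zeros.\<close>

lemma zeros_degree_bound:
 assumes x: "x : carrier F" "x ~= \<zero>" "x ~: K"
 shows "EX B. ALL S. finite S & S <= {V : VR. x : nonunits V} --> (\<Sum>V\<in>S. degv V * nat (valn V x)) <= B"
proof -
 obtain B where B: "!!A. asub A ==> finite A ==> (ALL k. card (ladder A x k) = card A ^ k) ==> card A <= B"
  using ladder_bound[OF x(1)] by blast
 have "(\<Sum>V\<in>S. degv V * nat (valn V x)) <= B"
  if S: "finite S" "S <= {V : VR. x : nonunits V}" for S
 proof -
  have S': "S <= VR" "!!V. V : S ==> x : V" using S nonunits_subset[OF vr] by auto
  obtain A where A: "asub A" "finite A" "ALL V:S. A <= V"
   "ALL a:A. (ALL V:S. a : vset V (valn V x)) --> a = \<zero>"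
   "card A = card K ^ (\<Sum>V\<in>S. degv V * nat (valn V x))"
   using independent_modulo[OF x(1,2) S(1) S'] by blast
  define R where "R = {z : carrier F. ALL V:S. z : V}"
  have sR: "subring R F"
  proof (rule subringI)
   fix a b assume "a : R" "b : R"
   thus "a \<otimes> b : R" "a \<oplus> b : R"
    using valring_mult[OF vr] valring_add[OF vr] S' by (auto simp: R_def)
  qed (use S' valring_one[OF vr] valring_neg[OF vr] in \<open>auto simp: R_def\<close>)
  have "card (ladder A x k) = card A ^ k" for k
  proof (rule ladder_card_eq[OF sR A(1) _ A(2) _ x(2)])
   show "A <= R" using A(3) asubD(1)[OF A(1)] by (auto simp: R_def)
   show "x : R" using x S' by (auto simp: R_def)
   fix a b assume ab: "a : A" "b : R" "a = x \<otimes> b"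
   have "a : vset V (valn V x)" if V: "V : S" for V
    using vset_scale[OF _ x(1,2), of V b "valn V x"] vset_0[of V] ab V S' by (auto simp: R_def)
   thus "a = \<zero>" using A(4) ab(1) by blast
  qed
  hence "card A <= B" using B[OF A(1,2)] by blast
  moreover have "(\<Sum>V\<in>S. degv V * nat (valn V x)) < card A"
   unfolding A(5) using card_K_gt_1 by (intro power_gt_expt) auto
  ultimately show ?thesis by simp
 qed
 thus ?thesis by blast
qed

lemma finite_zeros:
 assumes x: "x : carrier F" "x ~: K"
 shows "finite {V : VR. x : nonunits V}"
proof (rule ccontr)
 assume inf: "infinite {V : VR. x : nonunits V}"
 have xz: "x ~= \<zero>" using x K_carrier by auto
 obtain B where B: "!!S. finite S ==> S <= {V : VR. x : nonunits V} ==>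
   (\<Sum>V\<in>S. degv V * nat (valn V x)) <= B"
  using zeros_degree_bound[OF x(1) xz x(2)] by blast
 obtain S where S: "finite S" "card S = Suc B" "S <= {V : VR. x : nonunits V}"
  using infinite_arbitrarily_large[OF inf] by blast
 have "1 <= degv V * nat (valn V x)" if "V : S" for V
  using degv_pos[of V] valn_gt_0[of V x] x xz that S(3) by auto
 hence "(\<Sum>V\<in>S. 1) <= (\<Sum>V\<in>S. degv V * nat (valn V x))" by (intro sum_mono) auto
 thus False using B[OF S(1,3)] S(2) by simp
qed

text \<open>1/y is not in K[y] because \<open>y\<close> is transcendental, so Chevalley's theorem
  gives a valuation ring containing K[y] but not 1/y.\<close>

lemma exists_zero_of:
 assumes y: "y : carrier F" "y ~: K"
 shows "EX V:VR. y : nonunits V"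
proof -
 have yz: "y ~= \<zero>" using y K_carrier by auto
 note AD = adjoin_subring[OF K_subring y(1)]
 note iy = inv_nz[OF y(1) yz]
 have "inv y ~: adjoin K y"
  using nonconstant_ladder[OF y K_carrier(3) _ iy(3)[symmetric]] one_not_zero by blast
 then obtain V where V: "valring V" "adjoin K y <= V" "inv y ~: V"
  using exists_valring[OF AD(1,3) yz] by blast
 hence "V : VR" using valuation_rings_iff AD(2) iy(1) by blast
 moreover have "y : nonunits V" using V AD(3) by (auto simp: nonunits_def)
 ultimately show ?thesis by blast
qed

lemma integral_everywhere_constant:
 assumes z: "z : carrier F" "!!V. V : VR ==> z : V"
 shows "z : K"
proof (rule ccontr)
 assume n: "z ~: K"
 have zz: "z ~= \<zero>" using n K_carrier by auto
 note iz = inv_nz[OF z(1) zz]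
 have "inv z ~: K" using K_inv[of "inv z"] iz n by auto
 then obtain V where V: "V : VR" "inv z : nonunits V" using exists_zero_of[OF iz(1)] by blast
 thus False using z(2)[OF V(1)] iz(2,5) unfolding nonunits_def by auto
qed

section \<open>Riemann-Roch spaces and the degree of principal divisors\<close>

definition lspace :: "('a set => int) => 'a set" where
 "lspace D = {z : carrier F. ALL V:VR. z : vset V (- D V)}"

text \<open>Divisors are functions on all sets, of which only the values on valuation rings count.
  Finite support is a separate hypothesis, which makes sums and multiples of divisors plain
  pointwise expressions.\<close>

definition divsupp :: "('a set => int) => 'a set set" where
 "divsupp D = {V : VR. D V ~= 0}"

definition divdeg :: "('a set => int) => int" where
 "divdeg D = (\<Sum>V\<in>divsupp D. D V * int (degv V))"

abbreviation ldim :: "('a set => int) => nat" where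
 "ldim D == dim K (lspace D)"

lemma divdeg_sum:
 assumes "finite S" "divsupp D <= S" "S <= VR"
 shows "divdeg D = (\<Sum>V\<in>S. D V * int (degv V))"
 unfolding divdeg_def by (rule sum.mono_neutral_left) (use assms in \<open>auto simp: divsupp_def\<close>)

lemma divsupp_subset: "divsupp D <= VR"
 by (auto simp: divsupp_def)

lemma divdeg_add:
 assumes "finite (divsupp D)" "finite (divsupp E)"
 shows "divdeg (%V. D V + E V) = divdeg D + divdeg E" "finite (divsupp (%V. D V + E V))"
proof -
 define S where "S = divsupp D \<union> divsupp E"
 have S: "finite S" "divsupp D <= S" "divsupp E <= S" "divsupp (%V. D V + E V) <= S" "S <= VR"
  using assms by (simp add: S_def) (auto simp: S_def divsupp_def)
 show "finite (divsupp (%V. D V + E V))" using S finite_subset by blast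
 show "divdeg (%V. D V + E V) = divdeg D + divdeg E"
  using divdeg_sum[OF S(1,2,5)] divdeg_sum[OF S(1,3,5)] divdeg_sum[OF S(1,4,5)]
  by (simp add: algebra_simps)
qed

lemma divdeg_scale:
 assumes "finite (divsupp D)"
 shows "divdeg (%V. c * D V) = c * divdeg D" "finite (divsupp (%V. c * D V))"
proof -
 have s: "divsupp (%V. c * D V) <= divsupp D" by (auto simp: divsupp_def)
 thus "finite (divsupp (%V. c * D V))" using assms finite_subset by blast
 show "divdeg (%V. c * D V) = c * divdeg D"
  using divdeg_sum[OF assms s divsupp_subset] by (simp add: divdeg_def sum_distrib_left mult.assoc)
qed

lemma divdeg_mono:
 assumes "finite (divsupp D)" "finite (divsupp E)" "!!V. V : VR ==> D V <= E V"
 shows "divdeg D <= divdeg E"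
proof -
 define S where "S = divsupp D \<union> divsupp E"
 have S: "finite S" "divsupp D <= S" "divsupp E <= S" "S <= VR"
  using assms(1,2) by (simp add: S_def) (auto simp: S_def divsupp_def)
 show ?thesis unfolding divdeg_sum[OF S(1,2,4)] divdeg_sum[OF S(1,3,4)]
  using assms(3) S(4) by (intro sum_mono mult_right_mono) auto
qed

lemma lspace_kspace: "kspace (lspace D)"
 unfolding kspace_def
proof (intro conjI ballI asubI)
 fix a b assume "a : lspace D" "b : lspace D"
 thus "a \<ominus> b : lspace D" using asubD(5)[OF vset_asub] by (auto simp: lspace_def)
next
 show "\<zero> : lspace D" using asubD(2)[OF vset_asub] by (auto simp: lspace_def)
next
 fix c a assume "c : K" "a : lspace D"
 thus "c \<otimes> a : lspace D" using vset_K by (auto simp: lspace_def)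
qed (auto simp: lspace_def)

lemma lspace_asub: "asub (lspace D)"
 using lspace_kspace by (simp add: kspace_def)

lemma lspace_cong: "(!!V. V : VR ==> D V = E V) ==> lspace D = lspace E"
 by (auto simp: lspace_def)

lemma lspace_mono: "(!!V. V : VR ==> D V <= E V) ==> lspace D <= lspace E"
proof
 fix z assume le: "!!V. V : VR ==> D V <= E V" and z: "z : lspace D"
 have "z : vset V (- E V)" if "V : VR" for V
  using subsetD[OF vset_antimono[OF that, of "- E V" "- D V"]] le[OF that] z that by (auto simp: lspace_def)
 thus "z : lspace E" using z by (auto simp: lspace_def)
qed

lemma card_lspace: "finite (lspace D) ==> card (lspace D) = card K ^ ldim D"
 using card_kspace[OF lspace_kspace] .

text \<open>After scaling by \<open>unif ^ (D V + 1)\<close> the new pole coefficient at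
  \<open>V\<close> becomes a residue, and functions with equal residue differ by an element of the
  smaller space.\<close>

lemma lspace_step:
 assumes V: "V : VR" and fin: "finite (lspace D)"
 shows "finite (lspace (D(V := D V + 1))) & card (lspace (D(V := D V + 1))) <= card K ^ degv V * card (lspace D)"
proof -
 note vr = vr[OF V]
 obtain A where A: "finite A" "A <= V" "!!v. v : V ==> EX a:A. v \<ominus> a : nonunits V" "card A = card K ^ degv V"
  by (rule residues[OF V]) blast
 define t where "t = unif V [^] (D V + 1)"
 have t: "t : carrier F" "t ~= \<zero>" "valn V t = D V + 1"
  using ipow_nz[OF unif(4,2)[OF V]] valn_ipow[OF V unif(4,2)[OF V]] valn_unif[OF V] by (auto simp: t_def)
 define f where "f z = (SOME a. a : A & t \<otimes> z \<ominus> a : nonunits V)" for z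
 let ?L = "lspace (D(V := D V + 1))"
 have f: "f z : A & t \<otimes> z \<ominus> f z : nonunits V" if z: "z : ?L" for z
 proof -
  have "t \<otimes> z : V" using z V using vset_scale[OF V t(1,2), of z 0] t(3) vset_0[OF V] by (auto simp: lspace_def)
  thus ?thesis unfolding f_def using someI_ex[of "%a. a : A & t \<otimes> z \<ominus> a : nonunits V"] A(3) by blast
 qed
 have ker: "z \<ominus> w : lspace D" if zw: "z : ?L" "w : ?L" "f z = f w" for z w
 proof -
  have c: "z : carrier F" "w : carrier F" "f w : carrier F"
   using zw f[OF zw(2)] A(2) valring_carrier[OF vr] by (auto simp: lspace_def)
  have "t \<otimes> (z \<ominus> w) = (t \<otimes> z \<ominus> f z) \<ominus> (t \<otimes> w \<ominus> f w)"
   using c t(1) zw(3) by (simp add: minus_eq r_distr r_minus minus_add a_ac add_cancel)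
  hence "t \<otimes> (z \<ominus> w) : nonunits V" using nonunits_minus[OF vr] f zw by metis
  hence "z \<ominus> w : vset V (- D V)"
   using vset_scale[OF V t(1,2), of "z \<ominus> w" 1] c t(3) vset_1[OF V] by simp
  moreover have "z \<ominus> w : ?L" using asubD(5)[OF lspace_asub zw(1,2)] .
  ultimately show ?thesis by (auto simp: lspace_def split: if_splits)
 qed
 show ?thesis
  using card_le_fibres[OF lspace_asub A(1) fin, of "D(V := D V + 1)" f] f ker A(4) by auto
qed

lemma lspace_finite_mono:
 assumes S: "finite S" "S <= VR" and fin: "finite (lspace D)"
  and D: "!!V. V ~: S ==> D V = E V" "!!V. D V <= E V"
 shows "finite (lspace E) & card (lspace E) <= card K ^ (\<Sum>V\<in>S. nat (E V - D V) * degv V) * card (lspace D)"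
 using D
proof (induction "\<Sum>V\<in>S. nat (E V - D V)" arbitrary: E)
 case 0
 have "E V = D V" for V
 proof (cases "V : S")
  case True
  hence "nat (E V - D V) = 0" using 0(1) S(1) by (metis sum_eq_0_iff)
  thus ?thesis using 0(3)[of V] by simp
 qed (use 0(2) in simp)
 thus ?case using fin by simp
next
 case (Suc n)
 have "EX V:S. nat (E V - D V) ~= 0"
 proof (rule ccontr)
  assume "\<not> ?thesis"
  thus False using Suc.hyps(2) by simp
 qed
 then obtain V where V: "V : S" "D V < E V" by auto
 define E' where "E' = E(V := E V - 1)"
 have e: "E = E'(V := E' V + 1)" by (auto simp: E'_def)
 have VV: "V : VR" using V S by auto
 have V1: "nat (E V - D V) = Suc (nat (E' V - D V))" using V by (simp add: E'_def)
 have rest: "(\<Sum>U\<in>S - {V}. g (nat (E U - D U)) U) = (\<Sum>U\<in>S - {V}. g (nat (E' U - D U)) U)" for g :: "nat => 'a set => nat"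
  by (rule sum.cong) (auto simp: E'_def)
 have n: "n = (\<Sum>U\<in>S. nat (E' U - D U))" using sum.remove[OF S(1) V(1), of "%U. nat (E U - D U)"] sum.remove[OF S(1) V(1), of "%U. nat (E' U - D U)"]
   rest[of "%a U. a"] V1 using Suc by simp
 have c: "!!U. U ~: S ==> D U = E' U" "!!U. D U <= E' U" using Suc.prems V by (auto simp: E'_def)
 have IH: "finite (lspace E')" "card (lspace E') <= card K ^ (\<Sum>V\<in>S. nat (E' V - D V) * degv V) * card (lspace D)"
  using Suc.hyps(1)[OF n c] by blast+
 have w: "(\<Sum>U\<in>S. nat (E U - D U) * degv U) = degv V + (\<Sum>U\<in>S. nat (E' U - D U) * degv U)"
  using sum.remove[OF S(1) V(1), of "%U. nat (E U - D U) * degv U"]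
   sum.remove[OF S(1) V(1), of "%U. nat (E' U - D U) * degv U"] rest[of "%a U. a * degv U"] V1 by simp
 have st: "finite (lspace E) & card (lspace E) <= card K ^ degv V * card (lspace E')"
  using lspace_step[OF VV IH(1)] unfolding e[symmetric] .
 have "card K ^ degv V * card (lspace E') <= card K ^ degv V * (card K ^ (\<Sum>V\<in>S. nat (E' V - D V) * degv V) * card (lspace D))"
  using IH(2) by simp
 from order_trans[OF conjunct2[OF st] this] show ?case
  using st unfolding w power_add mult.assoc by blast
qed

lemma lspace_zero: "lspace (%_. 0) = K"
proof
 show "lspace (%_. 0) <= K" using integral_everywhere_constant vset_0 by (auto simp: lspace_def)
 show "K <= lspace (%_. 0)" using vr_K vset_0 by (auto simp: lspace_def)
qed

lemma ldim_zero: "ldim (%_. 0) = 1"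
proof -
 have "card K ^ ldim (%_. 0) = card K ^ 1" using card_lspace[of "%_. 0"] lspace_zero finite_constants by simp
 thus ?thesis using card_K_gt_1 power_inject_exp by metis
qed

lemma lspace_finite:
 assumes "finite (divsupp D)"
 shows "finite (lspace D)"
proof -
 define E where "E = (%V. if V : divsupp D then max 0 (D V) else 0)"
 have "finite (lspace E)"
  using lspace_finite_mono[OF assms divsupp_subset, of "%_. 0" E] lspace_zero finite_constants by (auto simp: E_def)
 moreover have "lspace D <= lspace E" by (rule lspace_mono) (auto simp: E_def divsupp_def)
 ultimately show ?thesis using finite_subset by blast
qed

lemma ldim_le_add_divdeg:
 assumes D: "finite (divsupp D)" "finite (divsupp E)" "!!V. V : VR ==> D V <= E V"
 shows "int (ldim E) <= int (ldim D) + (divdeg E - divdeg D)" "ldim D <= ldim E"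
proof -
 define S where "S = divsupp D \<union> divsupp E"
 have S: "finite S" "divsupp D <= S" "divsupp E <= S" "S <= VR"
  using assms(1,2) by (simp add: S_def) (auto simp: S_def divsupp_def)
 \<comment> \<open>\<open>lspace_finite_mono\<close> compares functions on all sets, so the values
   off \<open>S\<close> are set to zero.\<close>
 define D' where "D' = (%V. if V : S then D V else 0)"
 define E' where "E' = (%V. if V : S then E V else 0)"
 have L: "lspace D' = lspace D" "lspace E' = lspace E"
  using S by (auto intro!: lspace_cong simp: D'_def E'_def divsupp_def)
 have fin: "finite (lspace D)" "finite (lspace E)" using lspace_finite D by auto
 have c: "!!U. U ~: S ==> D' U = E' U" "!!U. D' U <= E' U" using S(4) D(3) by (auto simp: D'_def E'_def)
 have le: "card (lspace E) <= card K ^ (\<Sum>V\<in>S. nat (E' V - D' V) * degv V) * card (lspace D)"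
  using lspace_finite_mono[of S D' E', OF S(1,4) _ c, unfolded L] fin by blast
 have "int (\<Sum>V\<in>S. nat (E' V - D' V) * degv V) = (\<Sum>V\<in>S. (E V - D V) * int (degv V))"
  unfolding of_nat_sum by (rule sum.cong) (use D(3) S(4) in \<open>auto simp: D'_def E'_def\<close>)
 also have "\<dots> = divdeg E - divdeg D"
  unfolding divdeg_sum[OF S(1,2,4)] divdeg_sum[OF S(1,3,4)] by (simp add: algebra_simps sum_subtractf)
 finally have s: "int (\<Sum>V\<in>S. nat (E' V - D' V) * degv V) = divdeg E - divdeg D" .
 have "card K ^ ldim E <= card K ^ ((\<Sum>V\<in>S. nat (E' V - D' V) * degv V) + ldim D)"
  using le unfolding card_lspace[OF fin(1)] card_lspace[OF fin(2)] power_add .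
 hence "ldim E <= (\<Sum>V\<in>S. nat (E' V - D' V) * degv V) + ldim D" using card_K_gt_1 by simp
 thus "int (ldim E) <= int (ldim D) + (divdeg E - divdeg D)" using s by linarith
 have "card (lspace D) <= card (lspace E)" by (rule card_mono[OF fin(2) lspace_mono[OF D(3)]])
 thus "ldim D <= ldim E" unfolding card_lspace[OF fin(1)] card_lspace[OF fin(2)]
  using card_K_gt_1 by (simp only: power_increasing_iff)
qed

lemma ldim_bound:
 assumes "finite (divsupp D)" "!!V. V : VR ==> 0 <= D V"
 shows "int (ldim D) <= divdeg D + 1"
 using ldim_le_add_divdeg(1)[of "%_. 0" D] assms ldim_zero by (simp add: divsupp_def divdeg_def)

definition poles :: "'a => 'a set => int" where
 "poles x V = max 0 (- valn V x)"

lemma poles_pos: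
 assumes "V : VR" "x : carrier F" "x ~= \<zero>"
 shows "poles x V > 0 \<longleftrightarrow> x ~: V" "x : V ==> poles x V = 0" "x ~: V ==> poles x V = - valn V x"
 using valn_ge_0[OF assms] by (auto simp: poles_def)

lemma inv_nonconstant: "x : carrier F ==> x ~: K ==> inv x : carrier F & inv x ~: K & x ~= \<zero>"
proof -
 assume x: "x : carrier F" "x ~: K"
 hence xz: "x ~= \<zero>" using K_carrier by auto
 thus "inv x : carrier F & inv x ~: K & x ~= \<zero>" using K_inv[of "inv x"] inv_nz[OF x(1) xz] x(2) by auto
qed

lemma divsupp_poles:
 assumes x: "x : carrier F" "x ~: K"
 shows "finite (divsupp (poles x))"
proof -
 have xz: "x ~= \<zero>" using x K_carrier by auto
 have "divsupp (poles x) <= {V : VR. inv x : nonunits V}"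
  using poles_pos(2)[OF _ x(1) xz] valring_inv[OF vr _ ] x(1) by (auto simp: divsupp_def)
 thus ?thesis using finite_zeros inv_nonconstant[OF x] finite_subset by blast
qed

text \<open>With \<open>p\<close> the leading coefficient of a relation for \<open>a\<close> over
  K[y], the product \<open>p a\<close> satisfies a monic relation, and valuation rings are
  integrally closed.\<close>

lemma clear_denominator:
 assumes y: "y : carrier F" "y ~: K" and a: "a : carrier F"
 shows "EX p:adjoin K y. p ~= \<zero> & (ALL V:VR. y : V --> p \<otimes> a : V)"
proof -
 obtain k j p where p: "p : ladder K y k" "p ~= \<zero>" "p \<otimes> a [^] (j::nat) : ladder (ladder K y k) a j"
  using algebraic_relation[OF y a] by blast
 have Lc: "ladder K y k <= carrier F" by (rule ladder_carrier[OF K_carrier(1) y(1)])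
 have pc: "p : carrier F" using p Lc by auto
 have "p \<otimes> a : V" if V: "V : VR" "y : V" for V
 proof -
  note vr = vr[OF V(1)]
  have LV: "ladder K y k <= V" by (rule ladder_subring[OF valring_subring[OF vr] vr_K[OF V(1)] V(2)])
  hence pV: "p : V" using p by auto
  have zc: "p \<otimes> a : carrier F" using pc a by simp
  have *: "p [^] m \<otimes> f : ladder V (p \<otimes> a) i" if "f : ladder (ladder K y k) a i" "i <= Suc m" for f i and m :: nat
   using that
  proof (induction i arbitrary: f m)
   case 0 thus ?case using pc by simp
  next
   case (Suc i)
   then obtain c g where cg: "f = c \<oplus> a \<otimes> g" "c : ladder K y k" "g : ladder (ladder K y k) a i" by (meson ladder_SucE)
   have cl: "c : carrier F" "g : carrier F" using cg Lc subsetD[OF ladder_carrier[OF Lc a]] by auto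
   have pcV: "p [^] m \<otimes> c : V" using valring_mult[OF vr valring_pow[OF vr pV]] cg LV by auto
   show ?case
   proof (cases m)
    case 0
    hence "i = 0" using Suc by simp
    show ?thesis using cg pc a cl using ladder_SucI[OF pcV, of \<zero> "p \<otimes> a" i] \<open>i = 0\<close> by simp
   next
    case (Suc l)
    show ?thesis using cg pc a cl using ladder_SucI[OF pcV Suc.IH[OF cg(3), of l]] Suc Suc.prems(2) by (simp add: r_distr m_ac)
   qed
  qed
  obtain m where m: "j = Suc m" using p(3) p(2) pc by (cases j) auto
  have "(p \<otimes> a) [^] j = p [^] m \<otimes> (p \<otimes> a [^] j)"
   using pc a m by (simp add: nat_pow_distrib m_ac)
  also have "\<dots> : ladder V (p \<otimes> a) j" using *[OF p(3), of m] m by simp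
  finally show ?thesis by (rule valring_integral[OF vr zc])
 qed
 moreover have "p : adjoin K y" using p(1) by (auto simp only: adjoin_def)
 ultimately show ?thesis using p(2) by blast
qed

lemma clear_denominators:
 assumes y: "y : carrier F" "y ~: K" and A: "finite A" "A <= carrier F"
 shows "EX p:adjoin K y. p ~= \<zero> & (ALL a:A. ALL V:VR. y : V --> p \<otimes> a : V)"
 using A
proof (induction A)
 note AD = adjoin_subring[OF K_subring y(1)]
 case empty thus ?case using subringE(3)[OF AD(1)] one_not_zero by blast
next
 case (insert a A)
 note AD = adjoin_subring[OF K_subring y(1)]
 obtain p where p: "p : adjoin K y" "p ~= \<zero>" "ALL a:A. ALL V:VR. y : V --> p \<otimes> a : V" using insert by auto
 obtain r where r: "r : adjoin K y" "r ~= \<zero>" "ALL V:VR. y : V --> r \<otimes> a : V"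
  using clear_denominator[OF y, of a] insert.prems by blast
 have c: "p : carrier F" "r : carrier F" using p r subringE(1)[OF AD(1)] by auto
 have "(p \<otimes> r) \<otimes> b : V" if "b : insert a A" "V : VR" "y : V" for b V
 proof -
  have bc: "b : carrier F" using that insert by auto
  have pr: "p : V" "r : V" using adjoin_min[OF valring_subring[OF vr[OF that(2)]] vr_K[OF that(2)] that(3)] using p r by auto
  have "(p \<otimes> r) \<otimes> b = p \<otimes> (r \<otimes> b)" "(p \<otimes> r) \<otimes> b = r \<otimes> (p \<otimes> b)" using c bc by (simp_all add: m_ac)
  thus ?thesis using valring_mult[OF vr[OF that(2)]] pr p(3) r(3) that by (metis insertE)
 qed
 moreover have "p \<otimes> r : adjoin K y" "p \<otimes> r ~= \<zero>" using subringE(6)[OF AD(1)] p r c by (auto simp: integral_iff)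
 ultimately show ?case by blast
qed

text \<open>The Chinese remainder set at the zeros of \<open>x\<close>, multiplied by a polynomial
  in \<open>x\<close> that removes all poles away from those of \<open>x\<close>. Scaling preserves
  the independence in base \<open>x\<close>; \<open>poles (inv x)\<close> is the divisor of zeros of
  \<open>x\<close>.\<close>

lemma independent_integral_elements:
 assumes x: "x : carrier F" "x ~: K"
 shows "EX A. asub A & finite A & (ALL a:A. ALL V:VR. x : V --> a : V) &
  (ALL k. card (ladder A x k) = card A ^ k) & int (card A) = int (card K) ^ nat (divdeg (poles (inv x)))"
proof -
 have xz: "x ~= \<zero>" using inv_nonconstant[OF x] by blast
 define S where "S = {V : VR. x : nonunits V}"
 have S: "finite S" "S <= VR" "!!V. V : S ==> x : V"
  using finite_zeros[OF x] nonunits_subset[OF vr] by (auto simp: S_def)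
 obtain A where A: "asub A" "finite A" "ALL V:S. A <= V"
  "ALL a:A. (ALL V:S. a : vset V (valn V x)) --> a = \<zero>"
  "card A = card K ^ (\<Sum>V\<in>S. degv V * nat (valn V x))"
  using independent_modulo[OF x(1) xz S] by blast
 have Ac: "A <= carrier F" using asubD(1)[OF A(1)] .
 obtain p where p: "p : adjoin K x" "p ~= \<zero>" "ALL a:A. ALL V:VR. x : V --> p \<otimes> a : V"
  using clear_denominators[OF x A(2) Ac] by blast
 have pc: "p : carrier F" using p(1) subringE(1)[OF adjoin_subring(1)[OF K_subring x(1)]] by blast
 define B where "B = (\<otimes>) p ` A"
 define R where "R = {z : carrier F. ALL V:S. z : V}"
 have sR: "subring R F"
 proof (rule subringI)
  fix a b assume "a : R" "b : R"
  thus "a \<otimes> b : R" "a \<oplus> b : R"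
   using valring_mult[OF vr] valring_add[OF vr] S(2) by (auto simp: R_def)
 qed (use S(2) valring_one[OF vr] valring_neg[OF vr] in \<open>auto simp: R_def\<close>)
 have cardA: "card (ladder A x k) = card A ^ k" for k
 proof (rule ladder_card_eq[OF sR A(1) _ A(2) _ xz])
  show "A <= R" using A(3) Ac by (auto simp: R_def)
  show "x : R" using x S(3) by (auto simp: R_def)
  fix a b assume ab: "a : A" "b : R" "a = x \<otimes> b"
  have "a : vset V (valn V x)" if V: "V : S" for V
   using vset_scale[OF _ x(1) xz, of V b "valn V x"] vset_0[of V] ab V S(2) by (auto simp: R_def)
  thus "a = \<zero>" using A(4) ab(1) by blast
 qed
 have "ladder B x k = (\<otimes>) p ` ladder A x k" for k
 proof
  show "(\<otimes>) p ` ladder A x k <= ladder B x k"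
   using ladder_scale[of A p x B] Ac pc x(1) by (auto simp: B_def)
  show "ladder B x k <= (\<otimes>) p ` ladder A x k"
  proof (induction k)
   case 0 thus ?case using pc by simp
  next
   case (Suc k)
   show ?case
   proof
    fix f assume "f : ladder B x (Suc k)"
    then obtain b g where bg: "f = b \<oplus> x \<otimes> g" "b : B" "g : ladder B x k" by (meson ladder_SucE)
    obtain a h where ah: "a : A" "b = p \<otimes> a" "h : ladder A x k" "g = p \<otimes> h" using bg Suc by (auto simp: B_def)
    have "f = p \<otimes> (a \<oplus> x \<otimes> h)"
     using ah bg pc x(1) subsetD[OF Ac ah(1)] subsetD[OF ladder_carrier[OF Ac x(1)] ah(3)] by (simp add: r_distr m_lcomm)
    thus "f : (\<otimes>) p ` ladder A x (Suc k)" using ladder_SucI[OF ah(1,3)] by blast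
   qed
  qed
 qed
 hence cB: "card (ladder B x k) = card A ^ k" for k
  using card_scale[OF pc p(2) ladder_carrier[OF Ac x(1)]] cardA by simp
 have cardB: "card B = card A" unfolding B_def by (rule card_scale[OF pc p(2) Ac])
 have asub: "asub B"
 proof (rule asubI)
  show "B <= carrier F" using pc Ac by (auto simp: B_def)
  show "\<zero> : B" using pc using asubD(2)[OF A(1)] unfolding B_def by force
  fix z w assume "z : B" "w : B"
  then obtain a b where ab: "a : A" "b : A" "z = p \<otimes> a" "w = p \<otimes> b" by (auto simp: B_def)
  have "z \<ominus> w = p \<otimes> (a \<ominus> b)" using ab pc subsetD[OF Ac] by (simp add: minus_eq r_distr r_minus)
  thus "z \<ominus> w : B" using asubD(5)[OF A(1) ab(1,2)] by (simp add: B_def)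
 qed
 have eqS: "divsupp (poles (inv x)) <= S"
  using poles_pos(2)[of _ "inv x"] inv_nz[OF x(1) xz] valring_inv[OF vr, of _ "inv x"]
  by (fastforce simp: divsupp_def S_def)
 have pd: "poles (inv x) V = int (nat (valn V x))" if "V : S" for V
  using valn_inv[OF subsetD[OF S(2) that] x(1) xz] by (auto simp: poles_def)
 have deg: "divdeg (poles (inv x)) = int (\<Sum>V\<in>S. degv V * nat (valn V x))"
  unfolding divdeg_sum[OF S(1) eqS S(2)] of_nat_sum by (rule sum.cong) (use pd in \<open>auto simp: mult.commute\<close>)
 have "int (card B) = int (card K) ^ nat (divdeg (poles (inv x)))"
  unfolding cardB A(5) deg nat_int of_nat_power by (rule refl)
 moreover have "finite B" using A(2) by (simp add: B_def)
 ultimately show ?thesis using asub cB cardB p(3) by (intro exI[of _ B]) (auto simp: B_def)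
qed

lemma divdeg_pole_nonneg: "divdeg (poles x) >= 0"
 unfolding divdeg_def by (rule sum_nonneg) (auto simp: poles_def)

lemma poles_mult_mem:
 assumes V: "V : VR" and x: "x : carrier F" "x ~= \<zero>" and a: "a : vset V (- (c * poles x V))"
 shows "x \<otimes> a : vset V (- ((c + 1) * poles x V))"
proof -
 have "x : vset V (- poles x V)" using x by (simp add: vset_def[OF V] poles_def)
 from vset_mult[OF V this a] show ?thesis by (simp add: algebra_simps)
qed

text \<open>Expressions with \<open>k\<close> digits in base \<open>x\<close> have poles only at
  those of \<open>x\<close>, of order at most \<open>c + k\<close> times that of \<open>x\<close>.
  Counting them bounds the dimension from below by \<open>k\<close> times the degree of the
  zeros.\<close>

lemma ldim_pole_growth:
 assumes x: "x : carrier F" "x ~: K"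
 shows "EX c. ALL k. int k * divdeg (poles (inv x)) <= int (ldim (%V. int (c + k) * poles x V))"
proof -
 have xz: "x ~= \<zero>" using inv_nonconstant[OF x] by blast
 obtain A where A: "asub A" "finite A" "ALL a:A. ALL V:VR. x : V --> a : V"
  "ALL k. card (ladder A x k) = card A ^ k" "int (card A) = int (card K) ^ nat (divdeg (poles (inv x)))"
  using independent_integral_elements[OF x] by blast
 have Ac: "A <= carrier F" using asubD(1)[OF A(1)] .
 define S where "S = divsupp (poles x)"
 have S: "finite S" "S <= VR" unfolding S_def using divsupp_poles[OF x] divsupp_subset by auto
 obtain c where c: "ALL U:S. ALL b:A. b : vset U (- int c)" using vset_bounded_below[OF S A(2) Ac] by blast
 have Ain: "a : vset V (- (int c * poles x V))" if a: "a : A" and V: "V : VR" for a V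
 proof (cases "V : S")
  case True
  have "poles x V >= 1" using True by (auto simp: S_def divsupp_def poles_def)
  hence "int c * 1 <= int c * poles x V" by (intro mult_left_mono) simp_all
  thus ?thesis using subsetD[OF vset_antimono[OF V, of "- (int c * poles x V)" "- int c"]] c True a by simp
 next
  case False
  hence 0: "poles x V = 0" using V by (simp add: S_def divsupp_def)
  show ?thesis using poles_pos(1)[OF V x(1) xz] using A(3) a V vset_0[OF V] 0 by simp
 qed
 have sub: "ladder A x k <= lspace (%V. int (c + k) * poles x V)" for k
 proof
  fix f assume f: "f : ladder A x k"
  have "f : vset V (- (int (c + k) * poles x V))" if V: "V : VR" for V
   using f
  proof (induction k arbitrary: f)
   case 0 thus ?case using asubD(2)[OF vset_asub[OF V]] by simp
  next
   case (Suc k)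
   then obtain a b where ab: "f = a \<oplus> x \<otimes> b" "a : A" "b : ladder A x k" by (meson ladder_SucE)
   have pp: "poles x V >= 0" by (simp add: poles_def)
   have "x \<otimes> b : vset V (- ((int (c + k) + 1) * poles x V))"
    by (rule poles_mult_mem[OF V x(1) xz Suc.IH[OF ab(3)]])
   moreover have "int c * poles x V <= (int (c + k) + 1) * poles x V" using pp by (intro mult_right_mono) auto
   hence "a : vset V (- ((int (c + k) + 1) * poles x V))"
    using subsetD[OF vset_antimono[OF V] Ain[OF ab(2) V]] by simp
   ultimately show ?case using asubD(6)[OF vset_asub[OF V]] ab(1) by (simp add: algebra_simps)
  qed
  thus "f : lspace (%V. int (c + k) * poles x V)"
   using f subsetD[OF ladder_carrier[OF Ac x(1)]] by (simp add: lspace_def)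
 qed
 have "int k * divdeg (poles (inv x)) <= int (ldim (%V. int (c + k) * poles x V))" for k
 proof -
  let ?D = "%V. int (c + k) * poles x V"
  have fin: "finite (lspace ?D)" by (rule lspace_finite[OF divdeg_scale(2)[OF divsupp_poles[OF x]]])
  have cA: "card A = card K ^ nat (divdeg (poles (inv x)))" using A(5) by simp
  have "nat (divdeg (poles (inv x))) * k <= ldim ?D" using card_mono[OF fin sub] A(4) card_lspace[OF fin]
   unfolding cA power_mult[symmetric] using card_K_gt_1 by (simp only: power_increasing_iff)
  hence "int (nat (divdeg (poles (inv x))) * k) <= int (ldim ?D)" by linarith
  thus ?thesis using divdeg_pole_nonneg[of "inv x"] by (simp add: mult.commute)
 qed
 thus ?thesis by blast
qed

text \<open>The lower bound \<open>k\<close> times the degree of zeros meets the upper bound degree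
  plus one for \<open>(c + k)\<close> times the divisor of poles.\<close>

lemma zeros_le_poles:
 assumes x: "x : carrier F" "x ~: K"
 shows "divdeg (poles (inv x)) <= divdeg (poles x)"
proof (rule ccontr)
 assume "\<not> ?thesis"
 hence lt: "divdeg (poles x) + 1 <= divdeg (poles (inv x))" by simp
 obtain c where c: "!!k. int k * divdeg (poles (inv x)) <= int (ldim (%V. int (c + k) * poles x V))"
  using ldim_pole_growth[OF x] by blast
 define d where "d = divdeg (poles x)"
 \<comment> \<open>If there were more zeros than poles, the two bounds would give
   \<open>k <= c d + 1\<close>.\<close>
 define k where "k = nat (int c * d + 2)"
 have d0: "d >= 0" using divdeg_pole_nonneg by (simp add: d_def)
 have k: "int k = int c * d + 2" using d0 by (simp add: k_def)
 have "int (ldim (%V. int (c + k) * poles x V)) <= divdeg (%V. int (c + k) * poles x V) + 1"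
  by (rule ldim_bound[OF divdeg_scale(2)[OF divsupp_poles[OF x]]]) (simp add: poles_def)
 also have "divdeg (%V. int (c + k) * poles x V) = int (c + k) * d"
  unfolding d_def by (rule divdeg_scale(1)[OF divsupp_poles[OF x]])
 finally have "int k * divdeg (poles (inv x)) <= int (c + k) * d + 1" using c[of k] by simp
 moreover have "int k * (d + 1) <= int k * divdeg (poles (inv x))" using lt by (intro mult_left_mono) (auto simp: d_def)
 ultimately show False using k by (simp add: algebra_simps)
qed

theorem zeros_eq_poles:
 assumes x: "x : carrier F" "x ~: K"
 shows "divdeg (poles (inv x)) = divdeg (poles x)"
 using zeros_le_poles[OF x] zeros_le_poles[of "inv x"] inv_nonconstant[OF x] inv_nz[of x] x(1) by simp

lemma divdeg_principal:
 assumes z: "z : carrier F" "z ~= \<zero>"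
 shows "divdeg (%V. valn V z) = 0" "finite (divsupp (%V. valn V z))"
proof -
 have "divdeg (%V. valn V z) = 0 & finite (divsupp (%V. valn V z))"
 proof (cases "z : K")
  case True
  hence "divsupp (%V. valn V z) = {}" using valn_const z by (auto simp: divsupp_def)
  thus ?thesis by (simp add: divdeg_def)
 next
  case False
  note iz = inv_nonconstant[OF z(1) False]
  note s1 = divsupp_poles[of "inv z"] and s2 = divsupp_poles[OF z(1) False]
  have f1: "finite (divsupp (poles (inv z)))" using s1 iz by blast
  have f2: "finite (divsupp (%V. (-1) * poles z V))" by (rule divdeg_scale(2)[OF s2])
  have eq: "valn V z = poles (inv z) V + (-1) * poles z V" if "V : VR" for V
   using valn_inv[OF that z] by (auto simp: poles_def)
  have "divsupp (%V. valn V z) = divsupp (%V. poles (inv z) V + (-1) * poles z V)"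
   using eq by (auto simp: divsupp_def)
  moreover from this have "divdeg (%V. valn V z) = divdeg (%V. poles (inv z) V + (-1) * poles z V)"
   unfolding divdeg_def using eq by (intro sum.cong) (auto simp: divsupp_def)
  moreover have "\<dots> = divdeg (poles (inv z)) + (-1) * divdeg (poles z)"
   using divdeg_add(1)[OF f1 f2] divdeg_scale(1)[OF s2, of "-1"] by simp
  ultimately show ?thesis using zeros_eq_poles[OF z(1) False] divdeg_add(2)[OF f1 f2] by simp
 qed
 thus "divdeg (%V. valn V z) = 0" "finite (divsupp (%V. valn V z))" by auto
qed

lemma ldim_add_principal:
 assumes z: "z : carrier F" "z ~= \<zero>" and D: "finite (divsupp D)"
 shows "ldim (%V. D V + valn V z) = ldim D"
proof -
 note iz = inv_nz[OF z]
 let ?E = "%V. D V + valn V z"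
 have "lspace D = (\<otimes>) z ` lspace ?E"
 proof
  show "(\<otimes>) z ` lspace ?E <= lspace D"
   using vset_scale[OF _ z] z by (fastforce simp: lspace_def algebra_simps)
  show "lspace D <= (\<otimes>) z ` lspace ?E"
  proof
   fix w assume w: "w : lspace D"
   have wc: "w : carrier F" using w by (simp add: lspace_def)
   have eq: "w = z \<otimes> (inv z \<otimes> w)" using iz z wc by (simp flip: m_assoc)
   have "inv z \<otimes> w : vset V (- (D V + valn V z))" if V: "V : VR" for V
   proof -
    show ?thesis using w V eq using vset_scale[OF V z, of "inv z \<otimes> w" "- D V"] iz by (simp add: lspace_def)
   qed
   hence "inv z \<otimes> w : lspace ?E" using iz wc by (simp add: lspace_def)
   thus "w : (\<otimes>) z ` lspace ?E" using eq by blast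
  qed
 qed
 hence "card (lspace D) = card (lspace ?E)" using card_scale[OF z] by (simp add: lspace_def)
 hence "card K ^ ldim D = card K ^ ldim ?E" using card_lspace lspace_finite D divdeg_add(2)[OF D divdeg_principal(2)[OF z]] by simp
 thus ?thesis using card_K_gt_1 power_inject_exp by metis
qed

text \<open>Either \<open>x\<close> itself, or \<open>x^e - 1\<close> with \<open>e\<close> provided
  by the finiteness of the residue field.\<close>

lemma polynomial_vanishing_at:
 assumes x: "x : carrier F" "x ~: K" and V: "V : VR" "x : V"
 shows "EX H:adjoin K x. H ~= \<zero> & H : nonunits V"
proof (cases "x : nonunits V")
 case True
 thus ?thesis using adjoin_subring(3)[OF K_subring x(1)] inv_nonconstant[OF x] by blast
next
 case False
 note AD = adjoin_subring[OF K_subring x(1)]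
 obtain e where e: "e > 0" "ALL k. x [^] (e * k :: nat) \<ominus> \<one> : nonunits V" using unit_power_residue_one[OF V(1)] V False by blast
 define H where "H = x [^] e \<ominus> \<one>"
 have pw: "x [^] (n::nat) : adjoin K x" for n
  by (induction n) (use subringE(3,6)[OF AD(1)] AD(3) in auto)
 have "H : adjoin K x" unfolding H_def minus_eq using subringE(3,5,7)[OF AD(1)] pw by blast
 moreover have "H : nonunits V" using e(2)[rule_format, of 1] by (simp add: H_def)
 moreover have "H ~= \<zero>"
 proof
  assume "H = \<zero>"
  hence 1: "x [^] e = \<one>" using asub_diff_zero[of "x [^] e" \<one>] x(1) unfolding H_def by blast
  obtain n where "e = Suc n" using e(1) by (cases e) auto
  hence "\<one> = x \<otimes> x [^] n" using 1 x(1) by (simp add: m_comm)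
  thus False using nonconstant_ladder[OF x K_carrier(3) pw] one_not_zero by blast
 qed
 ultimately show ?thesis by blast
qed

lemma polynomial_dominating:
 assumes x: "x : carrier F" "x ~: K" and S: "finite S" "S <= {V : VR. x : V}"
 shows "EX H:adjoin K x. H ~= \<zero> & (ALL V:S. int n <= valn V H)"
 using S
proof (induction S)
 note AD = adjoin_subring[OF K_subring x(1)]
 case empty thus ?case using subringE(3)[OF AD(1)] one_not_zero by blast
next
 note AD = adjoin_subring[OF K_subring x(1)]
 case (insert V S)
 obtain H where H: "H : adjoin K x" "H ~= \<zero>" "ALL V:S. int n <= valn V H" using insert by auto
 have V: "V : VR" "x : V" using insert by auto
 obtain G where G: "G : adjoin K x" "G ~= \<zero>" "G : nonunits V" using polynomial_vanishing_at[OF x V] by blast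
 have c: "H : carrier F" "G : carrier F" using H G subringE(1)[OF AD(1)] by auto
 have pw: "G [^] n : adjoin K x" by (induction n) (use subringE(3,6)[OF AD(1)] G(1) in auto)
 note pz = nat_pow_closed[OF c(2), of n] pow_nz[OF c(2) G(2), of n]
 have int_at: "z : U" if "z : adjoin K x" "U : VR" "x : U" for z U
  using adjoin_min[OF valring_subring[OF vr[OF that(2)]] vr_K[OF that(2)] that(3)] that(1) by blast
 have v: "valn U (H \<otimes> G [^] n) = valn U H + int n * valn U G" if "U : VR" for U
  using valn_mult[OF that c(1) H(2) pz] valn_pow[OF that c(2) G(2)] by simp
 have "int n <= valn U (H \<otimes> G [^] n)" if U: "U : insert V S" for U
 proof -
  have U': "U : VR" "x : U" using U insert by auto
  have g: "valn U H >= 0" "valn U G >= 0"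
   using valn_ge_0[OF U'(1) c(1) H(2)] valn_ge_0[OF U'(1) c(2) G(2)] int_at[OF H(1) U'] int_at[OF G(1) U'] by auto
  show ?thesis
  proof (cases "U = V")
   case True
   have "int n * 1 <= int n * valn V G" using valn_gt_0[OF V(1) c(2) G(2)] G(3) by (intro mult_left_mono) simp_all
   thus ?thesis using v[OF U'(1)] g True by simp
  next
   case False
   hence "int n <= valn U H" using U H(3) by auto
   moreover have "int n * valn U G >= 0" using g by simp
   ultimately show ?thesis using v[OF U'(1)] by simp
  qed
 qed
 moreover have "H \<otimes> G [^] n : adjoin K x" "H \<otimes> G [^] n ~= \<zero>"
  using subringE(6)[OF AD(1) H(1) pw] H(2) c pz by (auto simp: integral_iff)
 ultimately show ?case by blast
qed

text \<open>A polynomial \<open>H\<close> in \<open>x\<close> that vanishes strongly at the support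
  of \<open>D\<close> away from the poles of \<open>x\<close> makes \<open>D\<close> at most
  \<open>j (x)_inf + (H)\<close> for large \<open>j\<close>. The difference of degree and dimension
  grows with the divisor and ignores principal divisors.\<close>

lemma defect_le_pole_multiple:
 assumes x: "x : carrier F" "x ~: K" and D: "finite (divsupp D)"
 shows "EX k. ALL j>=k. divdeg D - int (ldim D) <= int j * divdeg (poles x) - int (ldim (%V. int j * poles x V))"
proof -
 note ix = inv_nonconstant[OF x]
 have xz: "x ~= \<zero>" using ix by blast
 note px = divsupp_poles[OF x]
 define S where "S = {V : divsupp D. x : V}"
 have S: "finite S" "S <= {V : VR. x : V}" using D divsupp_subset by (auto simp: S_def)
 define n where "n = (\<Sum>V\<in>divsupp D. nat \<bar>D V\<bar>)"
 have Dn: "D V <= int n" if "V : divsupp D" for V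
 proof -
  have "nat \<bar>D V\<bar> <= n" unfolding n_def using D that by (intro member_le_sum) auto
  thus ?thesis by simp
 qed
 obtain H where H: "H : adjoin K x" "H ~= \<zero>" "ALL V:S. int n <= valn V H" using polynomial_dominating[OF x S] by blast
 have Hc: "H : carrier F" using H(1) subringE(1)[OF adjoin_subring(1)[OF K_subring x(1)]] by blast
 define P where "P = divsupp (poles x)"
 have P: "finite P" "P <= VR" using px divsupp_subset by (auto simp: P_def)
 \<comment> \<open>At a pole of \<open>x\<close>, of order at least one, \<open>k\<close> copies
   outweigh the gap between \<open>D\<close> and the divisor of \<open>H\<close>.\<close>
 define k where "k = (\<Sum>V\<in>P. nat \<bar>D V - valn V H\<bar>)"
 have "divdeg D - int (ldim D) <= int j * divdeg (poles x) - int (ldim (%V. int j * poles x V))"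
  if j: "j >= k" for j
 proof -
  let ?X = "%V. int j * poles x V"
  let ?E = "%V. ?X V + valn V H"
  note fX = divdeg_scale[OF px, of "int j"]
  note pH = divdeg_principal[OF Hc H(2)]
  have le: "D V <= ?E V" if V: "V : VR" for V
  proof (cases "x : V")
   case True
   have HV: "valn V H >= 0"
    using valn_ge_0[OF V Hc H(2)] adjoin_min[OF valring_subring[OF vr[OF V]] vr_K[OF V] True] H(1) by blast
   show ?thesis using HV H(3) Dn True V using poles_pos(2)[OF V x(1) xz True] by (cases "V : divsupp D") (force simp: S_def, simp add: divsupp_def)
  next
   case False
   hence p1: "poles x V >= 1" using poles_pos(1)[OF V x(1) xz] by simp
   hence "V : P" using V by (simp add: P_def divsupp_def)
   hence "nat \<bar>D V - valn V H\<bar> <= k" unfolding k_def using P(1) by (intro member_le_sum) auto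
   hence "D V - valn V H <= int j" using j by simp
   also have "int j * 1 <= int j * poles x V" using p1 by (intro mult_left_mono) simp_all
   finally show ?thesis by simp
  qed
  have "int (ldim ?E) <= int (ldim D) + (divdeg ?E - divdeg D)"
   by (rule ldim_le_add_divdeg(1)[OF D divdeg_add(2)[OF fX(2) pH(2)] le])
  thus ?thesis using divdeg_add(1)[OF fX(2) pH(2)] fX(1) pH(1) ldim_add_principal[OF Hc H(2) fX(2)] by simp
 qed
 thus ?thesis by blast
qed

lemma exists_nonconstant: obtains x where "x : carrier F" "x ~: K"
 using finite_over_rational_function_field transcendental_nonconstant by metis

lemma defect_bounded: "EX B. ALL D. finite (divsupp D) --> divdeg D - int (ldim D) <= B"
proof -
 obtain x where x: "x : carrier F" "x ~: K" by (rule exists_nonconstant)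
 define d where "d = divdeg (poles x)"
 obtain c where c: "!!k. int k * d <= int (ldim (%V. int (c + k) * poles x V))"
  using ldim_pole_growth[OF x] zeros_eq_poles[OF x] by (auto simp: d_def)
 have "divdeg D - int (ldim D) <= int c * d" if D: "finite (divsupp D)" for D
 proof -
  obtain k where k: "!!j. j >= k ==> divdeg D - int (ldim D) <= int j * d - int (ldim (%V. int j * poles x V))"
   using defect_le_pole_multiple[OF x D] unfolding d_def by blast
  have "divdeg D - int (ldim D) <= int (c + k) * d - int (ldim (%V. int (c + k) * poles x V))" by (rule k) simp
  thus ?thesis using c[of k] by (simp add: algebra_simps)
 qed
 thus ?thesis by blast
qed

section \<open>The genus and Riemann's theorem\<close>

definition of_divisor :: "('a set \<Rightarrow>\<^sub>0 int) => 'a set => int" where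
 "of_divisor D V = Poly_Mapping.lookup D (nonunits V)"

lemma of_divisor:
 assumes D: "D : carrier (divisor_group F K)"
 shows "finite (divsupp (of_divisor D))" "divisor_degree F K D = divdeg (of_divisor D)"
  "riemann_roch_space F K D = lspace (of_divisor D)"
proof -
 have keys: "Poly_Mapping.keys D <= nonunits ` VR"
  using D unfolding divisor_group_def carrier_free_Abelian_group_iff places_eq .
 have inj: "inj_on nonunits (divsupp (of_divisor D))"
  using nonunits_inj divsupp_subset inj_on_subset by blast
 have eq: "Poly_Mapping.keys D = nonunits ` divsupp (of_divisor D)"
  using keys by (auto simp: divsupp_def of_divisor_def in_keys_iff)
 show "finite (divsupp (of_divisor D))"
  using eq inj finite_imageD[of nonunits] finite_keys by metis
 show "divisor_degree F K D = divdeg (of_divisor D)"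
  unfolding divisor_degree_def divdeg_def eq sum.reindex[OF inj] by (simp add: of_divisor_def)
 have eq: "(ALL P:places F K. place_val F K P z >= - Poly_Mapping.lookup D P) \<longleftrightarrow>
  (ALL V:VR. - of_divisor D V <= valn V z)" if "z : carrier F" "z ~= \<zero>" for z
  unfolding places_eq using place_val_eq[OF _ that] by (simp add: of_divisor_def)
 have "z : riemann_roch_space F K D \<longleftrightarrow> z : lspace (of_divisor D)" for z
 proof (cases "z : carrier F & z ~= \<zero>")
  case True
  thus ?thesis using eq[of z] by (simp add: riemann_roch_space_def lspace_def vset_def cong: ball_cong)
 next
  case False
  thus ?thesis using asubD(2)[OF vset_asub] by (auto simp: riemann_roch_space_def lspace_def)
 qed
 thus "riemann_roch_space F K D = lspace (of_divisor D)" by blast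
qed

lemma exists_of_divisor:
 assumes D: "finite (divsupp D)"
 obtains E where "E : carrier (divisor_group F K)" "!!V. V : VR ==> of_divisor E V = D V"
proof -
 define f where "f P = (if P : nonunits ` divsupp D then D (inv_into (VR) nonunits P) else 0)" for P
 have "finite {P. f P ~= 0}" by (rule finite_subset[of _ "nonunits ` divsupp D"]) (use D in \<open>auto simp: f_def\<close>)
 hence lk: "Poly_Mapping.lookup (Abs_poly_mapping f) = f" by simp
 show thesis
 proof
  show "Abs_poly_mapping f : carrier (divisor_group F K)"
   unfolding divisor_group_def carrier_free_Abelian_group_iff places_eq
   by (auto simp: in_keys_iff lk f_def divsupp_def split: if_splits)
  fix V assume V: "V : VR"
  thus "of_divisor (Abs_poly_mapping f) V = D V"
   using inv_into_f_f[OF nonunits_inj V] by (auto simp: of_divisor_def lk f_def divsupp_def)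
 qed
qed

lemma divsupp_cong: "(!!V. V : VR ==> D V = E V) ==> divsupp D = divsupp E & divdeg D = divdeg E"
 by (auto simp: divsupp_def divdeg_def intro!: sum.cong)

text \<open>The integers \<open>deg D - dim L(D) + 1\<close> are bounded above and include 0,
  attained by \<open>D = 0\<close>; so \<open>GREATEST\<close> is attained and the conversion to
  \<open>nat\<close> loses nothing.\<close>

lemma genus_greatest:
 "(ALL D. finite (divsupp D) --> divdeg D - int (ldim D) + 1 <= int (genus F K)) &
  (EX D. finite (divsupp D) & divdeg D - int (ldim D) + 1 = int (genus F K))"
proof -
 define T where "T = {n. EX D. finite (divsupp D) & n = divdeg D - int (ldim D) + 1}"
 have set: "(EX D:carrier (divisor_group F K). n = divisor_degree F K D - int (dim K (riemann_roch_space F K D)) + 1) \<longleftrightarrow> n : T" for n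
 proof
  assume "EX D:carrier (divisor_group F K). n = divisor_degree F K D - int (dim K (riemann_roch_space F K D)) + 1"
  thus "n : T" using of_divisor by (auto simp: T_def)
 next
  assume "n : T"
  then obtain D where D: "finite (divsupp D)" "n = divdeg D - int (ldim D) + 1" by (auto simp: T_def)
  obtain E where E: "E : carrier (divisor_group F K)" "!!V. V : VR ==> of_divisor E V = D V"
   by (rule exists_of_divisor[OF D(1)]) blast
  show "EX D:carrier (divisor_group F K). n = divisor_degree F K D - int (dim K (riemann_roch_space F K D)) + 1" using lspace_cong[OF E(2)] divsupp_cong[OF E(2)]
   using D(2) of_divisor[OF E(1)] by (intro bexI[OF _ E(1)]) simp
 qed
 obtain B where B: "!!D. finite (divsupp D) ==> divdeg D - int (ldim D) <= B" using defect_bounded by blast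
 have zero: "0 : T"
  unfolding T_def by (rule CollectI, rule exI[of _ "%_. 0"]) (simp add: divsupp_def divdeg_def ldim_zero)
 define M where "M = (GREATEST m. int m : T)"
 have bound: "ALL m. int m : T --> m <= nat (B + 1)" using B by (fastforce simp: T_def)
 have MT: "int M : T" unfolding M_def using GreatestI_nat[of "%m. int m : T" 0 "nat (B + 1)"] zero bound by auto
 have Mmax: "n <= int M" if "n : T" for n
 proof (cases "n >= 0")
  case True
  have "nat n <= M" unfolding M_def using Greatest_le_nat[of "%m. int m : T" "nat n" "nat (B + 1)"] bound that True by auto
  thus ?thesis by simp
 qed simp
 have "(GREATEST n. n : T) = int M" by (rule Greatest_equality) (use MT Mmax in auto)
 hence g: "genus F K = M" unfolding genus_def set by simp
 have "divdeg D - int (ldim D) + 1 <= int M" if "finite (divsupp D)" for D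
  by (rule Mmax) (use that in \<open>auto simp: T_def\<close>)
 moreover obtain D where "finite (divsupp D)" "int M = divdeg D - int (ldim D) + 1" using MT by (auto simp: T_def)
 ultimately show ?thesis unfolding g by metis
qed

theorem riemann:
 assumes "finite (divsupp D)"
 shows "divdeg D + 1 <= int (ldim D) + int (genus F K)"
 using conjunct1[OF genus_greatest, rule_format, OF assms] by simp

text \<open>Some divisor attains the genus, and by \<open>defect_le_pole_multiple\<close> large
  multiples of the poles of \<open>x\<close> do at least as well.\<close>

theorem riemann_equality:
 assumes x: "x : carrier F" "x ~: K"
 shows "EX k. ALL j>=k. int (ldim (%V. int j * poles x V)) + int (genus F K) = int j * divdeg (poles x) + 1"
proof -
 obtain D where D: "finite (divsupp D)" "divdeg D - int (ldim D) + 1 = int (genus F K)" using genus_greatest by blast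
 obtain k where k: "!!j. j >= k ==> divdeg D - int (ldim D) <=
  int j * divdeg (poles x) - int (ldim (%V. int j * poles x V))"
  using defect_le_pole_multiple[OF x D(1)] by blast
 have "int (ldim (%V. int j * poles x V)) + int (genus F K) = int j * divdeg (poles x) + 1" if "j >= k" for j
  using k[OF that] D(2) riemann[OF divdeg_scale(2)[OF divsupp_poles[OF x], of "int j"]]
   divdeg_scale(1)[OF divsupp_poles[OF x], of "int j"] by simp
 thus ?thesis by blast
qed

lemma num_places_eq: "num_places F K t = card {V : VR. degv V = t}"
proof -
 have "{P : places F K. place_degree F K P = t} = nonunits ` {V : VR. degv V = t}"
  unfolding places_eq by auto
 moreover have "inj_on nonunits {V : VR. degv V = t}"
  using nonunits_inj by (rule inj_on_subset) auto
 ultimately show ?thesis unfolding num_places_def by (simp add: card_image)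
qed

lemma residue_pow_card:
 assumes V: "V : VR" and z: "z : V"
 shows "z [^] (card K ^ degv V) \<ominus> z : nonunits V"
proof -
 note vr = vr[OF V]
 obtain A where A: "finite A" "A <= V" "A \<inter> nonunits V = {\<zero>}" "kspace A"
  "!!v. v : V ==> EX a:A. v \<ominus> a : nonunits V" "card A = card K ^ degv V" by (rule residues[OF V]) blast
 have As: "asub A" using A(4) by (simp add: kspace_def)
 have cl: "!!v. v : V ==> v : carrier F" using valring_carrier[OF vr] by auto
 have zc: "z : carrier F" by (rule cl[OF z])
 have pos: "card A > 0" using A(1,3) card_gt_0_iff by blast
 show ?thesis
 proof (cases "z : nonunits V")
  case True
  thus ?thesis using nonunits_minus[OF vr nonunits_pow[OF vr True] True, of "card A"] pos A(6) by simp
 next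
  case False
  define B where "B = A - {\<zero>}"
  have B: "finite B" "!!b. b : B ==> b : V - nonunits V" using A by (auto simp: B_def)
  have cB: "card A = Suc (card B)" unfolding B_def by (rule card.remove[OF A(1) asubD(2)[OF As]])
  define r where "r v = (SOME a. a : A & v \<ominus> a : nonunits V)" for v
  have r: "r v : A & v \<ominus> r v : nonunits V" if "v : V" for v
   unfolding r_def by (rule someI_ex) (use A(5)[OF that] in blast)
  define g where "g b = r (z \<otimes> b)" for b
  have zb: "z \<otimes> b : V - nonunits V" if "b : B" for b using unit_mult[OF vr, of z b] z False B(2)[OF that] by blast
  have gB: "g b : B" if b: "b : B" for b
  proof -
   have "g b ~= \<zero>"
   proof
    assume "g b = \<zero>"
    hence "z \<otimes> b \<ominus> \<zero> : nonunits V" using r[of "z \<otimes> b"] zb[OF b] by (simp add: g_def)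
    thus False using zb[OF b] cl by (simp add: minus_eq)
   qed
   thus ?thesis using r[of "z \<otimes> b"] zb[OF b] by (simp add: g_def B_def)
  qed
  have inj: "inj_on g B"
  proof (rule inj_onI)
   fix b c assume bc: "b : B" "c : B" "g b = g c"
   have c: "b : carrier F" "c : carrier F" "g c : carrier F" using bc B(2) gB cl by auto
   have "z \<otimes> (b \<ominus> c) = (z \<otimes> b \<ominus> g b) \<ominus> (z \<otimes> c \<ominus> g c)"
    using c zc bc(3) by (simp add: minus_eq r_distr r_minus minus_add a_ac r_neg1 r_neg2 r_neg l_neg add_cancel)
   hence "z \<otimes> (b \<ominus> c) : nonunits V" using nonunits_minus[OF vr] r zb bc(1,2) unfolding g_def by (metis DiffD1)
   moreover have bcA: "b \<ominus> c : A" using asubD(5)[OF As] bc by (simp add: B_def)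
   ultimately have "b \<ominus> c = \<zero>" using nonunits_prime[OF vr _ z] A(2) False using bcA A(3) by force
   thus "b = c" using asub_diff_zero c by blast
  qed
  have surj: "g ` B = B" using inj gB B(1) by (simp add: endo_inj_surj image_subsetI)
  text \<open>Fermat's argument: multiplication by \<open>z\<close> permutes the nonzero residue classes.\<close>
  have prod_cong: "finprod F (%b. z \<otimes> b) C \<ominus> finprod F g C : nonunits V &
    finprod F (%b. z \<otimes> b) C : V & finprod F g C : V - nonunits V &
    finprod F (%b. z \<otimes> b) C = z [^] card C \<otimes> finprod F (%b. b) C" if "finite C" "C <= B" for C
   using that
  proof (induction C)
   case empty
   show ?case using zero_nonunit[OF vr] valring_one[OF vr] one_not_nonunit[OF vr] by (simp add: minus_eq r_neg)
  next
   case (insert c C)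
   have fc: "(%b. z \<otimes> b) : C \<rightarrow> carrier F" "g : C \<rightarrow> carrier F" "(%b. b) : C \<rightarrow> carrier F"
    "z \<otimes> c : carrier F" "g c : carrier F" "c : carrier F"
    using insert B(2) gB zc cl by (auto simp: subset_iff Pi_iff)
   note IH = insert.IH[OF subset_trans[OF subset_insertI insert.prems]]
   have c: "c : B" using insert by auto
   define P where "P = finprod F (%b. z \<otimes> b) C"
   define G where "G = finprod F g C"
   have PG: "P \<ominus> G : nonunits V" "P : V" "G : V - nonunits V" "P = z [^] card C \<otimes> finprod F (%b. b) C"
    using IH by (auto simp: P_def G_def)
   have e: "finprod F (%b. z \<otimes> b) (insert c C) = (z \<otimes> c) \<otimes> P" "finprod F g (insert c C) = g c \<otimes> G"
    "finprod F (%b. b) (insert c C) = c \<otimes> finprod F (%b. b) C"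
    unfolding P_def G_def using insert(1,2) fc by simp_all
   have zcV: "z \<otimes> c : V" using zb[OF c] by blast
   have "(z \<otimes> c) \<otimes> P \<ominus> g c \<otimes> G = (z \<otimes> c) \<otimes> (P \<ominus> G) \<oplus> (z \<otimes> c \<ominus> g c) \<otimes> G"
    using PG cl fc(4,5) by (simp add: minus_eq l_distr r_distr l_minus r_minus a_ac add_cancel)
   moreover have "(z \<otimes> c \<ominus> g c) : nonunits V" using r[OF zcV] by (simp add: g_def)
   ultimately have 1: "(z \<otimes> c) \<otimes> P \<ominus> g c \<otimes> G : nonunits V"
    using nonunits_add[OF vr nonunits_mult[OF vr zcV PG(1)] nonunits_mult2[OF vr]] PG(3) by simp
   have 2: "(z \<otimes> c) \<otimes> P = z [^] card (insert c C) \<otimes> (c \<otimes> finprod F (%b. b) C)" using fc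
    using PG(4) insert(1,2) zc by (simp add: m_ac)
   show ?case unfolding e using 1 2 valring_mult[OF vr zcV PG(2)] unit_mult[OF vr B(2)[OF gB[OF c]] PG(3)] by simp
  qed
  have idB: "finprod F g B = finprod F (%b. b) B"
  proof -
   have "finprod F (%b. b) (g ` B) = finprod F (%b. g b) B"
    by (rule finprod_reindex) (use inj surj B(2) cl in auto)
   thus ?thesis using surj by simp
  qed
  define P where "P = finprod F (%b. b) B"
  have P: "z [^] card B \<otimes> P \<ominus> P : nonunits V" "P : V - nonunits V"
   using prod_cong[OF B(1) subset_refl] idB by (auto simp: P_def)
  have "z [^] card B \<ominus> \<one> : nonunits V" using zc cl
   using nonunits_prime[OF vr, of "z [^] card B \<ominus> \<one>" P] P valring_minus[OF vr valring_pow[OF vr z] valring_one[OF vr]] by (simp add: minus_eq l_distr l_minus)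
  from nonunits_mult[OF vr z this] have "z \<otimes> (z [^] card B \<ominus> \<one>) : nonunits V" .
  moreover have "z \<otimes> (z [^] card B \<ominus> \<one>) = z [^] card A \<ominus> z" using zc cB by (simp add: minus_eq r_distr r_minus m_comm)
  ultimately show ?thesis by (simp add: A(6))
 qed
qed

section \<open>The incidence bound for the number of places of a given degree\<close>

definition point_divisor :: "'a set => nat => 'a set => int" where
 "point_divisor V n = (%U. if U = V then int n else 0)"

lemma point_divisor:
 assumes "V : VR"
 shows "finite (divsupp (point_divisor V n))" "divdeg (point_divisor V n) = int n * int (degv V)"
proof -
 have s: "divsupp (point_divisor V n) <= {V}" by (auto simp: divsupp_def point_divisor_def)
 thus "finite (divsupp (point_divisor V n))" using finite_subset by blast
 show "divdeg (point_divisor V n) = int n * int (degv V)"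
  using divdeg_sum[OF _ s] assms by (simp add: point_divisor_def)
qed

text \<open>Double counting of the pairs of a place in \<open>S\<close> and a nonzero function, taken from a
 Riemann--Roch space, that vanishes there.\<close>
lemma place_incidence:
 assumes S: "finite S" "S <= {V : VR. degv V = t}" and t: "t >= 1" and k: "k >= 1"
 shows "t * card S * (card K ^ (t * k) - 1) <= (card K ^ (t * Suc k) - 1) * (genus F K + (k + 2) * t - 2)"
proof (cases "S = {}")
 case False
 then obtain W where W: "W : VR" "degv W = t" using S by blast
 \<comment> \<open>The quotient is rounded down, and it is still large enough that Riemann's theorem
   gives L(nW) dimension at least \<open>t (k + 1)\<close>.\<close>
 define n where "n = (genus F K + (k + 2) * t - 2) div t"
 define D where "D = point_divisor W n"
 note D = point_divisor[OF W(1), of n, folded D_def, unfolded W(2)]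
 have nt: "n * t <= genus F K + (k + 2) * t - 2" by (simp add: n_def)
 have "genus F K + (k + 2) * t - 2 < t + n * t" unfolding n_def using t by (intro dividend_less_div_times) simp
 moreover have "(k + 2) * t = t * Suc k + t" by simp
 ultimately have "genus F K + t * Suc k <= n * t + 1" using t by linarith
 hence "int (genus F K + t * Suc k) <= int (n * t) + 1" by linarith
 moreover have "int (n * t) + 1 <= int (genus F K + ldim D)" using riemann[OF D(1)] D(2) by simp
 ultimately have "int (genus F K + t * Suc k) <= int (genus F K + ldim D)" by (rule order_trans)
 hence dim: "t * Suc k <= ldim D" by (simp only: of_nat_le_iff add_le_cancel_left)
 let ?U = "lspace D" and ?X = "card K ^ (ldim D - t)" and ?Y = "card K ^ (t * k)"
 have finU: "finite ?U" by (rule lspace_finite[OF D(1)])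
 have U0: "\<zero> : ?U" using asubD(2)[OF lspace_asub] .
 \<comment> \<open>Vanishing is meant relative to \<open>D\<close>, that is, \<open>f\<close> lies
   in L(D - V); so \<open>W\<close> may itself belong to \<open>S\<close>.\<close>
 define P where "P V f \<longleftrightarrow> f : vset V (1 - D V)" for V f
 have many: "?X - 1 <= card {f : ?U - {\<zero>}. P V f}" if V: "V : S" for V
 proof -
  have VV: "V : VR" "degv V = t" using V S(2) by auto
  define E where "E = D(V := D V - 1)"
  have "E = (%U. D U + (-1) * point_divisor V 1 U)" by (auto simp: E_def point_divisor_def)
  hence E: "finite (divsupp E)" "divdeg E = divdeg D - int t"
   using divdeg_add[OF D(1) divdeg_scale(2)[OF point_divisor(1)[OF VV(1)]], of "-1" 1]
    divdeg_scale(1)[OF point_divisor(1)[OF VV(1)], of "-1" 1] point_divisor(2)[OF VV(1), of 1] VV(2) by simp_all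
  have "int (ldim D) <= int (ldim E) + (divdeg D - divdeg E)"
   by (rule ldim_le_add_divdeg(1)[OF E(1) D(1)]) (simp add: E_def)
  hence "ldim E >= ldim D - t" using E(2) by simp
  hence "?X <= card (lspace E)"
   unfolding card_lspace[OF lspace_finite[OF E(1)]] using card_K_gt_1 by (intro power_increasing) auto
  moreover have "lspace E - {\<zero>} <= {f : ?U - {\<zero>}. P V f}"
  proof -
   have "lspace E <= ?U" by (rule lspace_mono) (simp add: E_def)
   moreover have "P V f" if "f : lspace E" for f using that VV(1) by (auto simp: lspace_def P_def E_def)
   ultimately show ?thesis by blast
  qed
  hence "card (lspace E - {\<zero>}) <= card {f : ?U - {\<zero>}. P V f}" using finU by (intro card_mono) auto
  moreover have "card (lspace E - {\<zero>}) = card (lspace E) - 1"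
   using asubD(2)[OF lspace_asub] by (simp add: card_Diff_singleton)
  ultimately show ?thesis by linarith
 qed
 \<comment> \<open>The divisor \<open>D + (f)\<close> is effective of degree \<open>n t\<close> and
   contains every incident place, each of degree \<open>t\<close>.\<close>
 have few: "card {V : S. P V f} <= n" if f: "f : ?U - {\<zero>}" for f
 proof -
  define T where "T = {V : S. P V f}"
  have fc: "f : carrier F" "f ~= \<zero>" using f by (auto simp: lspace_def)
  note pf = divdeg_principal[OF fc]
  define C where "C = (%V. if V : T then 1 else 0 :: int)"
  have sC: "divsupp C <= T" "T <= VR" "finite T"
   using S by (auto simp: C_def divsupp_def T_def)
  have "divdeg C = (\<Sum>V\<in>T. C V * int (degv V))" by (rule divdeg_sum[OF sC(3,1,2)])
  also have "\<dots> = (\<Sum>V\<in>T. int t)" using S(2) by (intro sum.cong) (auto simp: C_def T_def)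
  finally have dC: "divdeg C = int (card T) * int t" by simp
  have "divdeg C <= divdeg (%V. D V + valn V f)"
  proof (rule divdeg_mono[OF finite_subset[OF sC(1,3)] divdeg_add(2)[OF D(1) pf(2)]])
   fix V assume V: "V : VR"
   have 0: "- D V <= valn V f" using f V fc by (auto simp: lspace_def vset_def[OF V])
   have "1 - D V <= valn V f" if "V : T" using that fc by (auto simp: T_def P_def vset_def[OF V])
   thus "C V <= D V + valn V f" using 0 by (auto simp: C_def)
  qed
  hence "int (card T) * int t <= int n * int t" using divdeg_add(1)[OF D(1) pf(2)] pf(1) D(2) dC by simp
  thus ?thesis using t by (simp add: T_def)
 qed
 have "card S * (?X - 1) = (\<Sum>V\<in>S. ?X - 1)" by simp
 also have "\<dots> <= (\<Sum>V\<in>S. card {f : ?U - {\<zero>}. P V f})" by (rule sum_mono[OF many])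
 also have "\<dots> = (\<Sum>V\<in>S. \<Sum>f\<in>?U - {\<zero>}. if P V f then 1 else 0)"
  using finU by (simp add: sum.If_cases Int_def)
 also have "\<dots> = (\<Sum>f\<in>?U - {\<zero>}. \<Sum>V\<in>S. if P V f then 1 else 0)" by (rule sum.swap)
 also have "\<dots> = (\<Sum>f\<in>?U - {\<zero>}. card {V : S. P V f})"
  using S(1) by (simp add: sum.If_cases Int_def)
 also have "\<dots> <= (\<Sum>f\<in>?U - {\<zero>}. n)" by (rule sum_mono[OF few])
 also have "\<dots> = (card K ^ ldim D - 1) * n" using U0 by (simp add: card_Diff_singleton card_lspace[OF finU])
 also have "card K ^ ldim D = card K ^ t * ?X" using dim by (simp flip: power_add)
 finally have count: "card S * (?X - 1) <= (card K ^ t * ?X - 1) * n" .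
 have YX: "?Y <= ?X" using dim card_K_gt_1 by (intro power_increasing) auto
 have Y1: "?Y > 1" using card_K_gt_1 t k by (intro one_less_power) auto
 obtain a x y where axy: "card K ^ t = Suc a" "?X = Suc x" "?Y = Suc y"
  using YX Y1 card_K_gt_1 by (metis Suc_pred' less_trans not_less0 power_not_zero not_gr_zero zero_less_one less_le_trans)
 have xy: "y <= x" "x > 0" using YX Y1 unfolding axy by auto
 have "(t * card S * y) * x = t * y * (card S * x)" by simp
 also have "\<dots> <= t * y * ((Suc a * Suc x - 1) * n)" using count unfolding axy by (intro mult_left_mono) simp_all
 also have "\<dots> = (n * t) * (y * (Suc a * Suc x - 1))" by simp
 \<comment> \<open>(c X - 1)/(X - 1) decreases in X when c >= 1, so the size coming from the actual
   dimension may be replaced by the guaranteed one.\<close>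
 also have "\<dots> <= (n * t) * ((Suc a * Suc y - 1) * x)"
  using mult_le_mono2[OF xy(1), of a] by (intro mult_left_mono) (simp_all add: algebra_simps)
 finally have "t * card S * y <= (Suc a * Suc y - 1) * (n * t)" using xy(2) by (simp add: mult_ac)
 also have "\<dots> <= (Suc a * Suc y - 1) * (genus F K + (k + 2) * t - 2)" by (rule mult_le_mono2[OF nt])
 finally have "t * card S * (?Y - 1) <= (card K ^ t * ?Y - 1) * (genus F K + (k + 2) * t - 2)" unfolding axy by simp
 thus ?thesis by (simp add: power_add)
qed simp

lemma finite_places_degree:
 assumes t: "t >= 1"
 shows "finite {V : VR. degv V = t}"
proof -
 have "1 < card K ^ t" using card_K_gt_1 t by (intro one_less_power) auto
 hence "1 <= t * (card K ^ (t * 1) - 1)" using t by (simp add: Suc_le_eq)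
 hence "card S <= t * card S * (card K ^ (t * 1) - 1)" for S :: "'a set set"
  using mult_le_mono2[of 1 _ "card S"] by (simp add: mult_ac)
 note order_trans[OF this place_incidence[OF _ _ t order_refl]]
 thus ?thesis by (rule conjunct1[OF finite_if_finite_subsets_card_bdd])
qed

theorem num_places_incidence:
 assumes "t >= 1" "k >= 1"
 shows "t * num_places F K t * (card K ^ (t * k) - 1) <= (card K ^ (t * Suc k) - 1) * (genus F K + (k + 2) * t - 2)"
 unfolding num_places_eq by (rule place_incidence[OF finite_places_degree[OF assms(1)] order_refl assms])

text \<open>The case \<open>k = 1\<close>, where the quotient of (Q^2 - 1) by (Q - 1) is Q + 1 for Q
  = \<open>card K ^ t\<close>.\<close>

corollary num_places_genus_bound:
 assumes t: "t >= 1"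
 shows "t * num_places F K t <= (card K ^ t + 1) * (genus F K + 3 * t - 2)"
proof -
 have "card K ^ t > 1" using card_K_gt_1 t by (intro one_less_power) auto
 then obtain c where c: "card K ^ t = Suc c" "c > 0" by (metis less_imp_Suc_add zero_less_Suc plus_1_eq_Suc)
 define G where "G = genus F K + (1 + 2) * t - 2"
 have e: "card K ^ (t * 1) - 1 = c" "card K ^ (t * Suc 1) - 1 = c * (c + 2)" unfolding power_mult c(1) by simp_all
 have "t * num_places F K t * c <= (c + 2) * G * c"
  using num_places_incidence[OF t order_refl, folded G_def, unfolded e] by (simp only: mult_ac)
 moreover have "G = genus F K + 3 * t - 2" by (simp add: G_def)
 ultimately show ?thesis using c by simp
qed

end

section \<open>An upper bound for the right-hand side of the theorem\<close>

lemma power3_ge: "s >= 3 ==> s * (3 * s - 2) + 2 <= (3::nat) ^ s"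
proof (induction s rule: dec_induct)
 case (step n)
 then obtain m where "n = m + 3" by (metis add.commute le_Suc_ex)
 hence "Suc n * (3 * Suc n - 2) + 2 <= 3 * (n * (3 * n - 2) + 2)" by (simp add: algebra_simps)
 also have "\<dots> <= 3 * 3 ^ n" using step by simp
 finally show ?case by simp
qed simp

text \<open>\<open>C\<close> is at least 2 sqrt(2N + 1). Either it is large and absorbs the additive
  term of the linear bound for \<open>N\<close>, or it is small and then \<open>N\<close>, of size
  about C^2/8, is small as well. The smallest fields \<open>l = 9\<close> and \<open>l = 3\<close>
  are checked separately.\<close>

lemma place_quotient_le:
 fixes N s l g q :: nat and C m :: int
 assumes l: "l = q ^ s" and q: "odd q" "q >= 3" and s: "s >= 1"
  and C: "C >= 0" "C ^ 2 >= 8 * int N + 4" and m: "m >= 0"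
  and bound: "s * N <= (l + 1) * (g + 3 * s - 2)"
  and incidence: "s = 1 ==> N * (q ^ 3 - 1) <= (q ^ 4 - 1) * (g + 3)"
 shows "4 * real N * real s / (4 * real g + real_of_int m + real_of_int C) <= 2 * (real l ^ 2 - 1) / (real l + 2)"
proof (cases "N = 0")
 case True
 have "l >= 1" using q by (simp add: l Suc_le_eq)
 hence "real l ^ 2 >= 1" by simp
 thus ?thesis using True by simp
next
 case False
 have Cpos: "C >= 4"
 proof (rule ccontr)
  assume "\<not> ?thesis"
  hence "C ^ 2 <= 3 ^ 2" using C(1) by (intro power_mono) auto
  thus False using C(2) False by simp
 qed
 have key: "2 * (int N * int s) * (int l + 2) <= (int l ^ 2 - 1) * (4 * int g + C)"
 proof (cases "l >= 4")
  case True
  have l1: "int l ^ 2 - 1 >= 0" using True by (simp add: power2_eq_square)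
  define r where "r = 3 * s - 2"
  show ?thesis
  \<comment> \<open>\<open>r = 3 s - 2\<close> is the additive term of the linear bound; it is
    absorbed by \<open>C\<close> exactly if \<open>4 r <= C\<close>.\<close>
  proof (cases "C >= 4 * int r")
   case True
   have "s * N <= (l + 1) * (g + r)" using bound s by (simp add: r_def)
   hence b: "int N * int s <= (int l + 1) * (int g + int r)"
    by (metis (mono_tags, lifting) mult.commute of_nat_1 of_nat_add of_nat_le_iff of_nat_mult)
   have "2 * (int N * int s) * (int l + 2) <= 2 * ((int l + 1) * (int g + int r)) * (int l + 2)"
    using b by (intro mult_right_mono mult_left_mono) auto
   also have "\<dots> = (int l + 1) * (2 * (int l + 2)) * (int g + int r)" by (simp add: algebra_simps)
   also have "\<dots> <= (int l + 1) * (4 * (int l - 1)) * (int g + int r)"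
    using \<open>l >= 4\<close> by (intro mult_right_mono mult_left_mono) auto
   also have "\<dots> = (int l ^ 2 - 1) * (4 * int g + 4 * int r)" by (simp add: algebra_simps power2_eq_square)
   also have "\<dots> <= (int l ^ 2 - 1) * (4 * int g + C)" using True l1 by (intro mult_left_mono) auto
   finally show ?thesis by simp
  next
   case False
   hence s2: "s >= 2" using Cpos by (cases "s = 1") (auto simp: r_def)
   have n: "8 * int N + 4 <= C * C" using C(2) by (simp add: power2_eq_square)
   have "2 * (int N * int s) * (int l + 2) <= (int l ^ 2 - 1) * C"
   \<comment> \<open>Here \<open>s r + 2 = 10\<close> exceeds \<open>l = 9\<close>, so the general
     estimate fails by one; small \<open>C\<close> leaves finitely many cases.\<close>
   proof (cases "s = 2 & q = 3")
    case True
    hence sl: "s = 2" "l = 9" "C <= 15" using False by (auto simp: l r_def)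
    have "C * C <= 15 * 15" using sl(3) C(1) by (intro mult_mono) auto
    moreover have "C * C <= 14 * C" if "C <= 14" using that C(1) by (intro mult_right_mono) auto
    moreover have "int N <= 27" using n calculation(1) by presburger
    ultimately show ?thesis using n sl by (cases "C = 15") auto
   next
    case q5: False
    have "s * r + 2 <= l"
    proof (cases "s = 2")
     case True
     have "5 <= q" using q5 True q by (cases "q = 4") auto
     hence "5 ^ 2 <= q ^ 2" by (rule power_mono) simp
     thus ?thesis using True by (simp add: l r_def)
    next
     case False
     hence "s * r + 2 <= 3 ^ s" using power3_ge[of s] s2 by (simp add: r_def)
     also have "(3::nat) ^ s <= l" unfolding l using q by (intro power_mono) auto
     finally show ?thesis .
    qed
    hence "int (s * r + 2) <= int l" by (simp only: of_nat_le_iff)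
    hence sl: "int s * int r <= int l - 2" by simp
    have "C * C <= (4 * int r) * C" using False C(1) by (intro mult_right_mono) auto
    hence "2 * int N <= int r * C" using n by linarith
    hence "2 * int N * (int s * (int l + 2)) <= int r * C * (int s * (int l + 2))" by (intro mult_right_mono) auto
    also have "\<dots> = C * (int l + 2) * (int s * int r)" by simp
    also have "\<dots> <= C * (int l + 2) * (int l - 2)" using sl C(1) by (intro mult_left_mono) auto
    also have "\<dots> = C * (int l ^ 2 - 4)" by (simp add: algebra_simps power2_eq_square)
    also have "\<dots> <= C * (int l ^ 2 - 1)" using C(1) by (intro mult_left_mono) auto
    finally show ?thesis by (simp add: mult_ac)
   qed
   moreover have "(int l ^ 2 - 1) * C <= (int l ^ 2 - 1) * (4 * int g + C)" using l1 by (intro mult_left_mono) auto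
   ultimately show ?thesis by (rule order_trans)
  qed
 next
  case False
  have s1: "s = 1"
  proof (rule ccontr)
   assume "s ~= 1"
   hence "q ^ 2 <= l" unfolding l using s q by (intro power_increasing) auto
   moreover have "(3::nat) ^ 2 <= q ^ 2" using q by (intro power_mono) auto
   ultimately show False using False by simp
  qed
  hence q3: "q = 3" "l = 3" using False q by (auto simp: l)
  have b1: "int N <= 4 * (int g + 1)" using bound s1 q3 by simp
  \<comment> \<open>For \<open>l = 3\<close> the linear bound is too weak for large
    \<open>N\<close>; incidence with \<open>k = 3\<close> improves the slope from 4 to
    80/26.\<close>
  have b2: "26 * int N <= 80 * (int g + 3)" using incidence[OF s1] q3 by simp
  have "5 * int N <= 16 * int g + 4 * C"
  \<comment> \<open>From \<open>N = 18\<close> on, \<open>C >= 13\<close> covers the additive term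
    240/26 of \<open>b2\<close>; below that, squaring the negated claim contradicts the size of
    \<open>C\<close>.\<close>
  proof (cases "N >= 18")
   case True
   have "C >= 13"
   proof (rule ccontr)
    assume "\<not> ?thesis"
    hence "C ^ 2 <= 12 ^ 2" using C(1) by (intro power_mono) auto
    thus False using C(2) True by simp
   qed
   thus ?thesis using b2 by simp
  next
   case lt: False
   show ?thesis
   proof (rule ccontr)
    assume neg: "\<not> ?thesis"
    have c16: "16 * (C * C) >= 128 * int N + 64" using C(2) by (simp add: power2_eq_square)
    show False
    proof (cases "N <= 5")
     case True
     have "4 * C <= 5 * int N" using neg by linarith
     hence "(4 * C) * (4 * C) <= (5 * int N) * (5 * int N)" using C(1) by - (rule mult_mono, auto)
     moreover have "int N * int N <= 5 * int N" using True by (intro mult_right_mono) auto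
     ultimately show False using c16 by (simp add: algebra_simps)
    next
     case False
     have "4 * C <= int N + 16" using b1 neg by simp
     hence "(4 * C) * (4 * C) <= (int N + 16) * (int N + 16)" using C(1) by - (rule mult_mono, auto)
     moreover have "int N * int N <= 18 * int N" using lt by (intro mult_right_mono) auto
     ultimately show False using c16 False by (simp add: algebra_simps)
    qed
   qed
  qed
  thus ?thesis using s1 q3 by (simp add: algebra_simps)
 qed
 have pos: "4 * real g + real_of_int m + real_of_int C > 0" "real l + 2 > 0" using Cpos m by linarith+
 have l1: "int l ^ 2 - 1 >= 0" using q by (simp add: l power2_eq_square Suc_le_eq)
 have "2 * (int N * int s) * (int l + 2) <= (int l ^ 2 - 1) * (4 * int g + m + C)"
  using key mult_nonneg_nonneg[OF l1 m] by (simp add: algebra_simps)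
 hence "real_of_int (2 * (int N * int s) * (int l + 2)) <= real_of_int ((int l ^ 2 - 1) * (4 * int g + m + C))"
  by (simp only: of_int_le_iff)
 hence "2 * (real N * real s) * (real l + 2) <= (real l ^ 2 - 1) * (4 * real g + real_of_int m + real_of_int C)" by simp
 thus ?thesis using pos by (simp add: field_simps)
qed

section \<open>Valuations of an algebraically closed field\<close>

text \<open>A field filling a whole type, with the inverse of zero equal to zero, so that the
  rewriting rules of the type class apply. It is a locale because the field is only constructed
  within the proof.\<close>

locale total_field = w: Fields.field divide inverse times one plus zero minus uminus
 for divide :: "'a => 'a => 'a" (infixl "'/." 70) and inverse :: "'a => 'a"
  and times :: "'a => 'a => 'a" (infixl "*." 70) and one :: 'a
  and plus :: "'a => 'a => 'a" (infixl "+." 65) and zero :: 'a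
  and minus :: "'a => 'a => 'a" (infixl "-." 65) and uminus :: "'a => 'a"
begin

abbreviation pw :: "'a => nat => 'a" (infixr "^." 80) where
 "x ^. n == power.power one times x n"

abbreviation scalar :: "nat => 'a" where
 "scalar n == semiring_1.of_nat one plus zero n"

text \<open>A monic polynomial function of degree \<open>n\<close> paired with its formal
  derivative, in Horner form. Carrying the derivative along makes separability expressible without
  polynomial objects.\<close>

inductive monic :: "nat => ('a => 'a) => ('a => 'a) => bool" where
 monic_0: "monic 0 (%x. one) (%x. zero)"
| monic_Suc: "monic n h d ==> monic (Suc n) (%x. x *. h x +. c) (%x. h x +. x *. d x)"

lemma monic_power: "monic n (%x. x ^. n) (%x. scalar n *. x ^. (n - 1))"
proof (induction n)
 case 0
 show ?case using monic_0 by simp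
next
 case (Suc n)
 show ?case using monic_Suc[OF Suc, of zero] by (cases n) (simp_all add: algebra_simps)
qed

lemma monic_add_lower:
 "monic n h d ==> k < n ==> monic n (%x. h x +. c *. x ^. k) (%x. d x +. c *. (scalar k *. x ^. (k - 1)))"
proof (induction arbitrary: k rule: monic.induct)
 case (monic_Suc n h d b)
 show ?case
 proof (cases k)
  case 0
  have "monic (Suc n) (%x. x *. h x +. (b +. c)) (%x. h x +. x *. d x)" by (rule monic.monic_Suc[OF monic_Suc.hyps])
  thus ?thesis using 0 by (simp add: algebra_simps)
 next
  case (Suc i)
  hence "monic n (%x. h x +. c *. x ^. i) (%x. d x +. c *. (scalar i *. x ^. (i - 1)))" using monic_Suc by simp
  from monic.monic_Suc[OF this, of b]
  have "monic (Suc n) (%x. x *. (h x +. c *. x ^. i) +. b)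
   (%x. h x +. c *. x ^. i +. x *. (d x +. c *. (scalar i *. x ^. (i - 1))))" .
  moreover have "h x +. c *. x ^. i +. x *. (d x +. c *. (scalar i *. x ^. (i - 1))) =
   h x +. x *. d x +. c *. (scalar k *. x ^. (k - 1))" for x
   using Suc by (cases i) (simp_all add: algebra_simps)
  ultimately show ?thesis using Suc by (simp add: algebra_simps)
 qed
qed simp

text \<open>Division by \<open>x - r\<close>, with the product rule for the derivative. For
  \<open>n = 0\<close> the quotient is fixed to be zero, which the inductive step needs.\<close>

lemma monic_split:
 "monic n h d ==> EX k e. (n > 0 --> monic (n - 1) k e) & (n = 0 --> k = (%x. zero) & e = (%x. zero)) &
   (ALL x. h x = (x -. r) *. k x +. h r) & (ALL x. d x = k x +. (x -. r) *. e x)"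
proof (induction rule: monic.induct)
 case monic_0
 show ?case by simp
next
 case (monic_Suc n h d c)
 then obtain k e where k: "n > 0 --> monic (n - 1) k e" "n = 0 --> k = (%x. zero) & e = (%x. zero)"
  "!!x. h x = (x -. r) *. k x +. h r" "!!x. d x = k x +. (x -. r) *. e x" by blast
 have m: "monic n (%x. x *. k x +. h r) (%x. k x +. x *. e x)"
 proof (cases n)
  case 0
  show ?thesis using monic_Suc.hyps using 0 k(2) monic_0 by (cases rule: monic.cases) auto
 next
  case (Suc i)
  thus ?thesis using k(1) monic.monic_Suc[of i k e "h r"] by simp
 qed
 have f1: "x *. h x +. c = (x -. r) *. (x *. k x +. h r) +. (r *. h r +. c)" for x
  by (subst k(3)) (simp add: algebra_simps)
 have f2: "h x +. x *. d x = (x *. k x +. h r) +. (x -. r) *. (k x +. x *. e x)" for x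
  by (subst k(3), subst k(4)) (simp add: algebra_simps)
 show ?case
  by (intro exI[of _ "%x. x *. k x +. h r"] exI[of _ "%x. k x +. x *. e x"] conjI impI allI f1 f2)
   (simp_all add: m)
qed

lemma monic_factor:
 assumes "monic (Suc n) h d" "h r = zero"
 obtains k e where "monic n k e" "!!x. h x = (x -. r) *. k x" "!!x. d x = k x +. (x -. r) *. e x"
 using monic_split[OF assms(1), of r] assms(2) by auto

end

text \<open>No value group is available in the large field; orders are compared only by asking
  whether quotients lie in \<open>W\<close>.\<close>

locale valued_field = total_field +
 fixes W :: "'a set"
 assumes v_one [simp, intro]: "one : W"
  and v_minus [simp, intro]: "x : W ==> y : W ==> x -. y : W"
  and v_mult [simp, intro]: "x : W ==> y : W ==> x *. y : W"
  and v_total: "x ~: W ==> inverse x : W"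
begin

definition M :: "'a set" where "M = {x. x = zero \<or> inverse x ~: W}"

lemma v_zero [simp, intro]: "zero : W" using v_minus[OF v_one v_one] by simp
lemma v_neg [simp, intro]: "x : W ==> uminus x : W" using v_minus[OF v_zero, of x] by simp
lemma v_add [simp, intro]: "x : W ==> y : W ==> x +. y : W" using v_minus[OF _ v_neg, of x y] by simp
lemma v_pow [simp, intro]: "x : W ==> x ^. n : W" by (induction n) auto
lemma v_scalar [simp, intro]: "scalar n : W" by (induction n) auto

lemma M_W: "x : M ==> x : W" using v_total by (auto simp: M_def)
lemma not_M: "x ~: M \<longleftrightarrow> x ~= zero & inverse x : W" by (auto simp: M_def)
lemma M_zero [simp, intro]: "zero : M" by (simp add: M_def)
lemma M_one [simp]: "one ~: M" by (simp add: not_M)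
lemma inverse_M: "x ~: W ==> inverse x : M" by (auto simp: M_def)

lemma not_M_mult: "x ~: M ==> y ~: M ==> x *. y ~: M"
 by (simp add: not_M)

lemma M_mult: assumes "x : M" "y : W" shows "x *. y : M"
proof (rule ccontr)
 assume n: "x *. y ~: M"
 hence nz: "x ~= zero" "y ~= zero" by auto
 have "y *. inverse (x *. y) : W" using assms(2) n by (auto simp: not_M)
 also have "y *. inverse (x *. y) = inverse x" using nz by (simp add: field_simps)
 finally show False using assms(1) nz by (simp add: M_def)
qed

lemma M_mult2: "y : W ==> x : M ==> y *. x : M" using M_mult[of x y] by (simp add: w.mult.commute)

lemma M_neg: "x : M ==> uminus x : M" using M_mult[of x "uminus one"] by simp

lemma M_add: assumes "x : M" "y : M" shows "x +. y : M"
proof -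
 have *: "a +. b : M" if a: "a : M" and b: "b : M" and c: "b /. a : W" and z: "a ~= zero" for a b
 proof -
  have "a *. (one +. b /. a) : M" using M_mult[OF a v_add[OF v_one c]] .
  moreover have "a *. (one +. b /. a) = a +. b" using z by (simp add: w.distrib_left)
  ultimately show ?thesis by simp
 qed
 consider "x = zero" | "y = zero" | "x ~= zero" "y ~= zero" "y /. x : W" | "x ~= zero" "y ~= zero" "x /. y : W"
  using v_total[of "y /. x"] by auto
 thus ?thesis
 proof cases
  case 3
  thus ?thesis using *[OF assms] by simp
 next
  case 4
  thus ?thesis using *[OF assms(2,1)] by (simp add: w.add.commute)
 qed (use assms in auto)
qed

lemma M_minus: "x : M ==> y : M ==> x -. y : M" using M_add[of x "uminus y"] M_neg[of y] by simp
lemma M_pow: "x : M ==> n > 0 ==> x ^. n : M"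
 by (cases n) (auto intro!: M_mult dest: M_W)
lemma not_M_pow: "x ~: M ==> x ^. n ~: M" by (induction n) (auto simp: not_M_mult)
lemma pow_M: "x ^. n : M ==> x : M" using not_M_pow by blast
lemma pow_W: assumes "x ^. n : W" "n > 0" shows "x : W"
proof (rule ccontr)
 assume x: "x ~: W"
 hence "inverse x ^. n : M" by (intro M_pow inverse_M assms(2))
 hence "inverse x ^. n *. x ^. n : M" using assms(1) by (rule M_mult)
 moreover have "inverse x ^. n *. x ^. n = one"
  using x v_zero by (subst w.power_mult_distrib[symmetric]) (metis w.left_inverse w.power_one)
 ultimately show False by simp
qed
lemma unit_add_M: "x ~: M ==> x : W ==> y : M ==> x +. y ~: M"
 using M_minus[of "x +. y" y] by auto
lemma unit_minus_M: "x ~: M ==> x : W ==> y : M ==> x -. y ~: M"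
 using M_add[of "x -. y" y] by auto
lemma v_div: "x : W ==> y ~: M ==> x /. y : W" by (simp add: not_M w.divide_inverse)
text \<open>\<open>h\<close> splits into linear factors and \<open>M\<close> is prime, so some
  factor of \<open>h f\<close> lies in \<open>M\<close>.\<close>

lemma root_near:
 "monic n h d ==> (!!n h d. monic n h d ==> n > 0 ==> EX r. h r = zero) ==> h f : M ==>
   EX r. h r = zero & f -. r : M"
proof (induction n arbitrary: h d)
 case 0
 show ?case using 0 by (cases rule: monic.cases) auto
next
 case (Suc n)
 obtain r where r: "h r = zero" using Suc.prems(2)[OF Suc.prems(1)] by auto
 obtain k e where k: "monic n k e" "!!x. h x = (x -. r) *. k x" using monic_factor[OF Suc.prems(1) r] by metis
 show ?case
 proof (cases "f -. r : M")
  case False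
  hence "k f : M" using Suc.prems(3) not_M_mult unfolding k(2) by blast
  hence "EX r. k r = zero & f -. r : M"
   by (intro Suc.IH[OF k(1)]) (rule Suc.prems(2), assumption+)
  thus ?thesis using k(2) by auto
 qed (use r in auto)
qed

end

locale closed_field = total_field +
 fixes p :: nat
 assumes prime_p: "normalization_semidom_class.prime p" and char_p: "scalar p = zero"
  and root_exists: "monic n h d ==> n > 0 ==> EX r. h r = zero"
begin

lemma p_gt_1: "p > 1" using prime_p by (rule prime_gt_1_nat)

lemma scalar_dvd: "p dvd n ==> scalar n = zero"
 by (auto simp: char_p)

lemma add_pow_p: "(x +. y) ^. p = x ^. p +. y ^. p"
proof -
 let ?f = "%k. scalar (p choose k) *. x ^. k *. y ^. (p - k)"
 have "(x +. y) ^. p = w.sum ?f {..p}" by (rule w.binomial_ring)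
 also have "\<dots> = w.sum ?f {0, p}"
 proof (rule w.sum.mono_neutral_right)
  show "ALL k:{..p} - {0, p}. ?f k = zero"
  proof
   fix k assume "k : {..p} - {0, p}"
   hence "p dvd (p choose k)" using prime_p by (intro dvd_choose_prime) auto
   thus "?f k = zero" by (simp add: scalar_dvd)
  qed
 qed auto
 also have "\<dots> = x ^. p +. y ^. p" using p_gt_1 by (simp add: w.add.commute)
 finally show ?thesis .
qed

lemma frob_add: "(x +. y) ^. (p ^ e) = x ^. (p ^ e) +. y ^. (p ^ e)"
proof (induction e)
 case (Suc e)
 have "(x +. y) ^. (p ^ Suc e) = ((x +. y) ^. (p ^ e)) ^. p" by (simp add: w.power_mult[symmetric] mult.commute)
 also have "\<dots> = (x ^. (p ^ e)) ^. p +. (y ^. (p ^ e)) ^. p" unfolding Suc by (rule add_pow_p)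
 finally show ?case by (simp add: w.power_mult[symmetric] mult.commute)
qed simp

lemma frob_minus: "(x -. y) ^. (p ^ e) = x ^. (p ^ e) -. y ^. (p ^ e)"
 using frob_add[of "x -. y" y e] by simp

lemma frob_zero [simp]: "zero ^. (p ^ e) = zero" using p_gt_1 by simp

lemma frob_neg: "(uminus x) ^. (p ^ e) = uminus (x ^. (p ^ e))"
 using frob_minus[of zero x e] by simp

lemma frob_inj: "x ^. (p ^ e) = y ^. (p ^ e) \<longleftrightarrow> x = y"
proof
 assume "x ^. (p ^ e) = y ^. (p ^ e)"
 hence "(x -. y) ^. (p ^ e) = zero" by (simp add: frob_minus)
 thus "x = y" by simp
qed simp

lemma frob_scalar: "scalar i ^. (p ^ e) = scalar i"
 by (induction i) (simp_all add: frob_add)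

lemma scalar_unit: assumes "\<not> p dvd i" shows "scalar i ~= zero"
proof
 assume z: "scalar i = zero"
 have "gcd i p = 1" using prime_imp_coprime[OF prime_p assms] by (simp add: coprime_iff_gcd_eq_1 gcd.commute)
 moreover have "i ~= 0" using assms by (metis dvd_0_right)
 ultimately obtain a b where "i * a = p * b + 1" using bezout_nat[of i p] by auto
 hence "scalar (i * a) = scalar (p * b + 1)" by simp
 thus False using z by (simp add: char_p)
qed

lemma scalar_p_power: "e > 0 ==> scalar (p ^ e) = zero" by (intro scalar_dvd) simp

text \<open>For positive \<open>i\<close> the field with \<open>p^i\<close> elements; the union
  \<open>kbar\<close> is the algebraic closure of the prime field. The index 0 is left out of it
  because \<open>fixed 0\<close> is everything.\<close>

definition fixed :: "nat => 'a set" where "fixed i = {a. a ^. (p ^ i) = a}"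
definition kbar :: "'a set" where "kbar = (\<Union>i\<in>{1..}. fixed i)"

lemma fixed_one: "one : fixed i" by (simp add: fixed_def)
lemma fixed_zero: "zero : fixed i" by (simp add: fixed_def)
lemma fixed_minus: "a : fixed i ==> b : fixed i ==> a -. b : fixed i" by (simp add: fixed_def frob_minus)
lemma fixed_add: "a : fixed i ==> b : fixed i ==> a +. b : fixed i" by (simp add: fixed_def frob_add)
lemma fixed_mult: "a : fixed i ==> b : fixed i ==> a *. b : fixed i" by (simp add: fixed_def w.power_mult_distrib)
lemma fixed_inverse: "a : fixed i ==> inverse a : fixed i" by (simp add: fixed_def w.power_inverse)

lemma fixed_pow: "a : fixed i ==> a ^. (p ^ (i * k)) = a"
 by (induction k) (auto simp: fixed_def power_add w.power_mult)

lemma fixed_dvd: "i dvd k ==> fixed i <= fixed k"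
 by (auto simp: dvd_def) (simp add: fixed_def fixed_pow)

lemma kbarI: "i > 0 ==> a : fixed i ==> a : kbar" by (auto simp: kbar_def)

lemma kbar_common: assumes "a : kbar" "b : kbar" obtains i where "i > 0" "a : fixed i" "b : fixed i"
proof -
 obtain i k where i: "i >= 1" "a : fixed i" "k >= 1" "b : fixed k" using assms by (auto simp: kbar_def)
 have "a : fixed (i * k)" using fixed_dvd[of i "i * k"] i(2) by auto
 moreover have "b : fixed (i * k)" using fixed_dvd[of k "i * k"] i(4) by auto
 ultimately show thesis using that[of "i * k"] i by simp
qed

lemma kbar_one: "one : kbar" by (rule kbarI[OF zero_less_one fixed_one])
lemma kbar_minus: assumes "a : kbar" "b : kbar" shows "a -. b : kbar"
 using kbar_common[OF assms] by (metis kbarI fixed_minus)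
lemma kbar_mult: assumes "a : kbar" "b : kbar" shows "a *. b : kbar"
 using kbar_common[OF assms] by (metis kbarI fixed_mult)
lemma kbar_inverse: assumes "a : kbar" shows "inverse a : kbar"
 using kbar_common[OF assms assms] by (metis kbarI fixed_inverse)

lemma monic_roots_distinct:
 "monic n h d ==> (!!r. h r = zero ==> d r ~= zero) ==> finite {r. h r = zero} & card {r. h r = zero} = n"
proof (induction n arbitrary: h d)
 case 0
 hence "h = (%x. one)" by (cases rule: monic.cases) auto
 thus ?case by simp
next
 case (Suc n)
 obtain r where r: "h r = zero" using root_exists[OF Suc.prems(1)] by auto
 obtain k e where k: "monic n k e" "!!x. h x = (x -. r) *. k x" "!!x. d x = k x +. (x -. r) *. e x"
  using monic_factor[OF Suc.prems(1) r] by metis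
 have "e x ~= zero" if "k x = zero" for x
  using Suc.prems(2)[of x] k(2)[of x] k(3)[of x] that by auto
 hence IH: "finite {r. k r = zero} & card {r. k r = zero} = n" by (intro Suc.IH[OF k(1)])
 have "{r. h r = zero} = insert r {r. k r = zero}" using k(2) by auto
 thus ?case using IH Suc.prems(2)[OF r] k(3)[of r] by simp
qed

lemma monic_frobenius: assumes "e > 0"
 shows "monic (p ^ e) (%x. x ^. (p ^ e) -. x) (%x. uminus one)"
proof -
 have "monic (p ^ e) (%x. x ^. (p ^ e) +. uminus one *. x ^. 1)
  (%x. scalar (p ^ e) *. x ^. (p ^ e - 1) +. uminus one *. (scalar 1 *. x ^. (1 - 1)))"
  using assms p_gt_1 by (intro monic_add_lower monic_power one_less_power)
 thus ?thesis using assms by (simp add: char_p w.zero_power del: One_nat_def)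
qed

lemma card_fixed: assumes "e > 0" shows "finite (fixed e)" "card (fixed e) = p ^ e"
proof -
 show "finite (fixed e)" "card (fixed e) = p ^ e"
  using monic_roots_distinct[OF monic_frobenius[OF assms]] by (auto simp: fixed_def)
qed

end

locale valued_closed_field = closed_field + valued_field
begin

lemma residue_root: "monic n h d ==> h f : M ==> EX r. h r = zero & f -. r : M"
 using root_near root_exists by blast

lemma fixed_unit: assumes "a : fixed i" "i > 0" "a ~= zero" shows "a ^. (p ^ i - 1) = one"
proof -
 have "a *. a ^. (p ^ i - 1) = a ^. (Suc (p ^ i - 1))" by simp
 also have "\<dots> = a *. one" using assms p_gt_1 by (simp add: fixed_def del: w.power_Suc)
 finally show ?thesis using assms(3) by simp
qed

lemma kbar_W: assumes "a : kbar" shows "a : W"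
proof (cases "a = zero")
 case False
 obtain i where i: "i > 0" "a : fixed i" using kbar_common[OF assms assms] by auto
 have "a ^. (p ^ i - 1) : W" using fixed_unit[OF i(2,1) False] by simp
 moreover have "p ^ i > 1" using p_gt_1 i(1) by (rule one_less_power)
 ultimately show ?thesis using pow_W[of a "p ^ i - 1"] by simp
qed simp

lemma residue_fixed: assumes "e > 0" "f ^. (p ^ e) -. f : M" shows "EX a:fixed e. f -. a : M"
 using residue_root[OF monic_frobenius[OF assms(1)] assms(2)] by (auto simp: fixed_def)

end

section \<open>Formal derivatives along a parameter\<close>

text \<open>A pair \<open>(f, f')\<close> stands for the dual number \<open>f + f'\<epsilon>\<close>. The set \<open>CD\<close> consists of those dual numbers with
 a full expansion in powers of \<open>t + \<epsilon>\<close> with coefficients in \<open>k\<close>, so that \<open>f'\<close> is the derivative of \<open>f\<close>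
 with respect to \<open>t\<close>.\<close>

locale derivation_frame = valued_closed_field +
 fixes k :: "'a set" and t :: 'a
 assumes k_one: "one : k" and k_minus: "x : k ==> y : k ==> x -. y : k"
  and k_mult: "x : k ==> y : k ==> x *. y : k" and k_inverse: "x : k ==> inverse x : k"
  and k_W: "k <= W" and t_M: "t : M" and t_nz: "t ~= zero"
begin

lemma k_zero: "zero : k" using k_minus[OF k_one k_one] by simp
lemma k_neg: "x : k ==> uminus x : k" using k_minus[OF k_zero, of x] by simp
lemma k_add: "x : k ==> y : k ==> x +. y : k" using k_minus[OF _ k_neg, of x y] by simp
lemma k_pow: "x : k ==> x ^. n : k" by (induction n) (auto simp: k_one k_mult)
lemma k_M: "x : k ==> x : M ==> x = zero" using k_inverse k_W by (auto simp: M_def)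
lemma t_W: "t : W" by (rule M_W[OF t_M])

text \<open>\<open>n\<close> digits of an expansion: the rule is the dual number
  \<open>(c, 0) + (t, 1) (w, w')\<close>, a constant plus the parameter times a rest known to
  \<open>n\<close> digits.\<close>

primrec DT :: "nat => ('a \<times> 'a) set" where
 "DT 0 = W \<times> W"
| "DT (Suc n) = {(c +. t *. w, w +. t *. w') | c w w'. c : k & (w, w') : DT n}"

lemma DT_W: "(f, f') : DT n ==> f : W & f' : W"
 by (induction n arbitrary: f f') (use k_W t_W in fastforce)+

lemma DT_SucI: "c : k ==> (w, w') : DT n ==> (c +. t *. w, w +. t *. w') : DT (Suc n)"
 by auto

lemma DT_anti: "(f, f') : DT (Suc n) ==> (f, f') : DT n"
proof (induction n arbitrary: f f')
 case 0
 thus ?case using DT_W[OF 0] by simp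
next
 case (Suc n)
 obtain c w w' where e: "f = c +. t *. w" "f' = w +. t *. w'" "c : k" "(w, w') : DT (Suc n)"
  using Suc.prems unfolding DT.simps(2)[of "Suc n"] by blast
 show ?case unfolding e(1,2) by (rule DT_SucI[OF e(3) Suc.IH[OF e(4)]])
qed

lemma DT_zero: "(zero, zero) : DT n"
proof (induction n)
 case (Suc n)
 show ?case using DT_SucI[OF k_zero Suc] by simp
qed simp

lemma DT_const: "c : k ==> (c, zero) : DT n"
proof (cases n)
 case (Suc n)
 assume "c : k"
 thus ?thesis using DT_SucI[OF _ DT_zero, of c n] Suc by simp
qed (use k_W in auto)

lemma DT_shift: "(w, w') : DT n ==> (t *. w, w +. t *. w') : DT (Suc n)"
 using DT_SucI[OF k_zero] by simp

lemma DT_t: "(t, one) : DT n"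
 by (rule DT_anti) (use DT_shift[OF DT_const[OF k_one]] in simp)

lemma DT_minus: "(f, f') : DT n ==> (h, h') : DT n ==> (f -. h, f' -. h') : DT n"
proof (induction n arbitrary: f f' h h')
 case (Suc n)
 obtain c w w' where e: "f = c +. t *. w" "f' = w +. t *. w'" "c : k" "(w, w') : DT n"
  using Suc.prems(1) by auto
 obtain d v v' where e2: "h = d +. t *. v" "h' = v +. t *. v'" "d : k" "(v, v') : DT n"
  using Suc.prems(2) by auto
 have "((c -. d) +. t *. (w -. v), (w -. v) +. t *. (w' -. v')) : DT (Suc n)"
  by (rule DT_SucI[OF k_minus[OF e(3) e2(3)] Suc.IH[OF e(4) e2(4)]])
 thus ?case by (simp only: e(1,2) e2(1,2)) (simp add: algebra_simps del: DT.simps)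
qed auto

lemma DT_neg: "(f, f') : DT n ==> (uminus f, uminus f') : DT n"
 using DT_minus[OF DT_zero] by simp

lemma DT_add: "(f, f') : DT n ==> (h, h') : DT n ==> (f +. h, f' +. h') : DT n"
 using DT_minus[OF _ DT_neg] by simp

lemma DT_mult: "(f, f') : DT n ==> (h, h') : DT n ==> (f *. h, f' *. h +. f *. h') : DT n"
proof (induction n arbitrary: f f' h h')
 case (Suc n)
 obtain c w w' where e: "f = c +. t *. w" "f' = w +. t *. w'" "c : k" "(w, w') : DT n"
  using Suc.prems(1) by auto
 obtain d v v' where e2: "h = d +. t *. v" "h' = v +. t *. v'" "d : k" "(v, v') : DT n"
  using Suc.prems(2) by auto
 note cv = Suc.IH[OF DT_const[OF e(3)] e2(4)]
 note dw = Suc.IH[OF DT_const[OF e2(3)] e(4)]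
 note twv = DT_anti[OF DT_shift[OF Suc.IH[OF e(4) e2(4)]]]
 note sum = DT_SucI[OF k_mult[OF e(3) e2(3)] DT_add[OF DT_add[OF cv dw] twv]]
 show ?case by (rule back_subst[of "%x. x : DT (Suc n)", OF sum])
   (simp add: e(1,2) e2(1,2) algebra_simps)
qed auto

definition CD :: "('a \<times> 'a) set" where "CD = (\<Inter>n. DT n)"

lemma CD_W: "(f, f') : CD ==> f : W & f' : W" using DT_W by (auto simp: CD_def)
lemma CD_const: "c : k ==> (c, zero) : CD" using DT_const by (simp add: CD_def)
lemma CD_t: "(t, one) : CD" using DT_t by (simp add: CD_def)
lemma CD_minus: "(f, f') : CD ==> (h, h') : CD ==> (f -. h, f' -. h') : CD" using DT_minus by (simp add: CD_def)
lemma CD_neg: "(f, f') : CD ==> (uminus f, uminus f') : CD" using DT_neg by (simp add: CD_def)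
lemma CD_add: "(f, f') : CD ==> (h, h') : CD ==> (f +. h, f' +. h') : CD" using DT_add by (simp add: CD_def)
lemma CD_mult: "(f, f') : CD ==> (h, h') : CD ==> (f *. h, f' *. h +. f *. h') : CD" using DT_mult by (simp add: CD_def)

text \<open>Expansions of different lengths have the same first digit, since elements of
  \<open>k\<close> congruent modulo \<open>M\<close> are equal; so one rest works for all
  lengths.\<close>

lemma CD_split: assumes "(f, f') : CD"
 obtains c w w' where "c : k" "(w, w') : CD" "f = c +. t *. w" "f' = w +. t *. w'"
proof -
 have *: "EX c w w'. f = c +. t *. w & f' = w +. t *. w' & c : k & (w, w') : DT n" for n
 proof -
  have "(f, f') : DT (Suc n)" using assms unfolding CD_def by blast
  thus ?thesis by simp
 qed
 obtain c w w' where e: "f = c +. t *. w" "f' = w +. t *. w'" "c : k" "(w, w') : DT 0" using *[of 0] by blast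
 have "(w, w') : DT n" for n
 proof -
  obtain d v v' where e2: "f = d +. t *. v" "f' = v +. t *. v'" "d : k" "(v, v') : DT n" using *[of n] by blast
  have "v : W" "w : W" using DT_W[OF e(4)] DT_W[OF e2(4)] by auto
  hence "t *. (v -. w) : M" by (intro M_mult t_M v_minus)
  also have "t *. (v -. w) = c -. d" using e(1) e2(1) by (simp add: algebra_simps)
  finally have "c -. d = zero" by (rule k_M[OF k_minus[OF e(3) e2(3)]])
  hence "t *. v = t *. w" using e(1) e2(1) by simp
  hence vw: "v = w" using t_nz by simp
  hence "t *. v' = t *. w'" using e(2) e2(2) by simp
  hence "v' = w'" using t_nz by simp
  thus ?thesis using vw e2(4) by simp
 qed
 hence "(w, w') : CD" by (simp add: CD_def)
 thus thesis using that e(1-3) by blast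
qed

lemma CD_div: assumes "(t *. f, f +. t *. f') : CD" "f : W" shows "(f, f') : CD"
proof -
 obtain c w w' where e: "c : k" "(w, w') : CD" "t *. f = c +. t *. w" "f +. t *. f' = w +. t *. w'"
  by (rule CD_split[OF assms(1)])
 have "t *. (f -. w) : M" using CD_W[OF e(2)] assms(2) by (intro M_mult t_M v_minus) auto
 also have "t *. (f -. w) = c" using e(3) by (simp add: algebra_simps)
 finally have "c = zero" by (rule k_M[OF e(1)])
 hence "f = w" using e(3) t_nz by simp
 moreover from this have "f' = w'" using e(4) t_nz by simp
 ultimately show ?thesis using e(2) by simp
qed

text \<open>Thus \<open>t\<close> acts as a uniformizer among differentiable elements, although the
  valuation of the large field need not be discrete.\<close>

lemma CD_M: assumes "(f, f') : CD" "f : M" shows "f /. t : W"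
proof -
 obtain c w w' where e: "c : k" "(w, w') : CD" "f = c +. t *. w" "f' = w +. t *. w'"
  by (rule CD_split[OF assms(1)])
 have "f -. t *. w : M" using assms(2) CD_W[OF e(2)] by (intro M_minus M_mult t_M) auto
 also have "f -. t *. w = c" by (simp add: e(3))
 finally have "c = zero" by (rule k_M[OF e(1)])
 thus ?thesis using CD_W[OF e(2)] t_nz e(3) by simp
qed

lemma CD_residue: assumes "(f, f') : CD" shows "EX c:k. f -. c : M"
proof -
 obtain c w w' where e: "c : k" "(w, w') : CD" "f = c +. t *. w" "f' = w +. t *. w'"
  by (rule CD_split[OF assms(1)])
 have "t *. w : M" using CD_W[OF e(2)] by (intro M_mult t_M) auto
 thus ?thesis using e(1,3) by (intro bexI[of _ c]) simp_all
qed

lemma dual_inverse: assumes "x *. f = one" shows "x' *. f +. x *. f' = zero \<longleftrightarrow> x' = uminus (x *. x *. f')"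
proof -
 have "x' *. f +. x *. f' = zero \<longleftrightarrow> (x' *. f +. x *. f') *. x = zero" using assms by auto
 also have "(x' *. f +. x *. f') *. x = x' *. (x *. f) +. x *. x *. f'" by (simp add: algebra_simps)
 finally show ?thesis using assms by (simp add: w.eq_neg_iff_add_eq_0)
qed

text \<open>The first digit is 1/c and the rest comes from 1/f = 1/c - t (w/c) (1/f), where 1/f is
  known to one digit less. The second component is then forced by the product rule.\<close>

lemma DT_inverse: "(f, f') : DT n ==> f ~: M ==> (inverse f, uminus (inverse f *. inverse f *. f')) : DT n"
proof (induction n arbitrary: f f')
 case 0
 thus ?case by (auto simp: not_M)
next
 case (Suc n)
 obtain c w w' where e: "f = c +. t *. w" "f' = w +. t *. w'" "c : k" "(w, w') : DT n"
  using Suc.prems(1) by auto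
 note ff = Suc.prems(1)
 have f: "f ~= zero" "inverse f : W" using Suc.prems(2) by (auto simp: not_M)
 have c: "c ~= zero"
 proof
  assume "c = zero"
  hence "f : M" using e(1) DT_W[OF e(4)] by (auto intro!: M_mult t_M)
  thus False using Suc.prems(2) by simp
 qed
 let ?i = "inverse f" and ?i' = "uminus (inverse f *. inverse f *. f')"
 note IH = Suc.IH[OF DT_anti[OF ff] Suc.prems(2)]
 have cn: "(uminus (inverse c), zero) : DT n" by (intro DT_const k_neg k_inverse e(3))
 note m = DT_SucI[OF k_inverse[OF e(3)] DT_mult[OF DT_mult[OF cn e(4)] IH]]
 have i1: "inverse c +. t *. (uminus (inverse c) *. w *. ?i) = ?i"
 proof -
  have "?i = (inverse c *. f -. t *. (inverse c *. w)) *. ?i" using c by (simp add: e(1) algebra_simps)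
  also have "\<dots> = inverse c +. t *. (uminus (inverse c) *. w *. ?i)"
   using f(1) by (simp add: w.left_diff_distrib w.mult.assoc)
  finally show ?thesis by simp
 qed
 let ?x' = "uminus (inverse c) *. w *. ?i +. t *. ((zero *. w +. uminus (inverse c) *. w') *. ?i +. uminus (inverse c) *. w *. ?i')"
 have "?x' *. f +. ?i *. f' = zero"
 proof -
  have J: "?i *. f = one" and I: "c *. inverse c = one" using c f(1) by auto
  have "?x' *. f +. ?i *. f' = uminus (inverse c) *. (w *. (?i *. f)) +. t *. (uminus (inverse c) *. (w' *. (?i *. f))
    +. inverse c *. w *. (?i *. f' *. (?i *. f))) +. ?i *. f'" by (simp add: algebra_simps)
  also have "\<dots> = uminus (inverse c) *. w +. t *. (uminus (inverse c) *. w' +. inverse c *. w *. (?i *. f')) +. ?i *. f'"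
   unfolding J by simp
  finally have eq: "?x' *. f +. ?i *. f' = uminus (inverse c) *. w +. t *. (uminus (inverse c) *. w' +. inverse c *. w *. (?i *. f')) +. ?i *. f'" .
  have "c *. (?x' *. f +. ?i *. f') = (c *. inverse c) *. (t *. (w *. (?i *. f')) -. (w +. t *. w')) +. c *. (?i *. f')"
   unfolding eq by (simp add: algebra_simps)
  also have "\<dots> = uminus f' +. (?i *. (c +. t *. w)) *. f'" unfolding I by (simp add: e(2) algebra_simps)
  also have "\<dots> = zero" unfolding e(1)[symmetric] J by simp
  finally show ?thesis using c by simp
 qed
 hence i2: "?x' = ?i'" using dual_inverse[of ?i f ?x' f'] f(1) by simp
 show ?case using m unfolding i1 i2 .
qed

lemma CD_inverse: "(f, f') : CD ==> f ~: M ==> (inverse f, uminus (inverse f *. inverse f *. f')) : CD"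
 unfolding CD_def using DT_inverse by blast

definition D :: "nat => 'a" where "D n = scalar n *. t ^. (n - 1)"

lemma D_0 [simp]: "D 0 = zero" by (simp add: D_def)

lemma D_Suc: "D (Suc n) = t ^. n +. t *. D n"
 by (cases n) (simp_all add: D_def algebra_simps)

lemma D_add: "D (n + m) = D n *. t ^. m +. t ^. n *. D m"
 by (induction n) (simp_all add: D_Suc algebra_simps w.power_add)

lemma D_p: "e > 0 ==> D (p ^ e) = zero" unfolding D_def by (subst scalar_p_power) simp_all

lemma t_D: "t *. D n = scalar n *. t ^. n" by (cases n) (simp_all add: D_def algebra_simps)

lemma DT_mono: "m <= n ==> (f, f') : DT n ==> (f, f') : DT m"
 by (induction n rule: dec_induct) (use DT_anti in blast)+

lemma DT_t_power: "(y, y') : DT n ==> (t ^. m *. y, D m *. y +. t ^. m *. y') : DT (n + m)"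
proof (induction m)
 case (Suc m)
 from DT_shift[OF Suc.IH[OF Suc.prems]] show ?case by (simp add: D_Suc algebra_simps del: DT.simps)
qed simp

lemma DT_power: "(y, y') : DT n ==> (y ^. m, scalar m *. y ^. (m - 1) *. y') : DT n"
proof (induction m)
 case 0
 thus ?case using DT_const[OF k_one] by simp
next
 case (Suc m)
 note IH = DT_mult[OF Suc.prems Suc.IH[OF Suc.prems]]
 show ?case using IH by (cases m) (simp_all add: algebra_simps)
qed

lemma DT_frob: "(y, y') : DT n ==> e > 0 ==> (y ^. (p ^ e), zero) : DT n"
proof -
 assume a: "(y, y') : DT n" "e > 0"
 have "scalar (p ^ e) = zero" using a(2) by (rule scalar_p_power)
 thus ?thesis using DT_power[OF a(1), of "p ^ e"] by (metis w.mult_zero_left)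
qed

lemma CD_t_power: "(y, y') : CD ==> (t ^. m *. y, D m *. y +. t ^. m *. y') : CD"
 unfolding CD_def INT_iff
proof
 fix n assume "ALL n:UNIV. (y, y') : DT n"
 thus "(t ^. m *. y, D m *. y +. t ^. m *. y') : DT n" by (intro DT_mono[OF le_add1 DT_t_power]) simp
qed

lemma CD_power: "(y, y') : CD ==> (y ^. m, scalar m *. y ^. (m - 1) *. y') : CD"
 using DT_power by (simp add: CD_def)

lemma CD_frob: "(y, y') : CD ==> e > 0 ==> (y ^. (p ^ e), zero) : CD"
 using DT_frob[of y y' _ e] by (simp add: CD_def)

text \<open>In \<open>(c + t w)^(p^e) = c^(p^e) + t^(p^e) w^(p^e)\<close> the last factor keeps
  \<open>n\<close> digits and is shifted by at least two places; its derivative is zero.\<close>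

lemma DT_frob_raise:
 assumes "c : k" "(w, w') : DT n" "e > 0" shows "((c +. t *. w) ^. (p ^ e), zero) : DT (Suc (Suc n))"
proof -
 have "p <= p ^ e" using p_gt_1 assms(3) by (simp add: self_le_power)
 hence "n + 2 <= n + p ^ e" using p_gt_1 by simp
 moreover have "(t ^. (p ^ e) *. w ^. (p ^ e), D (p ^ e) *. w ^. (p ^ e) +. t ^. (p ^ e) *. zero) : DT (n + p ^ e)"
  by (rule DT_t_power[OF DT_frob[OF assms(2,3)]])
 ultimately have "(t ^. (p ^ e) *. w ^. (p ^ e), zero) : DT (Suc (Suc n))"
  using DT_mono[of "n + 2" "n + p ^ e"] by (simp add: D_p[OF assms(3)] del: DT.simps)
 from DT_add[OF DT_const[OF k_pow[OF assms(1)]] this, of "p ^ e"] show ?thesis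
  by (simp add: frob_add w.power_mult_distrib del: DT.simps)
qed

text \<open>The equation is separable in \<open>f\<close>, and raising to the power \<open>p\<close> doubles the precision at least.\<close>

lemma CD_additive_root:
 assumes d: "(d, d') : CD" and b1: "(b1, b1') : CD" and b2: "(b2, b2') : CD" and f: "f : W"
  and eq: "f = d +. b1 *. f ^. (p ^ e1) +. b2 *. f ^. (p ^ e2)" and e: "e1 > 0" "e2 > 0"
  and a: "a : k" "f -. a : M"
 shows "(f, d' +. b1' *. f ^. (p ^ e1) +. b2' *. f ^. (p ^ e2)) : CD"
proof -
 define x where "x = f -. a"
 let ?q1 = "p ^ e1" and ?q2 = "p ^ e2"
 let ?E = "d +. b1 *. a ^. ?q1 +. b2 *. a ^. ?q2 -. a"
 have fx: "f = a +. x" by (simp add: x_def algebra_simps)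
 have xM: "x : M" using a(2) by (simp add: x_def)
 have q: "?q1 - 1 > 0" "?q2 - 1 > 0" using one_less_power[OF p_gt_1 e(1)] one_less_power[OF p_gt_1 e(2)] by auto
 have W: "b1 : W" "b2 : W" using CD_W[OF b1] CD_W[OF b2] by auto
 have xE: "x = ?E +. b1 *. x ^. ?q1 +. b2 *. x ^. ?q2"
 proof -
  have "x = (d +. b1 *. (a +. x) ^. ?q1 +. b2 *. (a +. x) ^. ?q2) -. a"
   using eq unfolding fx by (simp add: w.add.commute)
  thus ?thesis unfolding frob_add by (simp add: algebra_simps)
 qed
 have qM: "x ^. ?q1 : M" "x ^. ?q2 : M" using xM p_gt_1 by (auto intro: M_pow)
 have "x -. b1 *. x ^. ?q1 -. b2 *. x ^. ?q2 : M" using xM W qM by (intro M_minus M_mult2)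
 also have "x -. b1 *. x ^. ?q1 -. b2 *. x ^. ?q2 = ?E" by (subst (1) xE) (simp add: algebra_simps)
 finally have EM: "?E : M" .
 note E = CD_minus[OF CD_add[OF CD_add[OF d CD_mult[OF b1 CD_const[OF k_pow[OF a(1), of ?q1]]]]
  CD_mult[OF b2 CD_const[OF k_pow[OF a(1), of ?q2]]]] CD_const[OF a(1)]]
 have Et: "?E /. t : W" by (rule CD_M[OF E EM])
 let ?u = "one -. (b1 *. x ^. (?q1 - 1) +. b2 *. x ^. (?q2 - 1))"
 have uM: "?u ~: M" using W xM q by (intro unit_minus_M M_add M_mult2 M_pow) auto
 have pp: "x *. x ^. (?q1 - 1) = x ^. ?q1" "x *. x ^. (?q2 - 1) = x ^. ?q2"
  using q by (metis Suc_diff_1 w.power_Suc zero_less_diff order_less_trans less_one)+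
 have "x *. ?u = x -. (b1 *. (x *. x ^. (?q1 - 1)) +. b2 *. (x *. x ^. (?q2 - 1)))" by (simp add: algebra_simps)
 also have "\<dots> = x -. b1 *. x ^. ?q1 -. b2 *. x ^. ?q2" unfolding pp by (simp add: algebra_simps)
 also have "\<dots> = ?E" by (subst (1) xE) (simp add: algebra_simps)
 finally have xu: "x *. ?u = ?E" .
 \<comment> \<open>\<open>x\<close> times a unit equals \<open>?E\<close>, which has an expansion
   and lies in \<open>M\<close>, hence is divisible by \<open>t\<close>. This is the first digit,
   from which the precision can grow.\<close>
 have "x /. t : W"
 proof -
  have "x /. t = (x *. ?u) /. t /. ?u" using uM by (simp add: not_M)
  thus ?thesis using v_div[OF Et uM] unfolding xu by simp
 qed
 define w0 where "w0 = x /. t"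
 have w0: "(w0, zero) : DT 0" "f = a +. t *. w0" using \<open>x /. t : W\<close> t_nz by (auto simp: w0_def fx)
 let ?f' = "d' +. b1' *. f ^. ?q1 +. b2' *. f ^. ?q2"
 have step: "(f, ?f') : DT n" if "(f ^. ?q1, zero) : DT n" "(f ^. ?q2, zero) : DT n" for n
 proof -
  have "(d, d') : DT n" "(b1, b1') : DT n" "(b2, b2') : DT n" using d b1 b2 by (auto simp: CD_def)
  from DT_add[OF DT_add[OF this(1) DT_mult[OF this(2) that(1)]] DT_mult[OF this(3) that(2)]]
  show ?thesis unfolding eq[symmetric] by simp
 qed
 have two: "(f, ?f') : DT (Suc (Suc 0))"
  using DT_frob_raise[OF a(1) w0(1)] e unfolding w0(2)[symmetric] by (intro step) blast+
 have "(f, ?f') : DT (Suc n)" for n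
 proof (induction n)
  case 0
  show ?case by (rule DT_anti[OF two])
 next
  case (Suc n)
  obtain c w w' where cw: "f = c +. t *. w" "c : k" "(w, w') : DT n"
   using Suc by auto
  show ?case using DT_frob_raise[OF cw(2,3)] e unfolding cw(1)[symmetric] by (intro step) blast+
 qed
 hence "(f, ?f') : DT n" for n by (rule DT_anti)
 thus ?thesis by (simp add: CD_def)
qed

text \<open>Laurent expansions: a power of \<open>t\<close> clears the pole, and the second
  component is the one required by the product rule.\<close>

definition CDF :: "('a \<times> 'a) set" where
 "CDF = {(f, f'). EX n. (t ^. n *. f, D n *. f +. t ^. n *. f') : CD}"

lemma CDF_I: "(t ^. n *. f, D n *. f +. t ^. n *. f') : CD ==> (f, f') : CDF" by (auto simp: CDF_def)

lemma CDF_raise: "(t ^. n *. f, D n *. f +. t ^. n *. f') : CD ==>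
  (t ^. (n + m) *. f, D (n + m) *. f +. t ^. (n + m) *. f') : CD"
 using CD_t_power[of "t ^. n *. f" "D n *. f +. t ^. n *. f'" m] by (simp add: D_add w.power_add algebra_simps)

lemma CD_CDF: "(f, f') : CD ==> (f, f') : CDF" by (rule CDF_I[of 0]) simp
lemma CDF_const: "c : k ==> (c, zero) : CDF" by (rule CD_CDF[OF CD_const])

lemma CDF_minus: assumes "(f, f') : CDF" "(h, h') : CDF" shows "(f -. h, f' -. h') : CDF"
proof -
 obtain n m where nm: "(t ^. n *. f, D n *. f +. t ^. n *. f') : CD" "(t ^. m *. h, D m *. h +. t ^. m *. h') : CD"
  using assms by (auto simp: CDF_def)
 have "(t ^. (n + m) *. h, D (n + m) *. h +. t ^. (n + m) *. h') : CD"
  using CDF_raise[OF nm(2), of n] by (simp only: add.commute[of m n])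
 from CD_minus[OF CDF_raise[OF nm(1), of m] this] show ?thesis
  by (intro CDF_I[of "n + m"]) (simp add: algebra_simps)
qed

lemma CDF_neg: "(f, f') : CDF ==> (uminus f, uminus f') : CDF"
 using CDF_minus[OF CDF_const[OF k_zero]] by simp
lemma CDF_add: "(f, f') : CDF ==> (h, h') : CDF ==> (f +. h, f' +. h') : CDF"
 using CDF_minus[OF _ CDF_neg] by simp

lemma CDF_mult: assumes "(f, f') : CDF" "(h, h') : CDF" shows "(f *. h, f' *. h +. f *. h') : CDF"
proof -
 obtain n m where "(t ^. n *. f, D n *. f +. t ^. n *. f') : CD" "(t ^. m *. h, D m *. h +. t ^. m *. h') : CD"
  using assms by (auto simp: CDF_def)
 from CD_mult[OF this] show ?thesis
  by (intro CDF_I[of "n + m"]) (simp add: algebra_simps D_add w.power_add)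
qed

lemma CDF_power: "(f, f') : CDF ==> (f ^. m, scalar m *. f ^. (m - 1) *. f') : CDF"
proof (induction m)
 case 0
 thus ?case using CDF_const[OF k_one] by simp
next
 case (Suc m)
 note IH = CDF_mult[OF Suc.prems Suc.IH[OF Suc.prems]]
 show ?case using IH by (cases m) (simp_all add: algebra_simps)
qed

lemma CDF_frob: assumes "(f, f') : CDF" "e > 0" shows "(f ^. (p ^ e), zero) : CDF"
proof -
 have "scalar (p ^ e) = zero" using assms(2) by (rule scalar_p_power)
 thus ?thesis using CDF_power[OF assms(1), of "p ^ e"] by (metis w.mult_zero_left)
qed

lemma CDF_W: assumes "(f, f') : CDF" "f : W" shows "(f, f') : CD"
proof -
 obtain n where "(t ^. n *. f, D n *. f +. t ^. n *. f') : CD" using assms by (auto simp: CDF_def)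
 thus ?thesis
 proof (induction n)
  case (Suc n)
  have "(t *. (t ^. n *. f), t ^. n *. f +. t *. (D n *. f +. t ^. n *. f')) : CD"
   using Suc.prems by (simp add: D_Suc algebra_simps)
  hence "(t ^. n *. f, D n *. f +. t ^. n *. f') : CD" by (rule CD_div) (simp add: assms(2) t_W)
  thus ?case by (rule Suc.IH)
 qed simp
qed

lemma CDF_t_inverse: "(inverse t, uminus (inverse t *. inverse t)) : CDF"
 using t_nz CD_const[OF k_one] by (intro CDF_I[of 1]) (simp add: D_def w.mult.assoc[symmetric])

text \<open>Divide by \<open>t\<close> until a unit is reached; the hypothesis on
  \<open>t^N / f\<close> says that \<open>N\<close> divisions are enough.\<close>

lemma CD_inverse_CDF:
 "(f, f') : CD ==> f ~= zero ==> t ^. N /. f : W ==> EX y. (inverse f, y) : CDF"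
proof (induction N arbitrary: f f')
 case 0
 hence "f ~: M" by (simp add: not_M w.divide_inverse)
 from CD_CDF[OF CD_inverse[OF 0(1) this]] show ?case by blast
next
 case (Suc N)
 show ?case
 proof (cases "f : M")
  case False
  from CD_CDF[OF CD_inverse[OF Suc.prems(1) this]] show ?thesis by blast
 next
  case True
  have w: "f /. t : W" by (rule CD_M[OF Suc.prems(1) True])
  let ?w' = "(f' -. f /. t) /. t"
  have "f /. t +. t *. ?w' = f'" using t_nz by (simp add: w.add_diff_eq)
  hence "(f /. t, ?w') : CD" using Suc.prems(1) t_nz by (intro CD_div[OF _ w]) simp
  moreover have "t ^. N /. (f /. t) = t ^. Suc N /. f" by (simp add: field_simps)
  ultimately obtain y where "(inverse (f /. t), y) : CDF"
   using Suc.IH[of "f /. t" ?w'] Suc.prems(2,3) t_nz by auto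
  from CDF_mult[OF this CDF_t_inverse] show ?thesis using t_nz by (auto simp: field_simps)
 qed
qed

lemma CDF_inverse: assumes "(f, f') : CDF" "f ~= zero" "t ^. N /. f : W" shows "EX y. (inverse f, y) : CDF"
proof -
 obtain n where n: "(t ^. n *. f, D n *. f +. t ^. n *. f') : CD" using assms by (auto simp: CDF_def)
 have nz: "t ^. n *. f ~= zero" using assms(2) t_nz by simp
 have "t ^. (N + n) /. (t ^. n *. f) = t ^. N /. f" using t_nz by (simp add: w.power_add)
 then obtain y where y: "(inverse (t ^. n *. f), y) : CDF"
  using CD_inverse_CDF[OF n nz, of "N + n"] assms(3) by auto
 from CDF_mult[OF CDF_power[OF CD_CDF[OF CD_t], of n] y] show ?thesis using t_nz by (auto simp: field_simps)
qed

lemma CDF_pole: assumes "(f, f') : CDF" "t ^. n *. f : W" shows "t ^. Suc n *. f' : W"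
proof -
 have "(t ^. n *. f, scalar n *. t ^. (n - 1) *. one *. f +. t ^. n *. f') : CD"
  by (rule CDF_W[OF CDF_mult[OF CDF_power[OF CD_CDF[OF CD_t]] assms(1)] assms(2)])
 hence "D n *. f +. t ^. n *. f' : W" using CD_W by (auto simp: D_def)
 hence "t *. (D n *. f +. t ^. n *. f') -. scalar n *. (t ^. n *. f) : W" using t_W assms(2) by auto
 also have "t *. (D n *. f +. t ^. n *. f') -. scalar n *. (t ^. n *. f) = t ^. Suc n *. f'"
 proof -
  have "t *. (D n *. f +. t ^. n *. f') = (t *. D n) *. f +. t ^. Suc n *. f'" by (simp add: algebra_simps)
  thus ?thesis unfolding t_D by (simp add: algebra_simps)
 qed
 finally show ?thesis .
qed

lemma CDF_sum: "(!!l. l <= n ==> (f l, f' l) : CDF) ==> (w.sum f {..n::nat}, w.sum f' {..n}) : CDF"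
 by (induction n) (simp_all add: CDF_add)

lemma scalar_not_M: "\<not> p dvd i ==> inverse (scalar i) : W"
 by (intro kbar_W kbar_inverse kbarI[of 1]) (simp_all add: fixed_def frob_scalar[of _ 1, simplified])

text \<open>Differentiate \<open>i\<close> times: the operator \<open>f' / g'\<close> maps \<open>\<Sum>f\<^sub>l\<^sup>p g\<^sup>l\<close> to \<open>\<Sum>l f\<^sub>l\<^sup>p g\<^bsup>l-1\<^esup>\<close>.\<close>

lemma top_coefficient_bound:
 assumes g: "(g, g') : CDF" "g' ~= zero"
  and step: "!!h h' n. (h, h') : CDF ==> t ^. (n * B) *. h : W ==> t ^. (Suc n * B) *. (h' /. g') : W"
 shows "i < p ==> (!!l. l <= i ==> EX y. (f l, y) : CDF) ==>
  t ^. (n * B) *. w.sum (%l. f l ^. p *. g ^. l) {..i} : W ==> t ^. ((n + i) * B) *. f i ^. p : W"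
proof (induction i arbitrary: f n)
 case (Suc i)
 have fp: "(f l ^. p, zero) : CDF" if "l <= Suc i" for l
  using Suc.prems(2)[OF that] CDF_frob[of _ _ 1] by auto
 let ?h' = "%l. f l ^. p *. (scalar l *. g ^. (l - 1) *. g')"
 have hl: "(f l ^. p *. g ^. l, ?h' l) : CDF" if "l <= Suc i" for l
  using CDF_mult[OF fp[OF that] CDF_power[OF g(1), of l]] by simp
 have "(w.sum (%l. f l ^. p *. g ^. l) {..Suc i}, w.sum ?h' {..Suc i}) : CDF"
  by (rule CDF_sum[where f = "%l. f l ^. p *. g ^. l" and f' = ?h', OF hl])
 from step[OF this Suc.prems(3)]
 have s: "t ^. (Suc n * B) *. (w.sum ?h' {..Suc i} /. g') : W" .
 \<comment> \<open>The derivative has the same shape in one degree less: the factor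
   \<open>l + 1\<close> is moved inside the p-th power, being its own p-th power.\<close>
 let ?f = "%l. scalar (Suc l) *. f (Suc l)"
 have "w.sum ?h' {..Suc i} = w.sum (%l. f (Suc l) ^. p *. (scalar (Suc l) *. g ^. l *. g')) {..i}"
  by (subst w.sum.atMost_Suc_shift) simp
 also have "\<dots> = w.sum (%l. g' *. (?f l ^. p *. g ^. l)) {..i}"
 proof (rule w.sum.cong[OF refl])
  fix l
  have "scalar (Suc l) ^. p = scalar (Suc l)" using frob_scalar[of "Suc l" 1] by simp
  thus "f (Suc l) ^. p *. (scalar (Suc l) *. g ^. l *. g') = g' *. (?f l ^. p *. g ^. l)"
   unfolding w.power_mult_distrib by (metis w.mult.commute w.mult.left_commute)
 qed
 also have "\<dots> = g' *. w.sum (%l. ?f l ^. p *. g ^. l) {..i}" by (simp only: w.sum_distrib_left)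
 finally have s2: "t ^. (Suc n * B) *. w.sum (%l. ?f l ^. p *. g ^. l) {..i} : W"
  using s g(2) by simp
 have "EX y. (?f l, y) : CDF" if l: "l <= i" for l
 proof -
  obtain y where y: "(f (Suc l), y) : CDF" using Suc.prems(2)[of "Suc l"] l by auto
  have "scalar m : k" for m by (induction m) (simp_all add: k_zero k_one k_add)
  from CDF_mult[OF CDF_const[OF this] y] show ?thesis by blast
 qed
 from Suc.IH[OF _ this s2] Suc.prems(1)
 have IH: "t ^. ((Suc n + i) * B) *. (?f i) ^. p : W" by simp
 have nd: "\<not> p dvd Suc i" using Suc.prems(1) by auto
 have "inverse (scalar (Suc i)) *. (t ^. ((Suc n + i) * B) *. (?f i) ^. p) : W"
  by (intro v_mult scalar_not_M nd IH)
 also have "inverse (scalar (Suc i)) *. (t ^. ((Suc n + i) * B) *. (?f i) ^. p) = t ^. ((n + Suc i) * B) *. f (Suc i) ^. p"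
 proof -
  have "scalar (Suc i) ^. p = scalar (Suc i)" using frob_scalar[of "Suc i" 1] by simp
  moreover have "inverse (scalar (Suc i)) *. scalar (Suc i) = one" using scalar_unit[OF nd] by simp
  ultimately have "inverse (scalar (Suc i)) *. (?f i) ^. p = f (Suc i) ^. p"
   unfolding w.power_mult_distrib by (metis w.mult.assoc w.mult_1_left)
  thus ?thesis by (metis w.mult.left_commute add_Suc add_Suc_right)
 qed
 finally show ?case .
qed simp

end

section \<open>A tower of torsion points\<close>

context total_field
begin

definition subf :: "'a set => bool" where
 "subf S \<longleftrightarrow> one : S & (ALL x:S. ALL y:S. x -. y : S & x *. y : S) & (ALL x:S. inverse x : S)"

lemma subfI: "one : S ==> (!!x y. x : S ==> y : S ==> x -. y : S) ==>
  (!!x y. x : S ==> y : S ==> x *. y : S) ==> (!!x. x : S ==> inverse x : S) ==> subf S"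
 by (simp add: subf_def)

lemma
 assumes "subf S"
 shows subf_one: "one : S" and subf_minus: "x : S ==> y : S ==> x -. y : S"
  and subf_mult: "x : S ==> y : S ==> x *. y : S" and subf_inverse: "x : S ==> inverse x : S"
 using assms by (auto simp: subf_def)

lemma subf_zero: "subf S ==> zero : S" using subf_minus[OF _ subf_one subf_one] by simp
lemma subf_neg: "subf S ==> x : S ==> uminus x : S" using subf_minus[OF _ subf_zero, of S x] by simp
lemma subf_add: "subf S ==> x : S ==> y : S ==> x +. y : S" using subf_minus[OF _ _ subf_neg, of S x y] by simp
lemma subf_div: "subf S ==> x : S ==> y : S ==> x /. y : S" by (simp add: w.divide_inverse subf_mult subf_inverse)
lemma subf_pow: "subf S ==> x : S ==> x ^. n : S" by (induction n) (auto simp: subf_one subf_mult)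

definition field_hull :: "'a set => 'a set" where "field_hull A = \<Inter>{S. subf S & A <= S}"

lemma subf_hull: "subf (field_hull A)"
 unfolding field_hull_def by (rule subfI) (auto simp: subf_def)
lemma hull_superset: "A <= field_hull A" by (auto simp: field_hull_def)
lemma hull_minimal: "subf S ==> A <= S ==> field_hull A <= S" by (auto simp: field_hull_def)
lemma hull_mono: "A <= B ==> field_hull A <= field_hull B" by (auto simp: field_hull_def)

end

text \<open>The map \<open>phi c\<close> is the action of \<open>T\<close> under a Drinfeld module of rank \<open>j + 1\<close>, the \<open>y i\<close> form a compatible
 system of \<open>T\<^bsup>i+1\<^esup>\<close>-torsion points, and \<open>H i\<close> is the isogeny whose kernel is spanned by \<open>y 0\<close>, ..., \<open>y (i - 1)\<close>.\<close>

context closed_field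
begin

lemma monic_power_ex: "EX d. monic n (%x. x ^. n) d" using monic_power by blast
lemma monic_add_ex: "EX d. monic n h d ==> k < n ==> EX d. monic n (%x. h x +. c *. x ^. k) d"
 using monic_add_lower by blast
lemma root_ex: "EX d. monic n h d ==> n > 0 ==> EX r. h r = zero" using root_exists by blast

lemma telescope: "w.sum (%k. f (Suc k) -. f k) {..<n::nat} = f n -. f 0"
proof (induction n)
 case (Suc n)
 show ?case unfolding w.sum.lessThan_Suc Suc by (simp add: algebra_simps)
qed simp

lemma sum_minus: "w.sum (%k. f k -. h k) {..n::nat} = w.sum f {..n} -. w.sum h {..n}"
 by (induction n) (simp_all add: algebra_simps)

end

locale torsion_tower = closed_field +
 fixes e j :: nat and g :: 'a
 assumes e_pos: "e > 0" and j_ge: "j >= 2" and g_kbar: "g ~: kbar"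
begin

text \<open>Here \<open>q\<close> is the l of the overview and \<open>qj = q^j\<close> is
  Q/l.\<close>

abbreviation q :: nat where "q == p ^ e"
definition qj :: nat where "qj = p ^ (e * j)"
definition Q :: nat where "Q = p ^ (e * Suc j)"

lemma q_ge: "q >= 2" using one_less_power[OF p_gt_1 e_pos] by simp
lemma qj_gt_q: "qj > q" unfolding qj_def using p_gt_1 e_pos j_ge by (intro power_strict_increasing) auto
lemma Q_gt_qj: "Q > qj" unfolding qj_def Q_def using p_gt_1 e_pos by (intro power_strict_increasing) auto
lemma Q_eq: "Q = qj * q" by (simp add: Q_def qj_def power_add)
lemma ej_pos: "e * j > 0" "e * Suc j > 0" using e_pos j_ge by auto
lemma pow_Q: "x ^. Q = (x ^. qj) ^. q" by (simp only: Q_eq w.power_mult)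

lemma frobs:
 "(r -. s) ^. q = r ^. q -. s ^. q" "(r +. s) ^. q = r ^. q +. s ^. q"
 "(r -. s) ^. qj = r ^. qj -. s ^. qj" "(r +. s) ^. qj = r ^. qj +. s ^. qj"
 "(r -. s) ^. Q = r ^. Q -. s ^. Q" "(r +. s) ^. Q = r ^. Q +. s ^. Q"
 unfolding qj_def Q_def by (rule frob_minus frob_add)+

lemma zero_frobs [simp]: "zero ^. qj = zero" "zero ^. Q = zero"
 by (simp_all add: qj_def Q_def del: mult_Suc_right)

definition phi :: "'a => 'a => 'a" where "phi c z = z +. c *. z ^. qj -. z ^. Q"
text \<open>The additive polynomial \<open>z^q - x^(q-1) z\<close>, whose zeros for nonzero
  \<open>x\<close> are the multiples of \<open>x\<close> by the field with \<open>q\<close>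
  elements.\<close>

definition eta :: "'a => 'a => 'a" where "eta x z = z ^. q -. x ^. q /. x *. z"

lemma phi_surj: "EX z. phi c z = b"
proof -
 have "EX z. z ^. Q +. uminus c *. z ^. qj +. uminus one *. z ^. 1 +. b *. z ^. 0 = zero"
  using Q_gt_qj qj_gt_q by (intro root_ex[of Q] monic_add_ex monic_power_ex) linarith+
 then obtain z where "z ^. Q +. uminus c *. z ^. qj +. uminus one *. z ^. 1 +. b *. z ^. 0 = zero" ..
 hence "phi c z = b" by (simp add: phi_def algebra_simps)
 thus ?thesis ..
qed

lemma phi_kernel: "EX z. z ~= zero & phi c z = zero"
proof -
 have k: "qj - 1 < Q - 1" "0 < qj - 1" "0 < Q - 1" using Q_gt_qj qj_gt_q q_ge by auto
 have "EX z. z ^. (Q - 1) +. uminus c *. z ^. (qj - 1) +. uminus one *. z ^. 0 = zero"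
  using k by (intro root_ex[of "Q - 1"] monic_add_ex monic_power_ex) linarith+
 then obtain z where z: "z ^. (Q - 1) +. uminus c *. z ^. (qj - 1) +. uminus one *. z ^. 0 = zero" ..
 have zz: "z *. z ^. (Q - 1) = z ^. Q" "z *. z ^. (qj - 1) = z ^. qj"
  using k w.power_Suc[of z "Q - 1"] w.power_Suc[of z "qj - 1"] by auto
 have "z ~= zero" using z k by (auto simp: w.zero_power)
 moreover have "z *. (z ^. (Q - 1) +. uminus c *. z ^. (qj - 1) +. uminus one *. z ^. 0) = z *. zero" by (simp only: z)
 hence "z *. z ^. (Q - 1) +. uminus c *. (z *. z ^. (qj - 1)) -. z = zero" by (simp add: algebra_simps)
 hence "phi c z = zero" unfolding zz phi_def by (simp add: algebra_simps)
 ultimately show ?thesis by blast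
qed

primrec y :: "nat => 'a" where
 "y 0 = (SOME z. z ~= zero & phi g z = zero)"
| "y (Suc i) = (SOME z. phi g z = y i)"

primrec H :: "nat => 'a => 'a" where
 "H 0 = (%z. z)"
| "H (Suc i) = (%z. eta (H i (y i)) (H i z))"

definition x :: "nat => 'a" where "x i = H i (y i)"

text \<open>The parameter of the i-th isogenous module; the formula is forced by
  \<open>eta_phi\<close>.\<close>

primrec gg :: "nat => 'a" where
 "gg 0 = g"
| "gg (Suc i) = x i ^. q /. x i -. x i ^. q /. x i ^. Q"

declare y.simps [simp del]

lemma y_0: "y 0 ~= zero" "phi g (y 0) = zero"
 using someI_ex[OF phi_kernel[of g]] by (simp_all add: y.simps)
lemma y_Suc: "phi g (y (Suc i)) = y i" using someI_ex[OF phi_surj[of g "y i"]] by (simp add: y.simps)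

text \<open>\<open>a\<close> determines \<open>c = (a^Q - a)/a^qj\<close>; with this value the two
  additive polynomials have equal coefficients.\<close>

lemma eta_phi:
 assumes c: "phi c a = zero" and a: "a ~= zero"
 shows "eta a (phi c z) = phi (a ^. q /. a -. a ^. q /. a ^. Q) (eta a z)"
proof -
 define a1 b b1 bq where d: "a1 = a ^. q" "b = a ^. qj" "b1 = b ^. q" "bq = b1 ^. q"
 have nz: "a1 ~= zero" "b ~= zero" "b1 ~= zero" using a by (auto simp: d)
 have bQ: "a ^. Q = b1" by (simp add: d pow_Q)
 have cb: "c *. b = b1 -. a" using c unfolding phi_def bQ d(2)[symmetric] by (simp add: algebra_simps)
 have "(c *. b) ^. q = (b1 -. a) ^. q" by (simp only: cb)
 hence cq: "c ^. q *. b1 = bq -. a1" by (simp add: w.power_mult_distrib frob_minus d)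
 have a1j: "a1 ^. qj = b1" by (simp add: d w.power_mult[symmetric] mult.commute)
 have b1Q: "a1 ^. Q = bq" by (simp add: pow_Q a1j d(4))
 define z1 v v1 v2 where dz: "z1 = z ^. q" "v = z ^. qj" "v1 = v ^. q" "v2 = v1 ^. q"
 have zQ: "z ^. Q = v1" by (simp add: dz pow_Q)
 have z1j: "z1 ^. qj = v1" by (simp add: dz w.power_mult[symmetric] mult.commute)
 have z1Q: "z1 ^. Q = v2" by (simp add: pow_Q z1j dz(4))
 have lhs: "eta a (phi c z) = (z1 +. c ^. q *. v1 -. v2) -. a1 /. a *. (z +. c *. v -. v1)"
  unfolding eta_def phi_def d(1)[symmetric] zQ frobs by (simp add: w.power_mult_distrib dz)
 have rhs: "phi (a1 /. a -. a1 /. b1) (eta a z) =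
   (z1 -. a1 /. a *. z) +. (a1 /. a -. a1 /. b1) *. (v1 -. b1 /. b *. v) -. (v2 -. bq /. b1 *. v1)"
  unfolding eta_def phi_def d(1)[symmetric] dz(1)[symmetric] frobs z1j z1Q
  by (simp add: w.power_mult_distrib w.power_divide a1j b1Q bQ zQ d(2)[symmetric] dz(2)[symmetric])
 have c1: "a1 /. a *. c = (a1 /. a -. a1 /. b1) *. (b1 /. b)"
 proof -
  have c': "c = (b1 -. a) /. b" using cb nz by (simp add: field_simps)
  show ?thesis unfolding c' using nz a by (simp add: field_simps)
 qed
 have c2: "c ^. q = bq /. b1 -. a1 /. b1" using cq nz by (simp add: field_simps)
 have "eta a (phi c z) = z1 +. c ^. q *. v1 -. v2 -. a1 /. a *. z -. (a1 /. a *. c) *. v +. a1 /. a *. v1"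
  unfolding lhs by (simp add: algebra_simps)
 also have "\<dots> = phi (a1 /. a -. a1 /. b1) (eta a z)"
  unfolding rhs c1 c2 by (simp add: algebra_simps)
 finally show ?thesis by (simp add: bQ d(1))
qed

text \<open>The isogeny dual to \<open>eta a\<close>: up to sign the two compose to
  \<open>phi c\<close>.\<close>

definition psi :: "'a => 'a => 'a" where
 "psi a z = z ^. qj +. w.sum (%k. z ^. (p ^ (e * k)) *. (a /. a ^. (p ^ (e * Suc k)))) {..<j}"

text \<open>The sum in \<open>psi\<close> telescopes, since the weights turn the powers of
  \<open>eta a z\<close> into differences of consecutive terms \<open>a (z/a)^(q^k)\<close>.\<close>

lemma psi_eta:
 assumes c: "phi c a = zero" and a: "a ~= zero"
 shows "psi a (eta a z) = uminus (phi c z)"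
proof -
 let ?f = "%k. a *. (z ^. (p ^ (e * k)) /. a ^. (p ^ (e * k)))"
 have pS: "u ^. (p ^ (e * Suc k)) = (u ^. q) ^. (p ^ (e * k))" for u k
  by (simp add: w.power_mult[symmetric] power_add)
 have "eta a z ^. (p ^ (e * k)) *. (a /. a ^. (p ^ (e * Suc k))) = ?f (Suc k) -. ?f k" for k
  unfolding eta_def frob_minus w.power_mult_distrib w.power_divide pS[symmetric]
  using a by (simp add: field_simps)
 hence "w.sum (%k. eta a z ^. (p ^ (e * k)) *. (a /. a ^. (p ^ (e * Suc k)))) {..<j} = w.sum (%k. ?f (Suc k) -. ?f k) {..<j}" by simp
 also have "\<dots> = ?f j -. ?f 0" by (rule telescope)
 finally have s: "psi a (eta a z) = eta a z ^. qj +. (a *. (z ^. qj /. a ^. qj) -. z)" using a by (simp add: psi_def qj_def)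
 have e: "eta a z ^. qj = z ^. Q -. a ^. Q /. a ^. qj *. z ^. qj"
  unfolding eta_def frobs w.power_mult_distrib w.power_divide by (simp add: qj_def Q_def pS del: mult_Suc_right)
 have c': "c = (a ^. Q -. a) /. a ^. qj" using c a unfolding phi_def by (simp add: field_simps)
 show ?thesis unfolding s e phi_def c' using a by (simp add: field_simps)
qed

lemma x_properties: "x i ~= zero & phi (gg i) (x i) = zero & (ALL z. phi (gg i) (H i z) = H i (phi g z))"
proof (induction i)
 case 0
 show ?case using y_0 by (simp add: x_def)
next
 case (Suc i)
 let ?z = "H i (y (Suc i))"
 have xS: "x (Suc i) = eta (x i) ?z" by (simp add: x_def)
 have z: "phi (gg i) ?z = x i" using Suc by (simp add: y_Suc x_def)
 \<comment> \<open>The dual isogeny maps \<open>x (i + 1)\<close> to \<open>- x i\<close>, which is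
   nonzero; so the chain never reaches zero.\<close>
 have "psi (x i) (x (Suc i)) = uminus (x i)" unfolding xS using psi_eta[of "gg i" "x i"] Suc z by simp
 moreover have "psi (x i) zero = zero" by (simp add: psi_def)
 ultimately have "x (Suc i) ~= zero" using Suc by auto
 moreover have "phi (gg (Suc i)) (H (Suc i) z') = H (Suc i) (phi g z')" for z'
 proof -
  have i: "phi (gg i) (x i) = zero" "x i ~= zero" "phi (gg i) (H i z') = H i (phi g z')" using Suc by auto
  show ?thesis using eta_phi[OF i(1,2), of "H i z'"] by (simp add: x_def[symmetric] i(3))
 qed
 moreover have "phi (gg (Suc i)) (x (Suc i)) = zero"
  unfolding xS using eta_phi[of "gg i" "x i" ?z] Suc z by (simp add: eta_def)
 ultimately show ?case by blast
qed

lemma x_nz: "x i ~= zero" and phi_x: "phi (gg i) (x i) = zero"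
 using x_properties by auto

lemma psi_x: "psi (x i) (x (Suc i)) = uminus (x i)"
 using psi_eta[OF phi_x x_nz, of i "H i (y (Suc i))"] x_properties[of i] by (simp add: x_def y_Suc)

definition K :: "'a set" where "K = fixed (e * Suc j)"
definition E :: "nat => 'a set" where "E m = field_hull (insert g (K \<union> x ` {..<m}))"

lemma subf_fixed: "subf (fixed i)"
 by (rule subfI) (auto simp: fixed_one fixed_minus fixed_mult fixed_inverse)

lemma subf_kbar: "subf kbar"
 by (rule subfI) (auto simp: kbar_one kbar_minus kbar_mult kbar_inverse)

lemma K_kbar: "K <= kbar" using kbarI[OF ej_pos(2)] by (auto simp: K_def)

lemma subf_E: "subf (E m)" by (simp add: E_def subf_hull)
lemma E_gen: "g : E m" "K <= E m" "i < m ==> x i : E m"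
 using hull_superset[of "insert g (K \<union> x ` {..<m})"] by (auto simp: E_def)
lemma E_minimal: "subf S ==> g : S ==> K <= S ==> (!!i. i < m ==> x i : S) ==> E m <= S"
 unfolding E_def by (rule hull_minimal) auto
lemma E_mono: "E m <= E (Suc m)" unfolding E_def by (rule hull_mono) auto

lemma x_root: "x i = uminus (gg i) *. x i ^. qj +. x i ^. Q"
 using phi_x[of i] by (simp add: phi_def algebra_simps)

lemma gg_mem: "subf S ==> g : S ==> (!!l. l < i ==> x l : S) ==> gg i : S"
 by (cases i) (simp_all add: subf_minus subf_div subf_pow)

text \<open>Every generator is a polynomial in \<open>g\<close> over the \<open>p\<close>-th powers, by the additive equation for \<open>x i\<close>.\<close>

lemma p_power_decomposition:
 assumes f: "f : E m"
 obtains c where "!!l. c l : E m" "f = w.sum (%l. c l ^. p *. g ^. l) {..p - 1}"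
proof -
 let ?E = "E m"
 \<comment> \<open>\<open>P\<close> is \<open>E^p[g]\<close>; it is shown to be a subfield
   containing all generators.\<close>
 define P where "P = {f. EX c. (ALL l. c l : ?E) & f = w.sum (%l. c l ^. p *. g ^. l) {..p - 1}}"
 note sE = subf_E[of m]
 have PI: "w.sum (%l. c l ^. p *. g ^. l) {..p - 1} : P" if "!!l. c l : ?E" for c using that by (auto simp: P_def)
 have PD: "EX c. (ALL l. c l : ?E) & f = w.sum (%l. c l ^. p *. g ^. l) {..p - 1}" if "f : P" for f using that by (simp add: P_def)
 have fr: "(r -. s) ^. p = r ^. p -. s ^. p" for r s using frob_minus[of r s 1] by simp
 have minus: "r -. s : P" if r: "r : P" and s: "s : P" for r s
 proof -
  obtain c where c: "ALL l. c l : ?E" "r = w.sum (%l. c l ^. p *. g ^. l) {..p - 1}" using PD[OF r] by metis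
  obtain d where d: "ALL l. d l : ?E" "s = w.sum (%l. d l ^. p *. g ^. l) {..p - 1}" using PD[OF s] by metis
  have "r -. s = w.sum (%l. (c l -. d l) ^. p *. g ^. l) {..p - 1}"
   unfolding c(2) d(2) fr by (simp add: w.left_diff_distrib sum_minus)
  thus ?thesis using PI[of "%l. c l -. d l"] c(1) d(1) subf_minus[OF sE] by simp
 qed
 have const: "a ^. p : P" if a: "a : ?E" for a
 proof -
  have "w.sum (%l. (if l = 0 then a else zero) ^. p *. g ^. l) {..p - 1} = w.sum (%l. if l = 0 then a ^. p else zero) {..p - 1}"
   using p_gt_1 by (intro w.sum.cong) (auto simp: w.zero_power)
  also have "\<dots> = a ^. p" by simp
  finally show ?thesis using PI[of "%l. if l = 0 then a else zero"] a subf_zero[OF sE] by (simp only: split: if_splits) simp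
 qed
 have zero: "zero : P" using const[OF subf_zero[OF sE]] p_gt_1 by (simp add: w.zero_power)
 have add: "r +. s : P" if "r : P" "s : P" for r s using minus[OF that(1) minus[OF zero that(2)]] by simp
 have scale: "a ^. p *. r : P" if a: "a : ?E" and r: "r : P" for a r
 proof -
  obtain c where c: "ALL l. c l : ?E" "r = w.sum (%l. c l ^. p *. g ^. l) {..p - 1}" using PD[OF r] by metis
  have "a ^. p *. r = w.sum (%l. (a *. c l) ^. p *. g ^. l) {..p - 1}"
   unfolding c(2) by (simp add: w.sum_distrib_left w.power_mult_distrib w.mult.assoc)
  thus ?thesis using PI[of "%l. a *. c l"] c(1) a subf_mult[OF sE] by simp
 qed
 have timesg: "g *. r : P" if r: "r : P" for r
 proof -
  obtain c where c: "ALL l. c l : ?E" "r = w.sum (%l. c l ^. p *. g ^. l) {..p - 1}" using PD[OF r] by metis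
  obtain s where s: "p = Suc (Suc s)" using p_gt_1 by (metis less_imp_Suc_add add_Suc plus_1_eq_Suc)
  \<comment> \<open>Multiplication by \<open>g\<close> rotates the coefficients: the overflow
    \<open>g^p\<close> is a p-th power and moves into the constant one.\<close>
  let ?d = "%l. if l = 0 then g *. c (p - 1) else c (l - 1)"
  have "w.sum (%l. ?d l ^. p *. g ^. l) {..p - 1} = (g *. c (Suc s)) ^. p +. w.sum (%l. c l ^. p *. g ^. Suc l) {..s}"
   unfolding s by (simp add: w.sum.atMost_Suc_shift del: w.sum.atMost_Suc)
  also have "(g *. c (Suc s)) ^. p = g *. (c (Suc s) ^. p *. g ^. Suc s)"
   unfolding w.power_mult_distrib by (simp add: s algebra_simps)
  also have "w.sum (%l. c l ^. p *. g ^. Suc l) {..s} = g *. w.sum (%l. c l ^. p *. g ^. l) {..s}"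
   unfolding w.sum_distrib_left by (intro w.sum.cong) (simp_all add: algebra_simps)
  also have "g *. (c (Suc s) ^. p *. g ^. Suc s) +. g *. w.sum (%l. c l ^. p *. g ^. l) {..s} = g *. r"
   unfolding c(2) s by (simp add: w.distrib_left w.add.commute)
  finally show ?thesis using PI[of ?d] c(1) E_gen(1) subf_mult[OF sE] by (metis (no_types, lifting))
 qed
 have gpow: "g ^. l *. r : P" if "r : P" for l r
  by (induction l) (use that timesg in \<open>auto simp: w.mult.assoc\<close>)
 have sum: "w.sum h {..n::nat} : P" if "!!l. h l : P" for h n by (induction n) (auto simp: that add)
 have mult: "r *. s : P" if r: "r : P" and s: "s : P" for r s
 proof -
  obtain c where c: "ALL l. c l : ?E" "r = w.sum (%l. c l ^. p *. g ^. l) {..p - 1}" using PD[OF r] by metis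
  have "r *. s = w.sum (%l. c l ^. p *. (g ^. l *. s)) {..p - 1}"
   unfolding c(2) by (simp add: w.sum_distrib_right w.mult.assoc)
  thus ?thesis using c(1) s by (auto intro!: sum scale gpow)
 qed
 have PE: "P <= ?E"
 proof
  fix r assume "r : P"
  then obtain c where c: "ALL l. c l : ?E" "r = w.sum (%l. c l ^. p *. g ^. l) {..p - 1}" using PD by metis
  have "w.sum (%l. c l ^. p *. g ^. l) {..n::nat} : ?E" for n
   by (induction n) (use c(1) E_gen(1) sE in \<open>auto simp: subf_mult subf_pow subf_add\<close>)
  thus "r : ?E" using c(2) by simp
 qed
 have oneP: "one : P" using const[OF subf_one[OF sE]] by simp
 have pow: "r ^. n : P" if "r : P" for r n by (induction n) (auto simp: oneP that mult)
 have inv: "inverse r : P" if r: "r : P" for r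
 proof (cases "r = zero")
  case False
  \<comment> \<open>An inverse is a p-th power times an element of \<open>P\<close>, hence stays in
    \<open>P\<close>.\<close>
  have "inverse r = inverse r ^. p *. r ^. (p - 1)"
  proof -
   obtain s where s: "p = Suc s" using p_gt_1 by (metis less_imp_Suc_add)
   have "inverse r ^. s *. r ^. s = one" using False by (simp add: w.power_mult_distrib[symmetric])
   thus ?thesis by (simp add: s w.mult.assoc)
  qed
  thus ?thesis using scale[OF subf_inverse[OF sE] pow[OF r], of r "p - 1"] PE r by auto
 qed (simp add: zero)
 have sP: "subf P" by (rule subfI) (auto simp: oneP minus mult inv)
 have pp: "a ^. (p ^ i) : P" if "a : ?E" "i > 0" for a i
 proof -
  obtain l where "i = Suc l" using \<open>i > 0\<close> by (cases i) auto
  hence "a ^. (p ^ i) = (a ^. (p ^ l)) ^. p" by (simp add: w.power_mult[symmetric] mult.commute)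
  thus ?thesis using const[OF subf_pow[OF sE \<open>a : ?E\<close>, of "p ^ l"]] by simp
 qed
 have gP: "g : P" using timesg[OF oneP] by simp
 have KP: "K <= P"
 proof
  fix a assume a: "a : K"
  hence "a ^. Q = a" by (simp add: K_def fixed_def Q_def)
  thus "a : P" using pp[of a "e * Suc j"] a E_gen(2)[of m] ej_pos by (auto simp: Q_def)
 qed
 have xP: "i < m ==> x i : P" for i
 proof (induction i rule: less_induct)
  case (less i)
  have "gg i : P" using less by (intro gg_mem[OF sP gP]) auto
  hence "uminus (gg i) *. x i ^. qj +. x i ^. Q : P"
   unfolding qj_def Q_def using less(2) ej_pos by (intro subf_add[OF sP] subf_mult[OF sP] subf_neg[OF sP] pp E_gen(3)) simp_all
  thus ?case by (subst x_root)
 qed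
 show thesis using E_minimal[OF sP gP KP xP] f using PD that by blast
qed

end

context derivation_frame
begin

text \<open>The quotient rule needs a pole of finite order in \<open>t\<close> for each inverse,
  which \<open>arch\<close> provides.\<close>

lemma subf_differentiable:
 assumes S: "subf S" and arch: "!!f. f : S ==> f ~= zero ==> EX n. t ^. n /. f : W"
 shows "subf {f : S. EX f'. (f, f') : CDF}"
proof (rule subfI)
 show "one : {f : S. EX f'. (f, f') : CDF}" using subf_one[OF S] CDF_const[OF k_one] by blast
 fix f assume f: "f : {f : S. EX f'. (f, f') : CDF}"
 then obtain f' where f': "f : S" "(f, f') : CDF" by blast
 show "inverse f : {f : S. EX f'. (f, f') : CDF}"
 proof (cases "f = zero")
  case False
  then obtain n where "t ^. n /. f : W" using arch f'(1) by blast
  from CDF_inverse[OF f'(2) False this] show ?thesis using subf_inverse[OF S f'(1)] by simp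
 qed (use f in simp)
 fix h assume "h : {f : S. EX f'. (f, f') : CDF}"
 then obtain h' where h': "h : S" "(h, h') : CDF" by blast
 show "f -. h : {f : S. EX f'. (f, f') : CDF}" using CDF_minus[OF f'(2) h'(2)] subf_minus[OF S f'(1) h'(1)] by blast
 show "f *. h : {f : S. EX f'. (f, f') : CDF}" using CDF_mult[OF f'(2) h'(2)] subf_mult[OF S f'(1) h'(1)] by blast
qed

end

section \<open>Places where g is integral\<close>

locale valued_tower = torsion_tower + valued_closed_field
begin

lemma K_W: "K <= W" using K_kbar kbar_W by blast

text \<open>From \<open>a^(Q-1) - c a^(qj-1) = 1\<close>: with \<open>c\<close> integral, neither a
  small nor a large \<open>a\<close> can satisfy this.\<close>

lemma kernel_unit:
 assumes c: "c : W" and a: "phi c a = zero" "a ~= zero"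
 shows "a : W" "a ~: M"
proof -
 have n: "qj - 1 > 0" "Q - 1 > 0" "Q - qj > 0" using Q_gt_qj qj_gt_q q_ge by auto
 have s: "a ^. Q = a *. a ^. (Q - 1)" "a ^. qj = a *. a ^. (qj - 1)"
  using n w.power_Suc[of a "Q - 1"] w.power_Suc[of a "qj - 1"] by auto
 have "a *. (a ^. (Q - 1) -. c *. a ^. (qj - 1)) = a ^. Q -. c *. a ^. qj" unfolding s by (simp add: algebra_simps)
 also have "\<dots> = a *. one" using a(1) by (simp add: phi_def algebra_simps)
 finally have eq: "a ^. (Q - 1) -. c *. a ^. (qj - 1) = one" using a(2) by simp
 show "a ~: M"
 proof
  assume "a : M"
  hence "a ^. (Q - 1) -. c *. a ^. (qj - 1) : M" using n by (intro M_minus M_mult2 c M_pow) auto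
  thus False using eq by simp
 qed
 show "a : W"
 proof (rule ccontr)
  assume "a ~: W"
  hence i: "inverse a : M" by (rule inverse_M)
  have "inverse a ^. (Q - 1) +. c *. inverse a ^. (Q - qj) : M" using n i by (intro M_add M_mult2 c M_pow) auto
  moreover have "inverse a ^. (Q - 1) +. c *. inverse a ^. (Q - qj) = one"
  proof -
   have 1: "inverse a ^. Q *. a ^. d = inverse a ^. (Q - d)" if "d <= Q" for d
   proof -
    have "inverse a ^. Q = inverse a ^. (Q - d) *. inverse a ^. d" using that by (simp add: w.power_add[symmetric])
    thus ?thesis using a(2) by (simp add: w.mult.assoc w.power_mult_distrib[symmetric])
   qed
   have "inverse a ^. Q *. a ^. 1 +. c *. (inverse a ^. Q *. a ^. qj) = inverse a ^. Q *. (a +. c *. a ^. qj)"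
    by (simp add: algebra_simps)
   also have "a +. c *. a ^. qj = a ^. Q" using a(1) by (simp add: phi_def)
   finally show ?thesis using 1[of 1] 1[of qj] Q_gt_qj a(2) by (simp add: w.power_mult_distrib[symmetric])
  qed
  ultimately show False by simp
 qed
qed

lemma gg_x_integral: "g : W ==> gg i : W & x i : W & x i ~: M"
proof (induction i)
 case 0
 thus ?case using kernel_unit[OF _ phi_x[of 0] x_nz[of 0]] by simp
next
 case (Suc i)
 hence "gg (Suc i) : W" by (auto intro!: v_div not_M_pow)
 thus ?case using kernel_unit[OF _ phi_x[of "Suc i"] x_nz[of "Suc i"]] by blast
qed

text \<open>If \<open>gg i\<close> vanishes, the equation of \<open>x i\<close> reduces to
  \<open>x^Q = x\<close>. Then \<open>gg (i + 1)\<close> vanishes too, being an integral multiple of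
  \<open>x i ^ Q - x i\<close>.\<close>

lemma x_residue: assumes "g : M" shows "gg i : M & (EX a:K. x i -. a : M)"
proof -
 have res: "x i ^. Q -. x i : M" if "gg i : M" for i
 proof -
  have "x i ^. Q -. x i = gg i *. x i ^. qj" using phi_x[of i] by (simp add: phi_def algebra_simps)
  thus ?thesis using M_mult[OF that, of "x i ^. qj"] gg_x_integral[OF M_W[OF assms], of i] by simp
 qed
 have gM: "gg i : M" for i
 proof (induction i)
  case (Suc i)
  have eq: "gg (Suc i) = x i ^. q /. (x i *. x i ^. Q) *. (x i ^. Q -. x i)"
   using x_nz[of i] by (simp add: field_simps)
  have "x i ^. q /. (x i *. x i ^. Q) : W"
   using gg_x_integral[OF M_W[OF assms], of i] by (intro v_div not_M_mult not_M_pow) auto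
  from M_mult2[OF this res[OF Suc]] show ?case by (simp only: eq)
 qed (simp add: assms)
 have "EX a:K. x i -. a : M" unfolding K_def
  using res[OF gM[of i]] ej_pos(2) by (intro residue_fixed) (simp_all only: Q_def)
 thus ?thesis using gM by simp
qed

end

text \<open>A place where \<open>g\<close> is integral with residue \<open>\<gamma>\<close>. The
  equations of the \<open>x i\<close> have integral coefficients and are separable, so
  \<open>g - \<gamma>\<close> stays a local parameter, and g' = 1.\<close>

locale finite_place_frame = torsion_tower + derivation_frame +
 fixes \<gamma> :: 'a and m :: nat
 assumes K_k: "K <= k" and g_W: "g : W" and \<gamma>: "\<gamma> : k" and t_def: "t = g -. \<gamma>"
  and x_res: "i < m ==> EX a:k. x i -. a : M"
  and arch: "f : E m ==> f ~= zero ==> EX n. t ^. n /. f : W"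
begin

sublocale valued_tower ..

lemma g_CD: "(g, one) : CD" using CD_add[OF CD_t CD_const[OF \<gamma>]] by (simp add: t_def)

lemma x_CD: assumes c: "(gg i, d) : CD" and i: "i < m" shows "EX d. (x i, d) : CD"
proof -
 obtain a where a: "a : k" "x i -. a : M" using x_res[OF i] by blast
 have eq: "x i = zero +. uminus (gg i) *. x i ^. (p ^ (e * j)) +. one *. x i ^. (p ^ (e * Suc j))"
  using x_root[of i] by (simp add: qj_def Q_def)
 have xW: "x i : W" using gg_x_integral[OF g_W] by simp
 show ?thesis
  using CD_additive_root[OF CD_const[OF k_zero] CD_neg[OF c] CD_const[OF k_one] xW eq ej_pos a] by blast
qed

lemma gg_x_CD: "i < m ==> (EX d. (gg i, d) : CD) & (EX d. (x i, d) : CD)"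
proof (induction i)
 case 0
 have g0: "(gg 0, one) : CD" using g_CD by simp
 show ?case using x_CD[OF g0 0] g0 by blast
next
 case (Suc i)
 then obtain d where d: "(x i, d) : CD" by auto
 have xM: "x i ~: M" "x i ^. Q ~: M" using gg_x_integral[OF g_W, of i] not_M_pow by auto
 note pq = CD_power[OF d, of q]
 from CD_minus[OF CD_mult[OF pq CD_inverse[OF d xM(1)]] CD_mult[OF pq CD_inverse[OF CD_power[OF d, of Q] xM(2)]]]
 obtain d2 where d2: "(gg (Suc i), d2) : CD" by (auto simp: w.divide_inverse)
 show ?case using x_CD[OF d2 Suc.prems] d2 by blast
qed

lemma E_CDF: assumes "f : E m" shows "EX d. (f, d) : CDF"
proof -
 have "E m <= {f : E m. EX f'. (f, f') : CDF}"
 proof (rule E_minimal[OF subf_differentiable[OF subf_E arch]])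
  show "g : {f : E m. EX f'. (f, f') : CDF}" using CD_CDF[OF g_CD] E_gen(1) by blast
  show "K <= {f : E m. EX f'. (f, f') : CDF}"
  proof
   fix c assume "c : K"
   thus "c : {f : E m. EX f'. (f, f') : CDF}" using CDF_const[of c] K_k E_gen(2)[of m] by blast
  qed
  fix i assume i: "i < m"
  then obtain d where "(x i, d) : CD" using gg_x_CD by blast
  thus "x i : {f : E m. EX f'. (f, f') : CDF}" using CD_CDF[of "x i" d] E_gen(3)[OF i] by blast
 qed
 thus ?thesis using assms by blast
qed

text \<open>Differentiation along \<open>g\<close> preserves integrality here, so the general bound
  applies with pole growth 0.\<close>

lemma top_coefficient_integral:
 assumes i: "i < p" and f: "!!l. f l : E m" and s: "w.sum (%l. f l ^. p *. g ^. l) {..i} : W"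
 shows "f i : W"
proof -
 have step: "t ^. (Suc n * 0) *. (h' /. one) : W" if h: "(h, h') : CDF" "t ^. (n * 0) *. h : W" for h h' n
  using CD_W[OF CDF_W[OF h(1)]] h(2) by simp
 have "t ^. ((0 + i) * 0) *. f i ^. p : W"
  by (rule top_coefficient_bound[OF CD_CDF[OF g_CD] _ step i]) (use E_CDF[OF f] s in simp_all)
 thus ?thesis using p_gt_1 pow_W[of "f i" p] by simp
qed

lemma residue_k: assumes "f : E m" "f : W" shows "EX c:k. f -. c : M"
 using E_CDF[OF assms(1)] CDF_W[OF _ assms(2)] CD_residue by blast

lemma uniformizer: assumes "f : E m" "f : M" shows "f /. t : W"
 using E_CDF[OF assms(1)] CDF_W[OF _ M_W[OF assms(2)]] CD_M[OF _ assms(2)] by blast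

end

context valued_tower
begin

lemma subfield_frame:
 assumes "subf S" "S <= W" "c : S" "g -. c : M" "c : kbar"
 shows "derivation_frame divide inverse times one plus zero minus uminus p W S (g -. c)"
proof
 show "g -. c ~= zero" using assms(5) g_kbar by auto
qed (use assms in \<open>auto simp: subf_def\<close>)

lemma finite_place_zero:
 assumes g: "g : M" and arch: "!!f. f : E m ==> f ~= zero ==> EX n. g ^. n /. f : W"
  and f: "f : E m" "f : W"
 shows "EX c:K. f -. c : M" "f : M ==> f /. g : W"
proof -
 have z: "zero : K" by (simp add: K_def fixed_zero)
 interpret derivation_frame divide inverse times one plus zero minus uminus p W K "g -. zero"
  using subfield_frame[of K zero] g z K_W K_kbar subf_fixed by (auto simp: K_def)
 interpret finite_place_frame divide inverse times one plus zero minus uminus p e j g W K "g -. zero" zero m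
  by unfold_locales (use g x_residue[OF g] z M_W[OF g] arch in auto)
 show "EX c:K. f -. c : M" using residue_k[OF f] .
 show "f : M ==> f /. g : W" using uniformizer[OF f(1)] by simp
qed

lemma finite_place_integral:
 assumes g: "g : W" and c: "c : kbar" "g -. c : M" and r: "!!i. i < m ==> EX a:kbar. x i -. a : M"
  and arch: "!!f. f : E m ==> f ~= zero ==> EX n. (g -. c) ^. n /. f : W"
  and i: "i < p" and f: "!!l. f l : E m" and s: "w.sum (%l. f l ^. p *. g ^. l) {..i} : W"
 shows "f i : W"
proof -
 have kW: "kbar <= W" using kbar_W by blast
 interpret derivation_frame divide inverse times one plus zero minus uminus p W kbar "g -. c"
  by (rule subfield_frame[OF subf_kbar kW c(1,2,1)])
 interpret finite_place_frame divide inverse times one plus zero minus uminus p e j g W kbar "g -. c" c m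
  by unfold_locales (use g c r arch K_kbar in auto)
 show ?thesis by (rule top_coefficient_integral[OF i f s])
qed

end

context closed_field
begin

text \<open>All conjugates of \<open>a\<close> are affine images of \<open>a\<close> over a finite field, so two of them agree.\<close>

lemma kbar_affine:
 assumes eq: "a ^. (p ^ f) = \<alpha> *. a +. \<beta>" and f: "f > 0" and k: "\<alpha> : kbar" "\<beta> : kbar"
 shows "a : kbar"
proof -
 obtain i where i: "i > 0" "\<alpha> : fixed i" "\<beta> : fixed i" using kbar_common[OF k] by blast
 have fr: "c ^. (p ^ l) : fixed i" if "c : fixed i" for c l
  using that by (simp add: fixed_def w.power_mult[symmetric] mult.commute) (simp add: w.power_mult)
 have "EX c:fixed i \<times> fixed i. a ^. (p ^ (f * r)) = fst c *. a +. snd c" for r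
 proof (induction r)
  case 0
  show ?case by (rule bexI[of _ "(one, zero)"]) (simp_all add: fixed_one fixed_zero)
 next
  case (Suc r)
  then obtain c d where c: "c : fixed i" "d : fixed i" "a ^. (p ^ (f * r)) = c *. a +. d" by auto
  have "a ^. (p ^ (f * Suc r)) = (a ^. (p ^ (f * r))) ^. (p ^ f)" by (simp add: w.power_mult[symmetric] power_add mult.commute)
  also have "\<dots> = c ^. (p ^ f) *. (\<alpha> *. a +. \<beta>) +. d ^. (p ^ f)"
   unfolding c(3) by (simp add: frob_add w.power_mult_distrib eq)
  also have "\<dots> = (c ^. (p ^ f) *. \<alpha>) *. a +. (c ^. (p ^ f) *. \<beta> +. d ^. (p ^ f))" by (simp add: algebra_simps)
  finally show ?case using fr[OF c(1)] fr[OF c(2)] i(2,3)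
   by (intro bexI[of _ "(c ^. (p ^ f) *. \<alpha>, c ^. (p ^ f) *. \<beta> +. d ^. (p ^ f))"]) (auto intro!: fixed_mult fixed_add)
 qed
 hence "range (%r. a ^. (p ^ (f * r))) <= (%c. fst c *. a +. snd c) ` (fixed i \<times> fixed i)" by blast
 moreover have "finite ((%c. fst c *. a +. snd c) ` (fixed i \<times> fixed i))" using card_fixed(1)[OF i(1)] by simp
 ultimately have "finite (range (%r. a ^. (p ^ (f * r))))" by (rule finite_subset)
 hence "\<not> inj (%r. a ^. (p ^ (f * r)))" using finite_imageD[of _ "UNIV::nat set"] by auto
 then obtain r s where rs: "r < s" "a ^. (p ^ (f * r)) = a ^. (p ^ (f * s))"
  unfolding inj_on_def by (metis linorder_neqE_nat)
 have "a ^. (p ^ (f * s)) = (a ^. (p ^ (f * (s - r)))) ^. (p ^ (f * r))"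
  using rs(1) by (simp add: w.power_mult[symmetric] power_add[symmetric] distrib_left[symmetric])
 hence "a ^. (p ^ (f * (s - r))) = a" using rs(2) frob_inj by metis
 thus ?thesis using kbarI[of "f * (s - r)" a] f rs(1) by (simp add: fixed_def)
qed

end

section \<open>Places where g has a pole\<close>

context valued_tower
begin

text \<open>The operator \<open>phi g\<close> rescaled by \<open>s\<close> with
  \<open>g s^(qj-1) = -1\<close>, for \<open>d = s^(Q-1)\<close>. At a pole of \<open>g\<close> this
  \<open>d\<close> is small, so modulo \<open>M\<close> only \<open>u - u^qj\<close> remains; the
  other solutions are unbounded.\<close>

definition Phi :: "'a => 'a => 'a" where "Phi d u = u -. u ^. qj -. d *. u ^. Q"

lemma Phi_add: "Phi d (u +. v) = Phi d u +. Phi d v" by (simp add: Phi_def frobs algebra_simps)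
lemma Phi_minus: "Phi d (u -. v) = Phi d u -. Phi d v" by (simp add: Phi_def frobs algebra_simps)

lemma fixed_e_powers: assumes "c : fixed e" shows "c ^. q = c" "c ^. qj = c" "c ^. Q = c"
 using assms fixed_pow[OF assms] by (auto simp: fixed_def qj_def Q_def simp del: mult_Suc_right)

lemma Phi_scale: "c : fixed e ==> Phi d (c *. u) = c *. Phi d u"
 by (simp add: Phi_def fixed_e_powers algebra_simps)

lemma M_one_plus_unit: assumes "r +. one : M" shows "r : W" "r ~: M"
proof -
 show "r : W" using v_minus[OF M_W[OF assms] v_one] by simp
 show "r ~: M" using M_minus[OF assms, of r] by auto
qed

text \<open>In terms of r = 1/u the equation becomes monic with constant term \<open>- d\<close> in
  \<open>M\<close>, so it has a root near zero.\<close>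

lemma big_root:
 assumes d: "d : M" "d ~= zero" shows "EX u. u ~: W & Phi d u = zero"
proof -
 have n: "Q - 1 > 0" "Q - qj > 0" "Q - qj < Q - 1" "0 < Q - 1" "qj <= Q" "1 <= Q" using Q_gt_qj qj_gt_q q_ge by auto
 let ?h = "%x. x ^. (Q - 1) +. uminus one *. x ^. (Q - qj) +. uminus d *. x ^. 0"
 have mo: "EX l. monic (Q - 1) ?h l" using n by (intro monic_add_ex monic_power_ex) linarith+
 have "?h zero : M" using n using M_neg[OF d(1)] by (simp add: w.zero_power)
 then obtain r where r: "?h r = zero" "zero -. r : M" using residue_root mo by blast
 have rM: "r : M" using M_neg[OF r(2)] by simp
 have rnz: "r ~= zero" using r(1) n d(2) by (auto simp: w.zero_power)
 let ?u = "inverse r"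
 have "?u ^. Q *. r ^. k = ?u ^. (Q - k)" if "k <= Q" for k
 proof -
  have "?u ^. Q = ?u ^. (Q - k) *. ?u ^. k" using that by (simp add: w.power_add[symmetric])
  thus ?thesis using rnz by (simp add: w.mult.assoc w.power_mult_distrib[symmetric])
 qed
 note pw = this[of "Q - 1"] this[of "Q - qj"] this[of 0]
 have "?u ^. Q *. ?h r = ?u ^. Q *. r ^. (Q - 1) -. ?u ^. Q *. r ^. (Q - qj) -. d *. (?u ^. Q *. r ^. 0)"
  by (simp add: algebra_simps)
 also have "\<dots> = Phi d ?u" using pw n by (simp add: Phi_def)
 finally have "Phi d ?u = zero" unfolding r(1) by simp
 moreover have "?u ~: W"
 proof
  assume "?u : W"
  from M_mult[OF rM this] show False using rnz by simp
 qed
 ultimately show ?thesis by blast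
qed

text \<open>For unbounded \<open>u\<close> the terms \<open>u^qj\<close> and \<open>d u^Q\<close>
  must cancel to leading order, as both \<open>u\<close> and \<open>Phi d u\<close> are smaller than
  \<open>u^qj\<close>.\<close>

lemma big_leading:
 assumes u: "u ~: W" and Phi: "Phi d u : W" shows "d *. u ^. Q /. u ^. qj +. one : M"
proof -
 have nz: "u ~= zero" using u by auto
 have n: "qj - 1 > 0" using qj_gt_q q_ge by simp
 have i: "inverse u : M" by (rule inverse_M[OF u])
 have 1: "u /. u ^. qj : M" using nz n w.power_Suc[of u "qj - 1"] using M_pow[OF i n] by (simp add: field_simps)
 have "inverse u ^. qj *. Phi d u : M" using n by (intro M_mult Phi M_pow i) simp
 hence 2: "Phi d u /. u ^. qj : M" by (simp add: w.divide_inverse w.power_inverse w.mult.commute)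
 show ?thesis using nz using M_minus[OF 1 2] by (simp add: Phi_def field_simps)
qed

text \<open>Solves \<open>Phi d u = U\<close> with \<open>u^qj\<close> close to \<open>- U\<close>;
  the condition on \<open>d U^q / U\<close> says that the term \<open>d u^Q\<close> is negligible,
  and it is inherited by the solution.\<close>

lemma lift:
 assumes d: "d : M" and U: "U ~: W" "d *. U ^. q /. U : M"
 shows "EX u. u ~: W & d *. u ^. q /. u : M & Phi d u = U & u ^. qj /. U +. one : M"
proof -
 have n: "0 < Q" "Q - 1 < Q" "Q - qj < Q" "Q - qj > 0" "qj > 0" "qj - 1 > 0" "qj <= Q" "1 <= Q" "Q - 1 > 0"
  using Q_gt_qj qj_gt_q q_ge by auto
 have Unz: "U ~= zero" using U by auto
 have "EX c. c ^. qj +. U *. c ^. 0 = zero" using n by (intro root_ex[of qj] monic_add_ex monic_power_ex)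
 then obtain c where c: "c ^. qj = uminus U" by (auto simp: w.eq_neg_iff_add_eq_0)
 have cW: "c ~: W" using v_pow[of c qj] v_neg[of "uminus U"] U(1) c by auto
 have cnz: "c ~= zero" using cW by auto
 define e1 where "e1 = c /. U"
 define e2 where "e2 = d *. c ^. Q /. U"
 have cQ: "c ^. Q = uminus (U ^. q)" unfolding pow_Q c by (rule frob_neg)
 have e2: "e2 : M" using M_neg[OF U(2)] by (simp add: e2_def cQ)
 have "uminus (c /. c ^. qj) : M" using cnz n w.power_Suc[of c "qj - 1"] using M_neg M_pow[OF inverse_M[OF cW] n(6)] by (simp add: field_simps)
 hence e1: "e1 : M" by (simp add: c e1_def)
 \<comment> \<open>The equation for \<open>u = c/r\<close>, multiplied by a power of
   \<open>r\<close>: the sizes \<open>e1\<close> and \<open>e2\<close> of the minor terms are in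
   \<open>M\<close>, so 1 is a root modulo \<open>M\<close>.\<close>
 let ?h = "%x. x ^. Q +. uminus e1 *. x ^. (Q - 1) +. uminus one *. x ^. (Q - qj) +. e2 *. x ^. 0"
 have mo: "EX l. monic Q ?h l" using n by (intro monic_add_ex monic_power_ex) auto
 have "?h one : M" using M_minus[OF e2 e1] by (simp add: algebra_simps)
 then obtain r where r: "?h r = zero" "one -. r : M" using residue_root mo by blast
 have rW: "r : W" "r ~: M"
 proof -
  have "one -. (one -. r) = r" "one -. r +. r = one" by (simp_all add: algebra_simps)
  thus "r : W" "r ~: M" using v_minus[OF v_one M_W[OF r(2)]] M_add[OF r(2), of r] by auto
 qed
 have rnz: "r ~= zero" using rW by auto
 let ?v = "inverse r"
 let ?u = "c *. ?v"
 have "?v ^. Q *. r ^. k = ?v ^. (Q - k)" if "k <= Q" for k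
 proof -
  have "?v ^. Q = ?v ^. (Q - k) *. ?v ^. k" using that by (simp add: w.power_add[symmetric])
  thus ?thesis using rnz by (simp add: w.mult.assoc w.power_mult_distrib[symmetric])
 qed
 note pw = this[of Q] this[of "Q - 1"] this[of "Q - qj"] this[of 0]
 have "zero = ?v ^. Q *. ?h r" unfolding r(1) by simp
 also have "\<dots> = ?v ^. Q *. r ^. Q -. e1 *. (?v ^. Q *. r ^. (Q - 1)) -. ?v ^. Q *. r ^. (Q - qj) +. e2 *. (?v ^. Q *. r ^. 0)"
  by (simp add: algebra_simps)
 also have "\<dots> = one -. e1 *. ?v -. ?v ^. qj +. e2 *. ?v ^. Q" using pw n by simp
 finally have v: "e1 *. ?v +. ?v ^. qj -. e2 *. ?v ^. Q = one" by (simp add: algebra_simps)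
 have eU: "e1 *. U = c" "e2 *. U = d *. c ^. Q" using Unz by (simp_all add: e1_def e2_def)
 have "Phi d ?u = (e1 *. U) *. ?v -. uminus U *. ?v ^. qj -. (e2 *. U) *. ?v ^. Q"
  unfolding eU by (simp add: Phi_def w.power_mult_distrib c w.mult.assoc)
 also have "\<dots> = U *. (e1 *. ?v +. ?v ^. qj -. e2 *. ?v ^. Q)" by (simp add: algebra_simps)
 finally have PU: "Phi d ?u = U" unfolding v by simp
 have uj: "?u ^. qj = uminus U *. ?v ^. qj" by (simp add: w.power_mult_distrib c)
 have "?v -. one = ?v *. (one -. r)" using rnz by (simp add: algebra_simps)
 hence "?v -. one : M" using M_mult2[of ?v "one -. r"] r(2) rW(2) by (simp add: not_M)
 hence "(?v -. one) ^. qj : M" using n by (intro M_pow)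
 hence "uminus (?v ^. qj -. one) : M" unfolding frobs by (intro M_neg) simp
 hence rho: "?u ^. qj /. U +. one : M" using Unz unfolding uj by (simp add: algebra_simps)
 have "?u ~: W"
 proof
  assume "?u : W"
  hence "?u ^. qj /. (?u ^. qj /. U) : W" using M_one_plus_unit(2)[OF rho] by (intro v_div v_pow)
  thus False using U(1) cnz rnz by simp
 qed
 moreover have "d *. ?u ^. q /. ?u : M"
 proof -
  define R where "R = ?u ^. qj /. U"
  have R: "R : W" "R ~: M" using M_one_plus_unit[OF rho] unfolding R_def by blast+
  have uR: "?u ^. qj = R *. U" using Unz by (simp add: R_def)
  have dq: "d ^. qj = d *. d ^. (qj - 1)" using n w.power_Suc[of d "qj - 1"] by simp
  have "(d *. ?u ^. q /. ?u) ^. qj = d ^. qj *. (?u ^. qj) ^. q /. ?u ^. qj"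
   by (simp add: w.power_mult_distrib w.power_divide w.power_mult[symmetric] mult.commute)
  also have "\<dots> = (d ^. (qj - 1) *. (R ^. q /. R)) *. (d *. U ^. q /. U)"
   unfolding uR dq by (simp add: field_simps)
  also have "\<dots> : M"
   using R M_W[OF d] by (intro M_mult2 U(2) v_mult v_pow v_div) auto
  finally show ?thesis by (rule pow_M)
 qed
 ultimately show ?thesis using PU rho by blast
qed

lemma chain_exists:
 assumes d: "d : M" "d ~= zero"
 obtains u where "u 0 ~: W" "Phi d (u 0) = zero" "!!i::nat. u i ~: W" "!!i. Phi d (u (Suc i)) = u i"
  "!!i. u (Suc i) ^. qj /. u i +. one : M"
proof -
 obtain u0 where u0: "u0 ~: W" "Phi d u0 = zero" using big_root[OF d] by blast
 have lead: "d *. u0 ^. Q /. u0 ^. qj +. one : M" using big_leading[OF u0(1)] u0(2) by simp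
 have u0nz: "u0 ~= zero" using u0(1) by auto
 have i: "inverse u0 : M" by (rule inverse_M[OF u0(1)])
 let ?n = "(qj - 1) * (q - 1)"
 have npos: "?n > 0" using qj_gt_q q_ge by simp
 \<comment> \<open>By \<open>lead\<close>, \<open>d u0^Q\<close> has the size of
   \<open>u0^qj\<close>; so \<open>d u0^q / u0\<close> has the size of a negative power of
   \<open>u0\<close> with this exponent.\<close>
 have e: "Q + 1 = qj + q + ?n"
 proof -
  obtain a b where ab: "qj = Suc a" "q = Suc b" using qj_gt_q q_ge by (metis Suc_le_D less_imp_le_nat numeral_2_eq_2)
  show ?thesis unfolding Q_eq ab by simp
 qed
 have "d *. u0 ^. q /. u0 = (d *. u0 ^. Q /. u0 ^. qj) *. inverse u0 ^. ?n"
 proof -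
  have "u0 ^. q *. u0 ^. qj *. u0 ^. ?n = u0 ^. Q *. u0"
   using arg_cong[OF e, of "%n. u0 ^. n"] by (simp add: w.power_add algebra_simps)
  thus ?thesis using u0nz by (simp add: field_simps)
 qed
 hence first: "d *. u0 ^. q /. u0 : M"
  using M_mult2[OF M_one_plus_unit(1)[OF lead] M_pow[OF i npos]] by simp
 let ?P = "%(n::nat) U. U ~: W & d *. U ^. q /. U : M & (n = 0 --> U = u0)"
 let ?R = "%(n::nat) U u. Phi d u = U & u ^. qj /. U +. one : M"
 have "EX u. ALL n. ?P n (u n) & ?R n (u n) (u (Suc n))"
 proof (rule dependent_nat_choice)
  show "EX x. ?P 0 x" using u0(1) first by blast
 next
  fix U n assume "?P n U"
  hence "EX u. u ~: W & d *. u ^. q /. u : M & Phi d u = U & u ^. qj /. U +. one : M" using lift[OF d(1)] by blast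
  thus "EX y. ?P (Suc n) y & ?R n U y" by auto
 qed
 then obtain u where u: "!!n. ?P n (u n) & ?R n (u n) (u (Suc n))" by blast
 show thesis using that[of u] u u0 by auto
qed

text \<open>By \<open>big_leading\<close> the ratio r of two unbounded solutions satisfies
  \<open>r^(Q-qj) = 1\<close> modulo \<open>M\<close>, and taking the qj-th root
  \<open>r^(q-1) = 1\<close>; so r is congruent to a nonzero element of the field with
  \<open>q\<close> elements. Removing that multiple of \<open>u\<close> leaves a bounded element, or
  a second ratio would be congruent to zero.\<close>

lemma torsion_reduction:
 assumes u: "u ~: W" "Phi d u = zero" and v: "Phi d v : W"
 shows "EX c:fixed e. v -. c *. u : W"
proof (cases "v : W")
 case True
 thus ?thesis using fixed_zero[of e] by (intro bexI[of _ zero]) simp_all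
next
 case False
 have ratio: "EX c:fixed e. y /. u -. c : M & c ~= zero" if y: "y ~: W" "Phi d y : W" for y
 proof -
  have nz: "y ~= zero" "u ~= zero" using y(1) u(1) by auto
  have ly: "d *. y ^. Q /. y ^. qj +. one : M" and lu: "d *. u ^. Q /. u ^. qj +. one : M"
   using big_leading[OF y] big_leading[OF u(1)] u(2) by auto
  have dnz: "d ~= zero" using lu by auto
  let ?a = "d *. y ^. Q /. y ^. qj" and ?b = "d *. u ^. Q /. u ^. qj"
  define r where "r = y /. u"
  have rnz: "r ~= zero" using nz by (simp add: r_def)
  have S: "Suc (q - 1) = q" using q_ge by simp
  have "r ^. Suc (q - 1) /. r = r ^. (q - 1)" using rnz by simp
  hence rq: "r ^. q /. r = r ^. (q - 1)" unfolding S .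
  have "inverse ?b *. (?a -. ?b) : M" using M_minus[OF ly lu] using M_one_plus_unit(2)[OF lu] by (intro M_mult2) (simp_all add: not_M)
  also have "inverse ?b *. (?a -. ?b) = r ^. Q /. r ^. qj -. one"
   using nz dnz by (simp add: r_def field_simps)
  also have "\<dots> = (r ^. q /. r -. one) ^. qj"
   unfolding frobs w.power_divide by (simp add: Q_eq w.power_mult[symmetric] mult.commute)
  finally have m: "r ^. q /. r -. one : M" by (rule pow_M)
  have rW: "r : W"
  proof -
   show ?thesis using v_add[OF M_W[OF m] v_one] using pow_W[of r "q - 1"] q_ge unfolding rq by simp
  qed
  have "r ^. q -. r : M" using rnz using M_mult2[OF rW m] by (simp add: algebra_simps)
  then obtain c where c: "c : fixed e" "r -. c : M" using residue_fixed[OF e_pos] by blast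
  have "c ~= zero"
  proof
   assume "c = zero"
   hence rM: "r : M" using c(2) by simp
   have "r ^. q /. r : M" using M_pow[OF rM, of "q - 1"] q_ge unfolding rq by simp
   from M_minus[OF this m] show False by (simp add: w.diff_diff_eq2)
  qed
  thus ?thesis using c unfolding r_def by blast
 qed
 obtain c where c: "c : fixed e" "v /. u -. c : M" using ratio[OF False v] by blast
 have unz: "u ~= zero" using u(1) by auto
 have "v -. c *. u : W"
 proof (rule ccontr)
  assume n: "v -. c *. u ~: W"
  have "Phi d (v -. c *. u) : W" using v u(2) by (simp add: Phi_minus Phi_scale[OF c(1)])
  then obtain c' where c': "c' : fixed e" "(v -. c *. u) /. u -. c' : M" "c' ~= zero" using ratio[OF n] by blast
  have "v /. u -. c -. c' : M" using unz using c'(2) by (simp add: w.diff_divide_distrib)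
  from M_minus[OF c(2) this] have "c' : M" by (simp add: algebra_simps)
  moreover have "inverse c' : W" using kbar_W[OF kbarI[OF e_pos fixed_inverse[OF c'(1)]]] .
  ultimately show False using c'(3) by (simp add: M_def)
 qed
 thus ?thesis using c(1) by blast
qed

end

text \<open>Over a pole of \<open>g\<close> the torsion points are \<open>s\<close> times torsion points of \<open>Phi (s\<^bsup>Q-1\<^esup>)\<close>. Of these, \<open>u 0\<close>,
 \<open>u 1\<close>, ... form a compatible system of unbounded ones, and \<open>t\<close> is a uniformizer of the field they generate.\<close>

locale infinite_place = valued_tower +
 fixes s :: 'a and u :: "nat => 'a" and t :: 'a and L :: nat
 assumes g_s: "g *. s ^. qj = uminus s" and s_M: "s : M" and s_nz: "s ~= zero"
  and u_W: "u i ~: W" and Phi_u_0: "Phi (s ^. (Q - 1)) (u 0) = zero"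
  and Phi_u: "Phi (s ^. (Q - 1)) (u (Suc i)) = u i" and u_ratio: "u (Suc i) ^. qj /. u i +. one : M"
  and t_u: "t ^. (Q - 1) *. u L = one"
begin

lemma numbers: "q >= 2" "qj > q" "Q > qj" "Q - 1 > 0" "qj >= 1" "Suc (Q - 1) = Q"
 using q_ge qj_gt_q Q_gt_qj by auto

lemma u_nz: "u i ~= zero" using u_W[of i] v_zero by metis

lemma t_nz0: "t ~= zero" using t_u numbers by (auto simp: w.zero_power)

lemma t_in_M: "t : M"
proof -
 have "t ^. (Q - 1) = inverse (u L)" using t_u u_nz[of L] by (simp add: field_simps)
 thus ?thesis using inverse_M[OF u_W[of L]] pow_M[of t "Q - 1"] by simp
qed

sublocale derivation_frame divide inverse times one plus zero minus uminus p W kbar t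
 using t_in_M t_nz0 kbar_W by unfold_locales (auto intro: kbar_one kbar_minus kbar_mult kbar_inverse)

text \<open>The scale in which \<open>t\<close> has order one: \<open>u i\<close> has order
  \<open>- A i\<close> and \<open>dl\<close> has order \<open>V\<close>, so \<open>mu i\<close> and
  \<open>be\<close> are the unit parts. A prime marks the derivative along \<open>t\<close>.\<close>

definition dl :: 'a where "dl = s ^. (Q - 1)"
definition A :: "nat => nat" where "A i = (Q - 1) * qj ^ (L - i)"
definition V :: nat where "V = (Q - qj) * A 0"
text \<open>Differentiating \<open>u i = u (i+1) - u (i+1)^qj - dl u (i+1)^Q\<close> gives
  \<open>u i' = u (i+1)' - dl' u (i+1)^Q\<close>, and \<open>u 0' = dl' u 0^Q\<close>; so the
  derivative of \<open>u i\<close> is \<open>dl' S i\<close>.\<close>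

definition S :: "nat => 'a" where "S i = w.sum (%l. u l ^. Q) {..i}"
text \<open>Forced by \<open>u L = t^(1-Q)\<close>, whose derivative is \<open>t^(-Q)\<close> in
  characteristic \<open>p\<close>.\<close>

definition dl' :: 'a where "dl' = inverse (t ^. Q) /. S L"
definition be :: 'a where "be = dl /. t ^. V"
definition be' :: 'a where "be' = dl' /. t ^. V"
definition mu :: "nat => 'a" where "mu i = t ^. A i *. u i"
definition mu' :: "nat => 'a" where "mu' i = D (A i) *. u i +. t ^. A i *. (dl' *. S i)"

lemma A_Suc: "i < L ==> A i = qj * A (Suc i)"
 by (simp add: A_def Suc_diff_Suc[symmetric])
lemma A_less: "i < L ==> A (Suc i) < A 0"
 unfolding A_def using numbers by (intro mult_strict_left_mono power_strict_increasing) auto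
lemma QA: "Q * A 0 = V + qj * A 0" using numbers by (simp add: V_def diff_mult_distrib)

lemma p_dvd: "p dvd qj" "p dvd Q - qj"
proof -
 show 1: "p dvd qj" unfolding qj_def using ej_pos by (intro dvd_power) simp
 show "p dvd Q - qj" using 1 Q_eq by simp
qed

lemma D_zero: "p dvd n ==> D n = zero" by (simp add: D_def scalar_dvd)

lemma mu_L: "mu L = one" "mu L : W" "mu L ~: M" using t_u by (simp_all add: mu_def A_def)

text \<open>Downward from \<open>mu L = 1\<close>: each \<open>mu i\<close> is the qj-th power of
  the next one up to a factor congruent to -1.\<close>

lemma mu_unit: "i <= L ==> mu i : W & mu i ~: M"
proof (induction rule: inc_induct)
 case (step i)
 let ?R = "u (Suc i) ^. qj /. u i"
 have R: "?R : W" "?R ~: M" using M_one_plus_unit[OF u_ratio] by blast+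
 have "mu (Suc i) ^. qj = t ^. A i *. u (Suc i) ^. qj"
  using step by (simp add: mu_def A_Suc w.power_mult_distrib w.power_mult[symmetric] mult.commute)
 also have "\<dots> = mu i *. ?R" using u_nz[of i] by (simp add: mu_def field_simps)
 finally have "mu (Suc i) ^. qj = mu i *. ?R" .
 moreover have "?R ~= zero" using R(2) M_zero by metis
 ultimately have eq: "mu i = mu (Suc i) ^. qj /. ?R" by simp
 have "mu i : W" unfolding eq by (intro v_div v_pow) (use step R in auto)
 moreover have "mu i ~: M" using \<open>mu (Suc i) ^. qj = mu i *. ?R\<close> not_M_pow[of "mu (Suc i)" qj] step using M_mult[of "mu i" ?R] R(1) by auto
 ultimately show ?case by blast
qed (use mu_L in simp)

definition Sh :: 'a where "Sh = t ^. (Q * A 0) *. S L"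

text \<open>\<open>u 0\<close> has the largest pole, so \<open>u 0 ^ Q\<close> dominates the sum
  \<open>S L\<close>.\<close>

lemma Sh_unit: "Sh : W" "Sh ~: M"
proof -
 have "n <= L ==> t ^. (Q * A 0) *. S n : W & t ^. (Q * A 0) *. S n ~: M" for n
 proof (induction n)
  case 0
  have "t ^. (Q * A 0) *. S 0 = mu 0 ^. Q"
   by (simp add: S_def mu_def w.power_mult_distrib w.power_mult[symmetric] mult.commute)
  thus ?case using mu_unit[of 0] not_M_pow by simp
 next
  case (Suc n)
  have le: "A (Suc n) < A 0" using A_less[of n] Suc.prems by simp
  have "Q * A 0 = Q * (A 0 - A (Suc n)) + Q * A (Suc n)" using le by (simp add: diff_mult_distrib2)
  hence "t ^. (Q * A 0) *. u (Suc n) ^. Q = t ^. (Q * (A 0 - A (Suc n))) *. mu (Suc n) ^. Q"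
   by (simp add: mu_def w.power_mult_distrib w.power_add w.power_mult[symmetric] mult.commute w.mult.assoc)
  moreover have "t ^. (Q * (A 0 - A (Suc n))) *. mu (Suc n) ^. Q : M"
   using le numbers mu_unit[OF Suc.prems] by (intro M_mult M_pow t_in_M) auto
  ultimately have x: "t ^. (Q * A 0) *. u (Suc n) ^. Q : M" by simp
  show ?case using unit_add_M[OF _ _ x] Suc v_add[OF _ M_W[OF x]] by (simp add: S_def w.distrib_left)
 qed
 thus "Sh : W" "Sh ~: M" by (simp_all add: Sh_def)
qed

lemma Sh_nz: "Sh ~= zero" using Sh_unit(2) M_zero by metis
lemma S_L_nz: "S L ~= zero" using Sh_nz by (auto simp: Sh_def)

lemma mu'_L: "mu' L = zero"
proof -
 have N: "A L = Q - 1" by (simp add: A_def)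
 have "scalar Q = zero" using p_dvd Q_eq by (intro scalar_dvd) simp
 hence "scalar (Suc (Q - 1)) = zero" by (simp only: numbers(6))
 hence sN: "scalar (Q - 1) = uminus one" by (simp add: w.eq_neg_iff_add_eq_0 w.add.commute)
 have tt: "t *. t ^. (Q - 1) = t ^. Q" using w.power_Suc[of t "Q - 1"] by (simp only: numbers(6))
 have "t *. mu' L = (t *. D (Q - 1)) *. u L +. (t *. t ^. (Q - 1)) *. (dl' *. S L)"
  by (simp add: mu'_def N algebra_simps)
 also have "\<dots> = uminus (t ^. (Q - 1) *. u L) +. t ^. Q *. (dl' *. S L)" unfolding t_D sN tt by simp
 also have "\<dots> = zero" unfolding t_u using t_nz0 S_L_nz by (simp add: dl'_def)
 finally show ?thesis using t_nz0 by simp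
qed

text \<open>The recursion of the \<open>u i\<close> and its derivative, scaled by
  \<open>t^(A i)\<close> so that all terms become integral; \<open>a\<close> and \<open>b\<close>
  are the remaining exponents.\<close>

lemma mu_step:
 assumes i: "i < L"
 defines "a == A i - A (Suc i)" and "b == (Q - qj) * (A 0 - A (Suc i))"
 shows "mu i = t ^. a *. mu (Suc i) -. mu (Suc i) ^. qj -. t ^. b *. be *. mu (Suc i) ^. Q"
  and "mu' i = D a *. mu (Suc i) +. t ^. a *. mu' (Suc i) -. t ^. b *. be' *. mu (Suc i) ^. Q"
proof -
 have a: "a + A (Suc i) = A i" using A_Suc[OF i] numbers by (simp add: a_def)
 have "(Q - qj) * A 0 = (Q - qj) * (A 0 - A (Suc i)) + (Q - qj) * A (Suc i)"
  using A_less[OF i] by (simp add: add_mult_distrib2[symmetric])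
 moreover have "(Q - qj) * A (Suc i) + qj * A (Suc i) = Q * A (Suc i)"
  using numbers by (simp add: add_mult_distrib[symmetric])
 ultimately have b: "b + Q * A (Suc i) = V + A i" unfolding b_def V_def A_Suc[OF i] by linarith
 have tb: "t ^. b *. t ^. (Q * A (Suc i)) = t ^. V *. t ^. A i" using b by (simp add: w.power_add[symmetric])
 have ta: "t ^. a *. t ^. A (Suc i) = t ^. A i" using a by (simp add: w.power_add[symmetric])
 have muQ: "mu (Suc i) ^. Q = t ^. (Q * A (Suc i)) *. u (Suc i) ^. Q"
  by (simp add: mu_def w.power_mult_distrib w.power_mult[symmetric] mult.commute)
 have muj: "mu (Suc i) ^. qj = t ^. A i *. u (Suc i) ^. qj"
  by (simp add: mu_def w.power_mult_distrib w.power_mult[symmetric] mult.commute A_Suc[OF i])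
 have z: "t ^. V *. be = dl" "t ^. V *. be' = dl'" using t_nz0 by (simp_all add: be_def be'_def)
 have *: "t ^. b *. y *. mu (Suc i) ^. Q = t ^. A i *. ((t ^. V *. y) *. u (Suc i) ^. Q)" for y
 proof -
  have "t ^. b *. y *. mu (Suc i) ^. Q = (t ^. b *. t ^. (Q * A (Suc i))) *. (y *. u (Suc i) ^. Q)"
   unfolding muQ by (simp add: w.mult.assoc w.mult.left_commute)
  thus ?thesis unfolding tb by (simp add: w.mult.left_commute w.mult.commute)
 qed
 have ui: "u i = u (Suc i) -. u (Suc i) ^. qj -. dl *. u (Suc i) ^. Q" using Phi_u[of i] by (simp add: Phi_def dl_def)
 have "mu i = t ^. A i *. (u (Suc i) -. u (Suc i) ^. qj -. dl *. u (Suc i) ^. Q)" unfolding mu_def[of i] by (subst ui) simp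
 also have "\<dots> = (t ^. a *. t ^. A (Suc i)) *. u (Suc i) -. t ^. A i *. u (Suc i) ^. qj -. t ^. A i *. (dl *. u (Suc i) ^. Q)"
  unfolding ta by (simp add: algebra_simps)
 finally show "mu i = t ^. a *. mu (Suc i) -. mu (Suc i) ^. qj -. t ^. b *. be *. mu (Suc i) ^. Q"
  unfolding * z muj by (simp add: mu_def w.mult.assoc)
 have "p dvd A i" using A_Suc[OF i] p_dvd by simp
 hence Dz: "D (A i) = zero" by (rule D_zero)
 hence Da: "D a *. t ^. A (Suc i) +. t ^. a *. D (A (Suc i)) = zero" using D_add[of a "A (Suc i)"] by (simp add: a)
 have "D a *. mu (Suc i) +. t ^. a *. mu' (Suc i) =
   (D a *. t ^. A (Suc i) +. t ^. a *. D (A (Suc i))) *. u (Suc i) +. (t ^. a *. t ^. A (Suc i)) *. (dl' *. S (Suc i))"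
  by (simp add: mu_def mu'_def algebra_simps)
 also have "\<dots> = t ^. A i *. (dl' *. S (Suc i))" unfolding Da ta by simp
 also have "S (Suc i) = S i +. u (Suc i) ^. Q" by (simp add: S_def)
 finally show "mu' i = D a *. mu (Suc i) +. t ^. a *. mu' (Suc i) -. t ^. b *. be' *. mu (Suc i) ^. Q"
  unfolding * z by (simp add: mu'_def Dz algebra_simps)
qed

lemma be_equation:
 defines "a == (qj - 1) * A 0"
 shows "be *. mu 0 ^. Q = t ^. a *. mu 0 -. mu 0 ^. qj" and "be' *. mu 0 ^. Q = D a *. mu 0 +. t ^. a *. mu' 0"
proof -
 have a: "a + A 0 = qj * A 0" using numbers by (simp add: a_def diff_mult_distrib)
 have ta: "t ^. a *. t ^. A 0 = t ^. (qj * A 0)" using a by (simp add: w.power_add[symmetric])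
 have z: "t ^. V *. be = dl" "t ^. V *. be' = dl'" using t_nz0 by (simp_all add: be_def be'_def)
 have *: "y *. mu 0 ^. Q = t ^. (qj * A 0) *. ((t ^. V *. y) *. u 0 ^. Q)" for y
 proof -
  have "mu 0 ^. Q = t ^. (Q * A 0) *. u 0 ^. Q" by (simp add: mu_def w.power_mult_distrib w.power_mult[symmetric] mult.commute)
  thus ?thesis unfolding QA w.power_add by (simp add: w.mult.left_commute w.mult.commute)
 qed
 have u0: "dl *. u 0 ^. Q = u 0 -. u 0 ^. qj" using Phi_u_0 by (simp add: Phi_def dl_def)
 have muj: "mu 0 ^. qj = t ^. (qj * A 0) *. u 0 ^. qj" by (simp add: mu_def w.power_mult_distrib w.power_mult[symmetric] mult.commute)
 have "be *. mu 0 ^. Q = (t ^. a *. t ^. A 0) *. u 0 -. mu 0 ^. qj" unfolding * z u0 ta muj by (simp add: algebra_simps)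
 thus "be *. mu 0 ^. Q = t ^. a *. mu 0 -. mu 0 ^. qj" by (simp add: mu_def w.mult.assoc)
 have "D (qj * A 0) = zero" using p_dvd by (intro D_zero) simp
 hence Da: "D a *. t ^. A 0 +. t ^. a *. D (A 0) = zero" using D_add[of a "A 0"] by (simp add: a)
 have "D a *. mu 0 +. t ^. a *. mu' 0 =
   (D a *. t ^. A 0 +. t ^. a *. D (A 0)) *. u 0 +. (t ^. a *. t ^. A 0) *. (dl' *. S 0)"
  by (simp add: mu_def mu'_def algebra_simps)
 also have "\<dots> = be' *. mu 0 ^. Q" unfolding Da ta * z by (simp add: S_def)
 finally show "be' *. mu 0 ^. Q = D a *. mu 0 +. t ^. a *. mu' 0" by simp
qed

lemma qjA: "qj * A 0 >= Q"
proof -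
 have "qj * A 0 = (Q - 1) * (qj * qj ^ L)" by (simp add: A_def)
 moreover have "qj * qj ^ L >= qj * 1" by simp
 hence "qj * qj ^ L >= 2" using numbers by linarith
 hence "(Q - 1) * 2 <= (Q - 1) * (qj * qj ^ L)" by simp
 ultimately show ?thesis using numbers by linarith
qed

lemma be'_eq: "be' = t ^. (qj * A 0 - Q) /. Sh"
proof -
 have "Q * A 0 = V + Q + (qj * A 0 - Q)" using QA qjA by simp
 hence "t ^. (Q * A 0) = t ^. V *. t ^. Q *. t ^. (qj * A 0 - Q)" by (simp add: w.power_add)
 thus ?thesis using t_nz0 S_L_nz unfolding be'_def dl'_def Sh_def by (simp add: field_simps)
qed

lemma be_unit: "be : W" "be ~: M"
proof -
 have m: "mu 0 : W" "mu 0 ~: M" using mu_unit[of 0] by auto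
 hence mQ: "mu 0 ^. Q ~: M" by (intro not_M_pow)
 hence nz: "mu 0 ^. Q ~= zero" using M_zero by metis
 have pos: "(qj - 1) * A 0 > 0" using numbers by (auto simp: A_def)
 let ?r = "t ^. ((qj - 1) * A 0) *. mu 0 -. mu 0 ^. qj"
 have "be = ?r /. mu 0 ^. Q" using be_equation(1) nz by (simp add: field_simps)
 thus "be : W" using v_div[OF _ mQ, of ?r] m t_W by simp
 have "?r ~: M"
 proof
  assume "?r : M"
  from M_minus[OF M_mult[OF M_pow[OF t_in_M pos] m(1)] this] show False using not_M_pow[OF m(2)] by (simp add: w.diff_diff_eq2)
 qed
 thus "be ~: M" using be_equation(1) M_mult[of be "mu 0 ^. Q"] m by auto
qed

text \<open>In the recursion \<open>be\<close> carries a positive power of \<open>t\<close> with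
  exponent divisible by \<open>p\<close>, so one more digit of the result is known, and the other
  terms come from \<open>mu (i + 1)\<close>.\<close>

lemma be_mu_DT: "(be, be') : DT n ==> i <= L ==> (mu i, mu' i) : DT (Suc n)"
proof -
 assume be: "(be, be') : DT n"
 show "i <= L ==> (mu i, mu' i) : DT (Suc n)"
 proof (induction rule: inc_induct)
  case base
  show ?case unfolding mu_L mu'_L by (rule DT_const[OF kbar_one])
 next
  case (step i)
  let ?a = "A i - A (Suc i)" and ?b = "(Q - qj) * (A 0 - A (Suc i))"
  have b: "?b > 0" using A_less[of i] step numbers by simp
  have Db: "D ?b = zero" using p_dvd by (intro D_zero) simp
  have 3: "(t ^. ?b *. be, t ^. ?b *. be') : DT (Suc n)" using DT_mono[OF _ DT_t_power[OF be, of ?b], of "Suc n"] b unfolding Db by (simp del: DT.simps add: Suc_le_eq)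
  have 1: "(t ^. ?a *. mu (Suc i), D ?a *. mu (Suc i) +. t ^. ?a *. mu' (Suc i)) : DT (Suc n)"
   using DT_mono[OF le_add1 DT_t_power[OF step.IH, of ?a]] .
  have 2: "(mu (Suc i) ^. qj, zero) : DT (Suc n)" "(mu (Suc i) ^. Q, zero) : DT (Suc n)"
   unfolding qj_def Q_def using DT_frob[OF step.IH] ej_pos by blast+
  from DT_minus[OF DT_minus[OF 1 2(1)] DT_mult[OF 3 2(2)]]
  show ?case unfolding mu_step[OF step(2)] by (simp del: DT.simps)
 qed
qed

text \<open>\<open>be\<close> and the \<open>mu i\<close> determine each other. Going from
  \<open>be\<close> to \<open>mu 0\<close> gains a digit and \<open>be_equation\<close> leads back
  without loss, so all digits follow from the integrality of \<open>be\<close> and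
  \<open>be'\<close>.\<close>

lemma be_CD: "(be, be') : CD"
proof -
 have "(be, be') : DT n" for n
 proof (induction n)
  case 0
  have "be' : W" unfolding be'_eq using t_W by (intro v_div Sh_unit) simp
  thus ?case using be_unit by simp
 next
  case (Suc n)
  have m0: "(mu 0, mu' 0) : DT (Suc n)" by (rule be_mu_DT[OF Suc]) simp
  have mQ: "(mu 0 ^. Q, zero) : DT (Suc n)" "(mu 0 ^. qj, zero) : DT (Suc n)"
   unfolding qj_def Q_def using DT_frob[OF m0] ej_pos by blast+
  have nM: "mu 0 ^. Q ~: M" using mu_unit[of 0] by (intro not_M_pow) simp
  hence nz: "mu 0 ^. Q ~= zero" using M_zero by metis
  let ?a = "(qj - 1) * A 0"
  from DT_mult[OF DT_minus[OF DT_mono[OF le_add1 DT_t_power[OF m0, of ?a]] mQ(2)] DT_inverse[OF mQ(1) nM]]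
  have "(be *. mu 0 ^. Q *. inverse (mu 0 ^. Q), be' *. mu 0 ^. Q *. inverse (mu 0 ^. Q)) : DT (Suc n)"
   unfolding be_equation by (simp del: DT.simps)
  thus ?case using nz by (simp add: w.mult.assoc del: DT.simps)
 qed
 thus ?thesis by (simp add: CD_def)
qed

lemma u_CDF: "i <= L ==> (u i, dl' *. S i) : CDF"
proof -
 assume i: "i <= L"
 have "(mu i, mu' i) : DT n" for n using be_CD by (intro DT_anti[OF be_mu_DT[OF _ i]]) (simp add: CD_def)
 hence "(mu i, mu' i) : CD" by (simp add: CD_def)
 thus ?thesis unfolding mu_def mu'_def by (rule CDF_I)
qed

end

context infinite_place
begin

text \<open>\<open>v\<close> is the order of \<open>s\<close>, because \<open>dl = s^(Q-1)\<close>
  has order \<open>V = v (Q - 1)\<close>; the pole of \<open>g\<close> has order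
  \<open>v (qj - 1)\<close>.\<close>

definition P :: nat where "P = qj ^ Suc L"
definition v :: nat where "v = (q - 1) * P"
definition \<sigma> :: 'a where "\<sigma> = s /. t ^. v"

lemma V_eq: "V = v * (Q - 1)"
proof -
 have "Q - qj = qj * (q - 1)" by (simp add: Q_eq diff_mult_distrib2)
 thus ?thesis by (simp add: V_def v_def P_def A_def)
qed

lemma p_dvd_v: "p dvd v" using p_dvd by (simp add: v_def P_def)

lemma s_eq: "s = t ^. v *. \<sigma>" using t_nz0 by (simp add: \<sigma>_def)

lemma sigma_power: "\<sigma> ^. (Q - 1) = be"
 unfolding \<sigma>_def be_def dl_def V_eq by (simp add: w.power_divide w.power_mult[symmetric])

lemma sigma_unit: "\<sigma> : W" "\<sigma> ~: M"
proof -
 show "\<sigma> : W" by (rule pow_W[OF _ numbers(4)]) (unfold sigma_power, rule be_unit(1))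
 show "\<sigma> ~: M" using M_pow[OF _ numbers(4), of \<sigma>] be_unit(2) unfolding sigma_power by blast
qed

lemma sigma_nz: "\<sigma> ~= zero" using sigma_unit M_zero by metis
lemma be_nz: "be ~= zero" using be_unit M_zero by metis

lemma sigma_Q: "\<sigma> ^. Q = be *. \<sigma>"
 using w.power_Suc[of \<sigma> "Q - 1"] unfolding numbers(6) sigma_power by (simp add: w.mult.commute)

lemma sigma_residue: "EX a:kbar. \<sigma> -. a : M"
proof -
 obtain c where c: "c : kbar" "be -. c : M" using CD_residue[OF be_CD] by blast
 have "EX d. monic (Q - 1) (%x. x ^. (Q - 1) +. uminus c *. x ^. 0) d"
  using numbers by (intro monic_add_ex monic_power_ex)
 moreover have "\<sigma> ^. (Q - 1) +. uminus c *. \<sigma> ^. 0 : M" using c(2) unfolding sigma_power by simp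
 ultimately obtain a where "a ^. (Q - 1) +. uminus c *. a ^. 0 = zero" and am: "\<sigma> -. a : M" using residue_root by blast
 hence a: "a ^. (Q - 1) = c" by simp
 have "a ^. Q = c *. a +. zero"
  using w.power_Suc[of a "Q - 1"] unfolding numbers(6) a by (simp add: w.mult.commute)
 hence "a : kbar" unfolding Q_def by (rule kbar_affine[OF _ ej_pos(2) c(1)]) (rule subf_zero[OF subf_kbar])
 thus ?thesis using am by blast
qed

text \<open>The unit part satisfies \<open>\<sigma> = \<sigma>^Q / be\<close>, an additive equation,
  so \<open>CD_additive_root\<close> applies. The derivative is the logarithmic one of
  \<open>s^(Q-1)\<close>, with Q - 1 = -1.\<close>

lemma s_CDF: "(s, uminus (be' /. be *. s)) : CDF"
proof -
 obtain a where a: "a : kbar" "\<sigma> -. a : M" using sigma_residue by blast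
 have z: "(zero, zero) : CD" by (rule CD_const[OF k_zero])
 have "\<sigma> = zero +. inverse be *. \<sigma> ^. Q +. zero *. \<sigma> ^. Q" using be_nz by (simp add: sigma_Q w.mult.assoc[symmetric])
 from CD_additive_root[OF z CD_inverse[OF be_CD be_unit(2)] z sigma_unit(1) this[unfolded Q_def] ej_pos(2,2) a]
 have "(\<sigma>, uminus (inverse be *. inverse be *. be') *. \<sigma> ^. Q) : CD" by (simp add: Q_def del: mult_Suc_right)
 also have "uminus (inverse be *. inverse be *. be') *. \<sigma> ^. Q = uminus (be' /. be *. \<sigma>)"
  unfolding sigma_Q using be_nz by (simp add: field_simps)
 finally have "(t ^. v *. \<sigma>, D v *. \<sigma> +. t ^. v *. uminus (be' /. be *. \<sigma>)) : CD" by (rule CD_t_power)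
 moreover have "D v *. \<sigma> +. t ^. v *. uminus (be' /. be *. \<sigma>) = uminus (be' /. be *. s)"
 proof -
  have "be' /. be *. s = be' /. be *. (t ^. v *. \<sigma>)" by (rule arg_cong[OF s_eq])
  thus ?thesis unfolding D_zero[OF p_dvd_v] by (simp only:) (simp add: algebra_simps)
 qed
 ultimately show ?thesis unfolding s_eq[symmetric] by (simp add: CD_CDF)
qed

lemma g_eq: "g = uminus (s /. s ^. qj)" using g_s s_nz by (simp add: field_simps)

definition g' :: 'a where "g' = be' /. be *. s /. s ^. qj"

lemma be'_nz: "be' ~= zero" unfolding be'_eq using t_nz0 Sh_nz by simp
lemma g'_nz: "g' ~= zero" using be'_nz be_nz s_nz by (simp add: g'_def)

lemma s_qj: "s ^. qj = t ^. (v * qj) *. \<sigma> ^. qj"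
 using arg_cong[OF s_eq, of "%z. z ^. qj"] by (simp only: w.power_mult_distrib w.power_mult)

lemma s_qj_inverse: "(inverse (s ^. qj), zero) : CDF"
proof -
 have 1: "(\<sigma> ^. qj, zero) : CDF"
 proof -
  obtain a where a: "a : kbar" "\<sigma> -. a : M" using sigma_residue by blast
  have z: "(zero, zero) : CD" by (rule CD_const[OF k_zero])
  have "\<sigma> = zero +. inverse be *. \<sigma> ^. Q +. zero *. \<sigma> ^. Q" using be_nz by (simp add: sigma_Q w.mult.assoc[symmetric])
  from CD_additive_root[OF z CD_inverse[OF be_CD be_unit(2)] z sigma_unit(1) this[unfolded Q_def] ej_pos(2,2) a]
  obtain d where d: "(\<sigma>, d) : CD" by blast
  thus ?thesis using CD_CDF[OF CD_frob[OF d ej_pos(1)]] by (simp add: qj_def)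
 qed
 have 2: "(inverse (\<sigma> ^. qj), zero) : CDF"
 proof -
  have "\<sigma> ^. qj ~: M" "\<sigma> ^. qj : W" using sigma_unit not_M_pow by auto
  from CD_CDF[OF CD_inverse[OF CDF_W[OF 1 this(2)] this(1)]] show ?thesis by simp
 qed
 have "(inverse t ^. qj, zero) : CDF" unfolding qj_def by (rule CDF_frob[OF CDF_t_inverse ej_pos(1)])
 from CDF_power[OF this, of v] have 3: "((inverse t ^. qj) ^. v, zero) : CDF" by simp
 from CDF_mult[OF 2 3] have "(inverse (\<sigma> ^. qj) *. (inverse t ^. qj) ^. v, zero) : CDF" by simp
 moreover have "inverse (s ^. qj) = inverse (\<sigma> ^. qj) *. (inverse t ^. qj) ^. v"
  unfolding s_qj
  by (simp add: w.power_inverse w.power_mult[symmetric] mult.commute w.mult.commute)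
 ultimately show ?thesis by simp
qed

lemma g_CDF: "(g, g') : CDF"
proof -
 from CDF_neg[OF CDF_mult[OF s_CDF s_qj_inverse]]
 show ?thesis unfolding g_eq g'_def by (simp add: w.divide_inverse)
qed

text \<open>\<open>g'\<close> has order \<open>B - Q\<close>, so \<open>h -> h'/g'\<close> raises
  pole orders by at most \<open>B\<close>. The slack of \<open>Q - 1\<close> buys a value whose
  ratio to the pole order \<open>v (qj - 1)\<close> of \<open>g\<close> is the same for all
  \<open>L\<close>.\<close>

abbreviation B :: nat where "B == P * (q + qj - 2)"

lemma exponents: "B + v * qj = (Q - 1) * P + v" "qj * A 0 = (Q - 1) * P" "B > 0"
proof -
 obtain a b where ab: "q = Suc a" "qj = Suc b" using numbers by (metis Suc_le_D less_imp_le_nat numeral_2_eq_2)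
 show "B + v * qj = (Q - 1) * P + v" using Q_eq by (simp add: v_def ab algebra_simps)
 show "qj * A 0 = (Q - 1) * P" by (simp add: A_def P_def)
 show "B > 0" using numbers by (auto simp: P_def)
qed

lemma different_bound: "t ^. (B - 1) /. g' : W"
proof -
 let ?X = "t ^. (Q - 1) *. be *. Sh *. (\<sigma> ^. qj /. \<sigma>)"
 have e: "qj * A 0 - Q + v + (Q - 1) = B - 1 + v * qj"
  using exponents qjA numbers by simp
 have "g' *. ?X = t ^. (B - 1)"
 proof -
  have s1: "be' /. be *. s = be' /. be *. (t ^. v *. \<sigma>)" by (rule arg_cong[OF s_eq])
  have "g' *. ?X = t ^. (qj * A 0 - Q) *. t ^. v *. t ^. (Q - 1) /. t ^. (v * qj)"
   unfolding g'_def s_qj s1 unfolding be'_eq using Sh_nz be_nz sigma_nz t_nz0 by (simp add: field_simps)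
  also have "t ^. (qj * A 0 - Q) *. t ^. v *. t ^. (Q - 1) = t ^. (B - 1) *. t ^. (v * qj)"
   unfolding w.power_add[symmetric] e ..
  finally show ?thesis using t_nz0 by simp
 qed
 hence "t ^. (B - 1) /. g' = ?X" using g'_nz by (simp add: field_simps)
 moreover have "?X : W" using t_W be_unit Sh_unit sigma_unit by (intro v_mult v_pow v_div) auto
 ultimately show ?thesis by simp
qed

lemma different_step: assumes "(h, h') : CDF" "t ^. (n * B) *. h : W"
 shows "t ^. (Suc n * B) *. (h' /. g') : W"
proof -
 have "t ^. Suc (n * B) *. h' : W" by (rule CDF_pole[OF assms])
 hence "(t ^. Suc (n * B) *. h') *. (t ^. (B - 1) /. g') : W" using different_bound by blast
 also have "(t ^. Suc (n * B) *. h') *. (t ^. (B - 1) /. g') = (t ^. Suc (n * B) *. t ^. (B - 1)) *. (h' /. g')"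
   by (simp add: field_simps)
 also have "t ^. Suc (n * B) *. t ^. (B - 1) = t ^. (Suc n * B)"
 proof -
  have "Suc (n * B) + (B - 1) = Suc n * B" using exponents(3) by simp
  thus ?thesis by (simp only: w.power_add[symmetric])
 qed
 finally show ?thesis .
qed

lemma g_inverse: "inverse g = uminus (\<sigma> ^. qj /. \<sigma>) *. t ^. (v * (qj - 1))"
proof -
 have "v * qj = v * (qj - 1) + v" using numbers by (cases qj) auto
 hence 1: "s ^. qj = t ^. (v * (qj - 1)) *. t ^. v *. \<sigma> ^. qj" by (simp only: s_qj w.power_add)
 have "s ^. qj /. s = s ^. qj /. (t ^. v *. \<sigma>)" by (rule arg_cong[OF s_eq])
 also have "\<dots> = \<sigma> ^. qj /. \<sigma> *. t ^. (v * (qj - 1))" unfolding 1 using t_nz0 by (simp add: field_simps)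
 finally have 2: "s ^. qj /. s = \<sigma> ^. qj /. \<sigma> *. t ^. (v * (qj - 1))" .
 have "inverse (s /. s ^. qj) = s ^. qj /. s" by simp
 moreover have "inverse g = inverse (uminus (s /. s ^. qj))" by (rule arg_cong[OF g_eq])
 ultimately show ?thesis unfolding 2 by simp
qed

text \<open>Bounded solutions satisfy a separable additive equation with differentiable
  coefficients; their residues satisfy \<open>r^qj = r - c\<close> and so lie in
  \<open>kbar\<close>.\<close>

lemma torsion_CD:
 assumes a: "(a, a') : CD" "Phi dl b = a" "b : W" shows "EX b'. (b, b') : CD"
proof -
 have dl: "(dl, dl') : CD"
 proof -
  have "(t ^. V *. be, D V *. be +. t ^. V *. be') : CD" by (rule CD_t_power[OF be_CD])
  moreover have "D V = zero" using p_dvd_v by (intro D_zero) (simp add: V_eq)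
  ultimately show ?thesis using t_nz0 by (simp add: be_def be'_def)
 qed
 have dlM: "dl : M" unfolding dl_def using s_M numbers by (intro M_pow)
 obtain c where c: "c : kbar" "a -. c : M" using CD_residue[OF a(1)] by blast
 let ?h = "%x. x ^. qj +. uminus one *. x ^. 1 +. c *. x ^. 0"
 have "1 < qj" "0 < qj" using numbers by auto
 hence mo: "EX d. monic qj ?h d" by (intro monic_add_ex monic_power_ex)
 have bj: "b ^. qj = b -. a -. dl *. b ^. Q" using a(2) by (simp add: Phi_def algebra_simps)
 have "?h b = uminus ((a -. c) +. dl *. b ^. Q)" unfolding bj by (simp add: algebra_simps)
 also have "\<dots> : M" using a(3) by (intro M_neg M_add c(2) M_mult dlM v_pow)
 finally obtain r where r: "?h r = zero" "b -. r : M" using residue_root mo by blast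
 have "r ^. qj = one *. r +. uminus c" using r(1) by (simp add: algebra_simps)
 hence "r : kbar" unfolding qj_def by (rule kbar_affine[OF _ ej_pos(1) kbar_one subf_neg[OF subf_kbar c(1)]])
 moreover have "b = a +. one *. b ^. (p ^ (e * j)) +. dl *. b ^. (p ^ (e * Suc j))"
  using a(2) by (simp add: Phi_def qj_def Q_def algebra_simps del: mult_Suc_right)
 ultimately show ?thesis
  using CD_additive_root[OF a(1) CD_const[OF k_one] dl a(3) _ ej_pos, of r] r(2) by blast
qed

lemma phi_Phi: "phi g (s *. b) = s *. Phi dl b"
proof -
 have "s ^. Q = s *. dl" using w.power_Suc[of s "Q - 1"] unfolding numbers(6) dl_def .
 moreover have "g *. (s ^. qj *. b ^. qj) = uminus s *. b ^. qj" unfolding w.mult.assoc[symmetric] g_s by simp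
 ultimately show ?thesis by (simp add: phi_def Phi_def algebra_simps)
qed

lemma Phi_combination:
 "(!!l. d l : fixed e) ==> Phi dl (w.sum (%l. d l *. u (Suc l)) {..i::nat}) = w.sum (%l. d l *. u l) {..i}"
 using Phi_u by (induction i) (simp_all add: Phi_add Phi_scale dl_def)

text \<open>The scaled torsion points are combinations of the unbounded chain plus a bounded
  differentiable part: shift the combination found for \<open>y i\<close>, then remove one multiple
  of \<open>u 0\<close> by \<open>torsion_reduction\<close>.\<close>

lemma torsion_combination:
 "i <= L ==> EX d b b'. (ALL l. d l : fixed e) & y i /. s = w.sum (%l. d l *. u l) {..i} +. b & (b, b') : CD"
proof (induction i)
 case 0
 have "s *. Phi dl (y 0 /. s) = zero" using phi_Phi[of "y 0 /. s"] y_0 s_nz by simp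
 hence y0: "Phi dl (y 0 /. s) = zero" using s_nz by simp
 then obtain c where c: "c : fixed e" "y 0 /. s -. c *. u 0 : W"
  using torsion_reduction[OF u_W[of 0], of dl "y 0 /. s"] Phi_u_0 by (auto simp: dl_def)
 have "Phi dl (y 0 /. s -. c *. u 0) = zero" using y0 Phi_u_0 by (simp add: Phi_minus Phi_scale[OF c(1)] dl_def)
 then obtain b' where "(y 0 /. s -. c *. u 0, b') : CD" using torsion_CD[OF CD_const[OF k_zero] _ c(2)] by blast
 thus ?case using c(1) by (intro exI[of _ "%l. c"] exI[of _ "y 0 /. s -. c *. u 0"] exI[of _ b']) (simp add: algebra_simps)
next
 case (Suc i)
 then obtain d b b' where d: "!!l. d l : fixed e" "y i /. s = w.sum (%l. d l *. u l) {..i} +. b" "(b, b') : CD" by auto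
 let ?v = "y (Suc i) /. s -. w.sum (%l. d l *. u (Suc l)) {..i}"
 have v: "Phi dl ?v = b" using phi_Phi[of "y (Suc i) /. s"] y_Suc s_nz using d(2) by (simp add: Phi_minus Phi_combination[of d, OF d(1)])
 then obtain c where c: "c : fixed e" "?v -. c *. u 0 : W"
  using torsion_reduction[OF u_W[of 0], of dl ?v] Phi_u_0 CD_W[OF d(3)] by (auto simp: dl_def)
 have "Phi dl (?v -. c *. u 0) = b" using v Phi_u_0 by (simp add: Phi_minus Phi_scale[OF c(1)] dl_def)
 then obtain b2 where b2: "(?v -. c *. u 0, b2) : CD" using torsion_CD[OF d(3) _ c(2)] by blast
 let ?d = "%l. case l of 0 => c | Suc l => d l"
 have "w.sum (%l. ?d l *. u l) {..Suc i} = c *. u 0 +. w.sum (%l. d l *. u (Suc l)) {..i}"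
  by (subst w.sum.atMost_Suc_shift) simp
 hence "y (Suc i) /. s = w.sum (%l. ?d l *. u l) {..Suc i} +. (?v -. c *. u 0)" by (simp add: algebra_simps del: w.sum.atMost_Suc)
 moreover have "ALL l. ?d l : fixed e" using d(1) c(1) by (simp split: nat.split)
 ultimately show ?case using b2 by blast
qed

lemma y_CDF: assumes "i <= L" shows "EX z. (y i, z) : CDF"
proof -
 obtain d b b' where d: "!!l. d l : fixed e" "y i /. s = w.sum (%l. d l *. u l) {..i} +. b" "(b, b') : CD"
  using torsion_combination[OF assms] by auto
 have "n <= L ==> EX z. (w.sum (%l. d l *. u l) {..n}, z) : CDF" for n
 proof (induction n)
  case 0
  show ?case using CDF_mult[OF CDF_const[OF kbarI[OF e_pos d(1)]] u_CDF[OF 0], of 0] by auto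
 next
  case (Suc n)
  then obtain z where "(w.sum (%l. d l *. u l) {..n}, z) : CDF" by auto
  from CDF_add[OF this CDF_mult[OF CDF_const[OF kbarI[OF e_pos d(1)]] u_CDF[OF Suc.prems]]] show ?case by auto
 qed
 then obtain z where "(w.sum (%l. d l *. u l) {..i}, z) : CDF" using assms by blast
 from CDF_mult[OF CDF_add[OF this CD_CDF[OF d(3)]] s_CDF] show ?thesis unfolding d(2)[symmetric] using s_nz by auto
qed

text \<open>\<open>x i\<close> is obtained from \<open>y i\<close> and earlier \<open>x k\<close> by
  field operations, so it inherits the derivative.\<close>

lemma E_CDF_infinite:
 assumes arch: "!!f. f : E L ==> f ~= zero ==> EX n. t ^. n /. f : W" and f: "f : E L"
 shows "EX z. (f, z) : CDF"
proof -
 have eta: "EX z. (eta a b, z) : CDF" if a: "(a, a') : CDF" "a : E L" "a ~= zero" and b: "(b, b') : CDF" for a a' b b'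
 proof -
  obtain n where "t ^. n /. a : W" using arch[OF a(2,3)] by blast
  from CDF_inverse[OF a(1,3) this] obtain z where z: "(inverse a, z) : CDF" by blast
  from CDF_minus[OF CDF_power[OF b, of q] CDF_mult[OF CDF_mult[OF CDF_power[OF a(1), of q] z] b]]
  show ?thesis by (auto simp: eta_def w.divide_inverse)
 qed
 have xC: "i < L ==> EX z. (x i, z) : CDF" for i
 proof (induction i rule: less_induct)
  case (less i)
  have "k <= i ==> (b, b') : CDF ==> EX z. (H k b, z) : CDF" for k b b'
  proof (induction k)
   case (Suc k)
   then obtain z where z: "(H k b, z) : CDF" by auto
   obtain z2 where "(x k, z2) : CDF" using less Suc.prems by fastforce
   moreover have "x k : E L" using Suc.prems less.prems by (intro E_gen(3)) simp
   ultimately show ?case using eta[OF _ _ x_nz z, of k z2] by (simp add: x_def)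
  qed auto
  moreover obtain z where "(y i, z) : CDF" using y_CDF[of i] less.prems by auto
  ultimately show ?case unfolding x_def by blast
 qed
 have "E L <= {f : E L. EX f'. (f, f') : CDF}"
 proof (rule E_minimal[OF subf_differentiable[OF subf_E arch]])
  show "g : {f : E L. EX f'. (f, f') : CDF}" using g_CDF E_gen(1) by blast
  show "K <= {f : E L. EX f'. (f, f') : CDF}"
  proof
   fix c assume "c : K"
   thus "c : {f : E L. EX f'. (f, f') : CDF}" using CDF_const[of c] K_kbar E_gen(2)[of L] by blast
  qed
  fix i assume i: "i < L"
  thus "x i : {f : E L. EX f'. (f, f') : CDF}" using xC[OF i] E_gen(3)[OF i] by blast
 qed
 thus ?thesis using f by blast
qed

lemma top_coefficient_pole:
 assumes arch: "!!f. f : E L ==> f ~= zero ==> EX n. inverse g ^. n /. f : W"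
  and i: "i < p" and f: "!!l. f l : E L" and sum: "w.sum (%l. f l ^. p *. g ^. l) {..i} : W"
 shows "f i ^. (p * ((q - 1) * (qj - 1))) *. inverse g ^. (i * (q + qj - 2)) : W"
proof -
 let ?b = "(q - 1) * (qj - 1)" and ?r = "uminus (\<sigma> ^. qj /. \<sigma>)"
 have r: "?r : W" "?r ~: M"
 proof -
  show "?r : W" using sigma_unit by (intro v_neg v_div v_pow)
  have "\<sigma> ^. qj /. \<sigma> = \<sigma> ^. (qj - 1)"
  proof -
   have S: "Suc (qj - 1) = qj" using numbers by simp
   have "\<sigma> ^. Suc (qj - 1) /. \<sigma> = \<sigma> ^. (qj - 1)" using sigma_nz by simp
   thus ?thesis unfolding S .
  qed
  thus "?r ~: M" using not_M_pow[OF sigma_unit(2), of "qj - 1"] M_neg[of ?r] by auto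
 qed
 have arch': "EX n. t ^. n /. f : W" if ff: "f : E L" "f ~= zero" for f
 proof -
  obtain n where "inverse g ^. n /. f : W" using arch[OF ff] by blast
  hence "inverse g ^. n /. f /. ?r ^. n : W" by (rule v_div[OF _ not_M_pow[OF r(2)]])
  moreover have "inverse g ^. n /. f /. ?r ^. n = t ^. (v * (qj - 1) * n) /. f"
  proof -
   have "?r ^. n ~= zero" using not_M_pow[OF r(2), of n] M_zero by metis
   moreover have "inverse g ^. n = ?r ^. n *. t ^. (v * (qj - 1) * n)"
    unfolding g_inverse by (simp only: w.power_mult_distrib w.power_mult[symmetric])
   ultimately show ?thesis by simp
  qed
  ultimately show ?thesis by auto
 qed
 have "t ^. ((0 + i) * B) *. f i ^. p : W"
  by (rule top_coefficient_bound[OF g_CDF g'_nz different_step i])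
   (use E_CDF_infinite[OF arch' f] sum in \<open>simp_all\<close>)
 hence tb: "t ^. (i * B) *. f i ^. p : W" by simp
 \<comment> \<open>Powers of \<open>t\<close> are traded for powers of 1/g. The pole order of
   \<open>g\<close> need not divide \<open>B\<close>, hence the power \<open>?b\<close>, which makes
   the exponents match.\<close>
 have "(t ^. (i * B) *. f i ^. p) ^. ?b *. ?r ^. (i * (q + qj - 2)) : W"
  by (rule v_mult[OF v_pow[OF tb] v_pow[OF r(1)]])
 also have "(t ^. (i * B) *. f i ^. p) ^. ?b *. ?r ^. (i * (q + qj - 2)) =
  f i ^. (p * ?b) *. inverse g ^. (i * (q + qj - 2))"
 proof -
  have 1: "i * B * ?b = v * (qj - 1) * (i * (q + qj - 2))" by (simp add: v_def)
  show ?thesis unfolding g_inverse w.power_mult_distrib w.power_mult[symmetric] 1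
   by (simp only: w.mult.assoc w.mult.commute w.mult.left_commute)
 qed
 finally show ?thesis .
qed

end

context valued_tower
begin

lemma infinite_place_exists:
 assumes g: "g ~: W"
 obtains s u t where "infinite_place divide inverse times one plus zero minus uminus p e j g W s u t L"
proof -
 have gnz: "g ~= zero" using g by auto
 have n: "qj - 1 > 0" "Suc (qj - 1) = qj" "Q - 1 > 0" using qj_gt_q q_ge Q_gt_qj by auto
 have "EX s. s ^. (qj - 1) +. inverse g *. s ^. 0 = zero" using n by (intro root_ex[of "qj - 1"] monic_add_ex monic_power_ex)
 then obtain s where s: "s ^. (qj - 1) = uminus (inverse g)" by (auto simp: w.eq_neg_iff_add_eq_0)
 have "s ^. (qj - 1) ~= zero" unfolding s using gnz by simp
 hence snz: "s ~= zero" using n by simp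
 have "s ^. (qj - 1) : M" unfolding s by (rule M_neg[OF inverse_M[OF g]])
 hence sM: "s : M" by (rule pow_M)
 have gs: "g *. s ^. qj = uminus s"
  using w.power_Suc[of s "qj - 1"] gnz unfolding n(2) s by (simp add: field_simps)
 have d: "s ^. (Q - 1) : M" "s ^. (Q - 1) ~= zero" using M_pow[OF sM n(3)] snz by auto
 obtain u where u: "u 0 ~: W" "Phi (s ^. (Q - 1)) (u 0) = zero" "!!i::nat. u i ~: W"
  "!!i. Phi (s ^. (Q - 1)) (u (Suc i)) = u i" "!!i. u (Suc i) ^. qj /. u i +. one : M"
  using chain_exists[OF d] by metis
 have uL: "u L ~= zero" using u(3)[of L] v_zero by metis
 have "EX t. t ^. (Q - 1) +. uminus (inverse (u L)) *. t ^. 0 = zero"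
  using n by (intro root_ex[of "Q - 1"] monic_add_ex monic_power_ex)
 then obtain t where "t ^. (Q - 1) = inverse (u L)" by auto
 hence t: "t ^. (Q - 1) *. u L = one" using uL by simp
 have "infinite_place divide inverse times one plus zero minus uminus p e j g W s u t L"
  by unfold_locales (use gs sM snz u t in auto)
 thus thesis by (rule that)
qed

lemma infinite_place_bound:
 assumes g: "g ~: W" and arch: "!!f. f : E m ==> f ~= zero ==> EX n. inverse g ^. n /. f : W"
  and i: "i < p" and f: "!!l. f l : E m" and sum: "w.sum (%l. f l ^. p *. g ^. l) {..i} : W"
 shows "f i ^. (p * ((q - 1) * (qj - 1))) *. inverse g ^. (i * (q + qj - 2)) : W"
proof -
 obtain s u t where "infinite_place divide inverse times one plus zero minus uminus p e j g W s u t m"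
  using infinite_place_exists[OF g] by blast
 then interpret infinite_place divide inverse times one plus zero minus uminus p e j g W s u t m .
 show ?thesis by (rule top_coefficient_pole[OF arch i f sum])
qed

end

section \<open>The function fields of the tower\<close>

context total_field
begin

definition ring_on :: "'a set => 'a ring" where
 "ring_on S = \<lparr>carrier = S, monoid.mult = times, monoid.one = one, ring.zero = zero, ring.add = plus\<rparr>"

lemma ring_on_simps [simp]:
 "carrier (ring_on S) = S" "x \<otimes>\<^bsub>ring_on S\<^esub> y = x *. y" "\<one>\<^bsub>ring_on S\<^esub> = one"
 "\<zero>\<^bsub>ring_on S\<^esub> = zero" "x \<oplus>\<^bsub>ring_on S\<^esub> y = x +. y"
 by (simp_all add: ring_on_def)

lemma ring_on_pow [simp]: "x [^]\<^bsub>ring_on S\<^esub> (n::nat) = x ^. n"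
 by (induction n) (simp_all add: nat_pow_def w.mult.commute)

lemma field_ring_on: assumes S: "subf S" shows "field (ring_on S)"
proof (rule cring.cring_fieldI)
 note c = subf_one[OF S] subf_zero[OF S] subf_add[OF S] subf_mult[OF S] subf_neg[OF S] subf_inverse[OF S]
 show cr: "cring (ring_on S)"
 proof (rule cringI)
  show "abelian_group (ring_on S)"
   by (rule abelian_groupI) (auto simp: c algebra_simps intro!: bexI[of _ "uminus _"])
  show "comm_monoid (ring_on S)" by (rule comm_monoidI) (auto simp: c algebra_simps)
 qed (auto simp: algebra_simps)
 show "Units (ring_on S) = carrier (ring_on S) - {\<zero>\<^bsub>ring_on S\<^esub>}"
 proof
  show "Units (ring_on S) <= carrier (ring_on S) - {\<zero>\<^bsub>ring_on S\<^esub>}" by (auto simp: Units_def)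
  show "carrier (ring_on S) - {\<zero>\<^bsub>ring_on S\<^esub>} <= Units (ring_on S)"
  proof
   fix z assume "z : carrier (ring_on S) - {\<zero>\<^bsub>ring_on S\<^esub>}"
   thus "z : Units (ring_on S)" unfolding Units_def by (auto intro!: bexI[of _ "inverse z"] simp: c)
  qed
 qed
qed

lemma ring_on_neg: assumes S: "subf S" and z: "z : S" shows "\<ominus>\<^bsub>ring_on S\<^esub> z = uminus z"
proof -
 interpret R: field "ring_on S" by (rule field_ring_on[OF S])
 show ?thesis using R.sum_zero_eq_neg[of "uminus z" z] z subf_neg[OF S z] by simp
qed

lemma ring_on_minus: "subf S ==> x : S ==> y : S ==> x \<ominus>\<^bsub>ring_on S\<^esub> y = x -. y"
 by (simp add: a_minus_def ring_on_neg)

lemma ring_on_inv: assumes S: "subf S" and z: "z : S" "z ~= zero" shows "inv\<^bsub>ring_on S\<^esub> z = inverse z"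
proof -
 interpret R: field "ring_on S" by (rule field_ring_on[OF S])
 show ?thesis using R.comm_inv_char[of z "inverse z"] z subf_inverse[OF S z(1)] by simp
qed

lemma ring_on_subring:
 assumes S: "subf S" and T: "T <= S" "one : T" "!!x y. x : T ==> y : T ==> x -. y : T" "!!x y. x : T ==> y : T ==> x *. y : T"
 shows "subring T (ring_on S)"
proof -
 interpret R: field "ring_on S" by (rule field_ring_on[OF S])
 have n: "uminus x : T" if "x : T" for x using T(3)[OF T(3)[OF T(2,2)] that] by simp
 have a: "x +. y : T" if "x : T" "y : T" for x y using T(3)[OF that(1) n[OF that(2)]] by simp
 have "\<ominus>\<^bsub>ring_on S\<^esub> x = uminus x" if "x : T" for x using ring_on_neg[OF S] T(1) that by blast
 thus ?thesis using T n a by (intro R.subringI) auto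
qed

lemma ring_on_subfield: assumes S: "subf S" and T: "subf T" "T <= S" shows "subfield T (ring_on S)"
proof -
 interpret R: field "ring_on S" by (rule field_ring_on[OF S])
 have "inv\<^bsub>ring_on S\<^esub> k : T" if "k : T" "k ~= zero" for k
  using ring_on_inv[OF S] that T subf_inverse[OF T(1)] by auto
 thus ?thesis using ring_on_subring[OF S T(2)] T(1)
  by (intro R.subfieldI') (auto simp: subf_def)
qed

lemma subfield_subf: assumes S: "subf S" and T: "subfield T (ring_on S)" shows "subf T"
proof -
 interpret R: field "ring_on S" by (rule field_ring_on[OF S])
 note c = subringE[OF subfieldE(1)[OF T]]
 show ?thesis
 proof (rule subfI)
  show "one : T" using c(3) by simp
  fix x y assume x: "x : T" and y: "y : T"
  hence "x : S" "y : S" using c(1) by auto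
  thus "x -. y : T" using c(5)[OF y] c(7)[OF x] ring_on_neg[OF S] by fastforce
  show "x *. y : T" using c(6)[OF x y] by simp
 next
  fix x assume x: "x : T"
  hence "x : S" using c(1) by auto
  show "inverse x : T"
  proof (cases "x = zero")
   case False
   thus ?thesis using R.subfield_m_inv(1)[OF T, of x] ring_on_inv[OF S \<open>x : S\<close>] x by simp
  qed (use c(2) in simp)
 qed
qed

lemma ring_on_eval: "ring.eval (ring_on S) (a # l) z = a *. z ^. length l +. ring.eval (ring_on S) l z"
 if "subf S" for a l z
proof -
 interpret R: field "ring_on S" by (rule field_ring_on[OF that])
 show ?thesis by simp
qed

end

context torsion_tower
begin

text \<open>A simple algebraic extension of the finite field \<open>K\<close> is finite, so two
  Frobenius powers of \<open>a\<close> agree.\<close>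

lemma algebraic_kbar:
 assumes S: "subf S" "K <= S" and a: "a : S" "(ring.algebraic (ring_on S) over K) a"
 shows "a : kbar"
proof -
 interpret R: field "ring_on S" by (rule field_ring_on[OF S(1)])
 have sK: "subfield K (ring_on S)" using ring_on_subfield[OF S(1) _ S(2)] subf_fixed by (simp add: K_def)
 have ac: "a : carrier (ring_on S)" using a(1) by simp
 let ?X = "R.simple_extension K a"
 have fK: "finite K" unfolding K_def by (rule card_fixed(1)[OF ej_pos(2)])
 have "finite ?X" using R.card_dimension[OF sK fK R.dimension_simple_extension[OF sK ac a(2)]] by blast
 moreover have "range (%r. a ^. (p ^ r)) <= ?X"
 proof -
  note sr = R.simple_extension_is_subring[OF subfieldE(1)[OF sK] ac]
  have m: "a : ?X" by (rule R.simple_extension_mem[OF subfieldE(1)[OF sK] ac])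
  have "a ^. n : ?X" for n by (induction n) (use subringE(3,6)[OF sr] m in auto)
  thus ?thesis by blast
 qed
 ultimately have "finite (range (%r. a ^. (p ^ r)))" by (rule rev_finite_subset)
 hence "\<not> inj (%r. a ^. (p ^ r))" using finite_imageD[of _ "UNIV::nat set"] by auto
 then obtain r s where rs: "r < s" "a ^. (p ^ r) = a ^. (p ^ s)"
  unfolding inj_on_def by (metis linorder_neqE_nat)
 have "a ^. (p ^ s) = (a ^. (p ^ (s - r))) ^. (p ^ r)"
  using rs(1) by (simp add: w.power_mult[symmetric] power_add[symmetric])
 hence "a ^. (p ^ (s - r)) = a" using rs(2) frob_inj by metis
 thus ?thesis using kbarI[of "s - r" a] rs(1) by (simp add: fixed_def)
qed

lemma kernel_algebraic:
 assumes S: "subf S" and T: "subf T" "T <= S" "c : T" and a: "a : S" "phi c a = zero"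
 shows "(ring.algebraic (ring_on S) over T) a"
proof -
 interpret R: field "ring_on S" by (rule field_ring_on[OF S])
 \<comment> \<open>Coefficients below the leading one of \<open>z^Q - c z^qj - z\<close>, which is
   \<open>- phi c z\<close>.\<close>
 define co where "co i = (if i = qj then uminus c else zero) +. (if i = 1 then uminus one else zero)" for i :: nat
 let ?l = "%n. map co (rev [0..<n])"
 have ev: "R.eval (?l n) a = w.sum (%i. co i *. a ^. i) {..<n}" for n
  by (induction n) (simp_all add: ring_on_eval[OF S] w.add.commute del: R.eval.simps(2))
 have q1: "qj ~= Suc 0" "Suc 0 < Q" using Q_gt_qj qj_gt_q q_ge by auto
 have "w.sum (%i. co i *. a ^. i) {..<Q} =
   w.sum (%i. (if i = qj then uminus c *. a ^. i else zero) +. (if i = 1 then uminus a else zero)) {..<Q}"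
  by (intro w.sum.cong) (auto simp: co_def q1)
 also have "\<dots> = uminus c *. a ^. qj -. a"
 proof -
  show ?thesis using q1 Q_gt_qj by (simp add: w.sum.distrib)
 qed
 finally have sum: "w.sum (%i. co i *. a ^. i) {..<Q} = uminus c *. a ^. qj -. a" .
 have "R.eval (one # ?l Q) a = a ^. Q +. (uminus c *. a ^. qj -. a)"
  by (simp add: ring_on_eval[OF S] ev sum del: R.eval.simps(2))
 also have "\<dots> = uminus (phi c a)" by (simp add: phi_def algebra_simps)
 finally have "R.eval (one # ?l Q) a = zero" using a(2) by simp
 moreover have "one # ?l Q : carrier (univ_poly (ring_on S) T)"
 proof -
  have "co i : T" for i using T(1,3) by (simp add: co_def subf_one subf_zero subf_neg subf_add)
  thus ?thesis using subf_one[OF T(1)] by (auto simp: univ_poly_def polynomial_def)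
 qed
 ultimately show ?thesis using R.algebraicI[of "one # ?l Q" T a] by simp
qed

lemma subf_UNIV: "subf UNIV" by (simp add: subf_def)

lemma valued_field_valring: assumes "field.valring (ring_on UNIV) V"
 shows "valued_field divide inverse times one plus zero minus uminus V"
proof -
 interpret R: field "ring_on UNIV" by (rule field_ring_on[OF subf_UNIV])
 note v = R.valring_subring[OF assms] and c = subringE[OF R.valring_subring[OF assms]]
 show ?thesis
 proof
  show "one : V" using c(3) by simp
  fix x y assume x: "x : V"
  show "x *. y : V" if y: "y : V" using c(6)[OF x y] by simp
  show "x -. y : V" if y: "y : V" using c(7)[OF x c(5)[OF y]] ring_on_neg[OF subf_UNIV, of y] by simp
 next
  fix x assume "x ~: V"
  moreover from this have "x ~= zero" using c(2) by auto
  ultimately show "inverse x : V" using assms ring_on_inv[OF subf_UNIV, of x] by (auto simp: R.valring_def)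
 qed
qed

text \<open>\<open>g\<close> is transcendental over \<open>K\<close>, so 1/g is not in K[g] and
  Chevalley's theorem applies in the whole closed field.\<close>

lemma place_over_zero:
 obtains W where "valued_field divide inverse times one plus zero minus uminus W" "g : W" "inverse g ~: W"
proof -
 interpret R: field "ring_on UNIV" by (rule field_ring_on[OF subf_UNIV])
 have sK: "subfield K (ring_on UNIV)" using ring_on_subfield[OF subf_UNIV] subf_fixed by (simp add: K_def)
 note S = R.adjoin_subring[OF subfieldE(1)[OF sK], of g, simplified]
 have gnz: "g ~= zero" using g_kbar subf_zero[OF subf_kbar] by auto
 have tr: "(R.transcendental over K) g" using algebraic_kbar[OF subf_UNIV subset_UNIV UNIV_I, of g] g_kbar by (auto simp: over_def)
 have "inverse g ~: R.adjoin K g"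
 proof
  assume i: "inverse g : R.adjoin K g"
  have "one = \<zero>\<^bsub>ring_on UNIV\<^esub>" using gnz
   by (intro R.transcendental_ladder[OF subfieldE(1)[OF sK] _ tr _ i]) (simp_all add: K_def fixed_one)
  thus False by simp
 qed
 moreover have "inv\<^bsub>ring_on UNIV\<^esub> g = inverse g" using ring_on_inv[OF subf_UNIV] gnz by simp
 ultimately obtain W where W: "R.valring W" "R.adjoin K g <= W" "inverse g ~: W"
  using R.exists_valring[OF S(1), of g] S gnz by auto
 show thesis using that[OF valued_field_valring[OF W(1)]] W S by auto
qed

lemma E_subset: "i <= m ==> E i <= E m"
 by (rule E_minimal[OF subf_E]) (auto simp: E_gen)

lemma finite_dimension_E: "i <= m ==> ring.finite_dimension (ring_on (E m)) (E 0) (E i)"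
proof (induction i)
 interpret R: field "ring_on (E m)" by (rule field_ring_on[OF subf_E])
 have s: "subfield (E i) (ring_on (E m))" if "i <= m" for i by (rule ring_on_subfield[OF subf_E subf_E E_subset[OF that]])
 { case 0
  show ?case by (rule R.finite_dimensionI[OF R.dimension_one[OF s[OF le0]]]) }
 fix i assume IH: "i <= m ==> R.finite_dimension (E 0) (E i)" and i: "Suc i <= m"
 hence im: "i <= m" "i < m" by auto
 have xc: "x i : carrier (ring_on (E m))" using E_gen(3)[OF im(2)] by simp
 have alg: "subfield (R.simple_extension (E i) (x i)) (ring_on (E m))" "R.finite_dimension (E i) (R.simple_extension (E i) (x i))" using kernel_algebraic[OF subf_E subf_E E_subset[OF im(1)] gg_mem[OF subf_E E_gen(1) E_gen(3)] _ phi_x[of i]] xc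
  using R.simple_extension_is_subfield[OF s[OF im(1)] xc] R.finite_dimension_simple_extension[OF s[OF im(1)] xc] by auto
 let ?X = "R.simple_extension (E i) (x i)"
 have inc: "E i <= ?X" "x i : ?X"
  using R.simple_extension_incl[OF _ xc, of "E i"] R.simple_extension_mem[OF subfieldE(1)[OF s[OF im(1)]] xc] E_subset[OF im(1)] by auto
 have "E (Suc i) <= ?X"
 proof (rule E_minimal[OF subfield_subf[OF subf_E alg(1)]])
  show "g : ?X" "K <= ?X" using inc(1) E_gen[of i] by auto
  show "l < Suc i ==> x l : ?X" for l using inc E_gen(3)[of l i] by (cases "l = i") auto
 qed
 moreover have "?X <= E (Suc i)"
  using R.simple_extension_subring_incl[OF subfieldE(1)[OF s[OF i]] E_mono E_gen(3)[of i "Suc i"]] by simp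
 ultimately show "R.finite_dimension (E 0) (E (Suc i))"
  using R.telescopic_base_dim(1)[OF s[OF le0] s[OF im(1)] IH[OF im(1)]] alg(2) by simp
qed

end

context valued_tower
begin

text \<open>The lowest nonzero coefficient is a unit, and factors \<open>g\<close> below it only
  shift the exponent.\<close>

lemma polynomial_comparable:
 assumes g: "g : M" shows "f : cring.ladder (ring_on UNIV) K g n ==> f ~= zero ==> EX l. g ^. l /. f : W"
proof (induction n arbitrary: f)
 interpret R: field "ring_on UNIV" by (rule field_ring_on[OF subf_UNIV])
 { case 0 thus ?case by simp }
 fix n f assume IH: "!!f. f : R.ladder K g n ==> f ~= zero ==> EX l. g ^. l /. f : W"
  and f: "f : R.ladder K g (Suc n)" "f ~= zero"
 obtain c h where h: "f = c +. g *. h" "c : K" "h : R.ladder K g n" using R.ladder_SucE[OF f(1)] by auto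
 have hW: "h : W" using h(3)
 proof (induction n arbitrary: h)
  case (Suc n)
  thus ?case using K_W M_W[OF g] by (auto elim!: R.ladder_SucE)
 qed simp
 show "EX l. g ^. l /. f : W"
 proof (cases "c = zero")
  case True
  then obtain l where "g ^. l /. h : W" using IH[OF h(3)] f(2) h(1) by auto
  moreover have "g ^. Suc l /. f = g ^. l /. h" using g_kbar subf_zero[OF subf_kbar] True h(1) by auto
  ultimately show ?thesis by metis
 next
  case False
  have "inverse c : W" using K_W subf_inverse[OF subf_fixed] h(2) by (auto simp: K_def)
  hence "c ~: M" using False by (simp add: not_M)
  hence "f ~: M" unfolding h(1) using K_W h(2) by (intro unit_add_M M_mult g hW) auto
  hence "g ^. 0 /. f : W" using v_div[OF v_one] by simp
  thus ?thesis ..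
 qed
qed

lemma comparable_base: assumes g: "g : M" and c: "c : E 0" shows "EX n. g ^. n *. c : W"
proof -
 interpret R: field "ring_on UNIV" by (rule field_ring_on[OF subf_UNIV])
 have sK: "subfield K (ring_on UNIV)" using ring_on_subfield[OF subf_UNIV] subf_fixed by (simp add: K_def)
 note S = R.adjoin_subring[OF subfieldE(1)[OF sK], of g, simplified]
 let ?P = "R.adjoin K g"
 have P: "one : ?P" "!!x y. x : ?P ==> y : ?P ==> x *. y : ?P" "!!x y. x : ?P ==> y : ?P ==> x -. y : ?P"
 proof -
  show "one : ?P" using subringE(3)[OF S(1)] by simp
  fix x y assume x: "x : ?P" and y: "y : ?P"
  show "x *. y : ?P" using subringE(6)[OF S(1) x y] by simp
  show "x -. y : ?P" using subringE(7)[OF S(1) x subringE(5)[OF S(1) y]] ring_on_neg[OF subf_UNIV UNIV_I, of y] by simp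
 qed
 have PW: "?P <= W"
 proof (rule R.adjoin_min)
  show "subring W (ring_on UNIV)" by (rule ring_on_subring[OF subf_UNIV]) auto
 qed (use K_W M_W[OF g] in auto)
 define T where "T = {f. EX a:?P. EX b:?P. b ~= zero & f = a /. b}"
 have TI: "a /. b : T" if "a : ?P" "b : ?P" "b ~= zero" for a b using that by (auto simp: T_def)
 have "subf T"
 proof (rule subfI)
  show "one : T" using TI[OF P(1,1)] by simp
  fix x y assume "x : T" "y : T"
  then obtain a b c d where e: "x = a /. b" "y = c /. d" "b ~= zero" "d ~= zero" "a : ?P" "b : ?P" "c : ?P" "d : ?P"
   unfolding T_def by blast
  have bd: "b *. d : ?P" "b *. d ~= zero" using P(2)[OF e(6,8)] e(3,4) by auto
  have "(a *. d -. c *. b) /. (b *. d) : T" by (rule TI[OF P(3)[OF P(2)[OF e(5,8)] P(2)[OF e(7,6)]] bd])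
  moreover have "x -. y = (a *. d -. c *. b) /. (b *. d)" unfolding e(1,2) by (rule w.diff_frac_eq[OF e(3,4)])
  ultimately show "x -. y : T" by simp
  have "(a *. c) /. (b *. d) : T" by (rule TI[OF P(2)[OF e(5,7)] bd])
  thus "x *. y : T" unfolding e(1,2) by simp
 next
  fix x assume "x : T"
  then obtain a b where e: "x = a /. b" "b ~= zero" "a : ?P" "b : ?P" unfolding T_def by blast
  show "inverse x : T"
  proof (cases "a = zero")
   case True
   thus ?thesis using e \<open>x : T\<close> by simp
  next
   case False
   thus ?thesis using TI[OF e(4,3)] e(1) by simp
  qed
 qed
 moreover have "z : T" if "z : ?P" for z using TI[OF that P(1)] by simp
 ultimately have "E 0 <= T" using S by (intro E_minimal) auto
 then obtain a b where ab: "a : ?P" "b : ?P" "b ~= zero" "c = a /. b" using c by (auto simp: T_def)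
 obtain n where "g ^. n /. b : W" using polynomial_comparable[OF g, of b] ab(2,3) by (auto simp: R.adjoin_def)
 hence "g ^. n /. b *. a : W" using PW ab(1) by blast
 thus ?thesis using ab(4) by auto
qed

text \<open>A relation for 1/f over \<open>E 0\<close>, multiplied by a power of the integral
  \<open>f\<close>, expresses a nonzero multiple of 1/f by coefficients from \<open>E 0\<close> and
  powers of \<open>f\<close>; the coefficients have poles of bounded order by
  \<open>comparable_base\<close>.\<close>

lemma comparable:
 assumes g: "g : M" and f: "f : E m" "f ~= zero" shows "EX n. g ^. n /. f : W"
proof (cases "inverse f : W")
 case True
 hence "g ^. 0 /. f : W" by (simp add: w.divide_inverse)
 thus ?thesis ..
next
 case False
 let ?y = "inverse f"
 have fW: "f : W" using v_total[OF False] by simp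
 interpret R: field "ring_on (E m)" by (rule field_ring_on[OF subf_E])
 have s: "subfield (E 0) (ring_on (E m))" by (rule ring_on_subfield[OF subf_E subf_E E_subset[OF le0]])
 have yE: "?y : E m" by (rule subf_inverse[OF subf_E f(1)])
 have alg: "(R.algebraic over (E 0)) ?y"
  using R.finite_dimension_imp_algebraic[OF s R.carrier_is_subring, simplified] finite_dimension_E[OF order_refl] yE by simp
 obtain l where l: "l : carrier (univ_poly (ring_on (E m)) (E 0))" "l ~= []" "R.eval l ?y = zero"
  using R.algebraicE[OF subfieldE(1)[OF s] _ alg] yE by auto
 then obtain c l' where c: "l = c # l'" "c : E 0" "c ~= zero" "set l' <= E 0"
  by (cases l) (auto simp: univ_poly_def polynomial_def)
 have "set l' <= E 0 ==> EX n. g ^. n *. (?y *. R.eval l' ?y *. f ^. length l') : W"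
 proof (induction l')
  case (Cons a l')
  then obtain n where n: "g ^. n *. (?y *. R.eval l' ?y *. f ^. length l') : W" by auto
  obtain n' where n': "g ^. n' *. a : W" using comparable_base[OF g, of a] Cons.prems by auto
  have yf: "?y ^. k *. f ^. k = one" for k using f(2) by (simp add: w.power_mult_distrib[symmetric])
  have "?y *. R.eval (a # l') ?y *. f ^. length (a # l') =
    a *. (?y *. f) *. (?y ^. length l' *. f ^. length l') +. f *. (?y *. R.eval l' ?y *. f ^. length l')"
   by (simp add: ring_on_eval[OF subf_E] algebra_simps del: R.eval.simps(2))
  also have "\<dots> = a +. f *. (?y *. R.eval l' ?y *. f ^. length l')" using f(2) by (simp add: yf)
  finally have "g ^. (n + n') *. (?y *. R.eval (a # l') ?y *. f ^. length (a # l')) =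
    g ^. n *. (g ^. n' *. a) +. g ^. n' *. f *. (g ^. n *. (?y *. R.eval l' ?y *. f ^. length l'))"
   by (simp only:) (simp add: w.power_add algebra_simps)
  moreover have "\<dots> : W" by (intro v_add v_mult v_pow M_W[OF g] n' n fW)
  ultimately show ?case by metis
 qed (auto intro: exI[of _ 0])
 then obtain n where n: "g ^. n *. (?y *. R.eval l' ?y *. f ^. length l') : W" using c(4) by blast
 have ev: "R.eval l' ?y = uminus (c *. ?y ^. length l')"
  using l(3) by (simp add: c(1) ring_on_eval[OF subf_E] w.eq_neg_iff_add_eq_0 w.add.commute del: R.eval.simps(2))
 have yf: "?y ^. length l' *. f ^. length l' = one" using f(2) by (simp add: w.power_mult_distrib[symmetric])
 have "?y *. R.eval l' ?y *. f ^. length l' = uminus (c *. ?y *. (?y ^. length l' *. f ^. length l'))"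
  unfolding ev by (simp add: algebra_simps)
 hence cy: "g ^. n *. (c *. ?y) : W" using v_neg[OF n] unfolding yf by simp
 obtain n' where "g ^. n' *. inverse c : W" using comparable_base[OF g subf_inverse[OF subf_E c(2)]] by blast
 hence "(g ^. n' *. inverse c) *. (g ^. n *. (c *. ?y)) : W" using cy by simp
 also have "(g ^. n' *. inverse c) *. (g ^. n *. (c *. ?y)) = g ^. (n' + n) /. f"
  using c(3) by (simp add: w.power_add field_simps)
 finally show ?thesis by blast
qed

end

context torsion_tower
begin

text \<open>For the full constant field: an element algebraic over \<open>K\<close> lies in
  \<open>kbar\<close>, and at a zero of \<open>g\<close> it is congruent to some \<open>c\<close> in
  \<open>K\<close>. A nonzero element of \<open>kbar\<close> is a unit, so it equals
  \<open>c\<close>.\<close>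

lemma tower_function_field: "global_function_field (ring_on (E m)) K"
proof -
 interpret R: field "ring_on (E m)" by (rule field_ring_on[OF subf_E])
 obtain W where W: "valued_field divide inverse times one plus zero minus uminus W" "g : W" "inverse g ~: W"
  using place_over_zero by blast
 interpret v: valued_field divide inverse times one plus zero minus uminus W by (rule W(1))
 interpret v: valued_tower divide inverse times one plus zero minus uminus p e j g W ..
 have g: "g : v.M" using W(3) by (simp add: v.M_def)
 have sK: "subfield K (ring_on (E m))" using ring_on_subfield[OF subf_E] subf_fixed E_gen(2) by (simp add: K_def)
 show ?thesis
 proof (intro global_function_field.intro global_function_field_axioms.intro R.field_axioms sK)
  show "finite K" unfolding K_def by (rule card_fixed(1)[OF ej_pos(2)])
  have gK: "insert g K <= carrier (ring_on (E m))" using E_gen by auto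
  have s0: "subfield (E 0) (ring_on (E m))" by (rule ring_on_subfield[OF subf_E subf_E E_subset[OF le0]])
  have "generate_field (ring_on (E m)) (insert g K) = E 0"
  proof
   show "generate_field (ring_on (E m)) (insert g K) <= E 0"
    by (rule R.generate_field_min_subfield1[OF gK s0]) (use E_gen in auto)
   note sg = R.generate_field_is_subfield[OF gK]
   show "E 0 <= generate_field (ring_on (E m)) (insert g K)"
    by (rule E_minimal[OF subfield_subf[OF subf_E sg]]) (auto intro: generate_field.incl)
  qed
  hence "R.finite_dimension (generate_field (ring_on (E m)) (insert g K)) (carrier (ring_on (E m)))"
   using finite_dimension_E[OF order_refl, of m] by simp
  thus "EX x:carrier (ring_on (E m)). (R.transcendental over K) x &
    R.finite_dimension (generate_field (ring_on (E m)) (insert x K)) (carrier (ring_on (E m)))"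
   using algebraic_kbar[OF subf_E E_gen(2) E_gen(1)] g_kbar E_gen(1) by (auto simp: over_def)
  fix a assume a: "a : carrier (ring_on (E m))" "(R.algebraic over K) a"
  have ak: "a : kbar" using algebraic_kbar[OF subf_E E_gen(2)] a by simp
  have aW: "a : W" using v.kbar_W[OF ak] .
  obtain c where c: "c : K" "a -. c : v.M"
   using v.finite_place_zero(1)[OF g v.comparable[OF g, where m = m] _ aW] a(1) by auto
  have ac: "a -. c : kbar" using c(1) K_kbar by (intro subf_minus[OF subf_kbar ak]) auto
  have "a -. c = zero" using v.kbar_W[OF subf_inverse[OF subf_kbar ac]] using c(2) by (simp add: v.M_def)
  thus "a : K" using c(1) by simp
 qed
qed

end

section \<open>Places of the function fields of the tower\<close>

locale tower_level = torsion_tower +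
 fixes m :: nat
 assumes odd_p: "odd p"
begin

lemma card_K: "card K = Q" unfolding K_def Q_def by (rule card_fixed(2)[OF ej_pos(2)])

sublocale F: global_function_field "ring_on (E m)" K by (rule tower_function_field)
sublocale F: odd_function_field "ring_on (E m)" K
 by unfold_locales (simp add: card_K Q_def odd_p del: mult_Suc_right)

abbreviation VR :: "'a set set" where "VR == valuation_rings (ring_on (E m)) K"

lemma E_inv: "z : E m ==> z ~= zero ==> inv\<^bsub>ring_on (E m)\<^esub> z = inverse z"
 by (rule ring_on_inv[OF subf_E])

lemma E_minus: "a : E m ==> b : E m ==> a \<ominus>\<^bsub>ring_on (E m)\<^esub> b = a -. b"
 by (rule ring_on_minus[OF subf_E])

lemma VR_props:
 assumes V: "V : VR"
 shows "V <= E m" "one : V" "a : V ==> b : V ==> a -. b : V" "a : V ==> b : V ==> a *. b : V"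
proof -
 note c = subringE[OF F.valring_subring[OF F.vr[OF V]]]
 show s: "V <= E m" "one : V" "a : V ==> b : V ==> a *. b : V" using c(1,3,6) by auto
 assume a: "a : V" and b: "b : V"
 hence "a : E m" "b : E m" using s(1) by auto
 thus "a -. b : V" using c(7)[OF a c(5)[OF b]] E_minus[of a b] by (simp add: a_minus_def)
qed

lemma VR_nonunits: "V : VR ==> F.nonunits V = {z : V. z = zero \<or> inverse z ~: V}"
 using VR_props(1)[of V] E_inv by (auto simp: F.nonunits_def)

text \<open>Chevalley's theorem keeps the inverse of the uniformizer outside \<open>W\<close>, so
  the restriction of \<open>W\<close> is a proper valuation ring containing \<open>V\<close>, and
  distinct ones are incomparable.\<close>

lemma extend_place:
 assumes V: "V : VR"
 obtains W where "valued_field divide inverse times one plus zero minus uminus W" "V = W \<inter> E m"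
proof -
 interpret R: field "ring_on UNIV" by (rule field_ring_on[OF subf_UNIV])
 note p = VR_props[OF V]
 let ?u = "F.unif V"
 have u: "?u : V" "?u ~= zero" "inverse ?u ~: V"
  using F.unif[OF V] VR_nonunits[OF V] by auto
 have "subring V (ring_on UNIV)" using p by (intro ring_on_subring[OF subf_UNIV]) auto
 moreover have "inv\<^bsub>ring_on UNIV\<^esub> ?u = inverse ?u" using ring_on_inv[OF subf_UNIV UNIV_I u(2)] .
 ultimately obtain W where W: "R.valring W" "V <= W" "inverse ?u ~: W"
  using R.exists_valring[of V ?u] u by auto
 have vW: "valued_field divide inverse times one plus zero minus uminus W" by (rule valued_field_valring[OF W(1)])
 interpret W: valued_field divide inverse times one plus zero minus uminus W by (rule vW)
 have sub: "subring (W \<inter> E m) (ring_on (E m))"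
  by (rule ring_on_subring[OF subf_E]) (auto intro: subf_one[OF subf_E] subf_minus[OF subf_E] subf_mult[OF subf_E])
 have "F.valring (W \<inter> E m)"
  unfolding F.valring_def using sub W.v_total subf_inverse[OF subf_E] E_inv by auto
 moreover have "K <= W \<inter> E m" using F.vr_K[OF V] W(2) p(1) by auto
 moreover have "W \<inter> E m ~= E m" using W(3) subf_inverse[OF subf_E, of ?u] u(1) p(1) by auto
 ultimately have "V = W \<inter> E m" using F.valuation_rings_iff using F.valuation_rings_incomparable[OF V] W(2) p(1) by auto
 thus thesis using that vW by blast
qed

lemma place_comparable:
 assumes V: "V : VR" and h: "h : F.nonunits V" "h ~= zero" and f: "f : E m" "f ~= zero"
 shows "EX n. h ^. n /. f : V"
proof -
 have hE: "h : E m" using F.nonunits_carrier[OF F.vr[OF V] h(1)] by simp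
 have h1: "F.valn V h >= 1" using F.valn_gt_0[OF V, of h] hE h by simp
 define n where "n = nat \<bar>F.valn V f\<bar>"
 have hn: "h ^. n : E m" "h ^. n ~= zero" using subf_pow[OF subf_E hE] h(2) by auto
 have fi: "inverse f : E m" "inverse f ~= zero" using subf_inverse[OF subf_E f(1)] f(2) by auto
 have "F.valn V (h ^. n *. inverse f) = F.valn V (h ^. n) + F.valn V (inverse f)"
  using F.valn_mult[OF V, of "h ^. n" "inverse f"] hn fi by simp
 also have "F.valn V (h ^. n) = int n * F.valn V h" using F.valn_pow[OF V, of h n] hE h(2) by simp
 also have "F.valn V (inverse f) = - F.valn V f" using F.valn_inv[OF V, of f] f E_inv[OF f] by simp
 finally have "F.valn V (h ^. n *. inverse f) >= 0" using mult_left_mono[OF h1, of "int n"] by (simp add: n_def)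
 hence "h ^. n *. inverse f : V" using F.valn_ge_0[OF V, of "h ^. n *. inverse f"] hn fi subf_mult[OF subf_E] by simp
 thus ?thesis unfolding w.divide_inverse by blast
qed

lemma g_nonconstant: "g : E m" "g ~: K" "g ~= zero"
 using E_gen(1) g_kbar K_kbar subf_zero[OF subf_kbar] by auto

text \<open>Residue representatives inject into \<open>K\<close>, which gives degree one, and the
  quotient of the uniformizer by \<open>g\<close> is integral, which gives valuation one.\<close>

lemma zero_place:
 assumes V: "V : VR" and g: "g : F.nonunits V"
 shows "F.degv V = 1" "F.valn V g = 1"
proof -
 obtain W where W: "valued_field divide inverse times one plus zero minus uminus W" "V = W \<inter> E m"
  using extend_place[OF V] by blast
 interpret v: valued_field divide inverse times one plus zero minus uminus W by (rule W(1))
 interpret v: valued_tower divide inverse times one plus zero minus uminus p e j g W ..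
 have M: "z : F.nonunits V \<longleftrightarrow> z : v.M" if "z : E m" for z
  unfolding VR_nonunits[OF V] v.M_def using that subf_inverse[OF subf_E that] v.v_total[of "inverse z"] by (auto simp: W(2))
 have gM: "g : v.M" using M g g_nonconstant by simp
 have arch: "EX n. g ^. n /. f : W" if "f : E m" "f ~= zero" for f
  using place_comparable[OF V g g_nonconstant(3) that] W(2) by auto
 obtain A where A: "F.kspace A" "finite A" "A <= V" "A \<inter> F.nonunits V = {zero}" "card A = card K ^ F.degv V"
  using F.residues[OF V] by (metis ring_on_simps(4))
 have "EX c:K. a -. c : v.M" if "a : A" for a
  using v.finite_place_zero(1)[OF gM arch, where m = m] that A(3) W(2) by auto
 then obtain h where h: "!!a. a : A ==> h a : K & a -. h a : v.M" by metis
 have "inj_on h A"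
 proof (rule inj_onI)
  fix a b assume ab: "a : A" "b : A" "h a = h b"
  have E: "a : E m" "b : E m" using ab A(3) VR_props(1)[OF V] by auto
  have "a -. h a -. (b -. h b) : v.M" using v.M_minus[of "a -. h a" "b -. h b"] h[OF ab(1)] h[OF ab(2)] by blast
  also have "a -. h a -. (b -. h b) = a -. b" by (simp add: ab(3) algebra_simps)
  finally have "a -. b : F.nonunits V" using M[OF subf_minus[OF subf_E E]] by simp
  moreover have "a -. b : A" using F.asubD(5)[of A a b] A(1) ab E_minus[OF E] by (simp add: F.kspace_def)
  ultimately have "a -. b = zero" using A(4) by blast
  thus "a = b" by simp
 qed
 hence "card A <= card K" using h by (intro card_inj_on_le[of h]) (auto simp: F.finite_constants)
 hence "card K ^ F.degv V <= card K ^ 1" using A(5) by simp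
 hence "F.degv V <= 1" using F.card_K_gt_1 power_le_imp_le_exp by blast
 thus "F.degv V = 1" using F.degv_pos[OF V] by simp
 let ?u = "F.unif V"
 have u: "?u : E m" "?u ~= zero" "?u : v.M" using F.unif[OF V] M[of ?u] by auto
 have ig: "inverse g : E m" "inverse g ~= zero" using subf_inverse[OF subf_E g_nonconstant(1)] g_nonconstant(3) by auto
 have "?u /. g : W" by (rule v.finite_place_zero(2)[OF gM arch u(1) v.M_W[OF u(3)] u(3)])
 hence "?u *. inverse g : V" using subf_mult[OF subf_E u(1) ig(1)] W(2) by (simp add: w.divide_inverse)
 hence "F.valn V (?u *. inverse g) >= 0" using F.valn_ge_0[OF V, of "?u *. inverse g"] u ig subf_mult[OF subf_E] by simp
 moreover have "F.valn V (?u *. inverse g) = F.valn V ?u + F.valn V (inverse g)"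
  using F.valn_mult[OF V, of ?u "inverse g"] u ig by simp
 moreover have "F.valn V (inverse g) = - F.valn V g" using F.valn_inv[OF V, of g] g_nonconstant E_inv by simp
 moreover have "F.valn V g > 0" using F.valn_gt_0[OF V, of g] g_nonconstant g by simp
 ultimately show "F.valn V g = 1" using F.valn_unif[OF V] by simp
qed

lemma place_integral:
 assumes V: "V : VR" "g : V" and i: "i < p" and f: "!!l. f l : E m"
  and sum: "w.sum (%l. f l ^. p *. g ^. l) {..i} : V"
 shows "f i : V"
proof -
 obtain W where W: "valued_field divide inverse times one plus zero minus uminus W" "V = W \<inter> E m"
  using extend_place[OF V(1)] by blast
 interpret v: valued_field divide inverse times one plus zero minus uminus W by (rule W(1))
 interpret v: valued_tower divide inverse times one plus zero minus uminus p e j g W ..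
 have M: "z : F.nonunits V \<longleftrightarrow> z : v.M" if "z : E m" for z
  unfolding VR_nonunits[OF V(1)] v.M_def using that subf_inverse[OF subf_E that] v.v_total[of "inverse z"] by (auto simp: W(2))
 have gW: "g : W" using V(2) W(2) by simp
 have res: "EX N>0. EX a:fixed N. z -. a : v.M" if z: "z : V" for z
 proof -
  let ?N = "e * Suc j * F.degv V"
  have zE: "z : E m" using z VR_props(1)[OF V(1)] by auto
  have n: "card K ^ F.degv V = p ^ ?N" by (simp add: card_K Q_def power_mult[symmetric] del: mult_Suc_right)
  have "z ^. (p ^ ?N) -. z : F.nonunits V"
   using F.residue_pow_card[OF V(1) z] E_minus[OF subf_pow[OF subf_E zE] zE] unfolding n by simp
  hence "z ^. (p ^ ?N) -. z : v.M" using M[OF subf_minus[OF subf_E subf_pow[OF subf_E zE] zE]] by simp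
  moreover have "?N > 0" using ej_pos(2) F.degv_pos[OF V(1)] by simp
  ultimately show ?thesis using v.residue_fixed by blast
 qed
 obtain N c where c: "N > 0" "c : fixed N" "g -. c : v.M" using res[OF V(2)] by blast
 have ck: "c : kbar" by (rule kbarI[OF c(1,2)])
 have xr: "EX a:kbar. x i -. a : v.M" if "i < m" for i
 proof -
  have "x i : V" using v.gg_x_integral[OF gW, of i] E_gen(3)[OF that] W(2) by simp
  from res[OF this] show ?thesis using kbarI by blast
 qed
 \<comment> \<open>The residue \<open>c\<close> of \<open>g\<close> may lie outside
   \<open>E m\<close>. The polynomial \<open>?h\<close> lies inside and equals \<open>g - c\<close>
   up to a unit, so it can be compared with elements of \<open>E m\<close> by their
   valuation.\<close>
 let ?h = "g ^. (p ^ N) -. g" and ?r = "(g -. c) ^. (p ^ N - 1) -. one"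
 have hE: "?h : E m" using subf_minus[OF subf_E subf_pow[OF subf_E]] g_nonconstant(1) by simp
 have "p ^ N - 1 > 0" "Suc (p ^ N - 1) = p ^ N" using one_less_power[OF p_gt_1 c(1)] by auto
 hence "?h = (g -. c) *. ?r" using w.power_Suc[of "g -. c" "p ^ N - 1"] c(2) by (simp add: frob_minus fixed_def algebra_simps)
 moreover have r: "?r ~: v.M" "?r : W"
 proof -
  have z: "(g -. c) ^. (p ^ N - 1) : v.M" using \<open>p ^ N - 1 > 0\<close> by (intro v.M_pow c(3))
  show "?r : W" using v.M_W[OF z] by simp
  show "?r ~: v.M" using v.M_minus[OF z, of ?r] by (auto simp: w.diff_diff_eq2)
 qed
 ultimately have h: "?h = (g -. c) *. ?r" "?h : v.M" using v.M_mult[OF c(3) r(2)] by auto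
 have hnz: "?h ~= zero"
 proof
  assume "?h = zero"
  hence "g : fixed N" by (simp add: fixed_def)
  thus False using kbarI[OF c(1)] g_kbar by blast
 qed
 have arch: "EX n. (g -. c) ^. n /. f : W" if ff: "f : E m" "f ~= zero" for f
 proof -
  obtain n where "?h ^. n /. f : W" using place_comparable[OF V(1) _ hnz ff] M[OF hE] h(2) W(2) by auto
  hence "?h ^. n /. f /. ?r ^. n : W" by (rule v.v_div[OF _ v.not_M_pow[OF r(1)]])
  moreover have "?r ^. n ~= zero" using v.not_M_pow[OF r(1), of n] v.M_zero by metis
  hence "?h ^. n /. f /. ?r ^. n = (g -. c) ^. n /. f" unfolding h(1) w.power_mult_distrib by simp
  ultimately show ?thesis by auto
 qed
 have "w.sum (%l. f l ^. p *. g ^. l) {..i} : W" using sum unfolding W(2) by (rule IntD1)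
 hence "f i : W"
  by (rule v.finite_place_integral[OF gW ck c(3), where m = m and i = i and f = f, rotated -1]) (fact xr arch i f)+
 thus ?thesis using f W(2) by simp
qed

lemma place_pole:
 assumes V: "V : VR" "g ~: V" and i: "i < p" and f: "!!l. f l : E m"
  and sum: "w.sum (%l. f l ^. p *. g ^. l) {..i} : V"
 shows "f i ^. (p * ((q - 1) * (qj - 1))) *. inverse g ^. (i * (q + qj - 2)) : V"
proof -
 obtain W where W: "valued_field divide inverse times one plus zero minus uminus W" "V = W \<inter> E m"
  using extend_place[OF V(1)] by blast
 interpret v: valued_field divide inverse times one plus zero minus uminus W by (rule W(1))
 interpret v: valued_tower divide inverse times one plus zero minus uminus p e j g W ..
 have gW: "g ~: W" using V(2) W(2) g_nonconstant(1) by simp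
 have igE: "inverse g : E m" by (rule subf_inverse[OF subf_E g_nonconstant(1)])
 have ig: "inverse g : F.nonunits V" using v.v_total[OF gW] gW igE VR_nonunits[OF V(1)] W(2) by auto
 have arch: "EX n. inverse g ^. n /. f : W" if "f : E m" "f ~= zero" for f using g_nonconstant(3)
  using place_comparable[OF V(1) ig _ that] unfolding W(2) by auto
 have "w.sum (%l. f l ^. p *. g ^. l) {..i} : W" using sum unfolding W(2) by (rule IntD1)
 hence "f i ^. (p * ((q - 1) * (qj - 1))) *. inverse g ^. (i * (q + qj - 2)) : W"
  by (rule v.infinite_place_bound[OF gW, where m = m and i = i and f = f, rotated -1]) (fact arch i f)+
 thus ?thesis using f igE subf_mult[OF subf_E] subf_pow[OF subf_E] W(2) by auto
qed

text \<open>In \<open>psi (x i) (x (i+1)) = - x i\<close> the other coefficients are small at a pole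
  of \<open>x i\<close>, so \<open>x (i+1)^qj\<close> dominates and the pole orders shrink by the
  factor \<open>qj\<close> at each level.\<close>

lemma pole_growth:
 assumes V: "V : VR" and x0: "x 0 ~: V" and m: "Suc i <= m"
 shows "x i ~: V & (i > 0 --> F.valn V (x (i - 1)) = int qj * F.valn V (x i))"
proof -
 obtain W where W: "valued_field divide inverse times one plus zero minus uminus W" "V = W \<inter> E m"
  using extend_place[OF V] by blast
 interpret v: valued_field divide inverse times one plus zero minus uminus W by (rule W(1))
 have step: "x (Suc i) ~: W & F.valn V (x i) = int qj * F.valn V (x (Suc i))" if xi: "x i ~: W" and im: "Suc i < m" for i
 proof -
  let ?c = "%k. x i /. x i ^. (p ^ (e * Suc k))" and ?y = "x (Suc i)"
  have cM: "?c k : v.M" for k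
  proof -
   have n: "p ^ (e * Suc k) - 1 > 0" "Suc (p ^ (e * Suc k) - 1) = p ^ (e * Suc k)"
    using one_less_power[OF p_gt_1, of "e * Suc k"] e_pos by auto
   have "inverse (x i) ^. (p ^ (e * Suc k) - 1) : v.M" by (intro v.M_pow v.inverse_M xi n)
   moreover have "?c k = inverse (x i) ^. (p ^ (e * Suc k) - 1)"
    using w.power_Suc[of "x i" "p ^ (e * Suc k) - 1"] x_nz[of i] unfolding n(2) by (simp add: field_simps)
   ultimately show ?thesis by simp
  qed
  have yW: "?y ~: W"
  proof
   assume y: "?y : W"
   have "w.sum (%k. ?y ^. (p ^ (e * k)) *. ?c k) {..<n::nat} : W" for n
   proof (induction n)
    case (Suc n)
    thus ?case unfolding w.sum.lessThan_Suc by (intro v.v_add v.v_mult v.v_pow y v.M_W[OF cM])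
   qed simp
   hence "uminus (uminus (x i)) : W" unfolding psi_x[symmetric] psi_def using y by (intro v.v_neg v.v_add v.v_pow)
   thus False using xi by simp
  qed
  have s: "w.sum (%k. ?y ^. (p ^ (e * k)) *. ?c k) {..<n} /. ?y ^. qj : v.M" if "n <= j" for n
   using that
  proof (induction n)
   case (Suc n)
   have le: "p ^ (e * n) <= qj" unfolding qj_def using Suc.prems p_gt_1 by (intro power_increasing) auto
   have "?y ^. qj = ?y ^. (p ^ (e * n)) *. ?y ^. (qj - p ^ (e * n))" using le by (simp add: w.power_add[symmetric])
   hence "?y ^. (p ^ (e * n)) *. ?c n /. ?y ^. qj = ?c n *. inverse ?y ^. (qj - p ^ (e * n))"
    using x_nz[of "Suc i"] by (simp add: field_simps)
   moreover have "?c n *. inverse ?y ^. (qj - p ^ (e * n)) : v.M"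
    by (intro v.M_mult cM v.v_pow v.v_total yW)
   ultimately have "?y ^. (p ^ (e * n)) *. ?c n /. ?y ^. qj : v.M" by simp
   from v.M_add[OF Suc.IH this] Suc.prems show ?case by (simp add: w.add_divide_distrib del: mult_Suc_right)
  qed simp
  let ?r = "uminus (x i) /. ?y ^. qj"
  have "?r = one +. w.sum (%k. ?y ^. (p ^ (e * k)) *. ?c k) {..<j} /. ?y ^. qj"
   unfolding psi_x[symmetric] psi_def using x_nz[of "Suc i"] by (simp add: w.add_divide_distrib)
  hence r: "?r ~: v.M" "?r : W" using v.unit_add_M[OF _ _ s[OF order_refl]] v.v_add[OF v.v_one v.M_W[OF s[OF order_refl]]] by auto
  have yE: "?y : E m" "x i : E m" using im by (auto intro: E_gen(3))
  have rE: "?r : E m" "?y ^. qj : E m" using yE by (auto intro: subf_div[OF subf_E] subf_neg[OF subf_E] subf_pow[OF subf_E])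
  have rnz: "?r ~= zero" using x_nz[of i] x_nz[of "Suc i"] by simp
  moreover have "uminus ?r : V - F.nonunits V"
  proof -
   have n: "uminus ?r : W" "uminus ?r : E m" "inverse (uminus ?r) : W" "uminus ?r ~= zero"
    using r rE subf_neg[OF subf_E] v.not_M[of ?r] by (simp_all only: w.inverse_minus_eq not_False_eq_True v.v_neg w.neg_equal_0_iff_equal)
   thus ?thesis using W(2) VR_nonunits[OF V] subf_inverse[OF subf_E n(2)] by auto
  qed
  ultimately have v0: "F.valn V (uminus ?r) = 0" using F.valn_unit[OF V] by blast
  have "F.valn V (x i) = F.valn V (uminus ?r *. ?y ^. qj)" using x_nz[of "Suc i"] by simp
  also have "\<dots> = F.valn V (uminus ?r) + F.valn V (?y ^. qj)"
   using F.valn_mult[OF V, of "uminus ?r" "?y ^. qj"] rE rnz subf_neg[OF subf_E rE(1)] by simp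
  also have "F.valn V (?y ^. qj) = int qj * F.valn V ?y" using F.valn_pow[OF V, of ?y qj] yE(1) x_nz[of "Suc i"] by simp
  finally show ?thesis using yW v0 by simp
 qed
 have E: "x i : E m" if "i < m" for i using that by (rule E_gen(3))
 have "Suc i <= m ==> x i ~: W" for i
 proof (induction i)
  case 0
  thus ?case using x0 W(2) E[of 0] by simp
 next
  case (Suc i)
  thus ?case using step[of i] by simp
 qed
 thus ?thesis using step[of "i - 1"] m W(2) by simp
qed

section \<open>The genus and the rational places of a level\<close>

abbreviation PD where "PD == F.poles g"

text \<open>The quotient \<open>ga / gb\<close> is 1/(q - 1) + 1/(qj - 1), the constant in the limit
  of the tower.\<close>

definition ga :: nat where "ga = q + qj - 2"
definition gb :: nat where "gb = (q - 1) * (qj - 1)"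

text \<open>The pole divisor allowed for the i-th coefficient of a function with poles at most
  \<open>p k PD\<close>; the second summand is what \<open>i\<close> differentiations cost, divided
  by \<open>p\<close>.\<close>

definition D :: "nat => nat => 'a set => int" where
 "D k i V = int k * PD V + int (i * ga) * PD V div int (p * gb)"

lemma b_pos: "p * gb > 0" using p_gt_1 qj_gt_q q_ge by (simp add: gb_def)

lemma PD_eq: "V : VR ==> g : V ==> PD V = 0" "V : VR ==> g ~: V ==> PD V = - F.valn V g"
 using F.poles_pos[of V g] g_nonconstant by auto

lemma PD_finite: "finite (F.divsupp PD)"
 using F.divsupp_poles[of g] g_nonconstant by simp

lemma valn_inverse_power: "V : VR ==> F.valn V (inverse g ^. n) = - int n * F.valn V g"
 using F.valn_pow[of V "inverse g" n] F.valn_inv[of V g] g_nonconstant subf_inverse[OF subf_E] E_inv by simp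

lemma vset_E: "V : VR ==> f : E m ==> f : F.vset V n \<longleftrightarrow> f = zero \<or> n <= F.valn V f"
 by (simp add: F.vset_def)

text \<open>Riemann--Hurwitz for \<open>E = E\<^sup>p[g]\<close>: the coefficients \<open>f\<^sub>i\<close> of \<open>f = \<Sum> f\<^sub>i\<^sup>p g\<^sup>i\<close> lie in spaces
 governed by the different exponents at the poles of \<open>g\<close>.\<close>

lemma top_coefficient_lspace:
 assumes i: "i < p" and c: "!!l. c l : E m"
  and h: "w.sum (%l. c l ^. p *. g ^. l) {..i} : F.lspace (%V. int (p * k) * PD V)" (is "?h : _")
 shows "c i : F.lspace (D k i)"
proof -
 note gn = g_nonconstant
 have hE: "?h : E m" using h by (simp add: F.lspace_def)
 have "c i : F.vset V (- D k i V)" if V: "V : VR" for V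
 proof (cases "g : V")
  case True
  have "?h : F.vset V (- (int (p * k) * PD V))" using h V unfolding F.lspace_def by blast
  hence "?h : F.vset V 0" using PD_eq(1)[OF V True] by simp
  hence "?h : V" using F.vset_0[OF V] by simp
  hence "c i : V" by (rule place_integral[OF V True i c])
  thus ?thesis using F.vset_0[OF V] PD_eq(1)[OF V True] by (simp add: D_def)
 next
  case False
  let ?ig = "inverse g" and ?n = "- F.valn V g"
  have Xn: "PD V = ?n" by (rule PD_eq(2)[OF V False])
  have ig: "?ig : E m" "?ig ~= zero" using subf_inverse[OF subf_E gn(1)] gn(3) by auto
  have igp: "?ig ^. r : E m" "?ig ^. r ~= zero" for r using subf_pow[OF subf_E ig(1)] ig(2) by auto
  have "?h *. ?ig ^. (p * k) : V"
  proof (cases "?h = zero")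
   case True
   thus ?thesis using VR_props(2,3)[OF V] by (metis w.diff_self w.mult_zero_left)
  next
   case nz: False
   have "F.valn V ?h >= - (int (p * k) * ?n)" using h V nz vset_E[OF V hE] Xn by (auto simp: F.lspace_def)
   moreover have "F.valn V (?h *. ?ig ^. (p * k)) = F.valn V ?h + int (p * k) * ?n"
    using F.valn_mult[OF V, of ?h "?ig ^. (p * k)"] hE nz igp valn_inverse_power[OF V, of "p * k"] by simp
   ultimately show ?thesis using F.valn_ge_0[OF V, of "?h *. ?ig ^. (p * k)"] hE nz igp subf_mult[OF subf_E] by simp
  qed
  \<comment> \<open>The factor \<open>g^(-p k)\<close> is a p-th power and is absorbed into the
    coefficients, which reduces to the integral case.\<close>
  also have "?h *. ?ig ^. (p * k) = w.sum (%l. (c l *. ?ig ^. k) ^. p *. g ^. l) {..i}"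
   unfolding w.sum_distrib_right
  proof (rule w.sum.cong[OF refl])
   fix l
   have "?ig ^. (p * k) = (?ig ^. k) ^. p" by (simp add: w.power_mult[symmetric] mult.commute)
   thus "c l ^. p *. g ^. l *. ?ig ^. (p * k) = (c l *. ?ig ^. k) ^. p *. g ^. l"
    by (simp only: w.power_mult_distrib w.mult.assoc w.mult.commute w.mult.left_commute)
  qed
  finally have "(c i *. ?ig ^. k) ^. (p * gb) *. ?ig ^. (i * ga) : V"
   using c igp(1) by (intro place_pole[OF V False i, folded ga_def gb_def]) (auto intro: subf_mult[OF subf_E])
  note mem = this
  show ?thesis
  proof (cases "c i = zero")
   case False
   have ci: "c i *. ?ig ^. k : E m" "c i *. ?ig ^. k ~= zero" using c igp False subf_mult[OF subf_E] by auto
   have cip: "(c i *. ?ig ^. k) ^. (p * gb) : E m" "(c i *. ?ig ^. k) ^. (p * gb) ~= zero"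
    using subf_pow[OF subf_E ci(1), of "p * gb"] ci(2) by auto
   have "0 <= F.valn V ((c i *. ?ig ^. k) ^. (p * gb) *. ?ig ^. (i * ga))"
    using F.valn_ge_0[OF V, of "(c i *. ?ig ^. k) ^. (p * gb) *. ?ig ^. (i * ga)"] mem cip igp subf_mult[OF subf_E] by simp
   also have "\<dots> = F.valn V ((c i *. ?ig ^. k) ^. (p * gb)) + int (i * ga) * ?n"
    using F.valn_mult[OF V, of "(c i *. ?ig ^. k) ^. (p * gb)" "?ig ^. (i * ga)"] cip igp valn_inverse_power[OF V, of "i * ga"] by simp
   also have "F.valn V ((c i *. ?ig ^. k) ^. (p * gb)) = int (p * gb) * F.valn V (c i *. ?ig ^. k)"
    using F.valn_pow[OF V, of "c i *. ?ig ^. k" "p * gb"] ci by simp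
   also have "F.valn V (c i *. ?ig ^. k) = F.valn V (c i) + int k * ?n"
    using F.valn_mult[OF V, of "c i" "?ig ^. k"] c False igp valn_inverse_power[OF V, of k] by simp
   finally have "(- F.valn V (c i) - int k * ?n) * int (p * gb) <= int (i * ga) * ?n" by (simp add: algebra_simps)
   hence "(- F.valn V (c i) - int k * ?n) * int (p * gb) div int (p * gb) <= int (i * ga) * ?n div int (p * gb)"
    using b_pos by (intro zdiv_mono1) simp_all
   moreover have "int (p * gb) ~= 0" using b_pos by simp
   ultimately show ?thesis using vset_E[OF V c, of i] by (simp add: D_def Xn)
  qed (use vset_E[OF V c, of i] in simp)
 qed
 thus ?thesis using c by (simp add: F.lspace_def)
qed

lemma D_finite: "finite (F.divsupp (D k i))"
 by (rule finite_subset[OF _ PD_finite]) (auto simp: F.divsupp_def D_def)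

text \<open>Filter the space by the degree in \<open>g\<close>: the i-th step is controlled by the
  coefficient of \<open>g^i\<close>, which lies in L(D k i).\<close>

lemma ldim_filtration:
 "int (F.ldim (%V. int (p * k) * PD V)) <= (\<Sum>i<p. int (F.ldim (D k i)))"
proof -
 let ?P = "%V. int (p * k) * PD V"
 have fP: "finite (F.divsupp ?P)" using F.divdeg_scale(2)[OF PD_finite] .
 define L where "L i = {h : F.lspace ?P. EX c. (ALL l. c l : E m) & h = w.sum (%l. c l ^. p *. g ^. l) {..<i}}" for i :: nat
 have Lf: "finite (L i)" for i using F.lspace_finite[OF fP] by (auto simp: L_def)
 have fr: "(r -. s) ^. p = r ^. p -. s ^. p" for r s using frob_minus[of r s 1] by simp
 have sub: "w.sum (%l. c l ^. p *. g ^. l) {..<i} -. w.sum (%l. d l ^. p *. g ^. l) {..<i} =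
   w.sum (%l. (c l -. d l) ^. p *. g ^. l) {..<i}" for c d and i :: nat
  by (induction i) (simp_all add: fr algebra_simps)
 have LE: "h : E m" if "h : L i" for h i using that by (simp add: L_def F.lspace_def)
 have ml: "a -. b : F.lspace ?P" if "a : F.lspace ?P" "b : F.lspace ?P" for a b
  using F.asubD(5)[OF F.lspace_asub that] E_minus[of a b] that by (simp add: F.lspace_def)
 have La: "F.asub (L i)" for i
 proof (rule F.asubI)
  show "L i <= carrier (ring_on (E m))" using LE by auto
  have "zero = w.sum (%l. zero ^. p *. g ^. l) {..<i}" using p_gt_1 by (simp add: w.zero_power)
  thus "\<zero>\<^bsub>ring_on (E m)\<^esub> : L i" unfolding L_def ring_on_simps
   using F.asubD(2)[OF F.lspace_asub, of ?P] subf_zero[OF subf_E] by force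
  fix a b assume ab: "a : L i" "b : L i"
  then obtain c d where cd: "ALL l. c l : E m" "a = w.sum (%l. c l ^. p *. g ^. l) {..<i}"
   "ALL l. d l : E m" "b = w.sum (%l. d l ^. p *. g ^. l) {..<i}" by (auto simp: L_def)
  have "a -. b : L i" unfolding L_def
  proof (intro CollectI conjI exI[of _ "%l. c l -. d l"])
   show "a -. b : F.lspace ?P" using ml ab by (simp add: L_def)
  qed (use cd sub[of c i d] subf_minus[OF subf_E] in auto)
  thus "a \<ominus>\<^bsub>ring_on (E m)\<^esub> b : L i" using E_minus[OF LE LE] ab by simp
 qed
 have step: "card (L (Suc i)) <= card (F.lspace (D k i)) * card (L i)" if i: "i < p" for i
 proof -
  have ex: "EX c. (ALL l. c l : E m) & h = w.sum (%l. c l ^. p *. g ^. l) {..i}" if "h : L (Suc i)" for h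
   using that by (simp add: L_def lessThan_Suc_atMost)
  \<comment> \<open>An arbitrary choice of coefficients; for \<open>card_le_fibres\<close> it is
    enough that functions with the same top coefficient differ by one of lower degree in
    \<open>g\<close>.\<close>
  define co where "co h = (SOME c. (ALL l. c l : E m) & h = w.sum (%l. c l ^. p *. g ^. l) {..i})" for h
  have co: "co h l : E m" "h = w.sum (%l. co h l ^. p *. g ^. l) {..i}" if "h : L (Suc i)" for h l
   using someI_ex[OF ex[OF that]] unfolding co_def by blast+
  show ?thesis
  proof (rule F.card_le_fibres(2)[OF La F.lspace_finite[OF D_finite] Lf, where f = "%h. co h i"])
   fix h assume h: "h : L (Suc i)"
   hence "w.sum (%l. co h l ^. p *. g ^. l) {..i} : F.lspace ?P" using co(2)[OF h] by (simp add: L_def)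
   thus "co h i : F.lspace (D k i)" by (rule top_coefficient_lspace[OF i co(1)[OF h]])
   fix h' assume h': "h' : L (Suc i)" and eq: "co h i = co h' i"
   let ?d = "%l. co h l -. co h' l"
   have "h -. h' = w.sum (%l. ?d l ^. p *. g ^. l) {..<Suc i}"
    using co(2)[OF h] co(2)[OF h'] sub[of "co h" "Suc i" "co h'"] by (simp only: lessThan_Suc_atMost)
   also have "\<dots> = w.sum (%l. ?d l ^. p *. g ^. l) {..<i}" using p_gt_1 by (simp add: eq)
   finally have "h -. h' : L i"
    unfolding L_def using ml[of h h'] h h' co(1)[OF h] co(1)[OF h'] subf_minus[OF subf_E]
    by (intro CollectI conjI exI[of _ ?d]) (auto simp: L_def)
   thus "h \<ominus>\<^bsub>ring_on (E m)\<^esub> h' : L i" using E_minus[OF LE[OF h] LE[OF h']] by simp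
  qed
 qed
 have cl: "card (F.lspace (D k i)) = card K ^ F.ldim (D k i)" for i using F.card_lspace F.lspace_finite[OF D_finite] by blast
 have le: "n <= p ==> card (L n) <= card K ^ (\<Sum>i<n. F.ldim (D k i))" for n
 proof (induction n)
  case 0
  show ?case using card_mono[of "{zero}" "L 0"] by (auto simp: L_def)
 next
  case (Suc n)
  have "card (L (Suc n)) <= card (F.lspace (D k n)) * card (L n)" using step Suc.prems by simp
  also have "\<dots> <= card (F.lspace (D k n)) * card K ^ (\<Sum>i<n. F.ldim (D k i))" using Suc by simp
  finally show ?case by (simp add: cl power_add mult.commute)
 qed
 have "F.lspace ?P <= L p"
 proof
  fix h assume h: "h : F.lspace ?P"
  hence "h : E m" by (simp add: F.lspace_def)
  then obtain c where c: "!!l. c l : E m" "h = w.sum (%l. c l ^. p *. g ^. l) {..p - 1}" by (rule p_power_decomposition) blast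
  moreover have "{..p - 1} = {..<p}" using p_gt_1 by auto
  ultimately show "h : L p" using h by (auto simp: L_def)
 qed
 hence "card (F.lspace ?P) <= card (L p)" using Lf by (intro card_mono) auto
 hence "card K ^ F.ldim ?P <= card K ^ (\<Sum>i<p. F.ldim (D k i))"
  using le[OF order_refl] F.card_lspace[OF F.lspace_finite[OF fP]] by simp
 hence "F.ldim ?P <= (\<Sum>i<p. F.ldim (D k i))" using F.card_K_gt_1 power_le_imp_le_exp by blast
 thus ?thesis unfolding of_nat_sum[symmetric] by (simp only: of_nat_le_iff)
qed

abbreviation d :: int where "d == F.divdeg PD"

text \<open>Insert Riemann's equality for \<open>k PD\<close> and \<open>p k PD\<close> into the
  filtration: the multiples of \<open>d\<close> cancel, leaving \<open>(p - 1)(genus - 1)\<close>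
  against the floors \<open>?e i\<close>. Their degrees are at most \<open>i ga d / (p gb)\<close>,
  and the sum of \<open>i < p\<close> is \<open>p (p - 1) / 2\<close>.\<close>

lemma genus_bound: "2 * int gb * (int (genus (ring_on (E m)) K) - 1) <= int ga * d"
proof -
 let ?G = "int (genus (ring_on (E m)) K)"
 obtain k where k: "!!l. l >= k ==> int (F.ldim (%V. int l * PD V)) + ?G = int l * d + 1"
  using F.riemann_equality[of g] g_nonconstant by auto
 let ?e = "%i V. int (i * ga) * PD V div int (p * gb)"
 have Xp: "PD V >= 0" for V by (simp add: F.poles_def)
 have ef: "finite (F.divsupp (?e i))" for i by (rule finite_subset[OF _ PD_finite]) (auto simp: F.divsupp_def)
 have fk: "finite (F.divsupp (%V. int k * PD V))" "F.divdeg (%V. int k * PD V) = int k * d"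
  using F.divdeg_scale[OF PD_finite] by auto
 have De: "D k i = (%V. int k * PD V + ?e i V)" for i by (auto simp: D_def)
 have dD: "int (F.ldim (D k i)) <= int k * d + 1 - ?G + F.divdeg (?e i)" for i
 proof -
  have "int k * PD V <= D k i V" for V using Xp[of V] b_pos by (simp add: D_def pos_imp_zdiv_nonneg_iff)
  hence "int (F.ldim (D k i)) <= int (F.ldim (%V. int k * PD V)) + (F.divdeg (D k i) - F.divdeg (%V. int k * PD V))"
   by (intro F.ldim_le_add_divdeg(1) fk D_finite)
  also have "F.divdeg (D k i) = int k * d + F.divdeg (?e i)" unfolding De using F.divdeg_add(1)[OF fk(1) ef] fk(2) by simp
  finally show ?thesis using k[of k] fk(2) by simp
 qed
 have e: "int (p * gb) * F.divdeg (?e i) <= int (i * ga) * d" for i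
 proof -
  have "F.divdeg (%V. int (p * gb) * ?e i V) <= F.divdeg (%V. int (i * ga) * PD V)"
  proof (rule F.divdeg_mono)
   show "finite (F.divsupp (%V. int (p * gb) * ?e i V))" by (rule F.divdeg_scale(2)[OF ef])
   show "finite (F.divsupp (%V. int (i * ga) * PD V))" by (rule F.divdeg_scale(2)[OF PD_finite])
   fix V
   have "int (p * gb) * (int (i * ga) * PD V div int (p * gb)) + int (i * ga) * PD V mod int (p * gb) = int (i * ga) * PD V"
    by simp
   moreover have "int (i * ga) * PD V mod int (p * gb) >= 0" using b_pos by auto
   ultimately show "int (p * gb) * ?e i V <= int (i * ga) * PD V" by linarith
  qed
  thus ?thesis using F.divdeg_scale(1)[OF ef] F.divdeg_scale(1)[OF PD_finite] by simp
 qed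
 have "int (p * k) * d + 1 - ?G <= (\<Sum>i<p. int (F.ldim (D k i)))" using ldim_filtration[of k] p_gt_1 k[of "p * k"] by simp
 also have "\<dots> <= (\<Sum>i<p. int k * d + 1 - ?G + F.divdeg (?e i))" by (intro sum_mono dD)
 also have "\<dots> = int p * (int k * d + 1 - ?G) + (\<Sum>i<p. F.divdeg (?e i))" by simp
 finally have "(int p - 1) * (?G - 1) <= (\<Sum>i<p. F.divdeg (?e i))" by (simp add: algebra_simps)
 hence "int (p * gb) * ((int p - 1) * (?G - 1)) <= int (p * gb) * (\<Sum>i<p. F.divdeg (?e i))" by (intro mult_left_mono) simp_all
 also have "\<dots> <= (\<Sum>i<p. int (i * ga) * d)" unfolding sum_distrib_left by (intro sum_mono e)
 also have "2 * (\<Sum>i<p. int (i * ga) * d) = (2 * (\<Sum>i<p. int i)) * (int ga * d)"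
  by (simp add: sum_distrib_right mult.assoc)
 also have "2 * (\<Sum>i<n. int i) = int n * (int n - 1)" for n by (induction n) (simp_all add: algebra_simps)
 finally have "(int p * (int p - 1)) * (2 * int gb * (?G - 1)) <= (int p * (int p - 1)) * (int ga * d)" by (simp add: algebra_simps)
 moreover have "int p * (int p - 1) > 0" using p_gt_1 by simp
 ultimately show ?thesis by (simp only: mult_le_cancel_left_pos)
qed

text \<open>All zeros of \<open>g\<close> are simple and rational, and their number is the degree of
  the zero divisor, equal to that of the poles.\<close>

lemma rational_places: "d <= int (num_places (ring_on (E m)) K 1)"
proof -
 let ?Z = "{V : VR. g : F.nonunits V}"
 have gn: "g : carrier (ring_on (E m))" "g ~: K" "g ~= zero" using g_nonconstant by auto
 have ig: "inv\<^bsub>ring_on (E m)\<^esub> g = inverse g" using E_inv g_nonconstant by simp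
 have fz: "finite ?Z" by (rule F.finite_zeros[OF gn(1,2)])
 have val: "F.valn V (inverse g) = - F.valn V g" if "V : VR" for V using F.valn_inv[OF that gn(1)] ig g_nonconstant(3) by simp
 have out: "F.poles (inverse g) V = 0" if "V : VR" "V ~: ?Z" for V
 proof -
  show ?thesis using F.valn_gt_0[OF that(1) gn(1)] gn(3) that using val[OF that(1)] by (simp add: F.poles_def)
 qed
 have "d = F.divdeg (F.poles (inverse g))" using F.zeros_eq_poles[OF gn(1,2)] ig by simp
 also have "\<dots> = (\<Sum>V\<in>?Z. F.poles (inverse g) V * int (F.degv V))"
  using out by (intro F.divdeg_sum[OF fz]) (auto simp: F.divsupp_def)
 also have "\<dots> = (\<Sum>V\<in>?Z. 1)"
  by (intro sum.cong) (auto simp: F.poles_def val zero_place)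
 moreover have "card ?Z <= card {V : VR. F.degv V = 1}"
 proof (rule card_mono)
  show "finite {V : VR. F.degv V = 1}" by (rule F.finite_places_degree) simp
 qed (use zero_place(1) in auto)
 ultimately show ?thesis by (simp add: F.num_places_eq)
qed

text \<open>At a pole of \<open>x 0\<close> its order is a multiple of \<open>qj^(m-1)\<close>, and
  \<open>g\<close> has a pole at least as large. Hence the number of rational places is unbounded
  along the tower.\<close>

lemma pole_degree_growth: assumes "m > 0" shows "int (qj ^ (m - 1)) <= d"
proof -
 have x0: "x 0 : E m" "x 0 ~= zero" using E_gen(3)[OF assms] x_nz by auto
 have eq: "x 0 ^. Q = x 0 +. g *. x 0 ^. qj" using phi_x[of 0] by (simp add: phi_def)
 have x0K: "x 0 ~: K"
 proof
  assume "x 0 : K"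
  hence "x 0 ^. Q = x 0" by (simp add: K_def fixed_def Q_def)
  hence "g *. x 0 ^. qj = zero" using eq by simp
  thus False using x0(2) g_nonconstant(3) by simp
 qed
 obtain V where V: "V : VR" "inverse (x 0) : F.nonunits V" using F.exists_zero_of[of "inverse (x 0)"] subf_inverse[OF subf_E x0(1)] x0K subf_inverse[OF subf_fixed, of "inverse (x 0)"] by (auto simp: K_def)
 have xV: "x 0 ~: V" using V(2) VR_nonunits[OF V(1)] x0(2) by auto
 have neg: "F.valn V (x i) < 0" if "i < m" for i
 proof -
  show ?thesis using pole_growth[OF V(1) xV, of i] that using F.valn_ge_0[OF V(1), of "x i"] E_gen(3)[OF that] x_nz[of i] by simp
 qed
 have vx: "i < m ==> F.valn V (x 0) = int (qj ^ i) * F.valn V (x i)" for i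
 proof (induction i)
  case (Suc i)
  have 1: "F.valn V (x i) = int qj * F.valn V (x (Suc i))"
   using pole_growth[OF V(1) xV, of "Suc i"] Suc.prems by simp
  have 2: "F.valn V (x 0) = int (qj ^ i) * F.valn V (x i)" by (rule Suc.IH) (rule Suc_lessD[OF Suc.prems])
  show ?case unfolding 2 1 of_nat_power power_Suc by (simp only: of_nat_mult of_nat_power mult.assoc mult.commute mult.left_commute)
 qed (simp only: power_0 of_nat_1 mult_1)
 have "m - 1 < m" using assms by simp
 note x0v = vx[OF this]
 have "int (qj ^ (m - 1)) * F.valn V (x (m - 1)) <= int (qj ^ (m - 1)) * (- 1)"
  using neg[of "m - 1"] assms by (intro mult_left_mono) auto
 hence big: "int (qj ^ (m - 1)) <= - F.valn V (x 0)" using x0v by simp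
 have xn: "F.valn V (x 0) < 0" using neg assms by simp
 \<comment> \<open>A smaller pole of \<open>g\<close> would give the right side of
   \<open>x 0^Q = x 0 + g x 0^qj\<close> a pole of at most \<open>qj + 1\<close> times that of
   \<open>x 0\<close>, less than the left side has.\<close>
 have gV: "PD V >= - F.valn V (x 0)"
 proof (rule ccontr)
  assume n: "\<not> ?thesis"
  let ?v = "F.valn V (x 0)"
  have vg: "F.valn V g > ?v" using n by (simp add: F.poles_def)
  have pw: "F.valn V (x 0 ^. n) = int n * ?v" "x 0 ^. n : E m" "x 0 ^. n ~= zero" for n
   using F.valn_pow[OF V(1), of "x 0" n] x0 subf_pow[OF subf_E] by auto
  let ?n = "int (qj + 1) * ?v"
  have "x 0 +. g *. x 0 ^. qj : F.vset V ?n" using x0 subf_mult[OF subf_E] vset_E[OF V(1), of _ ?n] F.valn_mult[OF V(1), of g "x 0 ^. qj"] g_nonconstant pw vg xn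
   using F.asubD(6)[OF F.vset_asub[OF V(1)]] by (auto simp: algebra_simps mult_nonneg_nonpos)
  hence "int Q * ?v >= ?n" using eq pw[of Q] vset_E[OF V(1) pw(2)[of Q], of ?n] by simp
  hence "int Q <= int (qj + 1)" using xn by simp
  moreover have "qj * 2 <= Q" unfolding Q_eq using q_ge by simp
  ultimately show False using qj_gt_q q_ge by simp
 qed
 have Xp: "PD V >= 0" for V by (simp add: F.poles_def)
 have Vs: "V : F.divsupp PD" using V(1) gV xn by (simp add: F.divsupp_def)
 have "PD V * 1 <= PD V * int (F.degv V)" using F.degv_pos[OF V(1)] Xp by (intro mult_left_mono) auto
 also have "\<dots> <= d" unfolding F.divdeg_def using Xp by (intro member_le_sum[OF Vs _ PD_finite]) auto
 finally show ?thesis using big gV by simp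
qed

end

section \<open>A countable algebraically closed field\<close>

text \<open>Names for the elements obtained from one generator by field operations and roots. There
  are countably many, so the closed field they describe can be moved to the natural numbers, where
  \<open>max_rational_places\<close> looks for its function fields.\<close>

datatype closure_term = Gen | Unit | Diff closure_term closure_term | Prod closure_term closure_term
 | Inv closure_term | Root "closure_term list"

instance closure_term :: countable by countable_datatype

context field
begin

text \<open>The monic polynomial with the listed lower coefficients, constant term first.\<close>

primrec horner :: "'a list => 'a => 'a" where
 "horner [] r = \<one>"
| "horner (c # ts) r = r \<otimes> horner ts r \<oplus> c"

lemma horner_eval: "set ts <= carrier R ==> r : carrier R ==> horner ts r = eval (\<one> # rev ts) r & horner ts r : carrier R"
proof (induction ts)
 case (Cons c ts)
 have "eval ((\<one> # rev ts) @ [c]) r = (eval (\<one> # rev ts) r \<otimes> r) \<oplus> c"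
  by (rule eval_append_aux) (use Cons in auto)
 moreover have IH: "horner ts r = eval (\<one> # rev ts) r" "horner ts r : carrier R" using Cons by auto
 ultimately have "horner (c # ts) r = eval (\<one> # rev (c # ts)) r"
  using m_comm[OF IH(2) Cons.prems(2)] by simp
 moreover have "horner (c # ts) r : carrier R" using IH(2) Cons.prems by simp
 ultimately show ?case by blast
qed simp

definition root_closed :: bool where
 "root_closed \<longleftrightarrow> (ALL ts. set ts <= carrier R --> ts ~= [] --> (EX r:carrier R. horner ts r = \<zero>))"

primrec cval :: "'a => closure_term => 'a" where
 "cval a Gen = a"
| "cval a Unit = \<one>"
| "cval a (Diff u v) = cval a u \<ominus> cval a v"
| "cval a (Prod u v) = cval a u \<otimes> cval a v"
| "cval a (Inv u) = (if cval a u = \<zero> then \<zero> else inv (cval a u))"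
| "cval a (Root ts) = (if ts = [] then \<one> else
   (SOME r. r : carrier R & horner (map (cval a) ts) r = \<zero>))"

lemma cval_closed:
 assumes rc: root_closed and a: "a : carrier R"
 shows "cval a u : carrier R"
  and "us ~= [] ==> horner (map (cval a) us) (cval a (Root us)) = \<zero>"
proof -
 have root: "cval a (Root us) : carrier R & horner (map (cval a) us) (cval a (Root us)) = \<zero>"
  if "us ~= []" "!!u. u : set us ==> cval a u : carrier R" for us
 proof -
  have "EX r. r : carrier R & horner (map (cval a) us) r = \<zero>"
   using rc[unfolded root_closed_def, rule_format, of "map (cval a) us"] that by auto
  from someI_ex[OF this] show ?thesis by auto
 qed
 show v: "cval a u : carrier R" for u
 proof (induction u)
  case (Inv u) thus ?case using inv_nz(1)[of "cval a u"] by simp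
 next
  case (Root us)
  show ?case
  proof (cases "us = []")
   case False
   thus ?thesis using root[OF False] Root by blast
  qed simp
 qed (simp_all add: a)
 show "us ~= [] ==> horner (map (cval a) us) (cval a (Root us)) = \<zero>" using root v by blast
qed

lemma countable_closure:
 assumes rc: root_closed and a: "a : carrier R"
 obtains S where "countable S" "a : S" "subfield S R" "field.root_closed (R\<lparr>carrier := S\<rparr>)"
proof -
 let ?v = "cval a"
 define S where "S = range ?v"
 note v = cval_closed[OF rc a]
 have vS: "?v u : S" for u by (simp add: S_def)
 have SE: "EX u. s = ?v u" if "s : S" for s using that by (auto simp: S_def)
 have S: "S <= carrier R" using v(1) by (auto simp: S_def)
 have m: "s \<ominus> t : S" "s \<otimes> t : S" if st: "s : S" "t : S" for s t
 proof -
  obtain u w where e: "s = ?v u" "t = ?v w" using SE[OF st(1)] SE[OF st(2)] by blast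
  show "s \<ominus> t : S" "s \<otimes> t : S" unfolding e using vS[of "Diff u w"] vS[of "Prod u w"] by simp_all
 qed
 have one: "\<one> : S" using vS[of Unit] by simp
 have zero: "\<zero> : S" using m(1)[OF one one] by (simp add: minus_eq r_neg)
 have neg: "\<ominus> s : S" if "s : S" for s using m(1)[OF zero that] S that by (auto simp: minus_eq)
 have add: "s \<oplus> t : S" if "s : S" "t : S" for s t
  using m(1)[OF that(1) neg[OF that(2)]] S that by (auto simp: minus_eq)
 have inv: "inv s : S" if s: "s : S" "s ~= \<zero>" for s
 proof -
  obtain u where "s = ?v u" using SE[OF s(1)] by blast
  thus ?thesis using vS[of "Inv u"] s(2) by simp
 qed
 have sS: "subfield S R" using S one neg add m(2) inv by (intro subfieldI' subringI) auto
 interpret S: field "R\<lparr>carrier := S\<rparr>" by (rule subfield_iff(2)[OF sS])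
 have h: "S.horner ts r = horner ts r" for ts r by (induction ts) simp_all
 have "S.root_closed" unfolding S.root_closed_def
 proof (intro allI impI)
  fix ts assume ts: "set ts <= carrier (R\<lparr>carrier := S\<rparr>)" "ts ~= []"
  have "EX us. ts = map ?v us" using ts(1)
  proof (induction ts)
   case (Cons t ts)
   then obtain us u where "ts = map ?v us" "t = ?v u" using SE[of t] by auto
   thus ?case by (intro exI[of _ "u # us"]) simp
  qed simp
  then obtain us where us: "ts = map ?v us" by blast
  show "EX r:carrier (R\<lparr>carrier := S\<rparr>). S.horner ts r = \<zero>\<^bsub>R\<lparr>carrier := S\<rparr>\<^esub>" using v(2)[of us] us ts(2) using vS[of "Root us"] h by auto
 qed
 thus thesis using that[of S] sS vS[of Gen] by (simp add: S_def)
qed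

lemma transport_closed_field:
 fixes f :: "'a => 'c" and i :: "'c => 'a"
 assumes fi: "!!s. s : carrier R ==> i (f s) = s" "!!n. i n : carrier R" "!!n. f (i n) = n"
  and rc: root_closed and p: "normalization_semidom_class.prime p" "[(p ^ l)] \<cdot> \<one> = \<zero>"
 shows "EX divide inverse times one plus zero minus uminus.
  closed_field divide inverse times one plus zero minus uminus p & (ALL a n. i (power.power one times a n) = i a [^] n)"
proof -
 define inverse' where "inverse' a = f (if i a = \<zero> then \<zero> else inv (i a))" for a
 define times' where "times' a b = f (i a \<otimes> i b)" for a b
 define plus' where "plus' a b = f (i a \<oplus> i b)" for a b
 define minus' where "minus' a b = f (i a \<ominus> i b)" for a b
 define uminus' where "uminus' a = f (\<ominus> i a)" for a
 note d = inverse'_def times'_def plus'_def minus'_def uminus'_def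
 have ii: "i a = i b \<longleftrightarrow> a = b" for a b using fi(3) by metis
 have fI: "f s = b \<longleftrightarrow> s = i b" if "s : carrier R" for s b using fi that by metis
 have inv_c: "(if i a = \<zero> then \<zero> else inv (i a)) : carrier R" for a using inv_nz(1)[of "i a"] fi(2) by simp
 have iz: "i a = \<zero> \<longleftrightarrow> a = f \<zero>" for a using fi by (metis zero_closed)
 have ia: "i a \<otimes> inv (i a) = \<one>" "inv (i a) \<otimes> i a = \<one>" "inv (i a) : carrier R" if "a ~= f \<zero>" for a
  using inv_nz(1,3,4)[OF fi(2)[of a]] that iz by auto
 have iT: "i (times' a b) = i a \<otimes> i b" "i (plus' a b) = i a \<oplus> i b" for a b by (simp_all add: d fi)
 have "class.field (%a b. times' a (inverse' b)) inverse' times' (f \<one>) plus' (f \<zero>) minus' uminus'"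
  by unfold_locales
   (use fi(3) inv_c in \<open>auto simp: d fi a_ac m_ac r_distr r_neg minus_eq fI iz ia\<close>)
 then interpret w: total_field "%a b. times' a (inverse' b)" inverse' times' "f \<one>" plus' "f \<zero>" minus' uminus'
  by (rule total_field.intro)
 have pw: "i (power.power (f \<one>) times' a n) = i a [^] n" for a n
  by (induction n) (simp_all add: iT fi m_comm)
 have sc: "i (w.scalar n) = [n] \<cdot> \<one>" for n
  by (induction n) (simp_all add: iT fi a_comm)
 have mo: "w.monic n h e ==> EX ts. set ts <= carrier R & length ts = n & (ALL a. i (h a) = horner ts (i a))" for n h e
 proof (induction rule: w.monic.induct)
  case monic_0
  show ?case by (rule exI[of _ "[]"]) (simp add: fi)
 next
  case (monic_Suc n h e c)
  then obtain ts where ts: "set ts <= carrier R" "length ts = n" "!!a. i (h a) = horner ts (i a)" by blast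
  have "i (plus' (times' a (h a)) c) = horner (i c # ts) (i a)" for a
    by (simp add: iT ts(3))
  thus ?case using ts fi(2) by (intro exI[of _ "i c # ts"]) simp
 qed
 have cf: "closed_field (%a b. times' a (inverse' b)) inverse' times' (f \<one>) plus' (f \<zero>) minus' uminus' p"
 proof
  show "normalization_semidom_class.prime p" by (rule p(1))
  \<comment> \<open>Only a power of \<open>p\<close> is known to vanish, and a field has no
    nilpotent elements.\<close>
  have "i (w.scalar (p ^ l)) = i (f \<zero>)" using sc[of "p ^ l"] p(2) fi(1) by simp
  hence "w.pw (w.scalar p) l = f \<zero>" by (simp only: ii w.w.of_nat_power)
  thus "w.scalar p = f \<zero>" by simp
  fix n h e assume h: "w.monic n h e" "n > 0"
  then obtain ts where ts: "set ts <= carrier R" "length ts = n" "!!a. i (h a) = horner ts (i a)" using mo by blast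
  have "ts ~= []" using ts(2) h(2) by auto
  then obtain r where "r : carrier R" "horner ts r = \<zero>"
   using rc[unfolded root_closed_def, rule_format, OF ts(1)] by blast
  hence "i (h (f r)) = \<zero>" using ts(3) fi(1) by simp
  hence "h (f r) = f \<zero>" using fi(3) by metis
  thus "EX r. h r = f \<zero>" ..
 qed
 show ?thesis by (intro exI, rule conjI[OF cf]) (use pw in blast)
qed

end

lemma (in algebraically_closed) root_closed: "root_closed"
 unfolding root_closed_def
proof (intro allI impI)
 fix ts assume ts: "set ts <= carrier L" "ts ~= []"
 let ?p = "\<one> # rev ts"
 have p: "?p : carrier (poly_ring L)" using ts by (simp add: univ_poly_def polynomial_def)
 have "size (roots ?p) = length ts" using roots_over_carrier[OF p] by (simp add: splitted_def)
 hence "roots ?p ~= {#}" using ts(2) by auto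
 then obtain r where "r :# roots ?p" by blast
 hence "is_root ?p r" using roots_mem_iff_is_root[OF p] by simp
 thus "EX r:carrier L. horner ts r = \<zero>" using horner_eval[OF ts(1)] unfolding is_root_def by auto
qed

text \<open>A nonconstant \<open>y\<close> with a zero at some place has no power equal to one, so
  its image in the algebraic closure of \<open>F\<close> lies outside the algebraic closure of the
  prime field. Its distinct powers also make the countable subfield infinite, hence in bijection
  with the naturals.\<close>

lemma exists_nat_closed_field:
 fixes F :: "('a, 'b) ring_scheme"
 assumes K: "global_function_field F K" and p: "normalization_semidom_class.prime p" "odd p" "card K = p ^ f" "f > 0"
 obtains divide inverse times one plus zero minus uminus and g :: nat
 where "closed_field divide inverse times one plus zero minus uminus p" "g ~: closed_field.kbar times one p"
proof -
 interpret F: global_function_field F K by (rule K)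
 interpret F: odd_function_field F K by unfold_locales (simp add: p)
 obtain y where y: "y : carrier F" "y ~: K" by (rule F.exists_nonconstant)
 obtain V where V: "V : valuation_rings F K" "y : F.nonunits V" using F.exists_zero_of[OF y] by blast
 have yn: "y [^]\<^bsub>F\<^esub> n ~= \<one>\<^bsub>F\<^esub>" if "n > 0" for n :: nat
  using F.nonunits_pow[OF F.vr[OF V(1)] V(2), of n] F.one_not_nonunit[OF F.vr[OF V(1)]] that by auto
 let ?L = "F.alg_closure" and ?h = "F.indexed_const :: 'a => ('a list \<times> nat) multiset => 'a"
 interpret L: algebraic_closure ?L "?h ` carrier F" by (rule F.alg_closureE(1))
 interpret h: ring_hom_ring F ?L ?h by (rule ring_hom_ringI2[OF F.is_ring L.is_ring F.alg_closureE(2)])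
 let ?x = "?h y"
 have hinj: "?h a = ?h b ==> a = b" for a b by (simp add: F.indexed_const_def) metis
 have xL: "?x : carrier ?L" using h.hom_closed[OF y(1)] .
 have xn: "?x [^]\<^bsub>?L\<^esub> n ~= \<one>\<^bsub>?L\<^esub>" if "n > 0" for n :: nat
 proof
  assume "?x [^]\<^bsub>?L\<^esub> n = \<one>\<^bsub>?L\<^esub>"
  moreover have "?h (y [^]\<^bsub>F\<^esub> n) = ?x [^]\<^bsub>?L\<^esub> n" by (induction n) (simp_all add: y(1))
  ultimately show False using hinj yn[OF that] by auto
 qed
 have K0: "[card K] \<cdot>\<^bsub>F\<^esub> \<one>\<^bsub>F\<^esub> = \<zero>\<^bsub>F\<^esub>"
 proof -
  interpret KR: ring "F\<lparr>carrier := K\<rparr>" by (rule F.subring_is_ring[OF F.K_subring])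
  have o: "order (add_monoid (F\<lparr>carrier := K\<rparr>)) = card K" by (simp add: order_def)
  have "[n] \<cdot>\<^bsub>F\<^esub> \<one>\<^bsub>F\<^esub> = [n] \<cdot>\<^bsub>F\<lparr>carrier := K\<rparr>\<^esub> \<one>\<^bsub>F\<^esub>" for n :: nat
   by (induction n) (simp_all add: add_pow_def nat_pow_def)
  hence "[card K] \<cdot>\<^bsub>F\<^esub> \<one>\<^bsub>F\<^esub> = [card K] \<cdot>\<^bsub>F\<lparr>carrier := K\<rparr>\<^esub> \<one>\<^bsub>F\<^esub>" .
  also have "\<dots> = \<zero>\<^bsub>F\<lparr>carrier := K\<rparr>\<^esub>"
   using KR.add.pow_order_eq_1[of "\<one>\<^bsub>F\<^esub>"] unfolding o by simp
  finally show ?thesis by simp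
 qed
 have "?h ([n] \<cdot>\<^bsub>F\<^esub> \<one>\<^bsub>F\<^esub>) = [n] \<cdot>\<^bsub>?L\<^esub> \<one>\<^bsub>?L\<^esub>" for n :: nat by (induction n) simp_all
 hence L0: "[(p ^ f)] \<cdot>\<^bsub>?L\<^esub> \<one>\<^bsub>?L\<^esub> = \<zero>\<^bsub>?L\<^esub>" using K0 p(3) h.hom_zero by metis
 obtain S where S: "countable S" "?x : S" "subfield S ?L" "field.root_closed (?L\<lparr>carrier := S\<rparr>)"
  by (rule L.countable_closure[OF L.root_closed xL])
 interpret S: field "?L\<lparr>carrier := S\<rparr>" by (rule L.subfield_iff(2)[OF S(3)])
 have Sp: "?x [^]\<^bsub>?L\<lparr>carrier := S\<rparr>\<^esub> n = ?x [^]\<^bsub>?L\<^esub> n" for n :: nat by (induction n) simp_all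
 have nz: "?x [^]\<^bsub>?L\<^esub> n ~= \<zero>\<^bsub>?L\<^esub>" for n :: nat using hinj[of y "\<zero>\<^bsub>F\<^esub>"] y(2) F.K_carrier(2) h.hom_zero using L.pow_nz[OF xL] by metis
 have cancel: "n <= m" if "?x [^]\<^bsub>?L\<^esub> n = ?x [^]\<^bsub>?L\<^esub> m" for n m :: nat
 proof (rule ccontr)
  assume "\<not> n <= m"
  hence "n = m + (n - m)" "n - m > 0" by auto
  hence "?x [^]\<^bsub>?L\<^esub> m \<otimes>\<^bsub>?L\<^esub> ?x [^]\<^bsub>?L\<^esub> (n - m) = ?x [^]\<^bsub>?L\<^esub> m \<otimes>\<^bsub>?L\<^esub> \<one>\<^bsub>?L\<^esub>"
   using that L.nat_pow_mult[OF xL, of m "n - m"] xL by simp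
  hence "?x [^]\<^bsub>?L\<^esub> (n - m) = \<one>\<^bsub>?L\<^esub>"
   by (rule iffD1[OF L.m_lcancel[OF nz[of m]], rotated -1]) (simp_all add: xL)
  thus False using xn \<open>n - m > 0\<close> by blast
 qed
 have "inj (%n::nat. ?x [^]\<^bsub>?L\<^esub> n)" by (rule injI) (metis cancel le_antisym)
 moreover have "range (%n::nat. ?x [^]\<^bsub>?L\<^esub> n) <= S" using S.nat_pow_closed[of ?x] S(2) Sp by auto
 ultimately have inf: "infinite S" using finite_imageD finite_subset by blast
 note fi = from_nat_into_to_nat_on[OF S(1)] from_nat_into[of S] to_nat_on_from_nat_into_infinite[OF S(1) inf]
 have S0: "[(p ^ f)] \<cdot>\<^bsub>?L\<lparr>carrier := S\<rparr>\<^esub> \<one>\<^bsub>?L\<lparr>carrier := S\<rparr>\<^esub> = \<zero>\<^bsub>?L\<lparr>carrier := S\<rparr>\<^esub>"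
 proof -
  have "[n] \<cdot>\<^bsub>?L\<lparr>carrier := S\<rparr>\<^esub> \<one>\<^bsub>?L\<^esub> = [n] \<cdot>\<^bsub>?L\<^esub> \<one>\<^bsub>?L\<^esub>" for n :: nat by (induction n) (simp_all add: add_pow_def nat_pow_def)
  thus ?thesis using L0 by simp
 qed
 have fS: "from_nat_into S n : carrier (?L\<lparr>carrier := S\<rparr>)" for n using S(2) by (simp add: from_nat_into) (metis empty_iff from_nat_into)
 obtain divide inverse times one plus zero minus uminus
  where cf: "closed_field divide inverse times one plus zero minus uminus p"
   and pw: "!!a n. from_nat_into S (power.power one times a n) = from_nat_into S a [^]\<^bsub>?L\<lparr>carrier := S\<rparr>\<^esub> n"
  using S.transport_closed_field[of "from_nat_into S" "to_nat_on S", OF _ fS fi(3) S(4) p(1) S0] fi(1) by auto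
 interpret c: closed_field divide inverse times one plus zero minus uminus p by (rule cf)
 have "to_nat_on S ?x ~: c.kbar"
 proof
  assume "to_nat_on S ?x : c.kbar"
  then obtain k where k: "k >= 1" "c.pw (to_nat_on S ?x) (p ^ k) = to_nat_on S ?x" by (auto simp: c.kbar_def c.fixed_def)
  have "?x [^]\<^bsub>?L\<^esub> (p ^ k) = ?x [^]\<^bsub>?L\<^esub> (1::nat)" using pw[of "to_nat_on S ?x" "p ^ k"] fi(1)[OF S(2)] xL by (simp add: k(2) Sp)
  from cancel[OF this] show False using one_less_power[OF c.p_gt_1, of k] k(1) by simp
 qed
 with cf show thesis by (rule that)
qed

section \<open>The bound for Ihara's constant\<close>

lemma (in tower_level) tower_numbers:
 defines "N == num_places (ring_on (E m)) K 1" and "G == genus (ring_on (E m)) K"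
 shows "2 * int gb * (int G - 1) <= int ga * int N" "m > 0 ==> qj ^ (m - 1) <= N"
  "global_function_field (ring_on (E m)) K" "card K = p ^ (e * Suc j)"
proof -
 have "int ga * d <= int ga * int N" using rational_places by (intro mult_left_mono) (simp_all add: N_def)
 thus "2 * int gb * (int G - 1) <= int ga * int N"
  using genus_bound unfolding G_def ga_def gb_def by linarith
 show "qj ^ (m - 1) <= N" if "m > 0"
 proof -
  have "int (qj ^ (m - 1)) <= int N" using pole_degree_growth[OF that] rational_places unfolding N_def of_nat_power by (rule order_trans)
  thus ?thesis by simp
 qed
 show "global_function_field (ring_on (E m)) K" by (rule F.global_function_field_axioms)
 show "card K = p ^ (e * Suc j)" by (simp only: card_K Q_def)
qed

lemma num_rational_places_le:
 assumes "global_function_field F K" "odd (card K)"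
 shows "num_places F K 1 <= (card K + 1) * (genus F K + 1)"
proof -
 interpret F: global_function_field F K by (rule assms(1))
 interpret F: odd_function_field F K by unfold_locales (rule assms(2))
 show ?thesis using F.num_places_genus_bound[of 1] by simp
qed

text \<open>The linear bound on rational places makes the set under \<open>Max\<close> finite,
  without which its value would mean nothing.\<close>

lemma max_rational_places_ge:
 fixes F :: "nat ring"
 assumes "global_function_field F K" "card K = Q" "odd Q"
 shows "num_places F K 1 <= max_rational_places Q (genus F K)"
 unfolding max_rational_places_def
proof (rule Max_ge)
 show "finite {num_places F' K' 1 | (F' :: nat ring) K'.
      global_function_field F' K' & card K' = Q & genus F' K' = genus F K}"
 proof (rule finite_subset, safe)
  fix F' :: "nat ring" and K' assume "global_function_field F' K'" "genus F' K' = genus F K" "Q = card K'"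
  thus "num_places F' K' 1 : {..(Q + 1) * (genus F K + 1)}" using num_rational_places_le[of F' K'] assms(3) by simp
 qed simp
qed (use assms in blast)

text \<open>The numbers of places grow without bound and are at most linear in the genus, so the
  genera are unbounded; the inequality divided by the genus then gives the limit.\<close>

lemma ihara_A_ge_of_sequence:
 fixes N G :: "nat => nat" and a b :: nat
 assumes le: "!!m. N m <= max_rational_places Q (G m)" and ab: "a > 0"
  and ineq: "!!m. 2 * int b * (int (G m) - 1) <= int a * int (N m)"
  and N: "!!m. N m <= (Q + 1) * (G m + 1)" "!!m. m > 0 ==> c ^ (m - 1) <= N m" "c >= 2"
 shows "ihara_A Q >= ereal (2 * real b / real a)"
 unfolding ihara_A_def limsup_INF_SUP
proof (rule INF_greatest)
 fix n :: nat
 let ?f = "%g. ereal (real (max_rational_places Q g) / real g)" and ?L = "2 * real b / real a"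
 show "ereal ?L <= (SUP g\<in>{n..}. ?f g)"
 proof (rule ereal_le_epsilon2)
  fix \<epsilon> :: real assume \<epsilon>: "\<epsilon> > 0"
  define L where "L = ?L"
  obtain k where k: "real k > L / \<epsilon>" using reals_Archimedean2 by blast
  \<comment> \<open>Since 2^x > x, this level has genus above \<open>n\<close> and above
    \<open>k\<close>, where \<open>k\<close> makes the correction L/genus at most
    \<open>\<epsilon>\<close>.\<close>
  define m where "m = Suc ((Q + 1) * (n + k + 2))"
  have "(Q + 1) * (n + k + 2) < 2 ^ (m - 1)" unfolding m_def by (simp only: diff_Suc_1 less_exp)
  also have "(2::nat) ^ (m - 1) <= c ^ (m - 1)" using N(3) by (rule power_mono) simp
  also have "\<dots> <= N m" by (rule N(2)) (simp add: m_def)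
  also have "\<dots> <= (Q + 1) * (G m + 1)" by (rule N(1))
  finally have "n + k + 2 < G m + 1" by (simp only: mult_less_cancel1)
  hence G: "G m >= n" "G m >= k" "G m > 0" by auto
  have "real_of_int (2 * int b * (int (G m) - 1)) <= real_of_int (int a * int (N m))" using ineq[of m] by (simp only: of_int_le_iff)
  hence "L * (real (G m) - 1) <= real (N m)" using ab by (simp add: L_def pos_divide_le_eq mult.commute)
  hence "L * (real (G m) - 1) / real (G m) <= real (max_rational_places Q (G m)) / real (G m)"
   using le[of m] by (intro divide_right_mono) simp_all
  moreover have "L * (real (G m) - 1) / real (G m) = L - L / real (G m)" using G(3) by (simp add: field_simps)
  moreover have "L / real (G m) <= \<epsilon>"
  proof -
   have "L < \<epsilon> * real k" using k \<epsilon> by (simp add: pos_divide_less_eq mult.commute)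
   also have "\<dots> <= \<epsilon> * real (G m)" using G(2) \<epsilon> by simp
   finally show ?thesis using G(3) by (simp add: pos_divide_le_eq)
  qed
  ultimately have "ereal ?L <= ?f (G m) + ereal \<epsilon>" by (simp add: L_def)
  also have "\<dots> <= (SUP g\<in>{n..}. ?f g) + ereal \<epsilon>" using G(1) by (intro add_right_mono SUP_upper) simp
  finally show "ereal ?L <= (SUP g\<in>{n..}. ?f g) + ereal \<epsilon>" .
 qed
qed

lemma ihara_A_tower:
 fixes divide inverse times one plus zero minus uminus and g :: nat
 assumes T: "torsion_tower divide inverse times one plus zero minus uminus p e j g" and p: "odd p"
 shows "ihara_A (p ^ (e * Suc j)) >= ereal (2 * real ((p ^ e - 1) * (p ^ (e * j) - 1)) / real (p ^ e + p ^ (e * j) - 2))"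
proof -
 have L: "tower_level divide inverse times one plus zero minus uminus p e j g"
  by (intro tower_level.intro tower_level_axioms.intro T p)
 interpret torsion_tower divide inverse times one plus zero minus uminus p e j g by (rule T)
 interpret l: tower_level divide inverse times one plus zero minus uminus p e j g 0 by (rule L)
 note numbers = tower_level.tower_numbers[OF L]
 have oQ: "odd (p ^ (e * Suc j))" using p by simp
 have "ihara_A (p ^ (e * Suc j)) >= ereal (2 * real l.gb / real l.ga)"
 proof (rule ihara_A_ge_of_sequence)
  fix m
  show "num_places (ring_on (E m)) K 1 <= max_rational_places (p ^ (e * Suc j)) (genus (ring_on (E m)) K)"
   by (rule max_rational_places_ge[OF numbers(3,4) oQ])
  show "2 * int l.gb * (int (genus (ring_on (E m)) K) - 1) <= int l.ga * int (num_places (ring_on (E m)) K 1)"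
   using numbers(1)[of m] unfolding tower_level.ga_def[OF L] tower_level.gb_def[OF L] .
  show "num_places (ring_on (E m)) K 1 <= (p ^ (e * Suc j) + 1) * (genus (ring_on (E m)) K + 1)"
   using num_rational_places_le[OF numbers(3)] oQ unfolding numbers(4) by blast
  show "m > 0 ==> qj ^ (m - 1) <= num_places (ring_on (E m)) K 1" by (rule numbers(2))
 qed (use qj_gt_q q_ge in \<open>auto simp: l.ga_def\<close>)
 thus ?thesis by (simp only: l.ga_def l.gb_def qj_def)
qed

text \<open>The right side increases with \<open>t\<close>, and at \<open>t = l^2\<close> it equals
  the left side, because l + l^2 - 2 = (l - 1)(l + 2).\<close>

lemma tower_constant_ge:
 fixes l t :: nat
 assumes l: "l >= 2" and t: "t >= l ^ 2"
 shows "2 * (real l ^ 2 - 1) / (real l + 2) <= 2 * real ((l - 1) * (t - 1)) / real (l + t - 2)"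
proof -
 have "l <= l ^ 2" by (simp add: power2_eq_square)
 hence lt: "t >= 1" using l t by simp
 have rt: "real t >= real l ^ 2" using t by simp
 have r: "real ((l - 1) * (t - 1)) = (real l - 1) * (real t - 1)" "real (l + t - 2) = real l + real t - 2"
  using l lt by auto
 have "(real l + 1) * (real l + real t - 2) <= (real l + 2) * (real t - 1)"
  using rt by (simp add: algebra_simps power2_eq_square)
 hence "(real l - 1) * ((real l + 1) * (real l + real t - 2)) <= (real l - 1) * ((real l + 2) * (real t - 1))"
  using l by simp
 hence "2 * (real l ^ 2 - 1) * (real l + real t - 2) <= 2 * ((real l - 1) * (real t - 1)) * (real l + 2)"
  by (simp add: algebra_simps power2_eq_square)
 moreover have "real l + real t - 2 > 0" "real l + 2 > 0" using l lt by auto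
 ultimately show ?thesis unfolding r by (simp add: divide_le_eq le_divide_eq)
qed

theorem theorem3p3:
  fixes F :: "('a, 'b) ring_scheme" and K :: "'a set" and q r s N :: nat
  assumes "primepow q" and "odd q"
    and "odd r" and "r \<ge> 3"
    and "s > 0" and "coprime s r"
    and "global_function_field F K" and "card K = q"
    and "num_places F K s \<ge> N"
    and "int (num_places F K r) >
           \<lfloor>(3 + real_of_int \<lceil>2 * sqrt (2 * real N + 1)\<rceil>) / (real r - 2)\<rfloor>"
    and "\<And>M :: nat. num_places F K s \<ge> M \<Longrightarrow>
           int (num_places F K r) >
             \<lfloor>(3 + real_of_int \<lceil>2 * sqrt (2 * real M + 1)\<rceil>) / (real r - 2)\<rfloor> \<Longrightarrow> M \<le> N"
    and "\<exists>m :: nat. odd m \<and>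
           real (class_number (constant_field_ext F K r) (ext_constants F K r)) /
             real (class_number F K) = real m"
  shows "ihara_A (q ^ (r * s)) \<ge>
           ereal (4 * real N * real s /
             (4 * real (genus F K) +
              real_of_int \<lfloor>(3 + real_of_int \<lceil>2 * sqrt (2 * real N + 1)\<rceil>) / (real r - 2)\<rfloor> +
              real_of_int \<lceil>2 * sqrt (2 * real N + 1)\<rceil>))"
proof -
 let ?C = "\<lceil>2 * sqrt (2 * real N + 1)\<rceil>"
 obtain p f where p: "normalization_semidom_class.prime p" "f > 0" "q = p ^ f" using assms(1) by (auto simp: primepow_def)
 have op: "odd p" using assms(2) p(2,3) by auto
 have p1: "p > 1" using prime_gt_1_nat[OF p(1)] .
 obtain divide inverse times one plus zero minus uminus and g :: nat
  where cf: "closed_field divide inverse times one plus zero minus uminus p" "g ~: closed_field.kbar times one p"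
  by (rule exists_nat_closed_field[OF assms(7) p(1) op _ p(2)]) (use assms(8) p(3) in auto)
 \<comment> \<open>With this choice the \<open>q\<close> of the tower is \<open>q^s\<close> and its
   constant field has \<open>q^(r s)\<close> elements; \<open>r >= 3\<close> becomes
   \<open>j >= 2\<close>.\<close>
 define e j where "e = f * s" and "j = r - 1"
 have "torsion_tower divide inverse times one plus zero minus uminus p e j g"
  by (intro torsion_tower.intro torsion_tower_axioms.intro cf) (use p(2) assms(4,5) in \<open>auto simp: e_def j_def\<close>)
 from ihara_A_tower[OF this op]
 have A: "ihara_A (p ^ (e * Suc j)) >= ereal (2 * real ((p ^ e - 1) * (p ^ (e * j) - 1)) / real (p ^ e + p ^ (e * j) - 2))" .
 have eq: "p ^ (e * Suc j) = q ^ (r * s)" "p ^ e = q ^ s"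
  using assms(4) by (simp_all add: p(3) e_def j_def power_mult[symmetric] algebra_simps)
 have "(q ^ s) ^ 2 <= p ^ (e * j)"
  unfolding eq(2)[symmetric] power_mult[symmetric] using p1 assms(4) by (intro power_increasing) (auto simp: j_def)
 moreover have "q >= 3"
 proof -
  have "q > 1" unfolding p(3) using one_less_power[OF p1 p(2)] .
  moreover have "q ~= 2" using assms(2) by auto
  ultimately show ?thesis by simp
 qed from this have "q ^ s >= 2" using self_le_power[of q s] assms(5) by simp
 ultimately have B: "2 * (real (q ^ s) ^ 2 - 1) / (real (q ^ s) + 2) <=
   2 * real ((p ^ e - 1) * (p ^ (e * j) - 1)) / real (p ^ e + p ^ (e * j) - 2)"
  using tower_constant_ge[of "q ^ s" "p ^ (e * j)"] unfolding eq(2) by blast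
 interpret F: global_function_field F K by (rule assms(7))
 interpret F: odd_function_field F K by unfold_locales (simp add: assms(2,8))
 have C: "real_of_int ?C >= 2 * sqrt (2 * real N + 1)" by simp
 have "0 <= 2 * sqrt (2 * real N + 1)" by simp
 hence C0: "?C >= 0" by linarith
 have "(2 * sqrt (2 * real N + 1))\<^sup>2 <= (real_of_int ?C)\<^sup>2" by (intro power_mono) simp_all
 hence "real_of_int (8 * int N + 4) <= real_of_int (?C ^ 2)" by simp
 hence C2: "?C ^ 2 >= 8 * int N + 4" by (simp only: of_int_le_iff)
 have m: "\<lfloor>(3 + real_of_int ?C) / (real r - 2)\<rfloor> >= 0" using C0 assms(4) by simp
 have "s * N <= s * num_places F K s" using assms(9) by simp
 also have "\<dots> <= (q ^ s + 1) * (genus F K + 3 * s - 2)" using F.num_places_genus_bound[of s] assms(5,8) by simp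
 finally have b: "s * N <= (q ^ s + 1) * (genus F K + 3 * s - 2)" .
 \<comment> \<open>The sharper incidence bound with \<open>k = 3\<close>, used for the field with
   three elements.\<close>
 have inc: "N * (q ^ 3 - 1) <= (q ^ 4 - 1) * (genus F K + 3)" if "s = 1"
  using order_trans[OF mult_le_mono1[OF assms(9)[unfolded that]]] F.num_places_incidence[of 1 3] by (simp add: assms(8) add.commute)
 have "4 * real N * real s / (4 * real (genus F K) + real_of_int \<lfloor>(3 + real_of_int ?C) / (real r - 2)\<rfloor> + real_of_int ?C)
   <= 2 * (real (q ^ s) ^ 2 - 1) / (real (q ^ s) + 2)"
  by (rule place_quotient_le[OF refl assms(2) \<open>q >= 3\<close> _ C0 C2 m b inc]) (use assms(5) in auto)
 also note B
 finally show ?thesis using A unfolding eq(1) by (meson ereal_less_eq(3) order_trans)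
qed

end
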